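(* Let $\psi$, $F$, $\Omega$, $T$ be as in the context. Assume $\{\mathbf{v}^k\}_{k\in\mathbb{N}}$ is a sequence of weak solutions of $D\psi(\mathbf{v}_t)=\operatorname{div}DF(D\mathbf{v})$ on $\Omega\times(0,T)$ converging to another weak solution $\mathbf{v}$ in the following sense: $$\mathbf{v}^k\to\mathbf{v}\ \text{ in } L^2([0,T];H^1(\Omega;\mathbb{R}^m)),\qquad \mathbf{v}^k_t\to\mathbf{v}_t\ \text{ in } L^2(\Omega\times[0,T];\mathbb{R}^m).$$ Then there is a subsequence $\{D^2\mathbf{v}^{k_j}\}_{j\in\mathbb{N}}$ that converges to $D^2\mathbf{v}$ in $L^2_{\mathrm{loc}}(\Omega\times(0,T);(\mathbb{M}^{n\times n})^m)$.
   Context: Setting: $m>1$, $\Omega\subset\mathbb R^n$ is a bounded domain with smooth boundary, $T>0$. $\mathbb M^{m\times n}$ is the space of real $m\times n$ matrices with $M\cdot N=\operatorname{tr}(M^tN)$. $\psi\in C^2(\mathbb R^m)$, $F\in C^2(\mathbb M^{m\times n})$, $\inf_{\mathbb R^m}\psi=\psi(0)=0$, and there are positive constants $\alpha,A,\theta,\Theta$ with $$\alpha|z|^2\le\sum_{i,j=1}^m\psi_{w_iw_j}(w)z_iz_j\le A|z|^2,\qquad \theta|\xi|^2\le\sum_{i,k=1}^m\sum_{j,l=1}^nF_{M^i_jM^k_l}(M)\xi^i_j\xi^k_l\le\Theta|\xi|^2$$ for all $w,z\in\mathbb R^m$ and $M,\xi\in\mathbb M^{m\times n}$. A weak solution of $D\psi(\mathbf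 v_t)=\operatorname{div}DF(D\mathbf v)$ on $\Omega\times(0,T)$ is a measurable $\mathbf v:\Omega\times(0,T)\to\mathbb R^m$ with $\mathbf v_t\in L^2(\Omega\times(0,T);\mathbb R^m)$, $\mathbf v\in L^\infty([0,T];W^{1,2}(\Omega;\mathbb R^m))$ and $\int_\Omega D\psi(\mathbf v_t(x,t))\cdot\mathbf w(x)\,dx+\int_\Omega DF(D\mathbf v(x,t))\cdot D\mathbf w(x)\,dx=0$ for each $\mathbf w\in W^{1,2}_0(\Omega;\mathbb R^m)$ and a.e. $t\in[0,T]$. $D^2\mathbf v:=(D^2v^1,\dots,D^2v^m)$ denotes the spatial Hessians. *)

theory Defs
  imports "HOL-Analysis.Analysis"
begin

section \<open>Classical derivatives and domains\<close>

definition partial :: "'a::real_normed_vector \<Rightarrow> ('a \<Rightarrow> 'b::real_normed_vector) \<Rightarrow> 'a \<Rightarrow> 'b"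
  where "partial b f x = frechet_derivative f (at x) b"

definition gradient :: "('a::euclidean_space \<Rightarrow> real) \<Rightarrow> 'a \<Rightarrow> 'a"
  where "gradient f x = (\<Sum>b\<in>Basis. partial b f x *\<^sub>R b)"

text \<open>The class \<open>C\<^sup>k(S)\<close>; intended for open \<open>S\<close>.\<close>

primrec Ck_on :: "nat \<Rightarrow> 'a::euclidean_space set \<Rightarrow> ('a \<Rightarrow> 'b::real_normed_vector) \<Rightarrow> bool" where
  "Ck_on 0 S f \<longleftrightarrow> continuous_on S f"
| "Ck_on (Suc k) S f \<longleftrightarrow>
     (\<forall>x\<in>S. f differentiable (at x)) \<and> (\<forall>b\<in>Basis. Ck_on k S (partial b f))"

definition smooth_on :: "'a::euclidean_space set \<Rightarrow> ('a \<Rightarrow> 'b::real_normed_vector) \<Rightarrow> bool"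
  where "smooth_on S f \<longleftrightarrow> (\<forall>k. Ck_on k S f)"

text \<open>Near each boundary point the set lies strictly on one side of a smooth graph over a coordinate
  hyperplane. Here \<open>\<gamma>\<close> is a function of all coordinates that does not depend on the coordinate \<open>e\<close>,
  and \<open>s\<close> is the orientation of the \<open>e\<close>-axis.\<close>

definition smooth_boundary :: "'a::euclidean_space set \<Rightarrow> bool" where
  "smooth_boundary \<Omega> \<longleftrightarrow>
     (\<forall>p\<in>frontier \<Omega>. \<exists>r>0. \<exists>e\<in>Basis. \<exists>s\<in>{-1, 1::real}. \<exists>\<gamma>::'a \<Rightarrow> real.
        smooth_on UNIV \<gamma> \<and> (\<forall>x t. \<gamma> (x + t *\<^sub>R e) = \<gamma> x) \<and>
        \<Omega> \<inter> ball p r = {x \<in> ball p r. s * (x \<bullet> e) > \<gamma> x})"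

definition bounded_smooth_domain :: "'a::euclidean_space set \<Rightarrow> bool" where
  "bounded_smooth_domain \<Omega> \<longleftrightarrow>
     open \<Omega> \<and> connected \<Omega> \<and> \<Omega> \<noteq> {} \<and> bounded \<Omega> \<and> smooth_boundary \<Omega>"


section \<open>Lebesgue spaces\<close>

definition L2_on :: "'a::euclidean_space set \<Rightarrow> ('a \<Rightarrow> 'b::euclidean_space) \<Rightarrow> bool" where
  "L2_on S f \<longleftrightarrow> f \<in> borel_measurable (lebesgue_on S) \<and>
                integrable (lebesgue_on S) (\<lambda>x. (norm (f x))\<^sup>2)"

definition tendsto_L2 ::
  "'a::euclidean_space set \<Rightarrow> (nat \<Rightarrow> 'a \<Rightarrow> 'b::euclidean_space) \<Rightarrow> ('a \<Rightarrow> 'b) \<Rightarrow> bool" where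
  "tendsto_L2 S f g \<longleftrightarrow> (\<forall>k. L2_on S (f k)) \<and> L2_on S g \<and>
     (\<lambda>k. LINT x|lebesgue_on S. (norm (f k x - g x))\<^sup>2) \<longlonglongrightarrow> 0"

definition tendsto_L2_loc ::
  "'a::euclidean_space set \<Rightarrow> (nat \<Rightarrow> 'a \<Rightarrow> 'b::euclidean_space) \<Rightarrow> ('a \<Rightarrow> 'b) \<Rightarrow> bool" where
  "tendsto_L2_loc S f g \<longleftrightarrow> (\<forall>K. compact K \<and> K \<subseteq> S \<longrightarrow> tendsto_L2 K f g)"

definition locally_integrable_on ::
  "'a::euclidean_space set \<Rightarrow> ('a \<Rightarrow> 'b::euclidean_space) \<Rightarrow> bool" where
  "locally_integrable_on S f \<longleftrightarrow> (\<forall>K. compact K \<and> K \<subseteq> S \<longrightarrow> f absolutely_integrable_on K)"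


section \<open>Weak derivatives and Sobolev spaces\<close>

text \<open>\<open>C\<^sub>c\<^sup>\<infinity>(S)\<close>, extended by zero to the whole space.\<close>

definition test_fun :: "'a::euclidean_space set \<Rightarrow> ('a \<Rightarrow> 'b::real_normed_vector) \<Rightarrow> bool" where
  "test_fun S \<phi> \<longleftrightarrow> smooth_on UNIV \<phi> \<and> compact (closure {x. \<phi> x \<noteq> 0}) \<and> closure {x. \<phi> x \<noteq> 0} \<subseteq> S"

text \<open>\<open>g\<close> is a weak (distributional) derivative of \<open>u\<close> in direction \<open>b\<close> on the open set \<open>S\<close>,
  and likewise a second-order derivative in directions \<open>a\<close>, \<open>b\<close>.\<close>

definition has_weak_deriv ::
  "'a::euclidean_space set \<Rightarrow> 'a \<Rightarrow> ('a \<Rightarrow> 'b::euclidean_space) \<Rightarrow> ('a \<Rightarrow> 'b) \<Rightarrow> bool" where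
  "has_weak_deriv S b u g \<longleftrightarrow> locally_integrable_on S u \<and> locally_integrable_on S g \<and>
     (\<forall>\<phi>::'a \<Rightarrow> real. test_fun S \<phi> \<longrightarrow>
        (LINT x|lebesgue_on S. partial b \<phi> x *\<^sub>R u x) = - (LINT x|lebesgue_on S. \<phi> x *\<^sub>R g x))"

definition has_weak_deriv2 ::
  "'a::euclidean_space set \<Rightarrow> 'a \<Rightarrow> 'a \<Rightarrow> ('a \<Rightarrow> 'b::euclidean_space) \<Rightarrow> ('a \<Rightarrow> 'b) \<Rightarrow> bool" where
  "has_weak_deriv2 S a b u g \<longleftrightarrow> locally_integrable_on S u \<and> locally_integrable_on S g \<and>
     (\<forall>\<phi>::'a \<Rightarrow> real. test_fun S \<phi> \<longrightarrow>
        (LINT x|lebesgue_on S. partial a (partial b \<phi>) x *\<^sub>R u x) = (LINT x|lebesgue_on S. \<phi> x *\<^sub>R g x))"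

text \<open>A representative of the weak derivative, which is unique up to null sets. It is only
  meaningful when a weak derivative exists.\<close>

definition weak_deriv ::
  "'a::euclidean_space set \<Rightarrow> 'a \<Rightarrow> ('a \<Rightarrow> 'b::euclidean_space) \<Rightarrow> 'a \<Rightarrow> 'b" where
  "weak_deriv S b u = (SOME g. has_weak_deriv S b u g)"

definition weak_D :: "(real^'n) set \<Rightarrow> (real^'n \<Rightarrow> real^'m) \<Rightarrow> real^'n \<Rightarrow> real^'n^'m" where
  "weak_D \<Omega> u x = (\<chi> i j. weak_deriv \<Omega> (axis j 1) u x $ i)"

definition W12 :: "'a::euclidean_space set \<Rightarrow> ('a \<Rightarrow> 'b::euclidean_space) \<Rightarrow> bool" where
  "W12 \<Omega> u \<longleftrightarrow> L2_on \<Omega> u \<and> (\<forall>b\<in>Basis. \<exists>g. has_weak_deriv \<Omega> b u g \<and> L2_on \<Omega> g)"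

definition W12_norm :: "'a::euclidean_space set \<Rightarrow> ('a \<Rightarrow> 'b::euclidean_space) \<Rightarrow> real" where
  "W12_norm \<Omega> u = sqrt ((LINT x|lebesgue_on \<Omega>. (norm (u x))\<^sup>2) +
                        (\<Sum>b\<in>Basis. LINT x|lebesgue_on \<Omega>. (norm (weak_deriv \<Omega> b u x))\<^sup>2))"

text \<open>\<open>W\<^sub>0\<^sup>1\<^sup>,\<^sup>2(\<Omega>)\<close> as the closure of the test functions in \<open>W\<^sup>1\<^sup>,\<^sup>2(\<Omega>)\<close>.\<close>

definition W12_0 :: "'a::euclidean_space set \<Rightarrow> ('a \<Rightarrow> 'b::euclidean_space) \<Rightarrow> bool" where
  "W12_0 \<Omega> w \<longleftrightarrow> W12 \<Omega> w \<and>
     (\<exists>\<phi>. (\<forall>k::nat. test_fun \<Omega> (\<phi> k)) \<and> (\<lambda>k. W12_norm \<Omega> (\<lambda>x. \<phi> k x - w x)) \<longlonglongrightarrow> 0)"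


section \<open>Functions of time with values in Sobolev spaces\<close>

text \<open>Strong (Bochner) measurability of \<open>u : [0,T] \<rightarrow> W\<^sup>1\<^sup>,\<^sup>2(\<Omega>)\<close>: an almost everywhere limit of
  simple functions.\<close>

definition strongly_measurable_W12 ::
  "'a::euclidean_space set \<Rightarrow> real \<Rightarrow> (real \<Rightarrow> 'a \<Rightarrow> 'b::euclidean_space) \<Rightarrow> bool" where
  "strongly_measurable_W12 \<Omega> T u \<longleftrightarrow>
     (AE t in lebesgue_on {0..T}. W12 \<Omega> (u t)) \<and>
     (\<exists>s :: nat \<Rightarrow> real \<Rightarrow> 'a \<Rightarrow> 'b.
        (\<forall>k. finite (s k ` {0..T}) \<and> (\<forall>t\<in>{0..T}. W12 \<Omega> (s k t)) \<and>
             (\<forall>f. {t\<in>{0..T}. s k t = f} \<in> sets lebesgue)) \<and>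
        (AE t in lebesgue_on {0..T}. (\<lambda>k. W12_norm \<Omega> (\<lambda>x. s k t x - u t x)) \<longlonglongrightarrow> 0))"

definition Linfty_W12 ::
  "'a::euclidean_space set \<Rightarrow> real \<Rightarrow> (real \<Rightarrow> 'a \<Rightarrow> 'b::euclidean_space) \<Rightarrow> bool" where
  "Linfty_W12 \<Omega> T u \<longleftrightarrow> strongly_measurable_W12 \<Omega> T u \<and>
     (\<exists>C. AE t in lebesgue_on {0..T}. W12_norm \<Omega> (u t) \<le> C)"

definition L2_W12 ::
  "'a::euclidean_space set \<Rightarrow> real \<Rightarrow> (real \<Rightarrow> 'a \<Rightarrow> 'b::euclidean_space) \<Rightarrow> bool" where
  "L2_W12 \<Omega> T u \<longleftrightarrow> strongly_measurable_W12 \<Omega> T u \<and>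
     integrable (lebesgue_on {0..T}) (\<lambda>t. (W12_norm \<Omega> (u t))\<^sup>2)"

definition tendsto_L2_W12 ::
  "'a::euclidean_space set \<Rightarrow> real \<Rightarrow> (nat \<Rightarrow> real \<Rightarrow> 'a \<Rightarrow> 'b::euclidean_space) \<Rightarrow>
     (real \<Rightarrow> 'a \<Rightarrow> 'b) \<Rightarrow> bool" where
  "tendsto_L2_W12 \<Omega> T u w \<longleftrightarrow> (\<forall>k. L2_W12 \<Omega> T (\<lambda>t x. u k t x - w t x)) \<and>
     (\<lambda>k. LINT t|lebesgue_on {0..T}. (W12_norm \<Omega> (\<lambda>x. u k t x - w t x))\<^sup>2) \<longlonglongrightarrow> 0"


section \<open>Weak solutions\<close>

abbreviation time_slice :: "('a \<times> real \<Rightarrow> 'b) \<Rightarrow> real \<Rightarrow> 'a \<Rightarrow> 'b"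
  where "time_slice v t \<equiv> (\<lambda>x. v (x, t))"

abbreviation cylinder :: "'a set \<Rightarrow> real \<Rightarrow> ('a \<times> real) set"
  where "cylinder \<Omega> T \<equiv> \<Omega> \<times> {0<..<T}"

definition weak_dt ::
  "'a::euclidean_space set \<Rightarrow> real \<Rightarrow> ('a \<times> real \<Rightarrow> 'b::euclidean_space) \<Rightarrow> 'a \<times> real \<Rightarrow> 'b" where
  "weak_dt \<Omega> T v = weak_deriv (cylinder \<Omega> T) (0, 1) v"

definition weak_solution ::
  "(real^'m \<Rightarrow> real) \<Rightarrow> (real^'n^'m \<Rightarrow> real) \<Rightarrow> (real^'n) set \<Rightarrow> real \<Rightarrow>
     ((real^'n) \<times> real \<Rightarrow> real^'m) \<Rightarrow> bool" where
  "weak_solution \<psi> F \<Omega> T v \<longleftrightarrow>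
     v \<in> borel_measurable (lebesgue_on (cylinder \<Omega> T)) \<and>
     (\<exists>g. has_weak_deriv (cylinder \<Omega> T) (0, 1) v g \<and> L2_on (cylinder \<Omega> T) g) \<and>
     Linfty_W12 \<Omega> T (time_slice v) \<and>
     (\<forall>w. W12_0 \<Omega> w \<longrightarrow> (AE t in lebesgue_on {0..T}.
        (LINT x|lebesgue_on \<Omega>. gradient \<psi> (weak_dt \<Omega> T v (x, t)) \<bullet> w x) +
        (LINT x|lebesgue_on \<Omega>. gradient F (weak_D \<Omega> (time_slice v t) x) \<bullet> weak_D \<Omega> w x) = 0))"

text \<open>\<open>H\<close> is the array of spatial Hessians \<open>D\<^sup>2v = (D\<^sup>2v\<^sup>1, \<dots>, D\<^sup>2v\<^sup>m)\<close>, in the sense of distributions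
  on the space-time cylinder: \<open>H $ i $ j $ l\<close> is the weak derivative of \<open>v\<^sup>i\<close> in \<open>x\<^sub>j\<close> and \<open>x\<^sub>l\<close>.\<close>

definition has_spatial_hessian ::
  "(real^'n) set \<Rightarrow> real \<Rightarrow> ((real^'n) \<times> real \<Rightarrow> real^'m) \<Rightarrow>
     ((real^'n) \<times> real \<Rightarrow> real^'n^'n^'m) \<Rightarrow> bool" where
  "has_spatial_hessian \<Omega> T v H \<longleftrightarrow>
     (\<forall>i j l. has_weak_deriv2 (cylinder \<Omega> T) (axis j 1, 0) (axis l 1, 0)
                (\<lambda>z. v z $ i) (\<lambda>z. H z $ i $ j $ l))"

end

theory Submission imports Defs "HOL-Computational_Algebra.Polynomial" begin

text \<open>
  On the cylinder \<open>Q = \<Omega> \<times> (0,T)\<close> the equation is an elliptic system \<open>div S(Dv) = f\<close> in the spatial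
  directions, with \<open>S = DF\<close> and \<open>f = D\<psi>(v\<^sub>t)\<close>; time is only a parameter. Since \<open>D\<psi>\<close> is Lipschitz
  and vanishes at the minimum of \<open>\<psi>\<close>, \<open>f\<close> is square integrable and depends continuously on \<open>v\<^sub>t\<close>
  in mean square.

  Difference quotients in space then give the existence of second derivatives: testing the difference of the
  equation and its translate with a cutoff of the difference of \<open>v\<close> bounds the difference quotients
  of \<open>Dv\<close> locally in mean square (\<open>energy_estimate\<close>), and a limit of convex combinations of them is
  the weak derivative (\<open>distr_deriv_exists\<close>).

  For the convergence, let \<open>w\<^sub>k = \<partial>\<^sub>l v\<^sup>k - \<partial>\<^sub>l v\<close>. Formally it solves the linear system
  \<open>div (DS(Dv\<^sup>k) Dw\<^sub>k) = \<partial>\<^sub>l (f\<^sub>k - f) - div ((DS(Dv\<^sup>k) - DS(Dv)) D\<partial>\<^sub>l v)\<close>,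
  so that Caccioppoli's inequality bounds \<open>Dw\<^sub>k\<close> on compact sets in mean square by \<open>f\<^sub>k - f\<close>,
  \<open>Dv\<^sup>k - Dv\<close> and \<open>(DS(Dv\<^sup>k) - DS(Dv)) D\<partial>\<^sub>l v\<close>. The first two tend to zero by assumption. The third does
  so by dominated convergence along a subsequence with \<open>Dv\<^sup>k \<rightarrow> Dv\<close> almost everywhere, because \<open>DS\<close> is
  bounded and continuous and the factor \<open>D\<partial>\<^sub>l v\<close> is fixed; this is the reason for passing to a subsequence.
  Since \<open>F\<close> is only twice continuously differentiable, the argument is carried out for differences in place of
  derivatives (\<open>weak_system_stability\<close>).

  What remains is to pass from the given notion of solution, which is formulated for single times and for
  equivalence classes of Lebesgue measurable functions, to a weak system in space-time for Borel functions
  (\<open>weak_solution_system\<close>). This needs a gradient that is jointly measurable in space and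
  time (\<open>W12_time_representative\<close>) and test functions that depend on time (\<open>slice_weak_equation\<close>).
\<close>

section \<open>Smooth functions and test functions\<close>

lemma partial_has_derivative: "(f has_derivative D) (at x) \<Longrightarrow> partial b f x = D b"
  unfolding partial_def by (metis frechet_derivative_at)

lemma Ck_on_continuous:
  "Ck_on k UNIV f \<Longrightarrow> continuous_on UNIV f"
  by (cases k) (auto intro!: continuous_at_imp_continuous_on differentiable_imp_continuous_within)

lemma Ck_on_Suc_imp: "Ck_on (Suc k) UNIV f \<Longrightarrow> Ck_on k UNIV f"
proof (induction k arbitrary: f)
  case 0
  then show ?case using Ck_on_continuous[of "Suc 0" f] by simp
next
  case (Suc k)
  then show ?case by simp
qed

lemma Ck_on_const: "Ck_on k UNIV (\<lambda>x. c)"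
proof (induction k arbitrary: c)
  case (Suc k)
  have "partial b (\<lambda>x. c) = (\<lambda>x. 0)" for b :: 'a
    by (auto intro!: ext partial_has_derivative)
  with Suc show ?case by simp
qed simp

lemma partial_add:
  assumes "f differentiable (at x)" "g differentiable (at x)"
  shows "partial b (\<lambda>x. f x + g x) x = partial b f x + partial b g x"
  using assms[unfolded frechet_derivative_works]
  unfolding partial_def[of b f] partial_def[of b g]
  by (intro partial_has_derivative[of _ "\<lambda>d. _ d + _ d"] has_derivative_add)

lemma Ck_on_add: "Ck_on k UNIV f \<Longrightarrow> Ck_on k UNIV g \<Longrightarrow> Ck_on k UNIV (\<lambda>x. f x + g x)"
proof (induction k arbitrary: f g)
  case 0 then show ?case by (simp add: continuous_on_add)
next
  case (Suc k)
  have "partial b (\<lambda>x. f x + g x) = (\<lambda>x. partial b f x + partial b g x)" for b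
    using Suc.prems by (intro ext partial_add) auto
  with Suc show ?case by auto
qed

lemma partial_scaleR:
  assumes "f differentiable (at x)" "g differentiable (at x)"
  shows "partial b (\<lambda>x. f x *\<^sub>R g x) x = f x *\<^sub>R partial b g x + partial b f x *\<^sub>R g x"
  using has_derivative_scaleR[OF assms[unfolded frechet_derivative_works]]
  unfolding partial_def[of b f] partial_def[of b g]
  by (rule partial_has_derivative)

lemma Ck_on_scaleR:
  "Ck_on k UNIV f \<Longrightarrow> Ck_on k UNIV g \<Longrightarrow> Ck_on k UNIV (\<lambda>x. f x *\<^sub>R g x)"
proof (induction k arbitrary: f g)
  case 0 then show ?case by (simp add: continuous_on_scaleR)
next
  case (Suc k)
  have "partial b (\<lambda>x. f x *\<^sub>R g x) = (\<lambda>x. f x *\<^sub>R partial b g x + partial b f x *\<^sub>R g x)" for b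
    using Suc.prems by (intro ext partial_scaleR) auto
  moreover have "Ck_on k UNIV f" "Ck_on k UNIV g"
    using Suc.prems Ck_on_Suc_imp by blast+
  ultimately show ?case using Suc by (auto intro!: Ck_on_add)
qed

lemma partial_affine:
  assumes "f differentiable (at (c + r *\<^sub>R x))"
  shows "partial b (\<lambda>x. f (c + r *\<^sub>R x)) x = r *\<^sub>R partial b f (c + r *\<^sub>R x)"
proof -
  let ?D = "frechet_derivative f (at (c + r *\<^sub>R x))"
  have *: "(f has_derivative ?D) (at (c + r *\<^sub>R x))"
    using assms frechet_derivative_works by blast
  have "((\<lambda>x. f (c + r *\<^sub>R x)) has_derivative (\<lambda>d. ?D (r *\<^sub>R d))) (at x)"
    using * by (rule has_derivative_compose[rotated]) (auto intro!: derivative_eq_intros)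
  then have "partial b (\<lambda>x. f (c + r *\<^sub>R x)) x = ?D (r *\<^sub>R b)"
    by (rule partial_has_derivative)
  also have "\<dots> = r *\<^sub>R ?D b"
    using * has_derivative_linear linear_cmul by blast
  finally show ?thesis unfolding partial_def .
qed

lemma differentiable_affine:
  fixes x :: "'a::real_normed_vector"
  assumes "f differentiable (at (c + r *\<^sub>R x))"
  shows "(\<lambda>x. f (c + r *\<^sub>R x)) differentiable (at x)"
proof -
  obtain D where "(f has_derivative D) (at (c + r *\<^sub>R x))"
    using assms differentiable_def by blast
  then have "((\<lambda>x. f (c + r *\<^sub>R x)) has_derivative (\<lambda>d. D (r *\<^sub>R d))) (at x)"
    by (rule has_derivative_compose[rotated]) (auto intro!: derivative_eq_intros)
  then show ?thesis unfolding differentiable_def by blast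
qed

lemma Ck_on_affine: "Ck_on k UNIV f \<Longrightarrow> Ck_on k UNIV (\<lambda>x. f (c + r *\<^sub>R x))"
proof (induction k arbitrary: f)
  case 0
  then show ?case
    by (auto intro!: continuous_on_compose2[of UNIV f] continuous_intros)
next
  case (Suc k)
  have "partial b (\<lambda>x. f (c + r *\<^sub>R x)) = (\<lambda>x. r *\<^sub>R partial b f (c + r *\<^sub>R x))" for b
    using Suc.prems by (intro ext partial_affine) auto
  with Suc show ?case by (auto intro!: Ck_on_scaleR Ck_on_const differentiable_affine)
qed

lemma smooth_on_differentiable: "smooth_on UNIV f \<Longrightarrow> f differentiable (at x)"
  unfolding smooth_on_def using Ck_on.simps(2)[of 0 UNIV f] by blast

lemma smooth_on_partial: "smooth_on UNIV f \<Longrightarrow> b \<in> Basis \<Longrightarrow> smooth_on UNIV (partial b f)"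
  unfolding smooth_on_def by (metis Ck_on.simps(2))

lemma smooth_on_continuous: "smooth_on UNIV f \<Longrightarrow> continuous_on A f"
  unfolding smooth_on_def using Ck_on_continuous continuous_on_subset by blast

lemma smooth_on_const: "smooth_on UNIV (\<lambda>x. k)"
  and smooth_on_add: "smooth_on UNIV f \<Longrightarrow> smooth_on UNIV g \<Longrightarrow> smooth_on UNIV (\<lambda>x. f x + g x)"
  and smooth_on_scaleR:
    "smooth_on UNIV \<alpha> \<Longrightarrow> smooth_on UNIV f \<Longrightarrow> smooth_on UNIV (\<lambda>x. \<alpha> x *\<^sub>R f x)"
  and smooth_on_affine: "smooth_on UNIV f \<Longrightarrow> smooth_on UNIV (\<lambda>x. f (c + r *\<^sub>R x))"
  unfolding smooth_on_def by (auto intro: Ck_on_const Ck_on_add Ck_on_scaleR Ck_on_affine)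

lemma smooth_on_sum:
  "(\<And>i. i \<in> I \<Longrightarrow> smooth_on UNIV (f i)) \<Longrightarrow> smooth_on UNIV (\<lambda>x. \<Sum>i\<in>I. f i x)"
  by (induction I rule: infinite_finite_induct) (simp_all add: smooth_on_const smooth_on_add)

lemma smooth_on_prod:
  fixes f :: "'i \<Rightarrow> 'a::euclidean_space \<Rightarrow> real"
  shows "(\<And>i. i \<in> I \<Longrightarrow> smooth_on UNIV (f i)) \<Longrightarrow> smooth_on UNIV (\<lambda>x. \<Prod>i\<in>I. f i x)"
  by (induction I rule: infinite_finite_induct)
     (simp_all add: smooth_on_const smooth_on_scaleR flip: real_scaleR_def)

text \<open>A compact set that carries the function is easier to provide than the closure of its support.\<close>

lemma test_funI:
  assumes "smooth_on UNIV f" "compact K" "K \<subseteq> S" "\<And>x. x \<notin> K \<Longrightarrow> f x = 0"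
  shows "test_fun S f"
proof -
  have "closure {x. f x \<noteq> 0} \<subseteq> K"
    using assms by (intro closure_minimal compact_imp_closed) auto
  then show ?thesis
    unfolding test_fun_def using assms by (metis compact_Int_closed closed_closure inf.absorb2 subset_trans)
qed

lemma test_funE:
  assumes "test_fun S f"
  obtains K where "compact K" "K \<subseteq> S" "\<And>x. x \<notin> K \<Longrightarrow> f x = 0"
    "\<And>x b. x \<notin> K \<Longrightarrow> partial b f x = 0"
proof (rule that[of "closure {x. f x \<noteq> 0}"])
  let ?K = "closure {x. f x \<noteq> 0}"
  show "compact ?K" "?K \<subseteq> S" using assms by (auto simp: test_fun_def)
  show 0: "f x = 0" if "x \<notin> ?K" for x
    using that closure_subset[of "{x. f x \<noteq> 0}"] by blast
  show "partial b f x = 0" if "x \<notin> ?K" for x b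
  proof -
    have "(f has_derivative (\<lambda>_. 0)) (at x)"
    proof (rule has_derivative_transform_within_open[OF has_derivative_const[of 0], of "- ?K"])
      show "0 = f y" if "y \<in> - ?K" for y using 0[of y] that by simp
    qed (use that in \<open>simp_all add: open_Compl\<close>)
    then show ?thesis by (rule partial_has_derivative)
  qed
qed

lemma test_fun_smooth: "test_fun S f \<Longrightarrow> smooth_on UNIV f"
  by (simp add: test_fun_def)

lemma test_fun_mono: "test_fun S f \<Longrightarrow> S \<subseteq> T \<Longrightarrow> test_fun T f"
  by (auto simp: test_fun_def)

lemma test_fun_partial:
  assumes "test_fun S f" "b \<in> Basis" shows "test_fun S (partial b f)"
proof -
  obtain K where "compact K" "K \<subseteq> S" "\<And>x. x \<notin> K \<Longrightarrow> partial b f x = 0"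
    using test_funE[OF assms(1)] by metis
  then show ?thesis
    using smooth_on_partial[OF test_fun_smooth[OF assms(1)] assms(2)] by (intro test_funI)
qed

lemma continuous_compact_support_bounded:
  fixes f :: "'a::topological_space \<Rightarrow> 'b::real_normed_vector"
  assumes "continuous_on UNIV f" "compact K" "\<And>x. x \<notin> K \<Longrightarrow> f x = 0"
  obtains B where "B > 0" "\<And>x. norm (f x) \<le> B"
proof -
  have "bounded (f ` K)"
    using continuous_on_subset[OF assms(1), of K] assms(2)
    by (intro compact_imp_bounded compact_continuous_image) auto
  then obtain B where B: "B > 0" "\<And>x. x \<in> K \<Longrightarrow> norm (f x) \<le> B"
    by (auto simp: bounded_pos)
  show ?thesis
    by (rule that[OF B(1)]) (metis B assms(3) less_imp_le norm_zero)
qed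

lemma test_fun_bounded:
  assumes "test_fun S f" obtains B where "B > 0" "\<And>x. norm (f x) \<le> B"
  using test_funE[OF assms] smooth_on_continuous[OF test_fun_smooth[OF assms]]
    continuous_compact_support_bounded by metis

lemma test_fun_measurable [measurable_dest]:
  "test_fun S f \<Longrightarrow> f \<in> borel_measurable borel"
  by (intro borel_measurable_continuous_onI smooth_on_continuous test_fun_smooth)

lemma smooth_measurable: "smooth_on UNIV f \<Longrightarrow> f \<in> borel_measurable borel"
  by (intro borel_measurable_continuous_onI smooth_on_continuous)

lemma test_fun_scaleR: assumes "test_fun S f" "smooth_on UNIV \<alpha>" shows "test_fun S (\<lambda>x. \<alpha> x *\<^sub>R f x)"
proof -
  obtain K where "compact K" "K \<subseteq> S" "\<And>x. x \<notin> K \<Longrightarrow> f x = 0"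
    using test_funE[OF assms(1)] by metis
  then show ?thesis
    using smooth_on_scaleR[OF assms(2) test_fun_smooth[OF assms(1)]] by (intro test_funI[of _ K]) auto
qed

lemma test_fun_affine:
  fixes f :: "'a::euclidean_space \<Rightarrow> 'b::real_normed_vector"
  assumes "test_fun S f" "r \<noteq> 0" and S: "\<And>x. c + r *\<^sub>R x \<in> S \<Longrightarrow> x \<in> T"
  shows "test_fun T (\<lambda>x. f (c + r *\<^sub>R x))"
proof -
  obtain K where K: "compact K" "K \<subseteq> S" "\<And>x. x \<notin> K \<Longrightarrow> f x = 0"
    using test_funE[OF assms(1)] by metis
  let ?K = "(\<lambda>y. (1/r) *\<^sub>R (y - c)) ` K"
  have "compact ?K" by (intro compact_continuous_image K continuous_intros)
  moreover have "?K \<subseteq> T" using K(2) assms by (auto intro!: S)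
  moreover have "f (c + r *\<^sub>R x) = 0" if "x \<notin> ?K" for x
    using that assms(2) by (intro K(3)) (force simp: image_iff)
  ultimately show ?thesis
    by (intro test_funI[OF smooth_on_affine[OF test_fun_smooth[OF assms(1)]], of ?K])
qed

subsection \<open>Bump functions\<close>

text \<open>Smooth functions that vanish on the negative half line: those of the form \<open>p(1/x) exp(-1/x)\<close> with a
  polynomial \<open>p\<close>. This class is closed under differentiation, which reduces smoothness to
  differentiability.\<close>

definition flat :: "real poly \<Rightarrow> real \<Rightarrow> real"
  where "flat p x = (if x > 0 then poly p (inverse x) * exp (- inverse x) else 0)"

lemma poly_mult_exp_tendsto_0: "((\<lambda>y. poly p y * exp (- y)) \<longlongrightarrow> (0::real)) at_top"
proof (induction p)
  case (pCons a p)
  have "((\<lambda>y::real. y ^ n * exp (- y)) \<longlongrightarrow> 0) at_top" for n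
    using tendsto_power_div_exp_0[of n] by (simp add: exp_minus field_simps)
  from this[of 0] have 0: "((\<lambda>y::real. exp (- y)) \<longlongrightarrow> 0) at_top" by simp
  have "((\<lambda>y. y * (poly p y * exp (- y))) \<longlongrightarrow> 0) at_top"
  proof -
    have eq: "y * (poly p y * exp (- y)) = (\<Sum>i\<le>degree p. coeff p i * (y ^ Suc i * exp (- y)))" for y
      by (simp add: poly_altdef sum_distrib_left sum_distrib_right mult_ac)
    show ?thesis unfolding eq
      by (intro tendsto_null_sum tendsto_mult_right_zero)
         (use \<open>\<And>n. ((\<lambda>y::real. y ^ n * exp (- y)) \<longlongrightarrow> 0) at_top\<close> in blast)
  qed
  from tendsto_add[OF tendsto_mult_right_zero[OF 0, of a] this]
  show ?case by (simp add: algebra_simps)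
qed simp

definition flat_deriv :: "real poly \<Rightarrow> real poly"
  where "flat_deriv p = [:0, 0, 1:] * (p - pderiv p)"

lemma flat_has_derivative: "(flat p has_real_derivative flat (flat_deriv p) x) (at x)"
proof (cases "x > 0" "x < 0" rule: bool.exhaust[case_product bool.exhaust])
  case True_False
  have "((\<lambda>x. poly p (inverse x) * exp (- inverse x)) has_real_derivative
     flat (flat_deriv p) x) (at x)"
    using True_False
    by (auto intro!: derivative_eq_intros
         simp: flat_def flat_deriv_def field_simps power2_eq_square)
  then show ?thesis
    by (rule has_field_derivative_transform_within_open[of _ _ _ "{0<..}"])
       (use True_False in \<open>auto simp: flat_def\<close>)
next
  case False_True
  then show ?thesis
    by (intro has_field_derivative_transform_within_open[OF DERIV_const[of 0], of "{..<0}", THEN DERIV_cong])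
       (auto simp: flat_def)
next
  case False_False
  then have x: "x = 0" by simp
  have "((\<lambda>h. flat p h / h) \<longlongrightarrow> 0) (at_right 0)"
  proof -
    have "((\<lambda>y. poly (pCons 0 p) y * exp (- y)) \<longlongrightarrow> (0::real)) at_top"
      by (rule poly_mult_exp_tendsto_0)
    from filterlim_compose[OF this filterlim_inverse_at_top_right]
    show ?thesis
      by (rule Lim_transform_eventually)
         (auto simp: flat_def eventually_at_filter field_simps intro!: always_eventually)
  qed
  moreover have "((\<lambda>h. flat p h / h) \<longlongrightarrow> 0) (at_left 0)"
    by (rule Lim_transform_eventually[OF tendsto_const[of 0]])
       (auto simp: flat_def eventually_at_filter)
  ultimately have "((\<lambda>h. flat p h / h) \<longlongrightarrow> 0) (at 0)"
    by (simp add: filterlim_split_at)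
  then show ?thesis
    unfolding x by (simp add: has_field_derivative_iff flat_def[of _ 0])
qed auto

lemma Ck_on_flat: "Ck_on k UNIV (\<lambda>z::'a::euclidean_space. flat p (z \<bullet> w + c))"
proof (induction k arbitrary: p)
  case 0
  have "continuous_on UNIV (flat p)"
    by (meson flat_has_derivative DERIV_isCont continuous_at_imp_continuous_on)
  then show ?case
    by (auto intro!: continuous_on_compose2[of UNIV "flat p"] continuous_intros)
next
  case (Suc k)
  have D: "((\<lambda>z. flat p (z \<bullet> w + c)) has_derivative (\<lambda>d. flat (flat_deriv p) (z \<bullet> w + c) * (d \<bullet> w))) (at z)"
    for z :: 'a
    by (rule has_derivative_compose[OF _ flat_has_derivative[unfolded has_field_derivative_def]])
       (auto intro!: derivative_eq_intros)
  have "partial b (\<lambda>z. flat p (z \<bullet> w + c)) = (\<lambda>z. (b \<bullet> w) *\<^sub>R flat (flat_deriv p) (z \<bullet> w + c))" for b :: 'a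
    using partial_has_derivative[OF D] by (auto simp: mult_ac)
  moreover have "(\<lambda>z. flat p (z \<bullet> w + c)) differentiable (at z)" for z :: 'a
    using D differentiable_def by blast
  ultimately show ?case
    using Ck_on_scaleR[OF Ck_on_const Suc.IH] by simp
qed

definition box_bump :: "real \<Rightarrow> 'a \<Rightarrow> 'a \<Rightarrow> 'a::euclidean_space \<Rightarrow> real" where
  "box_bump k a c z = (\<Prod>b\<in>Basis. flat 1 (k * (z \<bullet> b - a \<bullet> b)) * flat 1 (k * (c \<bullet> b - z \<bullet> b)))"

lemma flat_1_bounds: "0 \<le> flat 1 x" "flat 1 x \<le> 1" "flat 1 x > 0 \<longleftrightarrow> x > 0" "flat 1 x = 0 \<longleftrightarrow> x \<le> 0"
  by (auto simp: flat_def)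

lemma smooth_box_bump: "smooth_on UNIV (box_bump k a c)"
proof -
  have 1: "smooth_on UNIV (\<lambda>z. flat 1 (k * (z \<bullet> b - a \<bullet> b)))" for b :: 'a
    using Ck_on_flat[of _ 1 "k *\<^sub>R b" "- (k * (a \<bullet> b))"]
    by (simp add: smooth_on_def right_diff_distrib)
  have 2: "smooth_on UNIV (\<lambda>z. flat 1 (k * (c \<bullet> b - z \<bullet> b)))" for b :: 'a
    using Ck_on_flat[of _ 1 "- k *\<^sub>R b" "k * (c \<bullet> b)"]
    by (simp add: smooth_on_def right_diff_distrib)
  show ?thesis
    unfolding box_bump_def[abs_def]
    by (intro smooth_on_prod smooth_on_scaleR[OF 1 2, unfolded real_scaleR_def])
qed

lemma box_bump_pos: "k > 0 \<Longrightarrow> z \<in> box a c \<Longrightarrow> 0 < box_bump k a c z"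
  unfolding box_bump_def box_def
  by (intro prod_pos mult_pos_pos) (auto simp: flat_1_bounds)

lemma box_bump_zero: "k > 0 \<Longrightarrow> z \<notin> box a c \<Longrightarrow> box_bump k a c z = 0"
  unfolding box_bump_def box_def
  by (auto simp: flat_1_bounds not_less mult_le_0_iff)

lemma box_bump_bounds: "0 \<le> box_bump k a c z" "box_bump k a c z \<le> 1"
  unfolding box_bump_def
  by (auto intro!: prod_nonneg prod_le_1 mult_nonneg_nonneg mult_le_one simp: flat_1_bounds)

lemma test_fun_box_bump: "k > 0 \<Longrightarrow> cbox a c \<subseteq> S \<Longrightarrow> test_fun S (box_bump k a c)"
  using box_subset_cbox by (intro test_funI[of _ "cbox a c"] smooth_box_bump) (auto intro!: box_bump_zero)

text \<open>As \<open>k\<close> grows, the bumps increase to the indicator of the open box; this is how integrals against test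
  functions determine integrals over boxes.\<close>

lemma box_bump_tendsto_indicator:
  "(\<lambda>n. box_bump (Suc n) a c z) \<longlonglongrightarrow> indicator (box a c) z"
proof (cases "z \<in> box a c")
  case True
  have "(\<lambda>n. flat 1 (real (Suc n) * x)) \<longlonglongrightarrow> 1" if "x > 0" for x
  proof -
    have "(\<lambda>n. exp (- (inverse (real (Suc n)) * inverse x))) \<longlonglongrightarrow> exp (- (0 * inverse x))"
      by (intro tendsto_intros LIMSEQ_inverse_real_of_nat)
    then show ?thesis using that by (simp add: flat_def)
  qed
  then have "(\<lambda>n. box_bump (Suc n) a c z) \<longlonglongrightarrow> (\<Prod>b\<in>(Basis::'a set). 1 * 1)"
    using True unfolding box_bump_def
    by (intro tendsto_prod tendsto_mult) (auto simp: mem_box)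
  with True show ?thesis by simp
qed (simp add: box_bump_zero)

text \<open>A positive multiple of a finite sum of bumps is at least one on a given compact set.\<close>

lemma cutoff_exists:
  fixes K S :: "'a::euclidean_space set"
  assumes "compact K" "open S" "K \<subseteq> S"
  obtains \<eta> :: "'a \<Rightarrow> real" where "test_fun S \<eta>" "\<And>x. \<eta> x \<ge> 0" "\<And>x. x \<in> K \<Longrightarrow> \<eta> x \<ge> 1"
proof (cases "K = {}")
  case True
  then show ?thesis
    by (intro that[of "\<lambda>_. 0"] test_funI[of _ "{}"] smooth_on_const) auto
next
  case False
  have "\<exists>a c. x \<in> box a c \<and> cbox a c \<subseteq> S" if "x \<in> K" for x
    using that assms(2,3) by (meson in_mono open_contains_cbox)
  then obtain a c where ac: "\<And>x. x \<in> K \<Longrightarrow> x \<in> box (a x) (c x)" "\<And>x. x \<in> K \<Longrightarrow> cbox (a x) (c x) \<subseteq> S"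
    by metis
  obtain X where X: "X \<subseteq> K" "finite X" "K \<subseteq> (\<Union>x\<in>X. box (a x) (c x))"
  proof (rule compactE_image[OF assms(1), of K "\<lambda>x. box (a x) (c x)"])
    show "K \<subseteq> (\<Union>x\<in>K. box (a x) (c x))" using ac(1) by blast
  qed (use that in auto)
  define \<zeta> where "\<zeta> z = (\<Sum>x\<in>X. box_bump 1 (a x) (c x) z)" for z
  have z0: "\<zeta> z \<ge> 0" for z unfolding \<zeta>_def by (intro sum_nonneg box_bump_bounds)
  have sm: "smooth_on UNIV \<zeta>" unfolding \<zeta>_def[abs_def] by (intro smooth_on_sum smooth_box_bump)
  have pos: "\<zeta> z > 0" if zK: "z \<in> K" for z
  proof -
    obtain x where "x \<in> X" "z \<in> box (a x) (c x)" using X(3) zK by blast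
    then show ?thesis
      unfolding \<zeta>_def using X(2) by (intro sum_pos2[of X x] box_bump_pos box_bump_bounds) auto
  qed
  obtain m where m: "m \<in> K" "\<And>z. z \<in> K \<Longrightarrow> \<zeta> m \<le> \<zeta> z"
    using continuous_attains_inf[OF assms(1) False smooth_on_continuous[OF sm]] by blast
  have "test_fun S \<zeta>"
  proof (rule test_funI[OF sm])
    show "compact (\<Union>x\<in>X. cbox (a x) (c x))" using X by auto
    show "(\<Union>x\<in>X. cbox (a x) (c x)) \<subseteq> S" using ac X by blast
    show "\<zeta> z = 0" if "z \<notin> (\<Union>x\<in>X. cbox (a x) (c x))" for z
      unfolding \<zeta>_def using that box_subset_cbox by (intro sum.neutral ballI box_bump_zero) auto
  qed
  then have "test_fun S (\<lambda>z. (1 / \<zeta> m) *\<^sub>R \<zeta> z)"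
    by (rule test_fun_scaleR[OF _ smooth_on_const])
  then show ?thesis
    by (rule that) (use z0 m pos[OF m(1)] in \<open>auto simp: field_simps\<close>)
qed

section \<open>Square integrable functions on a Euclidean space\<close>

text \<open>Square integrable Borel functions on the whole space. Functions on a domain are extended by zero, so
  that translations and convolutions are defined everywhere, and equality of functions is pointwise.\<close>

definition L2 :: "('a::euclidean_space \<Rightarrow> 'b::euclidean_space) \<Rightarrow> bool" where
  "L2 u \<longleftrightarrow> u \<in> borel_measurable borel \<and> integrable lborel (\<lambda>x. (norm (u x))\<^sup>2)"

definition nrm2 :: "('a::euclidean_space \<Rightarrow> 'b::euclidean_space) \<Rightarrow> real" where
  "nrm2 u = sqrt (\<integral>x. (norm (u x))\<^sup>2 \<partial>lborel)"

lemma L2_measurable [measurable_dest]: "L2 u \<Longrightarrow> u \<in> borel_measurable borel"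
  by (simp add: L2_def)

lemma L2_integrable: "L2 u \<Longrightarrow> integrable lborel (\<lambda>x. (norm (u x))\<^sup>2)"
  by (simp add: L2_def)

lemma nrm2_nonneg [simp]: "0 \<le> nrm2 u"
  by (simp add: nrm2_def)

lemma nrm2_sq: "(nrm2 u)\<^sup>2 = (\<integral>x. (norm (u x))\<^sup>2 \<partial>lborel)"
  by (simp add: nrm2_def)

lemma nn_integral_L2: "L2 u \<Longrightarrow> (\<integral>\<^sup>+x. ennreal ((norm (u x))\<^sup>2) \<partial>lborel) = ennreal ((nrm2 u)\<^sup>2)"
  by (simp add: nrm2_sq L2_def nn_integral_eq_integral)

lemma L2I_nn:
  assumes "u \<in> borel_measurable borel" "(\<integral>\<^sup>+x. ennreal ((norm (u x))\<^sup>2) \<partial>lborel) \<le> ennreal (C\<^sup>2)" "C \<ge> 0"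
  shows "L2 u" "nrm2 u \<le> C"
proof -
  have int: "integrable lborel (\<lambda>x. (norm (u x))\<^sup>2)"
    using assms by (intro integrableI_bounded) (auto simp: le_less_trans[OF _ ennreal_less_top])
  then show "L2 u" using assms by (simp add: L2_def)
  then have "ennreal ((nrm2 u)\<^sup>2) \<le> ennreal (C\<^sup>2)" using assms nn_integral_L2 by metis
  then have "(nrm2 u)\<^sup>2 \<le> C\<^sup>2" by (simp add: ennreal_le_iff)
  then show "nrm2 u \<le> C" using assms(3) power2_le_imp_le by blast
qed

lemma L2_dominated:
  assumes "L2 w" and [measurable]: "u \<in> borel_measurable borel"
    and le: "AE x in lborel. norm (u x) \<le> c * norm (w x)" and "c \<ge> 0"
  shows "L2 u" "nrm2 u \<le> c * nrm2 w"
proof -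
  have [measurable]: "w \<in> borel_measurable borel" using assms by measurable
  have "(\<integral>\<^sup>+x. ennreal ((norm (u x))\<^sup>2) \<partial>lborel) \<le> (\<integral>\<^sup>+x. ennreal (c\<^sup>2) * ennreal ((norm (w x))\<^sup>2) \<partial>lborel)"
  proof (rule nn_integral_mono_AE, rule AE_mp[OF le AE_I2], intro impI)
    fix x assume "norm (u x) \<le> c * norm (w x)"
    then have "(norm (u x))\<^sup>2 \<le> (c * norm (w x))\<^sup>2" by (intro power_mono) auto
    then show "ennreal ((norm (u x))\<^sup>2) \<le> ennreal (c\<^sup>2) * ennreal ((norm (w x))\<^sup>2)"
      by (simp add: power_mult_distrib ennreal_leI flip: ennreal_mult)
  qed
  also have "\<dots> = ennreal (c\<^sup>2) * ennreal ((nrm2 w)\<^sup>2)"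
    by (simp add: nn_integral_cmult nn_integral_L2[OF assms(1)])
  also have "\<dots> = ennreal ((c * nrm2 w)\<^sup>2)"
    by (simp add: power_mult_distrib ennreal_mult)
  finally have le2: "(\<integral>\<^sup>+x. ennreal ((norm (u x))\<^sup>2) \<partial>lborel) \<le> ennreal ((c * nrm2 w)\<^sup>2)" .
  show "L2 u" "nrm2 u \<le> c * nrm2 w"
    by (rule L2I_nn[OF _ le2], use assms(4) in auto)+
qed

lemma L2_zero [simp]: "L2 (\<lambda>x. 0)" "nrm2 (\<lambda>x. 0) = 0"
  by (simp_all add: L2_def nrm2_def)

lemma L2_scaleR: "L2 u \<Longrightarrow> L2 (\<lambda>x. c *\<^sub>R u x)"
  by (auto simp: L2_def power_mult_distrib)

lemma nrm2_scaleR: "nrm2 (\<lambda>x. c *\<^sub>R u x) = \<bar>c\<bar> * nrm2 u"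
  by (simp add: nrm2_def power_mult_distrib real_sqrt_mult)

lemma L2_add: assumes "L2 u" "L2 v" shows "L2 (\<lambda>x. u x + v x)"
proof -
  have [measurable]: "u \<in> borel_measurable borel" "v \<in> borel_measurable borel" using assms by measurable
  have "integrable lborel (\<lambda>x. (norm (u x + v x))\<^sup>2)"
  proof (rule Bochner_Integration.integrable_bound)
    show "integrable lborel (\<lambda>x. 2 * (norm (u x))\<^sup>2 + 2 * (norm (v x))\<^sup>2)"
      using assms by (intro Bochner_Integration.integrable_add integrable_mult_right L2_integrable)
    have "(norm (u x + v x))\<^sup>2 \<le> 2 * (norm (u x))\<^sup>2 + 2 * (norm (v x))\<^sup>2" for x
    proof -
      have "(norm (u x + v x))\<^sup>2 \<le> (norm (u x) + norm (v x))\<^sup>2"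
        by (intro power_mono norm_triangle_ineq) auto
      also have "\<dots> \<le> 2 * (norm (u x))\<^sup>2 + 2 * (norm (v x))\<^sup>2"
        using sum_squares_bound[of "norm (u x)" "norm (v x)"] by (simp add: power2_sum)
      finally show ?thesis .
    qed
    then show "AE x in lborel. norm ((norm (u x + v x))\<^sup>2) \<le> norm (2 * (norm (u x))\<^sup>2 + 2 * (norm (v x))\<^sup>2)"
      by simp
  qed auto
  then show ?thesis by (simp add: L2_def)
qed

lemma L2_diff: "L2 u \<Longrightarrow> L2 v \<Longrightarrow> L2 (\<lambda>x. u x - v x)"
  using L2_add[of u "\<lambda>x. (-1) *\<^sub>R v x"] L2_scaleR[of v "-1"] by simp

lemma L2_sum: "(\<And>i. i \<in> I \<Longrightarrow> L2 (u i)) \<Longrightarrow> L2 (\<lambda>x. \<Sum>i\<in>I. u i x)"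
  by (induction I rule: infinite_finite_induct) (simp_all add: L2_add)

lemma Cauchy_Schwarz_nrm2:
  assumes "L2 u" "L2 v"
  shows "integrable lborel (\<lambda>x. norm (u x) * norm (v x))"
    "(\<integral>x. norm (u x) * norm (v x) \<partial>lborel) \<le> nrm2 u * nrm2 v"
proof -
  have [measurable]: "u \<in> borel_measurable borel" "v \<in> borel_measurable borel" using assms by measurable
  note int = L2_integrable[OF assms(1)] L2_integrable[OF assms(2)]
  show int2: "integrable lborel (\<lambda>x. norm (u x) * norm (v x))"
  proof (rule Bochner_Integration.integrable_bound)
    show "integrable lborel (\<lambda>x. (norm (u x))\<^sup>2 + (norm (v x))\<^sup>2)" using int by simp
    have "norm (u x) * norm (v x) \<le> (norm (u x))\<^sup>2 + (norm (v x))\<^sup>2" for x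
      using sum_squares_bound[of "norm (u x)" "norm (v x)"] mult_nonneg_nonneg[OF norm_ge_zero norm_ge_zero, of "u x" "v x"]
      by linarith
    then show "AE x in lborel. norm (norm (u x) * norm (v x)) \<le> norm ((norm (u x))\<^sup>2 + (norm (v x))\<^sup>2)" by simp
  qed auto
  define A B C where "A = (nrm2 u)\<^sup>2" and "B = (\<integral>x. norm (u x) * norm (v x) \<partial>lborel)" and "C = (nrm2 v)\<^sup>2"
  have B0: "B \<ge> 0" unfolding B_def by simp
  have q: "0 \<le> C * (C * A - B\<^sup>2)"
  proof -
    have "0 \<le> (\<integral>x. (C * norm (u x) - B * norm (v x))\<^sup>2 \<partial>lborel)" by simp
    also have "\<dots> = (\<integral>x. C\<^sup>2 * (norm (u x))\<^sup>2 - (2 * C * B) * (norm (u x) * norm (v x)) + B\<^sup>2 * (norm (v x))\<^sup>2 \<partial>lborel)"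
      by (intro Bochner_Integration.integral_cong) (auto simp: power2_eq_square algebra_simps)
    also have "\<dots> = C\<^sup>2 * A - (2 * C * B) * B + B\<^sup>2 * C"
      using int int2 unfolding A_def B_def C_def nrm2_sq by simp
    also have "\<dots> = C * (C * A - B\<^sup>2)" by (simp add: power2_eq_square algebra_simps)
    finally show ?thesis .
  qed
  have "B\<^sup>2 \<le> C * A"
  proof (cases "C = 0")
    case True
    then have "AE x in lborel. (norm (v x))\<^sup>2 = 0"
      using int(2) by (subst (asm) C_def) (simp add: nrm2_sq integral_nonneg_eq_0_iff_AE)
    then have "AE x in lborel. norm (u x) * norm (v x) = 0" by eventually_elim auto
    then have "B = 0" unfolding B_def by (rule integral_eq_zero_AE)
    with True show ?thesis by simp
  next
    case False
    then have "C > 0" unfolding C_def by simp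
    with q show ?thesis by (simp add: zero_le_mult_iff)
  qed
  then have "B\<^sup>2 \<le> (nrm2 u * nrm2 v)\<^sup>2" by (simp add: A_def C_def power_mult_distrib mult.commute)
  then show "(\<integral>x. norm (u x) * norm (v x) \<partial>lborel) \<le> nrm2 u * nrm2 v"
    unfolding B_def[symmetric] by (rule power2_le_imp_le) simp
qed

lemma L2_inner_integrable: assumes "L2 u" "L2 v" shows "integrable lborel (\<lambda>x. u x \<bullet> v x)"
  using assms[THEN L2_measurable]
  by (intro Bochner_Integration.integrable_bound[OF Cauchy_Schwarz_nrm2(1)[OF assms]])
     (auto simp: Cauchy_Schwarz_ineq2)

lemma L2_inner_bound: assumes "L2 u" "L2 v" shows "\<bar>\<integral>x. u x \<bullet> v x \<partial>lborel\<bar> \<le> nrm2 u * nrm2 v"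
proof -
  have "\<bar>\<integral>x. u x \<bullet> v x \<partial>lborel\<bar> \<le> (\<integral>x. \<bar>u x \<bullet> v x\<bar> \<partial>lborel)"
    using integral_abs_bound by blast
  also have "\<dots> \<le> (\<integral>x. norm (u x) * norm (v x) \<partial>lborel)"
    using assms by (intro integral_mono Cauchy_Schwarz_nrm2 integrable_abs L2_inner_integrable Cauchy_Schwarz_ineq2)
  finally show ?thesis using Cauchy_Schwarz_nrm2(2)[OF assms] by linarith
qed

lemma L2_scaleR_integrable:
  fixes \<phi> :: "'a::euclidean_space \<Rightarrow> real"
  assumes "L2 \<phi>" "L2 v" shows "integrable lborel (\<lambda>x. \<phi> x *\<^sub>R v x)"
  using assms[THEN L2_measurable]
  by (intro Bochner_Integration.integrable_bound[OF Cauchy_Schwarz_nrm2(1)[OF assms]]) auto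

lemma nrm2_triangle: assumes "L2 u" "L2 v" shows "nrm2 (\<lambda>x. u x + v x) \<le> nrm2 u + nrm2 v"
proof -
  have "(nrm2 (\<lambda>x. u x + v x))\<^sup>2 = (\<integral>x. (norm (u x))\<^sup>2 + 2 * (u x \<bullet> v x) + (norm (v x))\<^sup>2 \<partial>lborel)"
    unfolding nrm2_sq by (intro Bochner_Integration.integral_cong)
      (auto simp: power2_norm_eq_inner inner_simps inner_commute)
  also have "\<dots> = (nrm2 u)\<^sup>2 + 2 * (\<integral>x. u x \<bullet> v x \<partial>lborel) + (nrm2 v)\<^sup>2"
    using L2_integrable[OF assms(1)] L2_integrable[OF assms(2)] L2_inner_integrable[OF assms]
    by (simp add: nrm2_sq)
  also have "\<dots> \<le> (nrm2 u + nrm2 v)\<^sup>2"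
    using L2_inner_bound[OF assms] by (simp add: power2_sum)
  finally show ?thesis by (rule power2_le_imp_le) simp
qed

lemma nrm2_minus: "nrm2 (\<lambda>x. - u x) = nrm2 u"
  by (simp add: nrm2_def)

lemma nrm2_commute: "nrm2 (\<lambda>x. u x - v x) = nrm2 (\<lambda>x. v x - u x)"
  by (simp add: nrm2_def norm_minus_commute)

lemma nrm2_triangle_diff: "L2 u \<Longrightarrow> L2 v \<Longrightarrow> nrm2 (\<lambda>x. u x - v x) \<le> nrm2 u + nrm2 v"
  using nrm2_triangle[of u "\<lambda>x. (-1) *\<^sub>R v x"] L2_scaleR[of v "-1"] by (simp add: nrm2_minus)

lemma nrm2_triangle3:
  "L2 u \<Longrightarrow> L2 v \<Longrightarrow> L2 w \<Longrightarrow> nrm2 (\<lambda>x. u x - w x) \<le> nrm2 (\<lambda>x. u x - v x) + nrm2 (\<lambda>x. v x - w x)"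
  using nrm2_triangle[of "\<lambda>x. u x - v x" "\<lambda>x. v x - w x"] by (simp add: L2_diff)

lemma nrm2_le_add_diff: "L2 u \<Longrightarrow> L2 v \<Longrightarrow> nrm2 u \<le> nrm2 v + nrm2 (\<lambda>x. u x - v x)"
  using nrm2_triangle[of v "\<lambda>x. u x - v x"] by (simp add: L2_diff)

lemma nrm2_cong_AE:
  assumes "u \<in> borel_measurable borel" "v \<in> borel_measurable borel" "AE x in lborel. u x = v x"
  shows "nrm2 u = nrm2 v"
  unfolding nrm2_def using assms
  by (intro arg_cong[of _ _ sqrt] integral_cong_AE) auto

lemma nrm2_eq_0: assumes "L2 u" "nrm2 u = 0" shows "AE x in lborel. u x = 0"
proof -
  have "(\<integral>x. (norm (u x))\<^sup>2 \<partial>lborel) = 0" using assms(2) by (simp add: nrm2_def)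
  then have "AE x in lborel. (norm (u x))\<^sup>2 = 0"
    using L2_integrable[OF assms(1)] by (simp add: integral_nonneg_eq_0_iff_AE)
  then show ?thesis by eventually_elim simp
qed

lemma L2_bounded_mult:
  fixes \<zeta> :: "'a::euclidean_space \<Rightarrow> real"
  assumes "L2 u" "\<zeta> \<in> borel_measurable borel" "\<And>x. \<bar>\<zeta> x\<bar> \<le> B"
  shows "L2 (\<lambda>x. \<zeta> x *\<^sub>R u x)" "nrm2 (\<lambda>x. \<zeta> x *\<^sub>R u x) \<le> B * nrm2 u"
proof -
  have "B \<ge> 0" using assms(3)[of undefined] by linarith
  then show "L2 (\<lambda>x. \<zeta> x *\<^sub>R u x)" "nrm2 (\<lambda>x. \<zeta> x *\<^sub>R u x) \<le> B * nrm2 u"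
    using assms L2_measurable[OF assms(1)]
    by (auto intro!: L2_dominated[OF assms(1)] AE_I2 mult_right_mono)
qed

lemma L2_indicator_mult:
  assumes "L2 u" "A \<in> sets borel"
  shows "L2 (\<lambda>x. indicator A x *\<^sub>R u x)" "nrm2 (\<lambda>x. indicator A x *\<^sub>R u x) \<le> nrm2 u"
  using L2_bounded_mult[OF assms(1), of "indicator A" 1] assms(2) by (auto simp: indicator_def)

lemma nrm2_tendsto:
  assumes "\<And>n. L2 (u n)" "L2 v" "(\<lambda>n. nrm2 (\<lambda>x. u n x - v x)) \<longlonglongrightarrow> 0"
  shows "(\<lambda>n. nrm2 (u n)) \<longlonglongrightarrow> nrm2 v"
proof -
  have "\<bar>nrm2 (u n) - nrm2 v\<bar> \<le> nrm2 (\<lambda>x. u n x - v x)" for n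
    using nrm2_le_add_diff[OF assms(1) assms(2), of n] nrm2_le_add_diff[OF assms(2) assms(1), of n]
    by (simp add: nrm2_commute[of v])
  then show ?thesis
    by (intro LIM_zero_cancel[of _ "nrm2 v"] Lim_null_comparison[OF _ assms(3)]) auto
qed

lemma L2_inner_tendsto:
  assumes u: "\<And>n. L2 (u n)" "L2 u0" "(\<lambda>n. nrm2 (\<lambda>x. u n x - u0 x)) \<longlonglongrightarrow> 0"
    and v: "\<And>n. L2 (v n)" "L2 v0" "(\<lambda>n. nrm2 (\<lambda>x. v n x - v0 x)) \<longlonglongrightarrow> 0"
  shows "(\<lambda>n. \<integral>x. u n x \<bullet> v n x \<partial>lborel) \<longlonglongrightarrow> (\<integral>x. u0 x \<bullet> v0 x \<partial>lborel)"
proof -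
  have bound: "\<bar>(\<integral>x. u n x \<bullet> v n x \<partial>lborel) - (\<integral>x. u0 x \<bullet> v0 x \<partial>lborel)\<bar>
    \<le> nrm2 (\<lambda>x. u n x - u0 x) * nrm2 (v n) + nrm2 u0 * nrm2 (\<lambda>x. v n x - v0 x)" for n
  proof -
    have "(\<integral>x. u n x \<bullet> v n x \<partial>lborel) - (\<integral>x. u0 x \<bullet> v0 x \<partial>lborel)
      = (\<integral>x. (u n x - u0 x) \<bullet> v n x \<partial>lborel) + (\<integral>x. u0 x \<bullet> (v n x - v0 x) \<partial>lborel)"
      using u v by (simp add: inner_diff_left inner_diff_right L2_inner_integrable)
    then show ?thesis
      using L2_inner_bound[OF L2_diff[OF u(1)[of n] u(2)] v(1)[of n]]
        L2_inner_bound[OF u(2) L2_diff[OF v(1)[of n] v(2)]] by linarith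
  qed
  have lim: "(\<lambda>n. nrm2 (\<lambda>x. u n x - u0 x) * nrm2 (v n) + nrm2 u0 * nrm2 (\<lambda>x. v n x - v0 x)) \<longlonglongrightarrow> 0"
    using tendsto_add[OF tendsto_mult[OF u(3) nrm2_tendsto[OF v]] tendsto_mult[OF tendsto_const v(3)], of "nrm2 u0"]
    by simp
  have "(\<lambda>n. (\<integral>x. u n x \<bullet> v n x \<partial>lborel) - (\<integral>x. u0 x \<bullet> v0 x \<partial>lborel)) \<longlonglongrightarrow> 0"
    by (rule Lim_null_comparison[OF _ lim]) (use bound in simp)
  then show ?thesis by (rule LIM_zero_cancel)
qed

lemma L2_dominated_convergence:
  fixes u :: "nat \<Rightarrow> 'a::euclidean_space \<Rightarrow> 'b::euclidean_space" and w :: "'a \<Rightarrow> 'c::euclidean_space"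
  assumes "\<And>n. u n \<in> borel_measurable borel" "L2 w"
    and "AE x in lborel. (\<lambda>n. u n x) \<longlonglongrightarrow> 0" "\<And>n. AE x in lborel. norm (u n x) \<le> c * norm (w x)" "c \<ge> 0"
  shows "(\<lambda>n. nrm2 (u n)) \<longlonglongrightarrow> 0"
proof -
  have "(\<lambda>n. \<integral>x. (norm (u n x))\<^sup>2 \<partial>lborel) \<longlonglongrightarrow> (\<integral>x. 0 \<partial>(lborel :: 'a measure))"
  proof (rule integral_dominated_convergence)
    show "integrable lborel (\<lambda>x. c\<^sup>2 * (norm (w x))\<^sup>2)" using L2_integrable[OF assms(2)] by simp
    show "AE x in lborel. (\<lambda>n. (norm (u n x))\<^sup>2) \<longlonglongrightarrow> 0"
      using assms(3)
    proof (rule AE_mp[OF _ AE_I2], intro impI)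
      fix x assume elim: "(\<lambda>n. u n x) \<longlonglongrightarrow> 0"
      show "(\<lambda>n. (norm (u n x))\<^sup>2) \<longlonglongrightarrow> 0" using tendsto_power[OF tendsto_norm[OF elim], of 2] by simp
    qed
    show "AE x in lborel. norm ((norm (u n x))\<^sup>2) \<le> c\<^sup>2 * (norm (w x))\<^sup>2" for n
      using assms(4)[of n]
    proof eventually_elim
      case (elim x)
      then have "(norm (u n x))\<^sup>2 \<le> (c * norm (w x))\<^sup>2" by (intro power_mono) auto
      then show ?case by (simp add: power_mult_distrib)
    qed
    show "(\<lambda>x. (norm (u n x))\<^sup>2) \<in> borel_measurable lborel" for n using assms(1)[of n] by measurable
  qed simp
  from tendsto_real_sqrt[OF this] show ?thesis by (simp add: nrm2_def)
qed

text \<open>On a set of finite measure, convergence in mean square implies convergence in the mean.\<close>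

lemma L2_finite_support_integrable:
  assumes "L2 u" "B \<in> fmeasurable lborel" "\<And>x. x \<notin> B \<Longrightarrow> u x = 0"
  shows "integrable lborel u" "(\<integral>x. norm (u x) \<partial>lborel) \<le> sqrt (measure lborel B) * nrm2 u"
proof -
  have [measurable]: "B \<in> sets borel" using assms(2) by auto
  have fin: "emeasure lborel B < \<infinity>" using assms(2) by (auto simp: fmeasurable_def)
  have I: "(\<lambda>x. (norm (indicator B x :: real))\<^sup>2) = indicator B" by (auto simp: indicator_def)
  have B: "L2 (indicator B :: 'a \<Rightarrow> real)" "nrm2 (indicator B :: 'a \<Rightarrow> real) = sqrt (measure lborel B)"
    using fin unfolding L2_def nrm2_def I by (auto intro!: integrable_real_indicator)
  have eq: "norm (indicator B x :: real) * norm (u x) = norm (u x)" for x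
    using assms(3)[of x] by (auto simp: indicator_def)
  show "integrable lborel u"
    using Cauchy_Schwarz_nrm2(1)[OF B(1) assms(1)] L2_measurable[OF assms(1)]
    unfolding eq by (simp add: integrable_norm_iff)
  show "(\<integral>x. norm (u x) \<partial>lborel) \<le> sqrt (measure lborel B) * nrm2 u"
    using Cauchy_Schwarz_nrm2(2)[OF B(1) assms(1)] unfolding eq B(2) .
qed

subsection \<open>Approximation by continuous functions\<close>

lemma L2_indicator_compact:
  fixes K :: "'a::euclidean_space set"
  assumes K: "compact K" shows "L2 (indicator K :: 'a \<Rightarrow> real)"
proof -
  have "(norm (indicator K x :: real))\<^sup>2 = indicator K x" for x by (simp add: indicator_def)
  then show ?thesis using fmeasurable_compact[OF K] borel_compact[OF K] by (simp add: L2_def fmeasurable_def)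
qed

lemma continuous_compact_support_L2:
  fixes W :: "'a::euclidean_space \<Rightarrow> 'b::euclidean_space"
  assumes W: "continuous_on UNIV W" "compact K" "\<And>x. x \<notin> K \<Longrightarrow> W x = 0"
  shows "L2 W"
proof -
  obtain B where B: "B > 0" "\<And>x. norm (W x) \<le> B" using continuous_compact_support_bounded[OF W] by blast
  show ?thesis
    by (rule L2_dominated(1)[OF L2_indicator_compact[OF W(2)], where c = B])
      (use B W in \<open>auto simp: indicator_def intro!: borel_measurable_continuous_onI AE_I2\<close>)
qed

text \<open>A measurable function is almost everywhere a limit of continuous functions. Truncating both the function
  and its approximations, in the values and in the argument, makes dominated convergence applicable.\<close>

lemma L2_approx_continuous:
  fixes u :: "'a::euclidean_space \<Rightarrow> 'b::euclidean_space"
  assumes u: "L2 u" and e: "e > 0"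
  obtains w K where "continuous_on UNIV w" "compact K" "\<And>x. x \<notin> K \<Longrightarrow> w x = 0" "nrm2 (\<lambda>x. u x - w x) < e"
proof -
  have um: "u \<in> borel_measurable borel" by (rule L2_measurable[OF u])
  then have "u measurable_on UNIV" by (intro lebesgue_measurable_imp_measurable_on measurable_completion) auto
  then obtain N g where N: "negligible N" and g: "\<And>n. continuous_on UNIV (g n)" "\<And>x. x \<notin> N \<Longrightarrow> (\<lambda>n. g n x) \<longlonglongrightarrow> u x"
    unfolding measurable_on_def by auto
  define clamp :: "real \<Rightarrow> 'b \<Rightarrow> 'b" where "clamp M y = (M / max M (norm y)) *\<^sub>R y" for M y
  define k where "k M x = max 0 (min 1 (M + 1 - norm x))" for M and x :: 'a
  \<comment> \<open>\<open>t M\<close> truncates \<open>u\<close> and \<open>w M n\<close> truncates its continuous approximation; both are bounded by \<open>M\<close>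
    and vanish outside the ball of radius \<open>M + 1\<close>.\<close>
  define t where "t M x = k M x *\<^sub>R clamp M (u x)" for M x
  define w where "w M n x = k M x *\<^sub>R clamp M (g n x)" for M n x
  have kc: "continuous_on UNIV (k M)" "0 \<le> k M x" "k M x \<le> 1" for M x
    unfolding k_def by (auto intro!: continuous_intros)
  have cc: "continuous_on UNIV (clamp M)" if "M > 0" for M
    unfolding clamp_def using that by (intro continuous_intros) (auto simp: max_def)
  have nc: "norm (clamp M y) \<le> norm y" "norm (clamp M y) \<le> M" if "M > 0" for M y
    using that by (auto simp: clamp_def max_def field_simps mult_right_mono)
  have tm: "t M \<in> borel_measurable borel" if "M > 0" for M
    unfolding t_def using measurable_compose[OF um borel_measurable_continuous_onI[OF cc[OF that]]]
      borel_measurable_continuous_onI[OF kc(1)] by measurable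
  have tu: "norm (t M x) \<le> norm (u x)" if "M > 0" for M x
    using mult_mono[OF kc(3)[of M x] nc(1)[OF that, of "u x"]] kc(2)[of M x] by (simp add: t_def)
  have tL: "L2 (t M)" if "M > 0" for M
    by (rule L2_dominated(1)[OF u tm[OF that], where c = 1]) (use tu[OF that] in auto)
  have "(\<lambda>M. nrm2 (\<lambda>x. u x - t (real (Suc M)) x)) \<longlonglongrightarrow> 0"
  proof (rule L2_dominated_convergence[OF _ u, where c = 2])
    show "AE x in lborel. (\<lambda>M. u x - t (real (Suc M)) x) \<longlonglongrightarrow> 0"
    proof (rule AE_I2)
      fix x
      obtain M0 :: nat where M0: "max (norm (u x)) (norm x) \<le> real M0" using real_arch_simple by blast
      have "u x - t (real (Suc M)) x = 0" if "M \<ge> M0" for M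
      proof -
        have "norm (u x) < real (Suc M)" "norm x < real (Suc M)" using M0 that by auto
        then show ?thesis by (simp add: t_def k_def clamp_def)
      qed
      then show "(\<lambda>M. u x - t (real (Suc M)) x) \<longlonglongrightarrow> 0"
        by (intro tendsto_eventually eventually_sequentiallyI[of M0]) auto
    qed
    show "AE x in lborel. norm (u x - t (real (Suc M)) x) \<le> 2 * norm (u x)" for M
      using tu[of "real (Suc M)"] by (intro AE_I2 order_trans[OF norm_triangle_ineq4]) auto
  qed (use um tm in auto)
  from order_tendstoD(2)[OF this, of "e / 2"] e
  obtain M0 where M0: "nrm2 (\<lambda>x. u x - t (real (Suc M0)) x) < e / 2" by (auto simp: eventually_sequentially)
  define M where "M = real (Suc M0)"
  have M: "M > 0" by (simp add: M_def)
  define B where "B = cball (0 :: 'a) (M + 1)"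
  have B: "compact B" "\<And>x. x \<notin> B \<Longrightarrow> k M x = 0" by (auto simp: B_def k_def)
  have wc: "continuous_on UNIV (w M n)" for n
    unfolding w_def by (intro continuous_intros kc continuous_on_compose2[OF cc[OF M] g(1)]) auto
  have w0: "w M n x = 0" if "x \<notin> B" for n x using B(2)[OF that] by (simp add: w_def)
  have "L2 (\<lambda>x. k (M + 1) x)"
    by (rule continuous_compact_support_L2[OF kc(1), of "cball 0 (M + 2)"]) (auto simp: k_def)
  then have "(\<lambda>n. nrm2 (\<lambda>x. t M x - w M n x)) \<longlonglongrightarrow> 0"
  proof (rule L2_dominated_convergence[rotated, where c = "2 * M"])
    show "AE x in lborel. (\<lambda>n. t M x - w M n x) \<longlonglongrightarrow> 0"
    proof -
      have "AE x in lborel. x \<notin> N" using N negligible_iff_null_sets AE_completion_iff by (metis AE_not_in)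
      then show ?thesis
      proof eventually_elim
        case (elim x)
        have "isCont (clamp M) (u x)" using cc[OF M] by (simp add: continuous_on_eq_continuous_at)
        from isCont_tendsto_compose[OF this g(2)[OF elim]]
        have "(\<lambda>n. w M n x) \<longlonglongrightarrow> t M x" unfolding w_def t_def by (intro tendsto_intros)
        then show ?case using tendsto_diff[OF tendsto_const, of "\<lambda>n. w M n x" "t M x" sequentially "t M x"] by simp
      qed
    qed
    show "AE x in lborel. norm (t M x - w M n x) \<le> 2 * M * norm (k (M + 1) x)" for n
    proof (rule AE_I2)
      fix x
      show "norm (t M x - w M n x) \<le> 2 * M * norm (k (M + 1) x)"
      proof (cases "x \<in> B")
        case True
        then have k1: "k (M + 1) x = 1" by (auto simp: B_def k_def)
        have b: "norm (k M x *\<^sub>R clamp M y) \<le> M" for y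
          using mult_mono[OF kc(3)[of M x] nc(2)[OF M, of y]] kc(2)[of M x] M by simp
        have "norm (t M x) \<le> M" "norm (w M n x) \<le> M" unfolding t_def w_def by (rule b)+
        then show ?thesis using norm_triangle_ineq4[of "t M x" "w M n x"] by (simp add: k1)
      qed (use B(2) M in \<open>simp add: t_def w_def\<close>)
    qed
    show "(\<lambda>x. t M x - w M n x) \<in> borel_measurable borel" for n
      using tm[OF M] borel_measurable_continuous_onI[OF wc[of n]] by measurable
  qed (use M in simp)
  from order_tendstoD(2)[OF this, of "e / 2"] e
  obtain n where n: "nrm2 (\<lambda>x. t M x - w M n x) < e / 2" by (auto simp: eventually_sequentially)
  have "L2 (w M n)" by (rule continuous_compact_support_L2[OF wc B(1) w0])
  then have "nrm2 (\<lambda>x. u x - w M n x) < e" using nrm2_triangle3[OF u tL[OF M]] n M0 unfolding M_def[symmetric] by fastforce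
  then show thesis using that[OF wc B(1) w0] by blast
qed

subsection \<open>Translations\<close>

lemma lborel_distr_shift: "distr lborel borel (\<lambda>x. x + h) = (lborel :: 'a::euclidean_space measure)"
proof -
  have "(\<lambda>x. x + h) = (+) h" by (auto simp: add.commute)
  then show ?thesis by (simp only: lborel_distr_plus)
qed

lemma lborel_distr_reflect: "distr lborel borel (\<lambda>x. c - x) = (lborel :: 'a::euclidean_space measure)"
  using lborel_affine[of "-1" c] by (simp add: density_1 one_ennreal_def[symmetric] density_cong)

lemma integral_shift:
  fixes f :: "'a::euclidean_space \<Rightarrow> 'b::euclidean_space"
  assumes [measurable]: "f \<in> borel_measurable borel"
  shows "(\<integral>x. f (x + h) \<partial>lborel) = (\<integral>x. f x \<partial>lborel)"
    "integrable lborel (\<lambda>x. f (x + h)) \<longleftrightarrow> integrable lborel f"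
proof -
  show "(\<integral>x. f (x + h) \<partial>lborel) = (\<integral>x. f x \<partial>lborel)"
    by (subst (2) lborel_distr_shift[of h, symmetric]) (simp add: integral_distr)
  show "integrable lborel (\<lambda>x. f (x + h)) \<longleftrightarrow> integrable lborel f"
    by (subst (2) lborel_distr_shift[of h, symmetric]) (simp add: integrable_distr_eq)
qed

lemma integral_reflect:
  fixes f :: "'a::euclidean_space \<Rightarrow> 'b::euclidean_space"
  assumes [measurable]: "f \<in> borel_measurable borel"
  shows "(\<integral>x. f (c - x) \<partial>lborel) = (\<integral>x. f x \<partial>lborel)"
    "integrable lborel (\<lambda>x. f (c - x)) \<longleftrightarrow> integrable lborel f"
proof -
  show "(\<integral>x. f (c - x) \<partial>lborel) = (\<integral>x. f x \<partial>lborel)"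
    by (subst (2) lborel_distr_reflect[of c, symmetric]) (simp add: integral_distr)
  show "integrable lborel (\<lambda>x. f (c - x)) \<longleftrightarrow> integrable lborel f"
    by (subst (2) lborel_distr_reflect[of c, symmetric]) (simp add: integrable_distr_eq)
qed

lemma L2_shift: "L2 u \<Longrightarrow> L2 (\<lambda>x. u (x + h))"
  and nrm2_shift: "u \<in> borel_measurable borel \<Longrightarrow> nrm2 (\<lambda>x. u (x + h)) = nrm2 u"
  using integral_shift[of "\<lambda>x. (norm (u x))\<^sup>2" h] by (auto simp: L2_def nrm2_def)

lemma L2_shift_diff: "L2 u \<Longrightarrow> L2 (\<lambda>x. u (x + h) - u x)"
  by (intro L2_diff L2_shift)

lemma nrm2_shift_diff: "L2 u \<Longrightarrow> nrm2 (\<lambda>x. u (x + h) - u x) \<le> 2 * nrm2 u"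
  using nrm2_triangle_diff[OF L2_shift[of u h], of u] by (simp add: nrm2_shift L2_measurable)

text \<open>Continuity of translations in mean square: it holds for continuous functions with compact support by
  dominated convergence, and translations preserve the norm.\<close>

lemma L2_shift_tendsto:
  fixes u :: "'a::euclidean_space \<Rightarrow> 'b::euclidean_space"
  assumes u: "L2 u" and h: "h \<longlonglongrightarrow> 0"
  shows "(\<lambda>n. nrm2 (\<lambda>x. u (x + h n) - u x)) \<longlonglongrightarrow> 0"
proof (rule LIMSEQ_I)
  fix e :: real assume e: "e > 0"
  then have "e / 4 > 0" by simp
  from L2_approx_continuous[OF u this] obtain w K where w: "continuous_on UNIV w" "compact K" "\<And>x. x \<notin> K \<Longrightarrow> w x = 0"
    and uw: "nrm2 (\<lambda>x. u x - w x) < e / 4" by metis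
  have wL: "L2 w" by (rule continuous_compact_support_L2[OF w])
  obtain B where B: "B > 0" "\<And>x. norm (w x) \<le> B" using continuous_compact_support_bounded[OF w] by blast
  obtain H where H: "\<And>n. norm (h n) \<le> H" using h convergent_imp_bounded by (metis bounded_iff rangeI)
  obtain R where R: "\<And>x. x \<in> K \<Longrightarrow> norm x \<le> R" using compact_imp_bounded[OF w(2)] by (auto simp: bounded_iff)
  have "(\<lambda>n. nrm2 (\<lambda>x. w (x + h n) - w x)) \<longlonglongrightarrow> 0"
  proof (rule L2_dominated_convergence[OF _ L2_indicator_compact[OF compact_cball[of 0 "R + H"]], where c = "2 * B"])
    show "AE x in lborel. (\<lambda>n. w (x + h n) - w x) \<longlonglongrightarrow> 0"
    proof (rule AE_I2)
      fix x
      have "isCont w x" using w(1) by (simp add: continuous_on_eq_continuous_at)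
      moreover have "(\<lambda>n. x + h n) \<longlonglongrightarrow> x" using tendsto_add[OF tendsto_const h, of x] by simp
      ultimately show "(\<lambda>n. w (x + h n) - w x) \<longlonglongrightarrow> 0" by (intro LIM_zero isCont_tendsto_compose[of _ w])
    qed
    show "AE x in lborel. norm (w (x + h n) - w x) \<le> 2 * B * norm (indicator (cball 0 (R + H)) x :: real)" for n
    proof (rule AE_I2)
      fix x
      show "norm (w (x + h n) - w x) \<le> 2 * B * norm (indicator (cball 0 (R + H)) x :: real)"
      proof (cases "norm x \<le> R + H")
        case True
        then show ?thesis using norm_triangle_ineq4[of "w (x + h n)" "w x"] B(2)[of x] B(2)[of "x + h n"] by simp
      next
        case False
        have "norm x \<le> norm (x + h n) + norm (h n)" using norm_triangle_ineq4[of "x + h n" "h n"] by simp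
        then have "x + h n \<notin> K" "x \<notin> K" using R[of "x + h n"] R[of x] H[of n] norm_ge_zero[of "h n"] False by linarith+
        then show ?thesis using w(3) B(1) by simp
      qed
    qed
    show "(\<lambda>x. w (x + h n) - w x) \<in> borel_measurable borel" for n by (rule L2_measurable[OF L2_shift_diff[OF wL]])
  qed (use B in simp)
  from LIMSEQ_D[OF this, of "e / 2"] e obtain N where N: "\<And>n. n \<ge> N \<Longrightarrow> nrm2 (\<lambda>x. w (x + h n) - w x) < e / 2" by auto
  have d: "L2 (\<lambda>x. u x - w x)" by (rule L2_diff[OF u wL])
  have "nrm2 (\<lambda>x. u (x + h n) - u x) < e" if "n \<ge> N" for n
  proof -
    have "nrm2 (\<lambda>x. u (x + h n) - u x) \<le> nrm2 (\<lambda>x. w (x + h n) - w x)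
       + nrm2 (\<lambda>x. (u (x + h n) - u x) - (w (x + h n) - w x))"
      by (rule nrm2_le_add_diff[OF L2_shift_diff[OF u] L2_shift_diff[OF wL]])
    also have "(\<lambda>x. (u (x + h n) - u x) - (w (x + h n) - w x)) = (\<lambda>x. (u (x + h n) - w (x + h n)) - (u x - w x))"
      by (simp add: algebra_simps)
    also have "nrm2 \<dots> \<le> 2 * nrm2 (\<lambda>x. u x - w x)" using nrm2_shift_diff[OF d, of "h n"] .
    finally show ?thesis using N[OF that] uw by simp
  qed
  then show "\<exists>N. \<forall>n\<ge>N. norm (nrm2 (\<lambda>x. u (x + h n) - u x) - 0) < e" by auto
qed

lemma L2_shift_continuous:
  fixes u :: "'a::euclidean_space \<Rightarrow> 'b::euclidean_space"
  assumes "L2 u" "e > 0"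
  obtains d where "d > 0" "\<And>h. norm h < d \<Longrightarrow> nrm2 (\<lambda>x. u (x + h) - u x) < e"
proof -
  have "\<exists>d>0. \<forall>h. norm h < d \<longrightarrow> nrm2 (\<lambda>x. u (x + h) - u x) < e"
  proof (rule ccontr)
    assume "\<not> ?thesis"
    then have "\<exists>h. norm h < 1 / real (Suc n) \<and> \<not> nrm2 (\<lambda>x. u (x + h) - u x) < e" for n
      by (metis of_nat_0_less_iff zero_less_Suc zero_less_divide_1_iff)
    then obtain h where h: "\<And>n. norm (h n) < 1 / real (Suc n)" "\<And>n. \<not> nrm2 (\<lambda>x. u (x + h n) - u x) < e"
      by metis
    have "h \<longlonglongrightarrow> 0"
      by (rule Lim_null_comparison[OF _ LIMSEQ_inverse_real_of_nat])
         (use h(1) in \<open>auto intro!: always_eventually less_imp_le simp: inverse_eq_divide\<close>)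
    from LIMSEQ_D[OF L2_shift_tendsto[OF assms(1) this] assms(2)] h(2) show False by fastforce
  qed
  then show ?thesis using that by blast
qed

subsection \<open>Averages\<close>

lemma
  fixes f :: "'c::euclidean_space \<Rightarrow> 'b::euclidean_space"
  assumes [measurable]: "\<rho> \<in> borel_measurable borel" "f \<in> borel_measurable borel"
    and \<rho>: "\<And>y. 0 \<le> \<rho> y" "integrable lborel \<rho>"
    and fin: "(\<integral>\<^sup>+y. ennreal (\<rho> y) * ennreal ((norm (f y))\<^sup>2) \<partial>lborel) < \<infinity>"
  shows weighted_sq_integrable: "integrable lborel (\<lambda>y. \<rho> y * (norm (f y))\<^sup>2)"
    and weighted_norm_integrable: "integrable lborel (\<lambda>y. \<rho> y * norm (f y))"
    and weighted_integrable: "integrable lborel (\<lambda>y. \<rho> y *\<^sub>R f y)"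
proof -
  have e: "ennreal (\<rho> y) * ennreal ((norm (f y))\<^sup>2) = ennreal (\<rho> y * (norm (f y))\<^sup>2)" for y
    using \<rho>(1) by (simp add: ennreal_mult)
  show int2: "integrable lborel (\<lambda>y. \<rho> y * (norm (f y))\<^sup>2)"
    using fin \<rho>(1) unfolding e by (intro integrableI_nonneg) auto
  show int1: "integrable lborel (\<lambda>y. \<rho> y * norm (f y))"
  proof (rule Bochner_Integration.integrable_bound)
    show "integrable lborel (\<lambda>y. \<rho> y + \<rho> y * (norm (f y))\<^sup>2)" using \<rho>(2) int2 by simp
    have "norm (f y) \<le> 1 + (norm (f y))\<^sup>2" for y
      using sum_squares_bound[of 1 "norm (f y)"] norm_ge_zero[of "f y"]
      unfolding one_power2 mult_1_right by linarith
    then have "\<rho> y * norm (f y) \<le> \<rho> y * (1 + (norm (f y))\<^sup>2)" for y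
      using \<rho>(1) by (intro mult_left_mono) auto
    then show "AE y in lborel. norm (\<rho> y * norm (f y)) \<le> norm (\<rho> y + \<rho> y * (norm (f y))\<^sup>2)"
      using \<rho>(1) by (simp add: distrib_left abs_mult)
  qed measurable
  show "integrable lborel (\<lambda>y. \<rho> y *\<^sub>R f y)"
    using \<rho>(1) by (intro Bochner_Integration.integrable_bound[OF int1]) (auto simp: abs_mult)
qed

text \<open>Jensen's inequality for the square of the norm.\<close>

lemma norm_average_sq_le:
  fixes f :: "'c::euclidean_space \<Rightarrow> 'b::euclidean_space"
  assumes [measurable]: "\<rho> \<in> borel_measurable borel" "f \<in> borel_measurable borel"
    and \<rho>: "\<And>y. 0 \<le> \<rho> y" "integrable lborel \<rho>" "(\<integral>y. \<rho> y \<partial>lborel) = 1"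
  shows "ennreal ((norm (\<integral>y. \<rho> y *\<^sub>R f y \<partial>lborel))\<^sup>2) \<le> (\<integral>\<^sup>+y. ennreal (\<rho> y) * ennreal ((norm (f y))\<^sup>2) \<partial>lborel)"
proof (cases "(\<integral>\<^sup>+y. ennreal (\<rho> y) * ennreal ((norm (f y))\<^sup>2) \<partial>lborel) = \<infinity>")
  case False
  have e: "ennreal (\<rho> y) * ennreal ((norm (f y))\<^sup>2) = ennreal (\<rho> y * (norm (f y))\<^sup>2)" for y
    using \<rho>(1) by (simp add: ennreal_mult)
  have fin: "(\<integral>\<^sup>+y. ennreal (\<rho> y) * ennreal ((norm (f y))\<^sup>2) \<partial>lborel) < \<infinity>"
    using False by (simp add: less_top)
  note int1 = weighted_norm_integrable[OF assms(1-4) fin] and int2 = weighted_sq_integrable[OF assms(1-4) fin]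
  define m k where "m = (\<integral>y. \<rho> y * norm (f y) \<partial>lborel)" and "k = (\<integral>y. \<rho> y * (norm (f y))\<^sup>2 \<partial>lborel)"
  have "0 \<le> (\<integral>y. \<rho> y * (norm (f y) - m)\<^sup>2 \<partial>lborel)" using \<rho>(1) by (intro Bochner_Integration.integral_nonneg) simp
  also have "\<dots> = (\<integral>y. \<rho> y * (norm (f y))\<^sup>2 - (2 * m) * (\<rho> y * norm (f y)) + m\<^sup>2 * \<rho> y \<partial>lborel)"
    by (intro Bochner_Integration.integral_cong) (auto simp: power2_eq_square algebra_simps)
  also have "\<dots> = k - (2 * m) * m + m\<^sup>2"
    using int1 int2 \<rho> unfolding m_def k_def by simp
  finally have mk: "m\<^sup>2 \<le> k" by (simp add: power2_eq_square)
  have "norm (\<integral>y. \<rho> y *\<^sub>R f y \<partial>lborel) \<le> (\<integral>y. norm (\<rho> y *\<^sub>R f y) \<partial>lborel)" by (rule integral_norm_bound)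
  also have "\<dots> = m" unfolding m_def using \<rho>(1) by simp
  finally have "(norm (\<integral>y. \<rho> y *\<^sub>R f y \<partial>lborel))\<^sup>2 \<le> k"
    using mk by (meson norm_ge_zero order_trans power_mono)
  then have "ennreal ((norm (\<integral>y. \<rho> y *\<^sub>R f y \<partial>lborel))\<^sup>2) \<le> ennreal k" by (rule ennreal_leI)
  also have "ennreal k = (\<integral>\<^sup>+y. ennreal (\<rho> y * (norm (f y))\<^sup>2) \<partial>lborel)"
    unfolding k_def using int2 \<rho>(1) by (intro nn_integral_eq_integral[symmetric]) auto
  finally show ?thesis unfolding e .
qed simp

text \<open>Minkowski's integral inequality for averages: squaring is convex, so it follows from Jensen's
  inequality and Tonelli's theorem.\<close>

lemma average_L2:
  fixes g :: "'a::euclidean_space \<Rightarrow> 'c::euclidean_space \<Rightarrow> 'b::euclidean_space"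
  assumes g: "(\<lambda>p. g (fst p) (snd p)) \<in> borel_measurable borel"
    and [measurable]: "\<rho> \<in> borel_measurable borel"
    and \<rho>: "\<And>y. 0 \<le> \<rho> y" "integrable lborel \<rho>" "(\<integral>y. \<rho> y \<partial>lborel) = 1"
    and b: "\<And>y. \<rho> y \<noteq> 0 \<Longrightarrow> L2 (\<lambda>z. g z y)" "\<And>y. \<rho> y \<noteq> 0 \<Longrightarrow> nrm2 (\<lambda>z. g z y) \<le> C" and "C \<ge> 0"
  shows "L2 (\<lambda>z. \<integral>y. \<rho> y *\<^sub>R g z y \<partial>lborel)" "nrm2 (\<lambda>z. \<integral>y. \<rho> y *\<^sub>R g z y \<partial>lborel) \<le> C"
    "AE z in lborel. integrable lborel (\<lambda>y. \<rho> y *\<^sub>R g z y)"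
proof -
  have g'[measurable]: "case_prod g \<in> borel_measurable (borel \<Otimes>\<^sub>M borel)"
    using g by (simp add: borel_prod split_beta')
  have [measurable]: "(\<lambda>y. g z y) \<in> borel_measurable borel" for z by measurable
  have [measurable]: "(\<lambda>z. \<integral>y. \<rho> y *\<^sub>R g z y \<partial>lborel) \<in> borel_measurable borel"
    using lborel.borel_measurable_lebesgue_integral[of "\<lambda>z y. \<rho> y *\<^sub>R g z y" borel] by simp
  have "(\<integral>\<^sup>+z. (\<integral>\<^sup>+y. ennreal (\<rho> y) * ennreal ((norm (g z y))\<^sup>2) \<partial>lborel) \<partial>lborel)
    = (\<integral>\<^sup>+y. (\<integral>\<^sup>+z. ennreal (\<rho> y) * ennreal ((norm (g z y))\<^sup>2) \<partial>lborel) \<partial>lborel)"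
    by (rule lborel_pair.Fubini'[symmetric]) measurable
  also have "\<dots> \<le> (\<integral>\<^sup>+y. ennreal (\<rho> y) * ennreal (C\<^sup>2) \<partial>lborel)"
  proof (rule nn_integral_mono)
    fix y
    show "(\<integral>\<^sup>+z. ennreal (\<rho> y) * ennreal ((norm (g z y))\<^sup>2) \<partial>lborel) \<le> ennreal (\<rho> y) * ennreal (C\<^sup>2)"
    proof (cases "\<rho> y = 0")
      case False
      have "(\<integral>\<^sup>+z. ennreal (\<rho> y) * ennreal ((norm (g z y))\<^sup>2) \<partial>lborel) = ennreal (\<rho> y) * ennreal ((nrm2 (\<lambda>z. g z y))\<^sup>2)"
        by (subst nn_integral_cmult) (auto simp: nn_integral_L2[OF b(1)[OF False]])
      also have "\<dots> \<le> ennreal (\<rho> y) * ennreal (C\<^sup>2)"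
        using b(2)[OF False] by (intro mult_left_mono ennreal_leI power_mono) auto
      finally show ?thesis .
    qed simp
  qed
  also have "\<dots> = ennreal (C\<^sup>2)"
    using \<rho> by (subst nn_integral_multc) (auto simp: nn_integral_eq_integral)
  finally have le1: "(\<integral>\<^sup>+z. (\<integral>\<^sup>+y. ennreal (\<rho> y) * ennreal ((norm (g z y))\<^sup>2) \<partial>lborel) \<partial>lborel) \<le> ennreal (C\<^sup>2)" .
  have "(\<integral>\<^sup>+z. ennreal ((norm (\<integral>y. \<rho> y *\<^sub>R g z y \<partial>lborel))\<^sup>2) \<partial>lborel)
    \<le> (\<integral>\<^sup>+z. (\<integral>\<^sup>+y. ennreal (\<rho> y) * ennreal ((norm (g z y))\<^sup>2) \<partial>lborel) \<partial>lborel)"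
    using \<rho> by (intro nn_integral_mono norm_average_sq_le) auto
  with le1 have le: "(\<integral>\<^sup>+z. ennreal ((norm (\<integral>y. \<rho> y *\<^sub>R g z y \<partial>lborel))\<^sup>2) \<partial>lborel) \<le> ennreal (C\<^sup>2)"
    by (rule order_trans[rotated])
  have "AE z in lborel. (\<integral>\<^sup>+y. ennreal (\<rho> y) * ennreal ((norm (g z y))\<^sup>2) \<partial>lborel) \<noteq> \<infinity>"
    using le1 by (intro nn_integral_PInf_AE) (auto simp: top_unique)
  then show "AE z in lborel. integrable lborel (\<lambda>y. \<rho> y *\<^sub>R g z y)"
    by eventually_elim (intro weighted_integrable \<rho>, auto simp: less_top)
  show "L2 (\<lambda>z. \<integral>y. \<rho> y *\<^sub>R g z y \<partial>lborel)" "nrm2 (\<lambda>z. \<integral>y. \<rho> y *\<^sub>R g z y \<partial>lborel) \<le> C"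
    by (rule L2I_nn[OF _ le \<open>C \<ge> 0\<close>], measurable)+
qed

subsection \<open>Convolution with a test function\<close>

definition conv :: "('a::euclidean_space \<Rightarrow> real) \<Rightarrow> ('a \<Rightarrow> 'b::euclidean_space) \<Rightarrow> 'a \<Rightarrow> 'b" where
  "conv \<phi> u z = (\<integral>y. \<phi> (z - y) *\<^sub>R u y \<partial>lborel)"

lemma conv_altdef:
  assumes [measurable]: "\<phi> \<in> borel_measurable borel" "u \<in> borel_measurable borel"
  shows "conv \<phi> u z = (\<integral>y. \<phi> y *\<^sub>R u (z - y) \<partial>lborel)"
proof -
  have "conv \<phi> u z = (\<integral>y. \<phi> (z - (z - y)) *\<^sub>R u (z - y) \<partial>lborel)"
    unfolding conv_def by (rule integral_reflect(1)[symmetric]) measurable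
  then show ?thesis by simp
qed

lemma compact_support_uniformly_continuous:
  fixes f :: "'a::euclidean_space \<Rightarrow> 'b::real_normed_vector"
  assumes f: "continuous_on UNIV f" and K: "compact K" "\<And>x. x \<notin> K \<Longrightarrow> f x = 0" and e: "e > 0"
  obtains d where "d > 0" "\<And>x y. dist x y < d \<Longrightarrow> dist (f x) (f y) < e"
proof -
  define L where "L = {x + y |x y. x \<in> K \<and> y \<in> cball 0 1}"
  have "compact L" unfolding L_def using K(1) by (intro compact_sums) auto
  then have "uniformly_continuous_on L f"
    using f by (intro compact_uniformly_continuous) (auto intro: continuous_on_subset)
  from this[unfolded uniformly_continuous_on_def, rule_format, OF e]
  obtain d where d: "d > 0" "\<And>x y. x \<in> L \<Longrightarrow> y \<in> L \<Longrightarrow> dist y x < d \<Longrightarrow> dist (f y) (f x) < e"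
    by blast
  have L: "y \<in> L" if "x \<in> K" "dist x y \<le> 1" for x y
    using that unfolding L_def mem_Collect_eq
    by (intro exI[of _ x] exI[of _ "y - x"] conjI) (auto simp: dist_norm norm_minus_commute)
  show ?thesis
  proof (rule that[of "min d 1"])
    fix x y :: 'a assume xy: "dist x y < min d 1"
    show "dist (f x) (f y) < e"
    proof (cases "x \<in> K \<or> y \<in> K")
      case True
      then have "x \<in> L" "y \<in> L" using L[of x x] L[of x y] L[of y x] L[of y y] xy
        by (auto simp: dist_commute)
      then show ?thesis using d(2)[of y x] xy by simp
    next
      case False
      then show ?thesis using K(2) e by simp
    qed
  qed (use d in auto)
qed

lemma frechet_eq_sum_partial:
  fixes f :: "'a::euclidean_space \<Rightarrow> 'b::real_normed_vector"
  assumes "f differentiable (at x)"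
  shows "(f has_derivative (\<lambda>h. \<Sum>b\<in>Basis. (h \<bullet> b) *\<^sub>R partial b f x)) (at x)"
proof -
  have D: "(f has_derivative frechet_derivative f (at x)) (at x)"
    using assms frechet_derivative_works by blast
  have "frechet_derivative f (at x) h = (\<Sum>b\<in>Basis. (h \<bullet> b) *\<^sub>R partial b f x)" for h
  proof -
    interpret bounded_linear "frechet_derivative f (at x)" using D has_derivative_bounded_linear by blast
    show ?thesis unfolding partial_def
      by (subst euclidean_representation[of h, symmetric]) (simp add: sum scaleR)
  qed
  then have "frechet_derivative f (at x) = (\<lambda>h. \<Sum>b\<in>Basis. (h \<bullet> b) *\<^sub>R partial b f x)" by auto
  with D show ?thesis by simp
qed

lemma test_fun_uniformly_differentiable:
  fixes \<phi> :: "'a::euclidean_space \<Rightarrow> real"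
  assumes \<phi>: "test_fun S \<phi>" and e: "e > 0"
  obtains d where "d > 0"
    "\<And>x h. norm h < d \<Longrightarrow> \<bar>\<phi> (x + h) - \<phi> x - (\<Sum>b\<in>Basis. (h \<bullet> b) * partial b \<phi> x)\<bar> \<le> e * norm h"
proof -
  let ?n = "real DIM('a)"
  obtain K where K: "compact K" "\<And>x b. x \<notin> K \<Longrightarrow> partial b \<phi> x = 0" using test_funE[OF \<phi>] by metis
  have "\<exists>d>0. \<forall>x y. dist x y < d \<longrightarrow> dist (partial b \<phi> x) (partial b \<phi> y) < e / ?n" if "b \<in> Basis" for b
    using compact_support_uniformly_continuous[OF _ K(1), of "partial b \<phi>" "e / ?n"] K(2) e
      smooth_on_continuous[OF smooth_on_partial[OF test_fun_smooth[OF \<phi>] that]]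
    by (metis DIM_positive divide_pos_pos of_nat_0_less_iff)
  then obtain d where d: "\<And>b. b \<in> Basis \<Longrightarrow> d b > 0"
    "\<And>b x y. b \<in> Basis \<Longrightarrow> dist x y < d b \<Longrightarrow> dist (partial b \<phi> x) (partial b \<phi> y) < e / ?n"
    by metis
  define d0 where "d0 = Min (d ` Basis)"
  have d0: "d0 > 0" "\<And>b. b \<in> Basis \<Longrightarrow> d0 \<le> d b" unfolding d0_def using d(1) by auto
  show ?thesis
  proof (rule that[OF d0(1)])
    fix x h :: 'a assume h: "norm h < d0"
    have D: "((\<lambda>s. \<phi> (x + s *\<^sub>R h)) has_derivative
        (\<lambda>r. r * (\<Sum>b\<in>Basis. (h \<bullet> b) * partial b \<phi> (x + s *\<^sub>R h)))) (at s within T)" for s T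
    proof -
      have "((\<lambda>s. \<phi> (x + s *\<^sub>R h)) has_derivative
        (\<lambda>r. \<Sum>b\<in>Basis. (r *\<^sub>R h \<bullet> b) *\<^sub>R partial b \<phi> (x + s *\<^sub>R h))) (at s within T)"
        by (rule has_derivative_compose[OF _ frechet_eq_sum_partial[OF smooth_on_differentiable[OF test_fun_smooth[OF \<phi>]]]])
           (auto intro!: derivative_eq_intros)
      then show ?thesis by (simp add: sum_distrib_left mult.assoc)
    qed
    obtain s where s: "0 < s" "s < 1"
      "\<phi> (x + h) - \<phi> x = (\<Sum>b\<in>Basis. (h \<bullet> b) * partial b \<phi> (x + s *\<^sub>R h))"
      using mvt_simple[OF zero_less_one, of "\<lambda>s. \<phi> (x + s *\<^sub>R h)", OF D] by auto
    have "\<bar>\<phi> (x + h) - \<phi> x - (\<Sum>b\<in>Basis. (h \<bullet> b) * partial b \<phi> x)\<bar>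
      = \<bar>\<Sum>b\<in>Basis. (h \<bullet> b) * (partial b \<phi> (x + s *\<^sub>R h) - partial b \<phi> x)\<bar>"
      unfolding s(3) by (simp add: sum_subtractf right_diff_distrib)
    also have "\<dots> \<le> (\<Sum>b\<in>(Basis::'a set). norm h * (e / ?n))"
    proof (rule order_trans[OF sum_abs sum_mono])
      fix b :: 'a assume b: "b \<in> Basis"
      have "dist (x + s *\<^sub>R h) x < d b"
        using s h d0(2)[OF b] mult_left_le_one_le[of "norm h" s] by (simp add: dist_norm)
      then have "\<bar>partial b \<phi> (x + s *\<^sub>R h) - partial b \<phi> x\<bar> \<le> e / ?n"
        using d(2)[OF b, of "x + s *\<^sub>R h" x] by (simp add: dist_real_def)
      moreover have "\<bar>h \<bullet> b\<bar> \<le> norm h" using Basis_le_norm[OF b] .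
      ultimately show "\<bar>(h \<bullet> b) * (partial b \<phi> (x + s *\<^sub>R h) - partial b \<phi> x)\<bar> \<le> norm h * (e / ?n)"
        by (simp only: abs_mult) (intro mult_mono, auto)
    qed
    also have "\<dots> = e * norm h" by simp
    finally show "\<bar>\<phi> (x + h) - \<phi> x - (\<Sum>b\<in>Basis. (h \<bullet> b) * partial b \<phi> x)\<bar> \<le> e * norm h" .
  qed
qed

lemma test_fun_reflect: "test_fun UNIV \<phi> \<Longrightarrow> test_fun UNIV (\<lambda>y. \<phi> (z - y))"
  using test_fun_affine[of UNIV \<phi> "-1" z UNIV] by simp

lemma test_fun_scaleR_integrable:
  fixes \<phi> :: "'a::euclidean_space \<Rightarrow> real" and u :: "'a \<Rightarrow> 'b::euclidean_space"
  assumes "test_fun S \<phi>" "integrable lborel u"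
  shows "integrable lborel (\<lambda>y. \<phi> y *\<^sub>R u y)"
proof -
  obtain B where B: "\<And>x. norm (\<phi> x) \<le> B" using test_fun_bounded[OF assms(1)] by metis
  show ?thesis
  proof (rule Bochner_Integration.integrable_bound)
    show "integrable lborel (\<lambda>y. B * norm (u y))" using assms(2) by simp
    show "AE y in lborel. norm (\<phi> y *\<^sub>R u y) \<le> norm (B * norm (u y))"
      by (intro AE_I2) (simp add: abs_mult mult_right_mono order_trans[OF B[unfolded real_norm_def] abs_ge_self])
  qed (use assms test_fun_measurable in \<open>auto intro!: borel_measurable_scaleR\<close>)
qed

text \<open>The derivative falls on the test function, whose difference quotients converge uniformly.\<close>

lemma conv_has_derivative:
  fixes \<phi> :: "'a::euclidean_space \<Rightarrow> real" and u :: "'a \<Rightarrow> 'b::euclidean_space"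
  assumes \<phi>: "test_fun UNIV \<phi>" and u: "integrable lborel u"
  shows "(conv \<phi> u has_derivative (\<lambda>h. \<Sum>b\<in>Basis. (h \<bullet> b) *\<^sub>R conv (partial b \<phi>) u z)) (at z)"
  unfolding has_derivative_at_alt
proof (intro conjI allI impI)
  show "bounded_linear (\<lambda>h. \<Sum>b\<in>Basis. (h \<bullet> b) *\<^sub>R conv (partial b \<phi>) u z)"
    by (intro bounded_linear_sum bounded_linear_scaleR_const bounded_linear_inner_left)
  note int = test_fun_scaleR_integrable[OF test_fun_reflect[OF \<phi>] u]
  have intp: "integrable lborel (\<lambda>y. partial b \<phi> (z - y) *\<^sub>R u y)" if "b \<in> Basis" for b z
    by (rule test_fun_scaleR_integrable[OF test_fun_reflect[OF test_fun_partial[OF \<phi> that]] u])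
  define I where "I = (\<integral>y. norm (u y) \<partial>lborel)"
  have I0: "I \<ge> 0" unfolding I_def by simp
  fix e :: real assume "e > 0"
  then have "e / (I + 1) > 0" using I0 by simp
  then obtain d where d: "d > 0"
    "\<And>x h. norm h < d \<Longrightarrow> \<bar>\<phi> (x + h) - \<phi> x - (\<Sum>b\<in>Basis. (h \<bullet> b) * partial b \<phi> x)\<bar> \<le> e / (I + 1) * norm h"
    using test_fun_uniformly_differentiable[OF \<phi>, of "e / (I + 1)"] by metis
  show "\<exists>d>0. \<forall>y. norm (y - z) < d \<longrightarrow> norm (conv \<phi> u y - conv \<phi> u z
      - (\<Sum>b\<in>Basis. ((y - z) \<bullet> b) *\<^sub>R conv (partial b \<phi>) u z)) \<le> e * norm (y - z)"
  proof (intro exI[of _ d] conjI allI impI d(1))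
    fix y assume y: "norm (y - z) < d"
    define h where "h = y - z"
    let ?R = "\<lambda>w. \<phi> (y - w) - \<phi> (z - w) - (\<Sum>b\<in>Basis. (h \<bullet> b) * partial b \<phi> (z - w))"
    have eq: "conv \<phi> u y - conv \<phi> u z - (\<Sum>b\<in>Basis. (h \<bullet> b) *\<^sub>R conv (partial b \<phi>) u z)
      = (\<integral>w. ?R w *\<^sub>R u w \<partial>lborel)"
    proof -
      have "(\<integral>w. ?R w *\<^sub>R u w \<partial>lborel) = (\<integral>w. \<phi> (y - w) *\<^sub>R u w - \<phi> (z - w) *\<^sub>R u w
         - (\<Sum>b\<in>Basis. (h \<bullet> b) *\<^sub>R (partial b \<phi> (z - w) *\<^sub>R u w)) \<partial>lborel)"
        by (intro Bochner_Integration.integral_cong) (auto simp: scaleR_diff_left scaleR_sum_left)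
      also have "\<dots> = conv \<phi> u y - conv \<phi> u z - (\<Sum>b\<in>Basis. (h \<bullet> b) *\<^sub>R conv (partial b \<phi>) u z)"
      proof -
        have "(\<integral>w. (\<Sum>b\<in>Basis. (h \<bullet> b) *\<^sub>R (partial b \<phi> (z - w) *\<^sub>R u w)) \<partial>lborel)
          = (\<Sum>b\<in>Basis. (h \<bullet> b) *\<^sub>R conv (partial b \<phi>) u z)"
          unfolding conv_def using intp by (subst Bochner_Integration.integral_sum) (auto simp del: scaleR_scaleR)
        moreover have "integrable lborel (\<lambda>w. \<Sum>b\<in>Basis. (h \<bullet> b) *\<^sub>R (partial b \<phi> (z - w) *\<^sub>R u w))"
          using intp by (intro Bochner_Integration.integrable_sum integrable_scaleR_right) auto
        ultimately show ?thesis using int by (simp add: conv_def[of \<phi>])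
      qed
      finally show ?thesis by simp
    qed
    have R: "\<bar>?R w\<bar> \<le> e / (I + 1) * norm h" for w
      using d(2)[of h "z - w"] y unfolding h_def by (simp add: algebra_simps)
    have "norm (\<integral>w. ?R w *\<^sub>R u w \<partial>lborel) \<le> (\<integral>w. (e / (I + 1) * norm h) * norm (u w) \<partial>lborel)"
    proof (rule Bochner_Integration.integral_norm_bound_integral)
      show "norm (?R w *\<^sub>R u w) \<le> (e / (I + 1) * norm h) * norm (u w)" for w
        unfolding norm_scaleR by (rule mult_right_mono[OF R norm_ge_zero])
      have "integrable lborel (\<lambda>w. \<phi> (y - w) *\<^sub>R u w - \<phi> (z - w) *\<^sub>R u w
         - (\<Sum>b\<in>Basis. (h \<bullet> b) *\<^sub>R (partial b \<phi> (z - w) *\<^sub>R u w)))"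
        using int intp by (intro Bochner_Integration.integrable_diff Bochner_Integration.integrable_sum integrable_scaleR_right) auto
      then show "integrable lborel (\<lambda>w. ?R w *\<^sub>R u w)"
        by (simp add: scaleR_diff_left scaleR_sum_left)
    qed (use u in auto)
    also have "\<dots> = e * norm h * (I / (I + 1))" unfolding I_def by simp
    also have "\<dots> \<le> e * norm h * 1" using I0 \<open>e > 0\<close> by (intro mult_left_mono) auto
    finally show "norm (conv \<phi> u y - conv \<phi> u z - (\<Sum>b\<in>Basis. ((y - z) \<bullet> b) *\<^sub>R conv (partial b \<phi>) u z)) \<le> e * norm (y - z)"
      unfolding eq[unfolded h_def] by (simp add: h_def)
  qed
qed

lemma partial_conv:
  assumes "test_fun UNIV \<phi>" "integrable lborel u" "b \<in> Basis"
  shows "partial b (conv \<phi> u) z = conv (partial b \<phi>) u z"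
proof -
  have "partial b (conv \<phi> u) z = (\<Sum>b'\<in>Basis. (b \<bullet> b') *\<^sub>R conv (partial b' \<phi>) u z)"
    by (rule partial_has_derivative[OF conv_has_derivative[OF assms(1,2)]])
  also have "\<dots> = (\<Sum>b'\<in>Basis. if b' = b then conv (partial b \<phi>) u z else 0)"
    by (intro sum.cong) (auto simp: inner_Basis assms(3))
  finally show ?thesis using assms(3) by simp
qed

lemma smooth_conv:
  assumes "test_fun UNIV \<phi>" "integrable lborel u"
  shows "smooth_on UNIV (conv \<phi> u)"
  unfolding smooth_on_def
proof
  fix k show "Ck_on k UNIV (conv \<phi> u)"
    using assms(1)
  proof (induction k arbitrary: \<phi>)
    case 0
    then show ?case
      using conv_has_derivative[OF _ assms(2)] by (auto intro!: has_derivative_continuous_on)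
  next
    case (Suc k)
    have "partial b (conv \<phi> u) = conv (partial b \<phi>) u" if "b \<in> Basis" for b
      using partial_conv[OF Suc.prems assms(2) that] by auto
    moreover have "conv \<phi> u differentiable (at z)" for z
      using conv_has_derivative[OF Suc.prems assms(2)] by (rule differentiableI)
    ultimately show ?case
      using Suc.IH test_fun_partial[OF Suc.prems] by simp
  qed
qed

subsection \<open>Mollification\<close>

definition mollifier :: "real \<Rightarrow> 'a::euclidean_space \<Rightarrow> real" where
  "mollifier \<delta> z = box_bump 1 (- (\<delta> *\<^sub>R One)) (\<delta> *\<^sub>R One) z /
     (\<integral>z. box_bump 1 (- (\<delta> *\<^sub>R One)) (\<delta> *\<^sub>R One) (z::'a) \<partial>lborel)"

lemma test_fun_mollifier: "test_fun UNIV (mollifier \<delta>)"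
  unfolding mollifier_def[abs_def]
  using test_fun_scaleR[OF test_fun_box_bump[of 1, OF _ subset_UNIV] smooth_on_const,
      of "1 / (\<integral>z. box_bump 1 (- (\<delta> *\<^sub>R One)) (\<delta> *\<^sub>R One) (z::'a) \<partial>lborel)"]
  by simp

lemma mollifier_nonneg: "0 \<le> mollifier \<delta> z"
  unfolding mollifier_def by (intro divide_nonneg_nonneg integral_nonneg_AE AE_I2 box_bump_bounds)

lemma mollifier_measurable [measurable]: "mollifier \<delta> \<in> borel_measurable borel"
  using test_fun_mollifier by (rule test_fun_measurable)

lemma test_fun_integrable:
  fixes \<phi> :: "'a::euclidean_space \<Rightarrow> 'b::euclidean_space"
  assumes "test_fun S \<phi>" shows "integrable lborel \<phi>"
proof -
  obtain K where K: "compact K" "\<And>x. x \<notin> K \<Longrightarrow> \<phi> x = 0" using test_funE[OF assms] by metis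
  have "integrable lborel (\<lambda>x. indicator K x *\<^sub>R \<phi> x)"
    by (intro borel_integrable_compact K smooth_on_continuous[OF test_fun_smooth[OF assms]])
  moreover have "(\<lambda>x. indicator K x *\<^sub>R \<phi> x) = \<phi>" using K(2) by (auto simp: indicator_def)
  ultimately show ?thesis by simp
qed

lemma test_fun_L2:
  fixes \<phi> :: "'a::euclidean_space \<Rightarrow> 'b::euclidean_space"
  assumes "test_fun S \<phi>" shows "L2 \<phi>"
proof -
  obtain B where B: "B > 0" "\<And>x. norm (\<phi> x) \<le> B" using test_fun_bounded[OF assms] by metis
  have [measurable]: "\<phi> \<in> borel_measurable borel" by (rule test_fun_measurable[OF assms])
  have "integrable lborel (\<lambda>x. (norm (\<phi> x))\<^sup>2)"
  proof (rule Bochner_Integration.integrable_bound)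
    show "integrable lborel (\<lambda>x. B * norm (\<phi> x))" using test_fun_integrable[OF assms] by simp
    show "AE x in lborel. norm ((norm (\<phi> x))\<^sup>2) \<le> norm (B * norm (\<phi> x))"
      using B by (auto simp: power2_eq_square intro!: mult_right_mono)
  qed measurable
  then show ?thesis by (simp add: L2_def)
qed

lemma mollifier_integral:
  assumes "\<delta> > 0" shows "(\<integral>z. mollifier \<delta> z \<partial>lborel) = 1"
proof -
  let ?a = "- (\<delta> *\<^sub>R One) :: 'a" and ?c = "\<delta> *\<^sub>R One :: 'a"
  have int: "integrable lborel (box_bump 1 ?a ?c)"
    by (rule test_fun_integrable[OF test_fun_box_bump[OF _ subset_UNIV]]) simp
  have pos: "emeasure lborel (box ?a ?c) > 0"
    using assms by (subst emeasure_lborel_box) (auto intro!: prod_pos simp: inner_simps)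
  have "(\<integral>z. box_bump 1 ?a ?c z \<partial>lborel) \<noteq> 0"
  proof
    assume "(\<integral>z. box_bump 1 ?a ?c z \<partial>lborel) = 0"
    then have "AE z in lborel. box_bump 1 ?a ?c z = 0"
      using int by (subst (asm) integral_nonneg_eq_0_iff_AE) (auto simp: box_bump_bounds)
    then have "AE z in lborel. z \<notin> box ?a ?c"
      by eventually_elim (use box_bump_pos[of 1 _ ?a ?c] in force)
    then have "emeasure lborel (box ?a ?c) = 0" by (subst (asm) AE_iff_measurable[of "box ?a ?c"]) auto
    with pos show False by simp
  qed
  then show ?thesis unfolding mollifier_def by simp
qed

lemma mollifier_zero:
  fixes z :: "'a::euclidean_space" and \<delta> :: real
  assumes "\<delta> > 0" "\<delta> * DIM('a) \<le> norm z" shows "mollifier \<delta> z = 0"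
proof -
  have "z \<notin> box (- (\<delta> *\<^sub>R One)) (\<delta> *\<^sub>R One)"
  proof
    assume "z \<in> box (- (\<delta> *\<^sub>R One)) (\<delta> *\<^sub>R One)"
    then have "\<bar>z \<bullet> b\<bar> < \<delta>" if "b \<in> Basis" for b using that by (auto simp: mem_box abs_less_iff inner_minus_left)
    then have "(\<Sum>b\<in>Basis. \<bar>z \<bullet> b\<bar>) < (\<Sum>b\<in>(Basis::'a set). \<delta>)" by (intro sum_strict_mono) auto
    then show False using norm_le_l1[of z] assms(2) by (simp add: mult.commute)
  qed
  then show ?thesis unfolding mollifier_def by (simp add: box_bump_zero)
qed

lemma
  fixes u :: "'a::euclidean_space \<Rightarrow> 'b::euclidean_space" and \<delta> :: real
  assumes u: "L2 u" and d: "\<delta> > 0"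
  shows L2_mollify: "L2 (conv (mollifier \<delta>) u)"
    and nrm2_mollify_diff: "(\<And>h. norm h < \<delta> * DIM('a) \<Longrightarrow> nrm2 (\<lambda>x. u (x + h) - u x) \<le> C)
      \<Longrightarrow> nrm2 (\<lambda>x. conv (mollifier \<delta>) u x - u x) \<le> C"
proof -
  have [measurable]: "u \<in> borel_measurable borel" using u by measurable
  have eq: "conv (mollifier \<delta>) u = (\<lambda>z. \<integral>y. mollifier \<delta> y *\<^sub>R u (z - y) \<partial>lborel)"
    by (intro ext conv_altdef) measurable
  have \<rho>: "\<And>y. 0 \<le> mollifier \<delta> (y::'a)" "integrable lborel (mollifier \<delta> :: 'a \<Rightarrow> real)"
    "(\<integral>y. mollifier \<delta> y \<partial>(lborel :: 'a measure)) = 1"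
    by (rule mollifier_nonneg test_fun_integrable[OF test_fun_mollifier] mollifier_integral[OF d])+
  have sh: "L2 (\<lambda>z. u (z - y))" for y using L2_shift[OF u, of "- y"] by simp
  have nsh: "nrm2 (\<lambda>z. u (z - y)) = nrm2 u" for y using nrm2_shift[of u "- y"] by simp
  have meas: "(\<lambda>p. u (fst p - snd p)) \<in> borel_measurable borel"
    by (rule measurable_compose[of "\<lambda>p. fst p - snd p" borel borel])
       (auto intro!: borel_measurable_continuous_onI continuous_intros)
  from average_L2[where g = "\<lambda>z y. u (z - y)", OF meas _ \<rho> sh, of "nrm2 u"]
  show "L2 (conv (mollifier \<delta>) u)" unfolding eq by (auto simp: nsh)
  assume C: "\<And>h. norm h < \<delta> * DIM('a) \<Longrightarrow> nrm2 (\<lambda>x. u (x + h) - u x) \<le> C"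
  have "(\<lambda>x. conv (mollifier \<delta>) u x - u x) = (\<lambda>z. \<integral>y. mollifier \<delta> y *\<^sub>R (u (z - y) - u z) \<partial>lborel)"
  proof
    fix z
    have "L2 (\<lambda>y. u (z - y))"
      unfolding L2_def using integral_reflect(2)[of "\<lambda>x. (norm (u x))\<^sup>2" z] L2_integrable[OF u] by simp
    then have "integrable lborel (\<lambda>y. mollifier \<delta> y *\<^sub>R u (z - y))"
      using test_fun_L2[OF test_fun_mollifier] by (intro L2_scaleR_integrable) auto
    moreover have "integrable lborel (\<lambda>y::'a. mollifier \<delta> y *\<^sub>R u z)" by (intro integrable_scaleR_left \<rho>(2))
    ultimately have "(\<integral>y. mollifier \<delta> y *\<^sub>R (u (z - y) - u z) \<partial>lborel)
      = (\<integral>y. mollifier \<delta> y *\<^sub>R u (z - y) \<partial>lborel) - (\<integral>y. mollifier \<delta> y *\<^sub>R u z \<partial>(lborel :: 'a measure))"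
      unfolding scaleR_diff_right by (rule Bochner_Integration.integral_diff)
    then show "conv (mollifier \<delta>) u z - u z = (\<integral>y. mollifier \<delta> y *\<^sub>R (u (z - y) - u z) \<partial>lborel)"
      unfolding eq using \<rho>(2,3) by simp
  qed
  moreover have "nrm2 (\<lambda>z. \<integral>y. mollifier \<delta> y *\<^sub>R (u (z - y) - u z) \<partial>lborel) \<le> C"
  proof (rule average_L2(2)[where g = "\<lambda>z y. u (z - y) - u z"])
    have "(\<lambda>p. u (fst p)) \<in> borel_measurable (borel :: ('a \<times> 'a) measure)"
      by (rule measurable_compose[of fst borel borel])
         (auto intro!: borel_measurable_continuous_onI continuous_intros)
    with meas show "(\<lambda>p. u (fst p - snd p) - u (fst p)) \<in> borel_measurable borel" by measurable
    show "L2 (\<lambda>z. u (z - y) - u z)" for y using sh u by (rule L2_diff)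
    show "nrm2 (\<lambda>z. u (z - y) - u z) \<le> C" if "mollifier \<delta> y \<noteq> 0" for y
      using C[of "- y"] mollifier_zero[OF d, of y] that by fastforce
    show "C \<ge> 0" using C[of 0] d by simp
  qed (use \<rho> in auto)
  ultimately show "nrm2 (\<lambda>x. conv (mollifier \<delta>) u x - u x) \<le> C" by simp
qed

lemma mollify_tendsto:
  fixes u :: "'a::euclidean_space \<Rightarrow> 'b::euclidean_space"
  assumes "L2 u" "\<And>n. \<delta> n > (0::real)" "\<delta> \<longlonglongrightarrow> 0"
  shows "(\<lambda>n. nrm2 (\<lambda>x. conv (mollifier (\<delta> n)) u x - u x)) \<longlonglongrightarrow> 0"
proof (rule LIMSEQ_I)
  fix e :: real assume "e > 0"
  then obtain d where d: "d > 0" "\<And>h. norm h < d \<Longrightarrow> nrm2 (\<lambda>x. u (x + h) - u x) < e / 2"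
    using L2_shift_continuous[OF assms(1), of "e/2"] by (metis half_gt_zero)
  have "(\<lambda>n. \<delta> n * DIM('a)) \<longlonglongrightarrow> 0" using tendsto_mult_left_zero[OF assms(3)] .
  from LIMSEQ_D[OF this d(1)] obtain N where N: "\<And>n. n \<ge> N \<Longrightarrow> \<delta> n * DIM('a) < d"
    using assms(2) by fastforce
  show "\<exists>N. \<forall>n\<ge>N. norm (nrm2 (\<lambda>x. conv (mollifier (\<delta> n)) u x - u x) - 0) < e"
  proof (intro exI[of _ N] allI impI)
    fix n assume "n \<ge> N"
    have "nrm2 (\<lambda>x. conv (mollifier (\<delta> n)) u x - u x) \<le> e / 2"
      using N[OF \<open>n \<ge> N\<close>] d(2) by (intro nrm2_mollify_diff assms) (meson less_imp_le less_trans)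
    then show "norm (nrm2 (\<lambda>x. conv (mollifier (\<delta> n)) u x - u x) - 0) < e" using \<open>e > 0\<close> by simp
  qed
qed

section \<open>The fundamental lemma of the calculus of variations\<close>

text \<open>The boxes form a generator of the Borel sets that is stable under intersections, so the integral
  vanishes over every Borel set.\<close>

lemma zero_integral_on_boxes_imp_AE_zero:
  fixes f :: "'a::euclidean_space \<Rightarrow> real"
  assumes f: "integrable lborel f" "(\<integral>x. f x \<partial>lborel) = 0"
    and box: "\<And>a c. (\<integral>x. indicator (box a c) x *\<^sub>R f x \<partial>lborel) = 0"
  shows "AE x in lborel. f x = 0"
proof (rule density_unique_real[OF f(1)])
  fix A :: "'a set" assume "A \<in> sets lborel"
  let ?E = "range (\<lambda>(a, b). box a b::'a set)"
  have b: "sets borel = sigma_sets UNIV ?E" by (simp add: borel_eq_box)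
  have si: "set_integrable lborel A f" if "A \<in> sigma_sets UNIV ?E" for A
    using that f(1) unfolding b[symmetric] set_integrable_def by (intro integrable_mult_indicator) auto
  have int: "Int_stable ?E" by (auto simp: Int_stable_def box_Int_box)
  have "A \<in> sigma_sets UNIV ?E" using \<open>A \<in> sets lborel\<close> b by simp
  then have "(LINT x:A|lborel. f x) = 0"
  proof (induction rule: sigma_sets_induct_disjoint[OF int, of UNIV, simplified, consumes 1, case_names basic empty compl union])
    case (basic A) then show ?case using box by (auto simp: set_lebesgue_integral_def)
  next
    case empty then show ?case by (simp add: set_lebesgue_integral_def)
  next
    case (compl A)
    have "(\<integral>x. indicator (UNIV - A) x *\<^sub>R f x \<partial>lborel) = (\<integral>x. f x - indicator A x *\<^sub>R f x \<partial>lborel)"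
      by (intro Bochner_Integration.integral_cong) (auto simp: indicator_def)
    also have "\<dots> = 0"
      using f si[OF compl(1)] compl(2) by (simp add: set_lebesgue_integral_def set_integrable_def)
    finally show ?case by (simp add: set_lebesgue_integral_def)
  next
    case (union A)
    have "A i \<in> sets lborel" for i using union(2) b by auto
    moreover have "\<Union>(range A) \<in> sigma_sets UNIV ?E" using union(2) by (intro sigma_sets.Union) auto
    ultimately show ?case
      using union si by (subst lebesgue_integral_countable_add) (auto simp: disjoint_family_on_def)
  qed
  then show "(LINT x:A|lborel. f x) = (LINT x:A|lborel. 0)" by (simp add: set_lebesgue_integral_def)
qed simp

text \<open>Bumps converge boundedly to indicators of boxes, hence the integral over each box inside \<open>S\<close> is zero;
  countably many such boxes cover \<open>S\<close>.\<close>

lemma fundamental_lemma: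
  fixes g :: "'a::euclidean_space \<Rightarrow> 'b::euclidean_space"
  assumes S: "open S"
    and g: "\<And>K. compact K \<Longrightarrow> K \<subseteq> S \<Longrightarrow> integrable lborel (\<lambda>x. indicator K x *\<^sub>R g x)"
    and z: "\<And>\<phi>. test_fun S \<phi> \<Longrightarrow> (\<integral>x. \<phi> x *\<^sub>R g x \<partial>lborel) = 0"
  shows "AE x in lborel. x \<in> S \<longrightarrow> g x = 0"
proof -
  have box0: "(\<integral>x. indicator (box a c) x *\<^sub>R g x \<partial>lborel) = 0" if ac: "cbox a c \<subseteq> S" for a c
  proof -
    let ?h = "\<lambda>x. indicator (cbox a c) x *\<^sub>R g x"
    have h: "integrable lborel ?h" using g[of "cbox a c"] ac by auto
    have eqn: "box_bump (real (Suc n)) a c x *\<^sub>R g x = box_bump (real (Suc n)) a c x *\<^sub>R ?h x" for n x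
      using box_subset_cbox[of a c] box_bump_zero[of "real (Suc n)" x a c] by (auto simp: indicator_def)
    have "(\<lambda>n. \<integral>x. box_bump (real (Suc n)) a c x *\<^sub>R g x \<partial>lborel) \<longlonglongrightarrow> (\<integral>x. indicator (box a c) x *\<^sub>R ?h x \<partial>lborel)"
      unfolding eqn
    proof (rule integral_dominated_convergence)
      show "integrable lborel (\<lambda>x. norm (?h x))" using h by (rule integrable_norm)
      show "AE x in lborel. (\<lambda>n. box_bump (real (Suc n)) a c x *\<^sub>R ?h x) \<longlonglongrightarrow> indicator (box a c) x *\<^sub>R ?h x"
        by (intro AE_I2 tendsto_scaleR box_bump_tendsto_indicator tendsto_const)
      show "AE x in lborel. norm (box_bump (real (Suc n)) a c x *\<^sub>R ?h x) \<le> norm (?h x)" for n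
        unfolding norm_scaleR[of "box_bump _ _ _ _"] abs_of_nonneg[OF box_bump_bounds(1)]
        by (intro AE_I2 mult_left_le_one_le norm_ge_zero box_bump_bounds)
      show "(\<lambda>x. indicator (box a c) x *\<^sub>R ?h x) \<in> borel_measurable lborel"
        using borel_measurable_integrable[OF h] by measurable
      show "(\<lambda>x. box_bump (real (Suc n)) a c x *\<^sub>R ?h x) \<in> borel_measurable lborel" for n
        by (intro borel_measurable_scaleR[OF _ borel_measurable_integrable[OF h]])
           (simp add: smooth_measurable[OF smooth_box_bump])
    qed
    moreover have "(\<integral>x. box_bump (real (Suc n)) a c x *\<^sub>R g x \<partial>lborel) = 0" for n
      by (rule z[OF test_fun_box_bump[OF _ ac]]) simp
    ultimately have "(\<integral>x. indicator (box a c) x *\<^sub>R ?h x \<partial>lborel) = 0"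
      by (simp add: LIMSEQ_const_iff)
    moreover have "(\<lambda>x. indicator (box a c) x *\<^sub>R ?h x) = (\<lambda>x. indicator (box a c) x *\<^sub>R g x)"
      using box_subset_cbox[of a c] by (intro ext) (auto simp: indicator_def)
    ultimately show ?thesis by (simp only:)
  qed
  have boxAE: "AE x in lborel. x \<in> box a c \<longrightarrow> g x = 0" if ac: "cbox a c \<subseteq> S" for a c
  proof -
    have h: "integrable lborel (\<lambda>x. indicator (box a c) x *\<^sub>R g x)"
    proof -
      have "integrable lborel (\<lambda>x. indicator (box a c) x *\<^sub>R (indicator (cbox a c) x *\<^sub>R g x))"
        by (rule integrable_mult_indicator[OF _ g[OF compact_cbox ac]]) simp
      moreover have "(\<lambda>x. indicator (box a c) x *\<^sub>R (indicator (cbox a c) x *\<^sub>R g x)) = (\<lambda>x. indicator (box a c) x *\<^sub>R g x)"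
        using box_subset_cbox[of a c] by (intro ext) (auto simp: indicator_def)
      ultimately show ?thesis by (simp only:)
    qed
    have "AE x in lborel. (indicator (box a c) x *\<^sub>R g x) \<bullet> b = 0" for b
    proof (rule zero_integral_on_boxes_imp_AE_zero)
      show "integrable lborel (\<lambda>x. (indicator (box a c) x *\<^sub>R g x) \<bullet> b)"
        using h by (rule integrable_inner_left)
      show "(\<integral>x. (indicator (box a c) x *\<^sub>R g x) \<bullet> b \<partial>lborel) = 0"
        using integral_inner_left[OF h, of b] box0[OF ac] by simp
      fix a' c'
      obtain a2 c2 where 2: "box a' c' \<inter> box a c = box a2 c2" "cbox a' c' \<inter> cbox a c = cbox a2 c2"
        using box_Int_box[of a' c' a c] Int_interval[of a' c' a c] by metis
      have "(\<integral>x. indicator (box a' c') x *\<^sub>R ((indicator (box a c) x *\<^sub>R g x) \<bullet> b) \<partial>lborel)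
        = (\<integral>x. (indicator (box a' c' \<inter> box a c) x *\<^sub>R g x) \<bullet> b \<partial>lborel)"
        by (intro Bochner_Integration.integral_cong) (auto simp: indicator_def)
      also have "\<dots> = (\<integral>x. indicator (box a' c' \<inter> box a c) x *\<^sub>R g x \<partial>lborel) \<bullet> b"
      proof (rule integral_inner_left)
        have "integrable lborel (\<lambda>x. indicator (box a' c') x *\<^sub>R (indicator (box a c) x *\<^sub>R g x))"
          by (rule integrable_mult_indicator[OF _ h]) simp
        then show "integrable lborel (\<lambda>x. indicator (box a' c' \<inter> box a c) x *\<^sub>R g x)"
          by (simp add: indicator_inter_arith)
      qed
      also have "\<dots> = 0"
      proof -
        have "cbox a2 c2 \<subseteq> S" using ac 2(2) by blast
        then show ?thesis unfolding 2(1) using box0[of a2 c2] by simp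
      qed
      finally show "(\<integral>x. indicator (box a' c') x *\<^sub>R ((indicator (box a c) x *\<^sub>R g x) \<bullet> b) \<partial>lborel) = 0" .
    qed
    then have "AE x in lborel. \<forall>b\<in>Basis. (indicator (box a c) x *\<^sub>R g x) \<bullet> b = 0"
      by (subst AE_ball_countable) (auto intro: countable_finite)
    then show ?thesis
      by eventually_elim (auto simp: euclidean_eq_iff[of _ "0::'b"])
  qed
  define F where "F = {box a c |a c. cbox a c \<subseteq> S}"
  obtain F' where F': "F' \<subseteq> F" "countable F'" "\<Union>F' = \<Union>F"
    using Lindelof[of F] by (auto simp: F_def)
  have "S \<subseteq> \<Union>F"
  proof
    fix x assume "x \<in> S"
    then obtain a b where "cbox a b \<subseteq> S" "x \<in> box a b" using open_contains_cbox[OF S] by metis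
    then show "x \<in> \<Union>F" unfolding F_def by blast
  qed
  have "AE x in lborel. \<forall>B\<in>F'. x \<in> B \<longrightarrow> g x = 0"
    unfolding AE_ball_countable[OF F'(2)] using F'(1) boxAE by (auto simp: F_def)
  then show ?thesis
    by eventually_elim (use \<open>S \<subseteq> \<Union>F\<close> F'(3) in blast)
qed

section \<open>Completeness and Mazur's lemma\<close>

text \<open>On a set of finite measure the Cauchy condition in mean square implies the one in the mean, hence a
  subsequence converges almost everywhere. Its limit is the limit in mean square by Fatou's lemma.\<close>

lemma L2_complete:
  fixes u :: "nat \<Rightarrow> 'a::euclidean_space \<Rightarrow> 'b::euclidean_space"
  assumes u: "\<And>n. L2 (u n)" and B: "B \<in> fmeasurable lborel" "\<And>n x. x \<notin> B \<Longrightarrow> u n x = 0"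
    and cau: "\<And>e. e > 0 \<Longrightarrow> \<exists>N. \<forall>m\<ge>N. \<forall>n\<ge>N. nrm2 (\<lambda>x. u m x - u n x) < e"
  obtains Y where "L2 Y" "\<And>x. x \<notin> B \<Longrightarrow> Y x = 0" "(\<lambda>n. nrm2 (\<lambda>x. u n x - Y x)) \<longlonglongrightarrow> 0"
proof -
  have [measurable]: "u n \<in> borel_measurable borel" for n using u by measurable
  have [measurable]: "B \<in> sets borel" using B(1) by auto
  have "\<exists>N. \<forall>i\<ge>N. \<forall>j\<ge>N. (\<integral>x. norm (u i x - u j x) \<partial>lborel) < e" if "e > 0" for e
  proof -
    let ?s = "sqrt (measure lborel B)"
    have s: "?s \<ge> 0" by simp
    obtain N where N: "\<And>m n. m \<ge> N \<Longrightarrow> n \<ge> N \<Longrightarrow> nrm2 (\<lambda>x. u m x - u n x) < e / (?s + 1)"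
      using cau[of "e / (?s + 1)"] \<open>e > 0\<close> s by (metis add_nonneg_pos divide_pos_pos zero_less_one)
    have "(\<integral>x. norm (u i x - u j x) \<partial>lborel) < e" if "i \<ge> N" "j \<ge> N" for i j
    proof -
      have "(\<integral>x. norm (u i x - u j x) \<partial>lborel) \<le> ?s * nrm2 (\<lambda>x. u i x - u j x)"
        using B by (intro L2_finite_support_integrable L2_diff u) auto
      also have "\<dots> \<le> ?s * (e / (?s + 1))" using N[OF that] s by (intro mult_left_mono) auto
      also have "\<dots> < e"
        using s \<open>e > 0\<close> by (simp add: pos_divide_less_eq add_nonneg_pos distrib_left)
      finally show ?thesis .
    qed
    then show ?thesis by blast
  qed
  then obtain r where r: "strict_mono r" "AE x in lborel. Cauchy (\<lambda>i. u (r i) x)"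
    using cauchy_L1_AE_cauchy_subseq[of lborel u] L2_finite_support_integrable(1)[OF u B] by metis
  define Y where "Y x = (if x \<in> B then lim (\<lambda>i. u (r i) x) else 0)" for x
  have [measurable]: "Y \<in> borel_measurable borel" unfolding Y_def by measurable
  have lim: "AE x in lborel. (\<lambda>i. u (r i) x) \<longlonglongrightarrow> Y x"
    using r(2)
  proof eventually_elim
    case (elim x)
    then have "(\<lambda>i. u (r i) x) \<longlonglongrightarrow> lim (\<lambda>i. u (r i) x)"
      by (simp add: Cauchy_convergent_iff convergent_LIMSEQ_iff)
    then show ?case using B(2)[of x] by (cases "x \<in> B") (auto simp: Y_def)
  qed
  have bound: "L2 (\<lambda>x. u n x - Y x) \<and> nrm2 (\<lambda>x. u n x - Y x) \<le> e"
    if "e > 0" and N: "\<And>m n. m \<ge> N \<Longrightarrow> n \<ge> N \<Longrightarrow> nrm2 (\<lambda>x. u m x - u n x) < e" and "n \<ge> N" for e N n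
  proof -
    have "(\<integral>\<^sup>+x. ennreal ((norm (u n x - Y x))\<^sup>2) \<partial>lborel)
      = (\<integral>\<^sup>+x. liminf (\<lambda>i. ennreal ((norm (u n x - u (r i) x))\<^sup>2)) \<partial>lborel)"
    proof (rule nn_integral_cong_AE, use lim in eventually_elim)
      case (elim x)
      then have "(\<lambda>i. ennreal ((norm (u n x - u (r i) x))\<^sup>2)) \<longlonglongrightarrow> ennreal ((norm (u n x - Y x))\<^sup>2)"
        by (intro tendsto_intros)
      then show ?case by (rule lim_imp_Liminf[OF sequentially_bot, symmetric])
    qed
    also have "\<dots> \<le> liminf (\<lambda>i. \<integral>\<^sup>+x. ennreal ((norm (u n x - u (r i) x))\<^sup>2) \<partial>lborel)"
      by (rule nn_integral_liminf) measurable
    also have "\<dots> \<le> ennreal (e\<^sup>2)"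
    proof (rule Liminf_le)
      have "(\<integral>\<^sup>+x. ennreal ((norm (u n x - u (r i) x))\<^sup>2) \<partial>lborel) \<le> ennreal (e\<^sup>2)" if "i \<ge> N" for i
        using N[of n "r i"] \<open>n \<ge> N\<close> seq_suble[OF r(1), of i] that
        by (subst nn_integral_L2[OF L2_diff[OF u u]]) (auto intro!: ennreal_leI power_mono)
      then show "\<forall>\<^sub>F i in sequentially. (\<integral>\<^sup>+x. ennreal ((norm (u n x - u (r i) x))\<^sup>2) \<partial>lborel) \<le> ennreal (e\<^sup>2)"
        by (rule eventually_sequentiallyI)
    qed simp
    finally have le: "(\<integral>\<^sup>+x. ennreal ((norm (u n x - Y x))\<^sup>2) \<partial>lborel) \<le> ennreal (e\<^sup>2)" .
    show ?thesis using L2I_nn[OF _ le] \<open>e > 0\<close> by simp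
  qed
  obtain N1 where N1: "\<And>m n. m \<ge> N1 \<Longrightarrow> n \<ge> N1 \<Longrightarrow> nrm2 (\<lambda>x. u m x - u n x) < 1"
    using cau[of 1] by auto
  have Yn: "L2 (\<lambda>x. u N1 x - Y x)" using bound[OF _ N1, of N1] by simp
  have "L2 Y" using L2_diff[OF u[of N1] Yn] by simp
  moreover have "(\<lambda>n. nrm2 (\<lambda>x. u n x - Y x)) \<longlonglongrightarrow> 0"
  proof (rule LIMSEQ_I)
    fix e :: real assume "e > 0"
    then obtain N where "\<And>m n. m \<ge> N \<Longrightarrow> n \<ge> N \<Longrightarrow> nrm2 (\<lambda>x. u m x - u n x) < e / 2"
      using cau[of "e/2"] by auto
    from bound[OF _ this] \<open>e > 0\<close>
    show "\<exists>N. \<forall>n\<ge>N. norm (nrm2 (\<lambda>x. u n x - Y x) - 0) < e" by (intro exI[of _ N]) fastforce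
  qed
  ultimately show ?thesis using that[of Y] by (auto simp: Y_def)
qed

text \<open>Weights of the finite convex combinations of the members with index at least \<open>n\<close> of a sequence.\<close>

definition tail_weights :: "nat \<Rightarrow> (nat \<Rightarrow> real) set" where
  "tail_weights n = {w. (\<forall>i. 0 \<le> w i) \<and> (\<forall>i<n. w i = 0) \<and> (\<exists>N. (\<forall>i\<ge>N. w i = 0) \<and> (\<Sum>i<N. w i) = 1)}"

definition combination :: "(nat \<Rightarrow> real) \<Rightarrow> (nat \<Rightarrow> 'a \<Rightarrow> 'b::real_vector) \<Rightarrow> 'a \<Rightarrow> 'b" where
  "combination w y x = (\<Sum>i | w i \<noteq> 0. w i *\<^sub>R y i x)"

lemma sum_support_eq:
  fixes w :: "nat \<Rightarrow> real" and y :: "nat \<Rightarrow> 'b::real_vector"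
  assumes "\<And>i. i \<ge> N \<Longrightarrow> w i = 0"
  shows "(\<Sum>i | w i \<noteq> 0. w i *\<^sub>R y i) = (\<Sum>i<N. w i *\<^sub>R y i)"
  by (rule sum.mono_neutral_left) (use assms not_less in auto)

lemma combination_eq: "(\<And>i. i \<ge> N \<Longrightarrow> w i = 0) \<Longrightarrow> combination w y x = (\<Sum>i<N. w i *\<^sub>R y i x)"
  unfolding combination_def by (rule sum_support_eq)

lemma tail_weightsE:
  assumes "w \<in> tail_weights n"
  obtains N where "\<And>i. 0 \<le> w i" "\<And>i. i < n \<Longrightarrow> w i = 0" "\<And>i. i \<ge> N \<Longrightarrow> w i = 0" "(\<Sum>i<N. w i) = 1"
    "\<And>M. M \<ge> N \<Longrightarrow> (\<Sum>i<M. w i) = 1"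
proof -
  obtain N where N: "\<forall>i\<ge>N. w i = 0" "(\<Sum>i<N. w i) = 1" using assms by (auto simp: tail_weights_def)
  have "(\<Sum>i<M. w i) = 1" if "M \<ge> N" for M
    using N that by (subst N(2)[symmetric], intro sum.mono_neutral_right) auto
  with N show ?thesis using that[of N] assms by (auto simp: tail_weights_def)
qed

lemma tail_weights_mono: "m \<le> n \<Longrightarrow> tail_weights n \<subseteq> tail_weights m"
  by (auto simp: tail_weights_def)

lemma tail_weights_single: "(\<lambda>i. if i = n then 1 else 0) \<in> tail_weights n"
  unfolding tail_weights_def by (auto intro!: exI[of _ "Suc n"])

lemma
  assumes "w \<in> tail_weights n" "w' \<in> tail_weights n"
  shows tail_weights_midpoint: "(\<lambda>i. (w i + w' i) / 2) \<in> tail_weights n"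
    and combination_midpoint:
      "combination (\<lambda>i. (w i + w' i) / 2) y x = (1/2) *\<^sub>R (combination w y x + combination w' y x)"
proof -
  obtain N where N: "\<And>i. 0 \<le> w i" "\<And>i. i < n \<Longrightarrow> w i = 0" "\<And>i. i \<ge> N \<Longrightarrow> w i = 0"
    "\<And>M. M \<ge> N \<Longrightarrow> (\<Sum>i<M. w i) = 1" using tail_weightsE[OF assms(1)] by metis
  obtain N' where N': "\<And>i. 0 \<le> w' i" "\<And>i. i < n \<Longrightarrow> w' i = 0" "\<And>i. i \<ge> N' \<Longrightarrow> w' i = 0"
    "\<And>M. M \<ge> N' \<Longrightarrow> (\<Sum>i<M. w' i) = 1" using tail_weightsE[OF assms(2)] by metis
  let ?M = "max N N'"
  show "(\<lambda>i. (w i + w' i) / 2) \<in> tail_weights n"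
    unfolding tail_weights_def
    using N N' by (auto intro!: exI[of _ ?M] simp: sum_divide_distrib[symmetric] sum.distrib)
  show "combination (\<lambda>i. (w i + w' i) / 2) y x = (1/2) *\<^sub>R (combination w y x + combination w' y x)"
    using N(3) N'(3) by (subst (1 2 3) combination_eq[of ?M])
      (auto simp: scaleR_sum_right scaleR_add_left scaleR_add_right add_divide_distrib simp flip: sum.distrib)
qed

lemma L2_combination: "(\<And>k. L2 (y k)) \<Longrightarrow> L2 (combination w y)"
  unfolding combination_def[abs_def] by (intro L2_sum L2_scaleR)

lemma nrm2_parallelogram:
  assumes "L2 u" "L2 v"
  shows "(nrm2 (\<lambda>x. u x - v x))\<^sup>2 = 2 * (nrm2 u)\<^sup>2 + 2 * (nrm2 v)\<^sup>2 - 4 * (nrm2 (\<lambda>x. (1/2) *\<^sub>R (u x + v x)))\<^sup>2"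
proof -
  have sum: "L2 (\<lambda>x. u x + v x)" using assms by (rule L2_add)
  have "(nrm2 (\<lambda>x. u x - v x))\<^sup>2 = (\<integral>x. 2 * (norm (u x))\<^sup>2 + 2 * (norm (v x))\<^sup>2 - (norm (u x + v x))\<^sup>2 \<partial>lborel)"
    unfolding nrm2_sq by (intro Bochner_Integration.integral_cong)
      (auto simp: power2_norm_eq_inner inner_simps inner_commute)
  also have "\<dots> = 2 * (nrm2 u)\<^sup>2 + 2 * (nrm2 v)\<^sup>2 - (nrm2 (\<lambda>x. u x + v x))\<^sup>2"
    using assms sum by (simp add: nrm2_sq L2_integrable)
  also have "(nrm2 (\<lambda>x. u x + v x))\<^sup>2 = 4 * (nrm2 (\<lambda>x. (1/2) *\<^sub>R (u x + v x)))\<^sup>2"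
    by (simp only: nrm2_scaleR) (simp add: power2_eq_square)
  finally show ?thesis .
qed

text \<open>Mazur's lemma for a bounded sequence, which replaces weak compactness: nearly minimal elements of the
  convex hulls of the tails form a Cauchy sequence by the parallelogram identity.\<close>

lemma Mazur_L2:
  fixes y :: "nat \<Rightarrow> 'a::euclidean_space \<Rightarrow> 'b::euclidean_space"
  assumes y: "\<And>k. L2 (y k)" "\<And>k. nrm2 (y k) \<le> C"
    and B: "B \<in> fmeasurable lborel" "\<And>k x. x \<notin> B \<Longrightarrow> y k x = 0"
  obtains w Y where "\<And>n. w n \<in> tail_weights n" "L2 Y" "\<And>x. x \<notin> B \<Longrightarrow> Y x = 0"
    "(\<lambda>n. nrm2 (\<lambda>x. combination (w n) y x - Y x)) \<longlonglongrightarrow> 0"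
proof -
  define sq where "sq w = (nrm2 (combination w y))\<^sup>2" for w
  define d where "d n = Inf (sq ` tail_weights n)" for n
  have bdd: "bdd_below (sq ` A)" for A by (rule bdd_belowI[of _ 0]) (auto simp: sq_def)
  have ne: "sq ` tail_weights n \<noteq> {}" for n using tail_weights_single by blast
  have d_le: "d n \<le> sq w" if "w \<in> tail_weights n" for n w
    unfolding d_def using that bdd by (intro cInf_lower) auto
  have dC: "d n \<le> C\<^sup>2" for n
  proof -
    have "combination (\<lambda>i. if i = n then 1 else 0) y = y n"
      by (intro ext) (simp add: combination_def)
    then have "sq (\<lambda>i. if i = n then 1 else 0) \<le> C\<^sup>2" unfolding sq_def using y(2)[of n] by (simp add: power_mono)
    then show ?thesis using d_le[OF tail_weights_single, of n] by linarith
  qed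
  have "incseq d"
    unfolding d_def using tail_weights_mono bdd ne
    by (intro incseq_SucI cInf_superset_mono image_mono) auto
  then obtain L where L: "d \<longlonglongrightarrow> L" using dC by (metis incseq_convergent)
  have "\<exists>w\<in>tail_weights n. sq w < d n + 1 / real (Suc n)" for n
    using cInf_lessD[OF ne[of n], of "d n + 1 / real (Suc n)"] by (auto simp: d_def)
  then obtain w where w: "\<And>n. w n \<in> tail_weights n" "\<And>n. sq (w n) < d n + 1 / real (Suc n)" by metis
  let ?x = "\<lambda>n. combination (w n) y"
  have x: "L2 (?x n)" for n by (rule L2_combination[OF y(1)])
  have key: "(nrm2 (\<lambda>z. ?x n z - ?x m z))\<^sup>2 \<le> 2 * (d m - d n) + 4 * (1 / real (Suc n))" if "n \<le> m" for n m
  proof -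
    have wm: "w m \<in> tail_weights n" using w(1) tail_weights_mono[OF that] by blast
    have "d n \<le> (nrm2 (\<lambda>z. (1/2) *\<^sub>R (?x n z + ?x m z)))\<^sup>2"
      using d_le[OF tail_weights_midpoint[OF w(1) wm]]
      unfolding sq_def combination_midpoint[OF w(1) wm, abs_def] .
    moreover have "1 / real (Suc m) \<le> 1 / real (Suc n)" using that by (simp add: frac_le)
    moreover have "p \<le> 2 * (E - D) + 4 * s"
      if "D \<le> c" "t \<le> s" "p = 2 * a + 2 * b - 4 * c" "a < D + s" "b < E + t" for a b c p D E s t :: real
    proof -
      have "2 * a + 2 * b - 4 * c \<le> 2 * (D + s) + 2 * (E + s) - 4 * D"
        using that by (intro diff_mono add_mono mult_left_mono) auto
      then show ?thesis unfolding that(3) by (simp add: algebra_simps)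
    qed
    ultimately show ?thesis
      using nrm2_parallelogram[OF x[of n] x[of m]] w(2)[of n, unfolded sq_def] w(2)[of m, unfolded sq_def]
      by blast
  qed
  have cau: "\<exists>N. \<forall>m\<ge>N. \<forall>n\<ge>N. nrm2 (\<lambda>z. ?x m z - ?x n z) < e" if "e > 0" for e
  proof -
    have "e\<^sup>2 > 0" using that by simp
    obtain N1 where N1: "\<And>n. n \<ge> N1 \<Longrightarrow> \<bar>d n - L\<bar> < e\<^sup>2 / 8"
      using LIMSEQ_D[OF L, of "e\<^sup>2 / 8"] \<open>e\<^sup>2 > 0\<close> by auto
    obtain N2 :: nat where N2: "8 / e\<^sup>2 < real N2" using reals_Archimedean2 by blast
    have small: "nrm2 (\<lambda>z. ?x n z - ?x m z) < e" if "max N1 N2 \<le> n" "n \<le> m" for n m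
    proof -
      have "real N2 < real (Suc n)" using that by simp
      then have "8 / e\<^sup>2 < real (Suc n)" using N2 by linarith
      then have "8 < real (Suc n) * e\<^sup>2" using \<open>e\<^sup>2 > 0\<close> by (simp only: pos_divide_less_eq)
      then have "4 * (1 / real (Suc n)) < e\<^sup>2 / 2"
        by (simp add: pos_divide_less_eq mult.commute[of "e\<^sup>2"] del: of_nat_Suc)
      then have "(nrm2 (\<lambda>z. ?x n z - ?x m z))\<^sup>2 < e\<^sup>2"
        using key[OF that(2)] N1[of n] N1[of m] that unfolding abs_less_iff by auto
      then show ?thesis using \<open>e > 0\<close> by (meson less_imp_le power_less_imp_less_base)
    qed
    show ?thesis
    proof (intro exI[of _ "max N1 N2"] allI impI)
      fix m n assume "max N1 N2 \<le> m" "max N1 N2 \<le> n"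
      then show "nrm2 (\<lambda>z. ?x m z - ?x n z) < e"
        using small[of m n] small[of n m] by (cases "m \<le> n") (auto simp: nrm2_commute[of "?x m"])
    qed
  qed
  have xB: "?x n z = 0" if "z \<notin> B" for n z using B(2)[OF that] by (simp add: combination_def)
  show ?thesis
  proof (rule L2_complete[of ?x B, OF x B(1) xB cau])
    fix Y assume "L2 Y" "\<And>z. z \<notin> B \<Longrightarrow> Y z = 0" "(\<lambda>n. nrm2 (\<lambda>z. ?x n z - Y z)) \<longlonglongrightarrow> 0"
    with w(1) show thesis by (rule that)
  qed
qed

section \<open>Distributional derivatives\<close>

text \<open>The same integral identity as for weak derivatives, but for functions on the whole space and
  with integrals over it, so that it can be combined with translations and convolutions.\<close>

definition distr_deriv :: "'a::euclidean_space set \<Rightarrow> 'a \<Rightarrow> ('a \<Rightarrow> 'b::euclidean_space) \<Rightarrow> ('a \<Rightarrow> 'b) \<Rightarrow> bool" where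
  "distr_deriv U e u g \<longleftrightarrow> (\<forall>\<phi>::'a \<Rightarrow> real. test_fun U \<phi> \<longrightarrow>
     (\<integral>x. partial e \<phi> x *\<^sub>R u x \<partial>lborel) = - (\<integral>x. \<phi> x *\<^sub>R g x \<partial>lborel))"

lemma distr_derivD:
  "distr_deriv U e u g \<Longrightarrow> test_fun U \<phi> \<Longrightarrow>
     (\<integral>x. partial e \<phi> x *\<^sub>R u x \<partial>lborel) = - (\<integral>x. \<phi> x *\<^sub>R g x \<partial>lborel)"
  by (simp add: distr_deriv_def)

lemma test_fun_mult_L2_integrable:
  fixes \<phi> :: "'a::euclidean_space \<Rightarrow> real"
  assumes "test_fun S \<phi>" "L2 u"
  shows "integrable lborel (\<lambda>x. \<phi> x *\<^sub>R u x)"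
  using test_fun_L2[OF assms(1)] assms(2) by (rule L2_scaleR_integrable)

lemma distr_deriv_diff:
  assumes u: "L2 u" "L2 u'" "L2 g" "L2 g'" and "e \<in> Basis"
    and D: "distr_deriv U e u g" "distr_deriv U e u' g'"
  shows "distr_deriv U e (\<lambda>x. u x - u' x) (\<lambda>x. g x - g' x)"
  unfolding distr_deriv_def
proof (intro allI impI)
  fix \<phi> :: "'a \<Rightarrow> real" assume \<phi>: "test_fun U \<phi>"
  show "(\<integral>x. partial e \<phi> x *\<^sub>R (u x - u' x) \<partial>lborel) = - (\<integral>x. \<phi> x *\<^sub>R (g x - g' x) \<partial>lborel)"
    using distr_derivD[OF D(1) \<phi>] distr_derivD[OF D(2) \<phi>] u
    by (simp add: scaleR_diff_right test_fun_mult_L2_integrable[OF \<phi>]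
        test_fun_mult_L2_integrable[OF test_fun_partial[OF \<phi> \<open>e \<in> Basis\<close>]])
qed

lemma partial_shift:
  assumes "smooth_on UNIV f"
  shows "partial b (\<lambda>x. f (x + k)) x = partial b f (x + k)"
  using partial_affine[of f k 1 x b] smooth_on_differentiable[OF assms] by (simp add: add.commute)

lemma test_fun_shift:
  fixes f :: "'a::euclidean_space \<Rightarrow> 'b::real_normed_vector"
  assumes "test_fun S f" "\<And>x. x + k \<in> S \<Longrightarrow> x \<in> T"
  shows "test_fun T (\<lambda>x. f (x + k))"
  using test_fun_affine[of S f 1 k T] assms by (simp add: add.commute)

lemma distr_deriv_shift:
  fixes u g :: "'a::euclidean_space \<Rightarrow> 'b::euclidean_space"
  assumes D: "distr_deriv UNIV e u g" and [measurable]: "u \<in> borel_measurable borel" "g \<in> borel_measurable borel"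
    and e: "e \<in> Basis"
  shows "distr_deriv UNIV e (\<lambda>x. u (x + k)) (\<lambda>x. g (x + k))"
  unfolding distr_deriv_def
proof (intro allI impI)
  fix \<phi> :: "'a \<Rightarrow> real" assume \<phi>: "test_fun UNIV \<phi>"
  let ?\<psi> = "\<lambda>x. \<phi> (x - k)"
  have \<psi>: "test_fun UNIV ?\<psi>" using test_fun_shift[OF \<phi>, of "- k" UNIV] by simp
  have p\<psi>: "partial e ?\<psi> x = partial e \<phi> (x - k)" for x
    using partial_shift[OF test_fun_smooth[OF \<phi>], of e "- k" x] by simp
  have [measurable]: "\<phi> \<in> borel_measurable borel" "partial e \<phi> \<in> borel_measurable borel"
    using \<phi> test_fun_partial[OF \<phi> e] by (auto intro: test_fun_measurable)
  have "(\<integral>x. partial e \<phi> x *\<^sub>R u (x + k) \<partial>lborel) = (\<integral>x. partial e \<phi> (x - k) *\<^sub>R u x \<partial>lborel)"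
    using integral_shift(1)[of "\<lambda>x. partial e \<phi> (x - k) *\<^sub>R u x" k] by simp
  also have "\<dots> = - (\<integral>x. \<phi> (x - k) *\<^sub>R g x \<partial>lborel)"
    using distr_derivD[OF D \<psi>] by (simp add: p\<psi>)
  also have "(\<integral>x. \<phi> (x - k) *\<^sub>R g x \<partial>lborel) = (\<integral>x. \<phi> x *\<^sub>R g (x + k) \<partial>lborel)"
    using integral_shift(1)[of "\<lambda>x. \<phi> (x - k) *\<^sub>R g x" k] by simp
  finally show "(\<integral>x. partial e \<phi> x *\<^sub>R u (x + k) \<partial>lborel) = - (\<integral>x. \<phi> x *\<^sub>R g (x + k) \<partial>lborel)" .
qed

text \<open>The product rule for a cutoff of a difference of translates: both translates of the support of the
  cutoff have to stay inside the set where the derivative is known, and the result is global.\<close>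

lemma distr_deriv_cutoff_difference:
  fixes \<kappa> :: "'a::euclidean_space \<Rightarrow> real" and u g :: "'a \<Rightarrow> 'b::euclidean_space"
  assumes \<kappa>: "test_fun Q \<kappa>" "test_fun Q (\<lambda>x. \<kappa> (x - k))"
    and D: "distr_deriv Q b u g" and L: "L2 u" "L2 g" and b: "b \<in> Basis"
  shows "distr_deriv UNIV b (\<lambda>z. \<kappa> z *\<^sub>R (u (z + k) - u z))
    (\<lambda>z. \<kappa> z *\<^sub>R (g (z + k) - g z) + partial b \<kappa> z *\<^sub>R (u (z + k) - u z))"
  unfolding distr_deriv_def
proof (intro allI impI)
  fix \<phi> :: "'a \<Rightarrow> real" assume \<phi>: "test_fun UNIV \<phi>"
  define \<psi> where "\<psi> = (\<lambda>x. \<phi> x *\<^sub>R \<kappa> x)"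
  have \<psi>: "test_fun Q \<psi>" unfolding \<psi>_def by (rule test_fun_scaleR[OF \<kappa>(1) test_fun_smooth[OF \<phi>]])
  have \<psi>k: "test_fun Q (\<lambda>x. \<psi> (x - k))"
    using test_fun_scaleR[OF \<kappa>(2) smooth_on_affine[OF test_fun_smooth[OF \<phi>], of "- k" 1]]
    by (simp add: add.commute \<psi>_def)
  have p\<psi>: "partial b \<psi> x = \<phi> x * partial b \<kappa> x + partial b \<phi> x * \<kappa> x" for x
    using partial_scaleR[OF smooth_on_differentiable[OF test_fun_smooth[OF \<phi>]]
        smooth_on_differentiable[OF test_fun_smooth[OF \<kappa>(1)]]] by (simp add: \<psi>_def)
  have p\<psi>k: "partial b (\<lambda>x. \<psi> (x - k)) = (\<lambda>x. partial b \<psi> (x - k))"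
    using partial_shift[OF test_fun_smooth[OF \<psi>], of b "- k"] by auto
  note L2s = L(1) L2_shift[OF L(1), of k] L(2) L2_shift[OF L(2), of k]
  have [measurable]: "u \<in> borel_measurable borel" "g \<in> borel_measurable borel" using L by measurable
  have [measurable]: "\<psi> \<in> borel_measurable borel" "partial b \<psi> \<in> borel_measurable borel"
    using \<psi> test_fun_partial[OF \<psi> b] by (auto intro: test_fun_measurable)
  note i\<psi> = test_fun_mult_L2_integrable[OF \<psi>] test_fun_mult_L2_integrable[OF test_fun_partial[OF \<psi> b]]
  have A: "(\<integral>x. partial b \<psi> x *\<^sub>R (u (x + k) - u x) \<partial>lborel) = - (\<integral>x. \<psi> x *\<^sub>R (g (x + k) - g x) \<partial>lborel)"
  proof -
    have "(\<integral>x. partial b \<psi> x *\<^sub>R u (x + k) \<partial>lborel) = (\<integral>x. partial b (\<lambda>x. \<psi> (x - k)) x *\<^sub>R u x \<partial>lborel)"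
      unfolding p\<psi>k using integral_shift(1)[of "\<lambda>x. partial b \<psi> (x - k) *\<^sub>R u x" k] by simp
    also have "\<dots> = - (\<integral>x. \<psi> (x - k) *\<^sub>R g x \<partial>lborel)" by (rule distr_derivD[OF D \<psi>k])
    also have "(\<integral>x. \<psi> (x - k) *\<^sub>R g x \<partial>lborel) = (\<integral>x. \<psi> x *\<^sub>R g (x + k) \<partial>lborel)"
      using integral_shift(1)[of "\<lambda>x. \<psi> (x - k) *\<^sub>R g x" k] by simp
    finally show ?thesis
      using distr_derivD[OF D \<psi>] i\<psi>(1)[OF L2s(3)] i\<psi>(1)[OF L2s(4)] i\<psi>(2)[OF L2s(1)] i\<psi>(2)[OF L2s(2)]
      unfolding scaleR_diff_right by simp
  qed
  have \<phi>p\<kappa>: "test_fun Q (\<lambda>x. \<phi> x *\<^sub>R partial b \<kappa> x)"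
    by (rule test_fun_scaleR[OF test_fun_partial[OF \<kappa>(1) b] test_fun_smooth[OF \<phi>]])
  have p\<phi>\<kappa>: "test_fun Q (\<lambda>x. partial b \<phi> x *\<^sub>R \<kappa> x)"
    by (rule test_fun_scaleR[OF \<kappa>(1) test_fun_smooth[OF test_fun_partial[OF \<phi> b]]])
  have Lu: "L2 (\<lambda>x. u (x + k) - u x)" and Lg: "L2 (\<lambda>x. g (x + k) - g x)" using L by (auto intro: L2_shift_diff)
  note ints = test_fun_mult_L2_integrable[OF \<phi>p\<kappa> Lu] test_fun_mult_L2_integrable[OF p\<phi>\<kappa> Lu]
    test_fun_mult_L2_integrable[OF \<psi> Lg]
  have "(\<integral>x. partial b \<psi> x *\<^sub>R (u (x + k) - u x) \<partial>lborel)
    = (\<integral>x. (\<phi> x *\<^sub>R partial b \<kappa> x) *\<^sub>R (u (x + k) - u x) \<partial>lborel)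
      + (\<integral>x. (partial b \<phi> x *\<^sub>R \<kappa> x) *\<^sub>R (u (x + k) - u x) \<partial>lborel)"
    unfolding p\<psi> using ints(1,2) by (subst Bochner_Integration.integral_add[symmetric]) (auto simp: scaleR_add_left)
  with A have B: "(\<integral>x. (partial b \<phi> x *\<^sub>R \<kappa> x) *\<^sub>R (u (x + k) - u x) \<partial>lborel)
    = - ((\<integral>x. \<psi> x *\<^sub>R (g (x + k) - g x) \<partial>lborel) + (\<integral>x. (\<phi> x *\<^sub>R partial b \<kappa> x) *\<^sub>R (u (x + k) - u x) \<partial>lborel))"
    by (simp add: algebra_simps)
  have C: "(\<integral>x. \<phi> x *\<^sub>R (\<kappa> x *\<^sub>R (g (x + k) - g x) + partial b \<kappa> x *\<^sub>R (u (x + k) - u x)) \<partial>lborel)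
    = (\<integral>x. \<psi> x *\<^sub>R (g (x + k) - g x) \<partial>lborel) + (\<integral>x. (\<phi> x *\<^sub>R partial b \<kappa> x) *\<^sub>R (u (x + k) - u x) \<partial>lborel)"
    using ints(1,3) by (subst Bochner_Integration.integral_add[symmetric]) (auto simp: scaleR_add_right \<psi>_def)
  show "(\<integral>x. partial b \<phi> x *\<^sub>R \<kappa> x *\<^sub>R (u (x + k) - u x) \<partial>lborel)
    = - (\<integral>x. \<phi> x *\<^sub>R (\<kappa> x *\<^sub>R (g (x + k) - g x) + partial b \<kappa> x *\<^sub>R (u (x + k) - u x)) \<partial>lborel)"
    using B unfolding C by simp
qed

lemma partial_conv_distr_deriv:
  fixes \<phi> :: "'a::euclidean_space \<Rightarrow> real"
  assumes \<phi>: "test_fun UNIV \<phi>" and u: "integrable lborel u" and e: "e \<in> Basis"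
    and D: "distr_deriv U e u g" and U: "test_fun U (\<lambda>y. \<phi> (z - y))"
  shows "partial e (conv \<phi> u) z = conv \<phi> g z"
proof -
  have p: "partial e (\<lambda>y. \<phi> (z - y)) y = - partial e \<phi> (z - y)" for y
    using partial_affine[of \<phi> z "-1" y e] smooth_on_differentiable[OF test_fun_smooth[OF \<phi>]] by simp
  have "partial e (conv \<phi> u) z = - (\<integral>y. partial e (\<lambda>y. \<phi> (z - y)) y *\<^sub>R u y \<partial>lborel)"
    unfolding partial_conv[OF \<phi> u e] conv_def p by simp
  also have "\<dots> = conv \<phi> g z" unfolding conv_def using distr_derivD[OF D U] by simp
  finally show ?thesis .
qed

lemma test_fun_mollifier_at:
  fixes z :: "'a::euclidean_space" and \<delta> :: real
  assumes "\<delta> > 0" "cball z (\<delta> * DIM('a)) \<subseteq> U"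
  shows "test_fun U (\<lambda>y. mollifier \<delta> (z - y))"
proof (rule test_funI[OF _ compact_cball assms(2)])
  show "smooth_on UNIV (\<lambda>y. mollifier \<delta> (z - y))"
    using test_fun_smooth[OF test_fun_reflect[OF test_fun_mollifier]] .
  show "mollifier \<delta> (z - y) = 0" if "y \<notin> cball z (\<delta> * DIM('a))" for y
    using that by (intro mollifier_zero[OF assms(1)]) (simp add: dist_norm)
qed

lemma conv_component:
  assumes \<phi>: "test_fun UNIV \<phi>" and u: "integrable lborel u" and T: "bounded_linear T"
  shows "conv \<phi> (\<lambda>x. T (u x)) z = T (conv \<phi> u z)"
proof -
  interpret T: bounded_linear T by fact
  have "integrable lborel (\<lambda>y. \<phi> (z - y) *\<^sub>R u y)"
    by (rule test_fun_scaleR_integrable[OF test_fun_reflect[OF \<phi>] u])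
  from integral_bounded_linear[OF T this] show ?thesis
    unfolding conv_def by (simp add: T.scaleR)
qed

lemma mollifier_scales:
  fixes r D :: real
  assumes "r > 0" "D > 0"
  obtains \<delta> :: "nat \<Rightarrow> real" where "\<And>n. \<delta> n > 0" "\<And>n. \<delta> n * D \<le> r" "\<delta> \<longlonglongrightarrow> 0"
proof
  show "r / D * inverse (real (Suc n)) > 0" for n using assms by simp
  have "inverse (real (Suc n)) \<le> 1" for n by (simp add: inverse_le_1_iff)
  from mult_left_mono[OF this less_imp_le[OF assms(1)]]
  show "r / D * inverse (real (Suc n)) * D \<le> r" for n using assms(2) by simp
  show "(\<lambda>n. r / D * inverse (real (Suc n))) \<longlonglongrightarrow> 0"
    by (rule tendsto_mult_right_zero[OF LIMSEQ_inverse_real_of_nat])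
qed

definition jacobian :: "('n::finite \<Rightarrow> 'a::euclidean_space) \<Rightarrow> ('a \<Rightarrow> real^'m) \<Rightarrow> 'a \<Rightarrow> real^'n^'m" where
  "jacobian e w x = (\<chi> i j. partial (e j) w x $ i)"

lemma jacobian_continuous:
  fixes w :: "'a::euclidean_space \<Rightarrow> real^'m" and e :: "'n::finite \<Rightarrow> 'a"
  assumes "smooth_on UNIV w" "\<And>j. e j \<in> Basis"
  shows "continuous_on A (jacobian e w)"
  unfolding jacobian_def
  by (intro continuous_on_vec_lambda continuous_intros smooth_on_continuous smooth_on_partial assms)

lemma test_fun_jacobian_L2:
  fixes w :: "'a::euclidean_space \<Rightarrow> real^'m" and e :: "'n::finite \<Rightarrow> 'a"
  assumes w: "test_fun S w" and e: "\<And>j. e j \<in> Basis"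
  shows "L2 (jacobian e w)"
proof -
  obtain K where K: "compact K" "\<And>x b. x \<notin> K \<Longrightarrow> partial b w x = 0" using test_funE[OF w] by metis
  show ?thesis
    by (rule continuous_compact_support_L2[OF jacobian_continuous[OF test_fun_smooth[OF w] e] K(1)])
      (simp add: jacobian_def vec_eq_iff K(2))
qed

lemma bounded_linear_column: "bounded_linear (column j :: real^'n^'m \<Rightarrow> real^'m)"
  by (rule linear_conv_bounded_linear[THEN iffD1], rule linearI) (simp_all add: column_def vec_eq_iff)

lemma L2_column:
  fixes W :: "'a::euclidean_space \<Rightarrow> real^'n^'m"
  assumes W: "L2 W" shows "L2 (\<lambda>x. column j (W x))"
proof -
  have "norm (column j M) \<le> norm M" for M :: "real^'n^'m"
  proof -
    have "norm (column j M) \<le> norm (\<chi> i. norm (M $ i))"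
      by (rule norm_le_componentwise_cart) (simp add: column_def component_le_norm_cart)
    also have "\<dots> = norm M" by (simp add: norm_vec_def L2_set_def)
    finally show ?thesis .
  qed
  moreover have "(\<lambda>x. column j (W x)) \<in> borel_measurable borel"
    using measurable_compose[OF L2_measurable[OF W]
        borel_measurable_continuous_onI[OF linear_continuous_on[OF bounded_linear_column]]] .
  ultimately show ?thesis by (intro L2_dominated(1)[OF W, of _ 1]) auto
qed

text \<open>A weak equation that holds for test functions also holds for functions with compact support and
  square integrable derivatives: mollify.\<close>

lemma weak_equation_extend:
  fixes f w :: "'a::euclidean_space \<Rightarrow> real^'m" and \<sigma> W :: "'a \<Rightarrow> real^'n^'m" and e :: "'n \<Rightarrow> 'a"
  assumes e: "\<And>j. e j \<in> Basis" and L: "L2 f" "L2 \<sigma>" "L2 w" "L2 W"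
    and eqn: "\<And>w. test_fun Q w \<Longrightarrow> (\<integral>x. f x \<bullet> w x \<partial>lborel) + (\<integral>x. \<sigma> x \<bullet> jacobian e w x \<partial>lborel) = 0"
    and K: "compact K" "K \<subseteq> Q" "open Q" "\<And>x. x \<notin> K \<Longrightarrow> w x = 0" "\<And>x. x \<notin> K \<Longrightarrow> W x = 0"
    and D: "\<And>j. distr_deriv UNIV (e j) w (\<lambda>x. column j (W x))"
  shows "(\<integral>x. f x \<bullet> w x \<partial>lborel) + (\<integral>x. \<sigma> x \<bullet> W x \<partial>lborel) = 0"
proof -
  obtain r where r: "r > 0" "(\<Union>x\<in>K. cball x r) \<subseteq> Q"
    using compact_subset_open_imp_cball_epsilon_subset[OF K(1,3,2)] by metis
  obtain \<delta> :: "nat \<Rightarrow> real" where \<delta>: "\<And>n. \<delta> n > 0" "\<And>n. \<delta> n * DIM('a) \<le> r" and \<delta>0: "\<delta> \<longlonglongrightarrow> 0"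
    by (rule mollifier_scales[OF r(1), of "DIM('a)"]) auto
  have fK: "K \<in> fmeasurable lborel"
    using K(1) emeasure_bounded_finite[OF compact_imp_bounded[OF K(1)]]
    by (simp add: fmeasurable_def compact_imp_closed)
  have iw: "integrable lborel w" and iW: "integrable lborel W"
    using L2_finite_support_integrable(1)[OF L(3) fK] L2_finite_support_integrable(1)[OF L(4) fK] K by auto
  let ?w = "\<lambda>n. conv (mollifier (\<delta> n)) w" and ?W = "\<lambda>n. conv (mollifier (\<delta> n)) W"
  have jac: "jacobian e (?w n) = ?W n" for n
  proof
    fix x
    have "partial (e j) (?w n) x = column j (?W n x)" for j
      using partial_conv_distr_deriv[OF test_fun_mollifier iw e D test_fun_reflect[OF test_fun_mollifier]]
        conv_component[OF test_fun_mollifier iW bounded_linear_column] by metis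
    then show "jacobian e (?w n) x = ?W n x" by (simp add: jacobian_def vec_eq_iff column_def)
  qed
  have tw: "test_fun Q (?w n)" for n
  proof (rule test_funI[OF smooth_conv[OF test_fun_mollifier iw]])
    show "compact {x + y |x y. x \<in> K \<and> y \<in> cball 0 r}" using K(1) by (intro compact_sums) auto
    show "{x + y |x y. x \<in> K \<and> y \<in> cball 0 r} \<subseteq> Q" using r(2) by (force simp: dist_norm)
    fix z assume z: "z \<notin> {x + y |x y. x \<in> K \<and> y \<in> cball 0 r}"
    have zero: "mollifier (\<delta> n) (z - y) *\<^sub>R w y = 0" for y
    proof (cases "y \<in> K")
      case True
      have "norm (z - y) > r"
      proof (rule ccontr)
        assume "\<not> norm (z - y) > r"
        then have "\<exists>x y'. z = x + y' \<and> x \<in> K \<and> y' \<in> cball 0 r"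
          using True by (intro exI[of _ y] exI[of _ "z - y"]) auto
        with z show False by blast
      qed
      then show ?thesis using \<delta>[of n] by (simp add: mollifier_zero)
    qed (simp add: K(4))
    show "?w n z = 0" unfolding conv_def zero by simp
  qed
  have "(\<lambda>n. (\<integral>x. f x \<bullet> ?w n x \<partial>lborel) + (\<integral>x. \<sigma> x \<bullet> ?W n x \<partial>lborel))
     \<longlonglongrightarrow> (\<integral>x. f x \<bullet> w x \<partial>lborel) + (\<integral>x. \<sigma> x \<bullet> W x \<partial>lborel)"
    using L \<delta>(1) mollify_tendsto[OF L(3) \<delta>(1) \<delta>0] mollify_tendsto[OF L(4) \<delta>(1) \<delta>0]
    by (intro tendsto_add L2_inner_tendsto) (auto intro: L2_mollify)
  moreover have "(\<integral>x. f x \<bullet> ?w n x \<partial>lborel) + (\<integral>x. \<sigma> x \<bullet> ?W n x \<partial>lborel) = 0" for n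
    using eqn[OF tw, of n] unfolding jac .
  ultimately show ?thesis by (simp add: LIMSEQ_const_iff)
qed

subsection \<open>Differences as averages of derivatives\<close>

text \<open>The mean of \<open>g\<close> over the segment from \<open>z\<close> to \<open>z + k\<close>. For \<open>k = h e\<close> and \<open>g = \<partial>\<^sub>e u\<close> it is
  the difference quotient of \<open>u\<close>.\<close>

definition segment_average :: "'a::euclidean_space \<Rightarrow> ('a \<Rightarrow> 'b::euclidean_space) \<Rightarrow> 'a \<Rightarrow> 'b" where
  "segment_average k g z = (\<integral>s. indicator {0..1::real} s *\<^sub>R g (z + s *\<^sub>R k) \<partial>lborel)"

lemma
  fixes g :: "'a::euclidean_space \<Rightarrow> 'b::euclidean_space"
  assumes g: "L2 g"
  shows L2_segment_average: "L2 (segment_average k g)"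
    and nrm2_segment_average: "nrm2 (segment_average k g) \<le> nrm2 g"
    and segment_integrable: "AE z in lborel. integrable lborel (\<lambda>s. indicator {0..1::real} s *\<^sub>R g (z + s *\<^sub>R k))"
    and nrm2_segment_average_diff: "(\<And>y. norm y \<le> norm k \<Longrightarrow> nrm2 (\<lambda>x. g (x + y) - g x) \<le> C)
      \<Longrightarrow> nrm2 (\<lambda>z. segment_average k g z - g z) \<le> C"
proof -
  have gm[measurable]: "g \<in> borel_measurable borel" using g by measurable
  have \<rho>: "\<And>y. 0 \<le> (indicator {0..1::real} y :: real)" "integrable lborel (indicator {0..1::real} :: real \<Rightarrow> real)"
    "(\<integral>y. indicator {0..1::real} y \<partial>lborel) = (1::real)" "indicator {0..1::real} \<in> borel_measurable borel"
    by (auto intro!: integrable_real_indicator)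
  have meas: "(\<lambda>p::'a \<times> real. g (fst p + snd p *\<^sub>R k)) \<in> borel_measurable borel"
    by (rule measurable_compose[OF _ gm]) (auto intro!: borel_measurable_continuous_onI continuous_intros)
  note av = average_L2[where \<rho> = "indicator {0..1::real}" and g = "\<lambda>z s. g (z + s *\<^sub>R k)",
      OF meas \<rho>(4) \<rho>(1,2,3) L2_shift[OF g], of "nrm2 g"]
  show 1: "L2 (segment_average k g)" "nrm2 (segment_average k g) \<le> nrm2 g"
    "AE z in lborel. integrable lborel (\<lambda>s. indicator {0..1::real} s *\<^sub>R g (z + s *\<^sub>R k))"
    using av unfolding segment_average_def[abs_def] by (auto simp: nrm2_shift)
  assume C: "\<And>y. norm y \<le> norm k \<Longrightarrow> nrm2 (\<lambda>x. g (x + y) - g x) \<le> C"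
  have meas': "(\<lambda>p::'a \<times> real. g (fst p + snd p *\<^sub>R k) - g (fst p)) \<in> borel_measurable borel"
  proof -
    have "(\<lambda>p::'a \<times> real. g (fst p)) \<in> borel_measurable borel"
      by (rule measurable_compose[OF _ gm]) (auto intro!: borel_measurable_continuous_onI continuous_intros)
    with meas show ?thesis by measurable
  qed
  have le: "nrm2 (\<lambda>z. \<integral>s. indicator {0..1::real} s *\<^sub>R (g (z + s *\<^sub>R k) - g z) \<partial>lborel) \<le> C"
  proof (rule average_L2(2)[OF meas' \<rho>(4) \<rho>(1,2,3)])
    show "L2 (\<lambda>z. g (z + s *\<^sub>R k) - g z)" for s by (rule L2_shift_diff[OF g])
    show "nrm2 (\<lambda>z. g (z + s *\<^sub>R k) - g z) \<le> C" if "indicator {0..1::real} s \<noteq> (0::real)" for s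
      using that by (intro C) (auto simp: indicator_def mult_left_le_one_le split: if_splits)
    show "0 \<le> C" using C[of 0] by simp
  qed
  have [measurable]: "segment_average k g \<in> borel_measurable borel" using 1(1) by measurable
  have [measurable]: "(\<lambda>z. \<integral>s. indicator {0..1::real} s *\<^sub>R (g (z + s *\<^sub>R k) - g z) \<partial>lborel) \<in> borel_measurable borel"
    using average_L2(1)[OF meas' \<rho>(4) \<rho>(1,2,3) L2_shift_diff[OF g] nrm2_shift_diff[OF g]] by (simp add: L2_def)
  have "nrm2 (\<lambda>z. segment_average k g z - g z) = nrm2 (\<lambda>z. \<integral>s. indicator {0..1::real} s *\<^sub>R (g (z + s *\<^sub>R k) - g z) \<partial>lborel)"
  proof (rule nrm2_cong_AE)
    show "AE z in lborel. segment_average k g z - g z = (\<integral>s. indicator {0..1::real} s *\<^sub>R (g (z + s *\<^sub>R k) - g z) \<partial>lborel)"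
      using 1(3)
    proof eventually_elim
      case (elim z)
      have i: "integrable lborel (\<lambda>s::real. indicator {0..1::real} s *\<^sub>R g z)" by (intro integrable_scaleR_left \<rho>(2))
      have "(\<integral>s. indicator {0..1::real} s *\<^sub>R (g (z + s *\<^sub>R k) - g z) \<partial>lborel)
        = segment_average k g z - (\<integral>s. indicator {0..1::real} s *\<^sub>R g z \<partial>lborel)"
        unfolding scaleR_diff_right segment_average_def by (rule Bochner_Integration.integral_diff[OF elim i])
      then show ?case by simp
    qed
  qed measurable
  with le show "nrm2 (\<lambda>z. segment_average k g z - g z) \<le> C" by simp
qed

lemma segment_average_diff:
  assumes "integrable lborel (\<lambda>s. indicator {0..1::real} s *\<^sub>R g (z + s *\<^sub>R k))"
    "integrable lborel (\<lambda>s. indicator {0..1::real} s *\<^sub>R g' (z + s *\<^sub>R k))"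
  shows "segment_average k (\<lambda>x. g x - g' x) z = segment_average k g z - segment_average k g' z"
  unfolding segment_average_def scaleR_diff_right by (rule Bochner_Integration.integral_diff[OF assms])

lemma smooth_difference_eq_segment_average:
  fixes V :: "'a::euclidean_space \<Rightarrow> 'b::euclidean_space"
  assumes V: "smooth_on UNIV V" and e: "e \<in> Basis"
  shows "V (z + h *\<^sub>R e) - V z = h *\<^sub>R segment_average (h *\<^sub>R e) (partial e V) z"
proof -
  have D: "((\<lambda>s. V (z + s *\<^sub>R h *\<^sub>R e)) has_vector_derivative h *\<^sub>R partial e V (z + s *\<^sub>R h *\<^sub>R e)) (at s within T)" for s T
  proof -
    have *: "(V has_derivative (\<lambda>d. \<Sum>b\<in>Basis. (d \<bullet> b) *\<^sub>R partial b V (z + s *\<^sub>R h *\<^sub>R e))) (at (z + s *\<^sub>R h *\<^sub>R e))"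
      by (rule frechet_eq_sum_partial[OF smooth_on_differentiable[OF V]])
    have "((\<lambda>s. V (z + s *\<^sub>R h *\<^sub>R e)) has_derivative
      (\<lambda>r. \<Sum>b\<in>Basis. ((r *\<^sub>R h *\<^sub>R e) \<bullet> b) *\<^sub>R partial b V (z + s *\<^sub>R h *\<^sub>R e))) (at s within T)"
      using * by (rule has_derivative_compose[rotated]) (auto intro!: derivative_eq_intros)
    moreover have "(\<Sum>b\<in>Basis. ((r *\<^sub>R h *\<^sub>R e) \<bullet> b) *\<^sub>R partial b V (z + s *\<^sub>R h *\<^sub>R e))
      = r *\<^sub>R h *\<^sub>R partial e V (z + s *\<^sub>R h *\<^sub>R e)" for r
    proof -
      have "(\<Sum>b\<in>Basis. ((r *\<^sub>R h *\<^sub>R e) \<bullet> b) *\<^sub>R partial b V (z + s *\<^sub>R h *\<^sub>R e))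
        = (\<Sum>b\<in>Basis. if b = e then (r * h) *\<^sub>R partial e V (z + s *\<^sub>R h *\<^sub>R e) else 0)"
        by (intro sum.cong) (auto simp: inner_Basis e)
      then show ?thesis using e by simp
    qed
    ultimately show ?thesis by (simp add: has_vector_derivative_def)
  qed
  have "continuous_on {0..1} (\<lambda>s. h *\<^sub>R partial e V (z + s *\<^sub>R h *\<^sub>R e))"
    by (intro continuous_intros continuous_on_compose2[OF smooth_on_continuous[OF smooth_on_partial[OF V e], of UNIV]]) auto
  from integral_FTC_Icc[OF zero_le_one D this]
  have "V (z + h *\<^sub>R e) - V z = (\<integral>s. indicator {0..1} s *\<^sub>R h *\<^sub>R partial e V (z + s *\<^sub>R h *\<^sub>R e) \<partial>lborel)"
    by simp
  also have "\<dots> = (\<integral>s. h *\<^sub>R (indicator {0..1} s *\<^sub>R partial e V (z + s *\<^sub>R h *\<^sub>R e)) \<partial>lborel)"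
    by (intro Bochner_Integration.integral_cong) (auto simp: mult.commute)
  also have "\<dots> = h *\<^sub>R segment_average (h *\<^sub>R e) (partial e V) z"
    unfolding segment_average_def by (rule integral_scaleR_right)
  finally show ?thesis .
qed

text \<open>The fundamental theorem of calculus along a coordinate direction for distributional derivatives.
  It holds for mollified functions, and both sides are continuous in mean square.\<close>

lemma distr_deriv_difference_eq_segment_average:
  fixes u g :: "'a::euclidean_space \<Rightarrow> 'b::euclidean_space" and \<zeta> :: "'a \<Rightarrow> real"
  assumes u: "L2 u" "integrable lborel u" and g: "L2 g" and e: "e \<in> Basis" and D: "distr_deriv Q e u g"
    and \<zeta>[measurable]: "\<zeta> \<in> borel_measurable borel" and N: "\<And>z. \<bar>\<zeta> z\<bar> \<le> N"
    and margin: "\<And>z. \<zeta> z \<noteq> 0 \<Longrightarrow> cball z r \<subseteq> Q" "\<bar>h\<bar> < r"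
  shows "AE z in lborel. \<zeta> z *\<^sub>R (u (z + h *\<^sub>R e) - u z) = \<zeta> z *\<^sub>R h *\<^sub>R segment_average (h *\<^sub>R e) g z"
proof -
  obtain \<delta> :: "nat \<Rightarrow> real" where \<delta>: "\<And>n. \<delta> n > 0" "\<And>n. \<delta> n * DIM('a) \<le> r - \<bar>h\<bar>" and \<delta>0: "\<delta> \<longlonglongrightarrow> 0"
    by (rule mollifier_scales[of "r - \<bar>h\<bar>" "DIM('a)"]) (use margin(2) in auto)
  let ?V = "\<lambda>n. conv (mollifier (\<delta> n)) u" and ?G = "\<lambda>n. conv (mollifier (\<delta> n)) g"
  let ?A = "segment_average (h *\<^sub>R e)"
  let ?d = "\<lambda>z. u (z + h *\<^sub>R e) - u z"
  have LV: "L2 (?V n)" and LG: "L2 (?G n)" for n using L2_mollify u g \<delta> by blast+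
  have smV: "smooth_on UNIV (?V n)" for n by (rule smooth_conv[OF test_fun_mollifier u(2)])
  have loc: "\<zeta> z *\<^sub>R (?V n (z + h *\<^sub>R e) - ?V n z) = \<zeta> z *\<^sub>R h *\<^sub>R ?A (?G n) z" for n z
  proof (cases "\<zeta> z = 0")
    case False
    have "partial e (?V n) (z + s *\<^sub>R h *\<^sub>R e) = ?G n (z + s *\<^sub>R h *\<^sub>R e)" if s: "s \<in> {0..1}" for s
    proof (rule partial_conv_distr_deriv[OF test_fun_mollifier u(2) e D test_fun_mollifier_at[OF \<delta>(1)]])
      have "dist (z + s *\<^sub>R h *\<^sub>R e) z \<le> \<bar>h\<bar>"
        using s e by (auto simp: dist_norm abs_mult mult_left_le_one_le)
      then have "cball (z + s *\<^sub>R h *\<^sub>R e) (\<delta> n * DIM('a)) \<subseteq> cball z r"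
        using \<delta>(2)[of n] by (simp add: cball_subset_cball_iff)
      then show "cball (z + s *\<^sub>R h *\<^sub>R e) (\<delta> n * real DIM('a)) \<subseteq> Q" using margin(1)[OF False] by simp
    qed
    then have "?A (partial e (?V n)) z = ?A (?G n) z"
      unfolding segment_average_def by (intro Bochner_Integration.integral_cong) (auto simp: indicator_def)
    then show ?thesis using smooth_difference_eq_segment_average[OF smV e, of n z h] by simp
  qed simp
  let ?L = "\<lambda>z. \<zeta> z *\<^sub>R ?d z" and ?R = "\<lambda>z. \<zeta> z *\<^sub>R (h *\<^sub>R ?A g z)"
  have Ld: "L2 ?d" by (rule L2_shift_diff[OF u(1)])
  have LdV: "L2 (\<lambda>z. ?V n (z + h *\<^sub>R e) - ?V n z)" for n by (rule L2_shift_diff[OF LV])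
  have LA: "L2 (\<lambda>z. h *\<^sub>R ?A g z)" "L2 (\<lambda>z. h *\<^sub>R ?A (?G n) z)" for n
    by (intro L2_scaleR L2_segment_average g LG)+
  note bm = L2_bounded_mult[OF _ \<zeta> N]
  have le: "nrm2 (\<lambda>z. ?L z - ?R z) \<le> N * (2 * nrm2 (\<lambda>z. ?V n z - u z)) + N * (\<bar>h\<bar> * nrm2 (\<lambda>z. ?G n z - g z))" for n
  proof -
    have "nrm2 (\<lambda>z. ?L z - ?R z) \<le> nrm2 (\<lambda>z. ?L z - \<zeta> z *\<^sub>R (?V n (z + h *\<^sub>R e) - ?V n z))
      + nrm2 (\<lambda>z. \<zeta> z *\<^sub>R (?V n (z + h *\<^sub>R e) - ?V n z) - ?R z)"
      by (intro nrm2_triangle3 bm Ld LdV LA)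
    also have "nrm2 (\<lambda>z. ?L z - \<zeta> z *\<^sub>R (?V n (z + h *\<^sub>R e) - ?V n z))
       = nrm2 (\<lambda>z. \<zeta> z *\<^sub>R (?d z - (?V n (z + h *\<^sub>R e) - ?V n z)))"
      by (simp only: scaleR_diff_right)
    also have "\<dots> \<le> N * nrm2 (\<lambda>z. ?d z - (?V n (z + h *\<^sub>R e) - ?V n z))"
      by (intro bm L2_diff Ld LdV)
    also have "nrm2 (\<lambda>z. ?d z - (?V n (z + h *\<^sub>R e) - ?V n z)) = nrm2 (\<lambda>z. (?V n (z + h *\<^sub>R e) - u (z + h *\<^sub>R e)) - (?V n z - u z))"
      by (subst nrm2_commute) (simp add: algebra_simps)
    also have "\<dots> \<le> 2 * nrm2 (\<lambda>z. ?V n z - u z)"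
      using nrm2_shift_diff[OF L2_diff[OF LV u(1)], of n "h *\<^sub>R e"] .
    also have "nrm2 (\<lambda>z. \<zeta> z *\<^sub>R (?V n (z + h *\<^sub>R e) - ?V n z) - ?R z) = nrm2 (\<lambda>z. \<zeta> z *\<^sub>R (h *\<^sub>R ?A (?G n) z - h *\<^sub>R ?A g z))"
      unfolding loc by (simp only: scaleR_diff_right)
    also have "\<dots> \<le> N * nrm2 (\<lambda>z. h *\<^sub>R ?A (?G n) z - h *\<^sub>R ?A g z)"
      by (intro bm L2_diff LA)
    also have "nrm2 (\<lambda>z. h *\<^sub>R ?A (?G n) z - h *\<^sub>R ?A g z) = \<bar>h\<bar> * nrm2 (\<lambda>z. ?A (?G n) z - ?A g z)"
      unfolding scaleR_diff_right[symmetric] by (rule nrm2_scaleR)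
    also have "nrm2 (\<lambda>z. ?A (?G n) z - ?A g z) = nrm2 (?A (\<lambda>z. ?G n z - g z))"
    proof (rule nrm2_cong_AE)
      show "AE z in lborel. ?A (?G n) z - ?A g z = ?A (\<lambda>z. ?G n z - g z) z"
        using segment_integrable[OF LG[of n], of "h *\<^sub>R e"] segment_integrable[OF g, of "h *\<^sub>R e"]
        by eventually_elim (simp add: segment_average_diff)
    qed (rule L2_measurable L2_diff L2_segment_average LG g)+
    also have "\<dots> \<le> nrm2 (\<lambda>z. ?G n z - g z)" by (intro nrm2_segment_average L2_diff LG g)
    finally show ?thesis
      by this (use order_trans[OF abs_ge_zero N] in \<open>auto intro!: mult_left_mono\<close>)
  qed
  have "(\<lambda>n. N * (2 * nrm2 (\<lambda>z. ?V n z - u z)) + N * (\<bar>h\<bar> * nrm2 (\<lambda>z. ?G n z - g z))) \<longlonglongrightarrow> N * (2 * 0) + N * (\<bar>h\<bar> * 0)"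
    by (intro tendsto_intros mollify_tendsto u g \<delta> \<delta>0)
  then have "nrm2 (\<lambda>z. ?L z - ?R z) \<le> N * (2 * 0) + N * (\<bar>h\<bar> * 0)"
    by (rule LIMSEQ_le_const) (use le in auto)
  then have "nrm2 (\<lambda>z. ?L z - ?R z) = 0" by (simp add: antisym)
  then have "AE z in lborel. ?L z - ?R z = 0" by (intro nrm2_eq_0 L2_diff bm Ld LA)
  then show ?thesis by eventually_elim simp
qed

text \<open>Differences are averages of derivatives, so they inherit the size of the derivative, and difference
  quotients are as close to the derivative as its translates are.\<close>

lemma
  fixes u g :: "'a::euclidean_space \<Rightarrow> 'b::euclidean_space" and \<zeta> :: "'a \<Rightarrow> real"
  assumes u: "L2 u" "integrable lborel u" and g: "L2 g" and e: "e \<in> Basis" and D: "distr_deriv Q e u g"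
    and \<zeta>[measurable]: "\<zeta> \<in> borel_measurable borel" and N: "\<And>z. \<bar>\<zeta> z\<bar> \<le> N"
    and margin: "\<And>z. \<zeta> z \<noteq> 0 \<Longrightarrow> cball z r \<subseteq> Q" "\<bar>h\<bar> < r"
  shows nrm2_difference_le: "nrm2 (\<lambda>z. \<zeta> z *\<^sub>R (u (z + h *\<^sub>R e) - u z)) \<le> N * (\<bar>h\<bar> * nrm2 g)"
    and nrm2_difference_deriv_le: "(\<And>y. norm y \<le> \<bar>h\<bar> \<Longrightarrow> nrm2 (\<lambda>x. g (x + y) - g x) \<le> C) \<Longrightarrow>
      nrm2 (\<lambda>z. \<zeta> z *\<^sub>R (u (z + h *\<^sub>R e) - u z - h *\<^sub>R g z)) \<le> N * (\<bar>h\<bar> * C)"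
proof -
  let ?A = "segment_average (h *\<^sub>R e)"
  have AE: "AE z in lborel. \<zeta> z *\<^sub>R (u (z + h *\<^sub>R e) - u z) = \<zeta> z *\<^sub>R h *\<^sub>R ?A g z"
    by (rule distr_deriv_difference_eq_segment_average[OF u g e D \<zeta> N _ margin(2)]) (rule margin(1))
  have [measurable]: "u \<in> borel_measurable borel" "g \<in> borel_measurable borel" "?A g \<in> borel_measurable borel"
    using u g L2_segment_average[OF g] by measurable
  have N0: "N \<ge> 0" using N[of 0] by linarith
  have "nrm2 (\<lambda>z. \<zeta> z *\<^sub>R (u (z + h *\<^sub>R e) - u z)) = nrm2 (\<lambda>z. \<zeta> z *\<^sub>R (h *\<^sub>R ?A g z))"
    by (rule nrm2_cong_AE[OF _ _ AE]) measurable
  also have "\<dots> \<le> N * nrm2 (\<lambda>z. h *\<^sub>R ?A g z)"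
    by (intro L2_bounded_mult[OF _ \<zeta> N] L2_scaleR L2_segment_average g)
  also have "\<dots> \<le> N * (\<bar>h\<bar> * nrm2 g)"
    unfolding nrm2_scaleR using N0 nrm2_segment_average[OF g] by (intro mult_left_mono) auto
  finally show "nrm2 (\<lambda>z. \<zeta> z *\<^sub>R (u (z + h *\<^sub>R e) - u z)) \<le> N * (\<bar>h\<bar> * nrm2 g)" .
  assume C: "\<And>y. norm y \<le> \<bar>h\<bar> \<Longrightarrow> nrm2 (\<lambda>x. g (x + y) - g x) \<le> C"
  have "nrm2 (\<lambda>z. \<zeta> z *\<^sub>R (u (z + h *\<^sub>R e) - u z - h *\<^sub>R g z)) = nrm2 (\<lambda>z. \<zeta> z *\<^sub>R (h *\<^sub>R (?A g z - g z)))"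
  proof (rule nrm2_cong_AE)
    show "AE z in lborel. \<zeta> z *\<^sub>R (u (z + h *\<^sub>R e) - u z - h *\<^sub>R g z) = \<zeta> z *\<^sub>R (h *\<^sub>R (?A g z - g z))"
      using AE by eventually_elim (simp add: scaleR_diff_right)
  qed measurable
  also have "\<dots> \<le> N * nrm2 (\<lambda>z. h *\<^sub>R (?A g z - g z))"
    by (intro L2_bounded_mult[OF _ \<zeta> N] L2_scaleR L2_diff L2_segment_average g)
  also have "\<dots> \<le> N * (\<bar>h\<bar> * C)"
    unfolding nrm2_scaleR using N0 C e by (intro mult_left_mono nrm2_segment_average_diff[OF g]) auto
  finally show "nrm2 (\<lambda>z. \<zeta> z *\<^sub>R (u (z + h *\<^sub>R e) - u z - h *\<^sub>R g z)) \<le> N * (\<bar>h\<bar> * C)" .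
qed

section \<open>The energy estimate for difference quotients\<close>

definition outer :: "real^'m \<Rightarrow> real^'n \<Rightarrow> real^'n^'m" where
  "outer a b = (\<chi> i. (a $ i) *\<^sub>R b)"

lemma norm_outer: "norm (outer a b) = norm a * norm b"
  unfolding outer_def norm_vec_def[of "vec_lambda _"] norm_vec_def[of a]
  by (simp add: L2_set_left_distrib)

lemma outer_measurable [measurable]:
  assumes "a \<in> borel_measurable M" "b \<in> borel_measurable M"
  shows "(\<lambda>x. outer (a x) (b x)) \<in> borel_measurable M"
  unfolding outer_def
  by (rule borel_measurable_continuous_Pair[OF assms])
     (intro continuous_on_vec_lambda continuous_intros)

lemma norm_column_le: "norm (column j M) \<le> norm (M :: real^'n^'m)"
proof -
  have "norm (column j M) \<le> norm (\<chi> i. norm (M $ i))"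
    by (rule norm_le_componentwise_cart) (simp add: column_def component_le_norm_cart)
  also have "\<dots> = norm M" by (simp add: norm_vec_def L2_set_def)
  finally show ?thesis .
qed

lemma nrm2_column_le:
  fixes W :: "'a::euclidean_space \<Rightarrow> real^'n^'m"
  assumes "L2 W" shows "nrm2 (\<lambda>x. column j (W x)) \<le> nrm2 W"
  using L2_dominated(2)[OF assms L2_measurable[OF L2_column[OF assms]], of j 1] by (simp add: norm_column_le)

text \<open>Absorbs the linear term into the left-hand side.\<close>

lemma quadratic_absorb:
  fixes a t \<theta> k1 k2 :: real
  assumes "0 \<le> a" "0 \<le> t" "0 < \<theta>" "0 \<le> k1" "0 \<le> k2" "\<theta> * a\<^sup>2 \<le> k1 * t * a + k2 * t\<^sup>2"
  shows "a \<le> ((k1 + k2) / \<theta> + 1) * t"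
proof (cases "a \<le> t")
  case True
  have "1 * t \<le> ((k1 + k2) / \<theta> + 1) * t" using assms by (intro mult_right_mono) auto
  with True show ?thesis by simp
next
  case False
  then have "k2 * t\<^sup>2 \<le> k2 * (t * a)" unfolding power2_eq_square using assms by (intro mult_left_mono) auto
  with assms(6) have "\<theta> * a * a \<le> (k1 + k2) * t * a" by (simp add: power2_eq_square algebra_simps)
  then have "\<theta> * a \<le> (k1 + k2) * t" using False assms(2) by (simp add: mult_le_cancel_right)
  then have "a \<le> (k1 + k2) / \<theta> * t" using assms(3) by (simp add: field_simps)
  then show ?thesis using assms(2) by (simp add: distrib_right)
qed

text \<open>The constant of Caccioppoli's inequality; \<open>N\<close> and \<open>B\<close> bound the cutoff and its gradient.\<close>

definition energy_const :: "real \<Rightarrow> real \<Rightarrow> real \<Rightarrow> real \<Rightarrow> real" where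
  "energy_const \<theta> \<Theta> N B = ((N + 1 + 2 * \<Theta> * B) + (2 * N * B + 2 * B)) / \<theta> + 1"

text \<open>Caccioppoli's inequality for differences. The equation is tested with
  \<open>w = \<Delta>\<^sup>* (\<eta>\<^sup>2 \<Delta>u)\<close>, where \<open>\<Delta>\<close> is the difference by the vector \<open>h e\<^sub>l\<close> and \<open>\<Delta>\<^sup>*\<close> its adjoint.
  Ellipticity enters only through the splitting \<open>\<Delta>\<sigma> = P + r\<close> into a part \<open>P\<close> that is strongly monotone
  in \<open>\<Delta>g\<close> and a remainder \<open>r\<close>.\<close>

lemma energy_estimate:
  fixes u f :: "'a::euclidean_space \<Rightarrow> real^'m" and g \<sigma> P r :: "'a \<Rightarrow> real^'n^'m"
    and e :: "'n \<Rightarrow> 'a" and \<eta> :: "'a \<Rightarrow> real" and h :: real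
  assumes Q: "open Q" and e: "\<And>j. e j \<in> Basis"
    and L: "L2 u" "L2 g" "L2 f" "L2 \<sigma>" and iu: "integrable lborel u"
    and D: "\<And>j. distr_deriv Q (e j) u (\<lambda>x. column j (g x))"
    and eqn: "\<And>w. test_fun Q w \<Longrightarrow> (\<integral>x. f x \<bullet> w x \<partial>lborel) + (\<integral>x. \<sigma> x \<bullet> jacobian e w x \<partial>lborel) = 0"
    and \<eta>: "smooth_on UNIV \<eta>" "\<And>x. \<bar>\<eta> x\<bar> \<le> N" "\<And>x. norm (\<chi> j. partial (e j) \<eta> x) \<le> B"
    and K: "compact K" "\<And>x. x \<notin> K \<Longrightarrow> \<eta> x = 0" "\<And>x. x \<in> K \<Longrightarrow> cball x \<rho> \<subseteq> Q" and h: "\<bar>h\<bar> < \<rho>"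
    and P[measurable]: "P \<in> borel_measurable borel" and r: "L2 (\<lambda>z. \<eta> z *\<^sub>R r z)"
    and split: "\<And>z. z \<in> K \<Longrightarrow> \<sigma> (z + h *\<^sub>R e l) - \<sigma> z = P z + r z"
    and mono: "\<And>z. \<theta> * (norm (g (z + h *\<^sub>R e l) - g z))\<^sup>2 \<le> P z \<bullet> (g (z + h *\<^sub>R e l) - g z)"
    and lip: "\<And>z. norm (P z) \<le> \<Theta> * norm (g (z + h *\<^sub>R e l) - g z)"
    and pos: "\<theta> > 0" "\<Theta> \<ge> 0"
  shows "nrm2 (\<lambda>z. \<eta> z *\<^sub>R (g (z + h *\<^sub>R e l) - g z))
    \<le> energy_const \<theta> \<Theta> N B * (\<bar>h\<bar> * nrm2 f + \<bar>h\<bar> * nrm2 g + nrm2 (\<lambda>z. \<eta> z *\<^sub>R r z))"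
proof -
  define k where "k = h *\<^sub>R e l"
  have kn: "norm k = \<bar>h\<bar>" unfolding k_def using e[of l] by simp
  have N0: "N \<ge> 0" using \<eta>(2)[of 0] by linarith
  have B0: "B \<ge> 0" using order_trans[OF norm_ge_zero \<eta>(3)] .
  let ?du = "\<lambda>z. u (z + k) - u z" and ?dg = "\<lambda>z. g (z + k) - g z"
  define grad where "grad z = (\<chi> j. partial (e j) \<eta> z)" for z
  define \<kappa> where "\<kappa> = (\<lambda>z. \<eta> z *\<^sub>R \<eta> z)"
  have gz: "partial (e j) \<eta> z = grad z $ j" for j z by (simp add: grad_def)
  have p\<kappa>: "partial (e j) \<kappa> z = 2 * \<eta> z * grad z $ j" for j z
    using partial_scaleR[OF smooth_on_differentiable[OF \<eta>(1)] smooth_on_differentiable[OF \<eta>(1)], of "e j" z]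
    by (simp add: \<kappa>_def gz)
  have [measurable]: "\<eta> \<in> borel_measurable borel" by (rule smooth_measurable[OF \<eta>(1)])
  have [measurable]: "grad \<in> borel_measurable borel"
    unfolding grad_def
    by (intro borel_measurable_continuous_onI continuous_on_vec_lambda smooth_on_continuous smooth_on_partial \<eta> e)
  have [measurable]: "u \<in> borel_measurable borel" "g \<in> borel_measurable borel" "f \<in> borel_measurable borel"
    "\<sigma> \<in> borel_measurable borel"
    using L by (auto intro: L2_measurable)
  have KQ: "K \<subseteq> Q" using K(3) h by (smt (verit, ccfv_SIG) abs_ge_zero centre_in_cball in_mono subsetI)
  let ?Kk = "(\<lambda>x. x + k) ` K"
  have KkQ: "?Kk \<subseteq> Q" using K(3) h kn by (force simp: dist_norm)
  have cKk: "compact ?Kk" by (intro compact_continuous_image K continuous_intros)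
  have t\<eta>: "test_fun Q \<eta>" by (rule test_funI[OF \<eta>(1) K(1) KQ K(2)])
  have sm\<kappa>: "smooth_on UNIV \<kappa>" unfolding \<kappa>_def by (intro smooth_on_scaleR \<eta>)
  have t\<kappa>: "test_fun Q \<kappa>" by (rule test_funI[OF sm\<kappa> K(1) KQ]) (simp add: \<kappa>_def K(2))
  have t\<kappa>k: "test_fun Q (\<lambda>x. \<kappa> (x - k))"
  proof (rule test_funI[OF _ cKk KkQ])
    show "smooth_on UNIV (\<lambda>x. \<kappa> (x - k))" using smooth_on_affine[OF sm\<kappa>, of "- k" 1] by (simp add: add.commute)
    show "\<kappa> (x - k) = 0" if "x \<notin> ?Kk" for x
    proof -
      have "x - k \<notin> K" using that by (metis diff_add_cancel image_eqI)
      then show ?thesis by (simp add: \<kappa>_def K(2))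
    qed
  qed
  \<comment> \<open>The test function is \<open>w = p(\<cdot> - k) - p\<close> with \<open>p = \<eta>\<^sup>2 \<Delta>u\<close>; \<open>X\<close> is the Jacobian of \<open>p\<close>.\<close>
  define p where "p z = \<kappa> z *\<^sub>R ?du z" for z
  define Y where "Y z = outer (?du z) (grad z)" for z
  define X where "X z = \<eta> z *\<^sub>R (\<eta> z *\<^sub>R ?dg z) + (2 * \<eta> z) *\<^sub>R Y z" for z
  have colX: "column j (X z) = \<kappa> z *\<^sub>R (column j (g (z + k)) - column j (g z)) + partial (e j) \<kappa> z *\<^sub>R ?du z" for j z
    unfolding p\<kappa> by (simp add: X_def Y_def \<kappa>_def outer_def column_def vec_eq_iff algebra_simps)
  have Lcol: "L2 (\<lambda>x. column j (g x))" for j by (rule L2_column[OF L(2)])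
  have Dp: "distr_deriv UNIV (e j) p (\<lambda>z. column j (X z))" for j
    using distr_deriv_cutoff_difference[OF t\<kappa> t\<kappa>k D L(1) Lcol e] unfolding colX p_def by simp
  have Ldu: "L2 ?du" and Ldg: "L2 ?dg" using L by (auto intro: L2_shift_diff)
  define a b R F t where "a = nrm2 (\<lambda>z. \<eta> z *\<^sub>R ?dg z)" and "b = nrm2 Y" and "R = nrm2 (\<lambda>z. \<eta> z *\<^sub>R r z)"
    and "F = nrm2 f" and "t = \<bar>h\<bar> * nrm2 f + \<bar>h\<bar> * nrm2 g + nrm2 (\<lambda>z. \<eta> z *\<^sub>R r z)"
  have La: "L2 (\<lambda>z. \<eta> z *\<^sub>R ?dg z)" by (rule L2_bounded_mult[OF Ldg _ \<eta>(2)]) measurable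
  have grad0: "grad z = 0" if "z \<notin> K" for z
  proof -
    have "(\<eta> has_derivative (\<lambda>_. 0)) (at z)"
    proof (rule has_derivative_transform_within_open[OF has_derivative_const[of 0], of "- K"])
      show "0 = \<eta> y" if "y \<in> - K" for y using K(2)[of y] that by simp
    qed (use that K(1) in \<open>simp_all add: open_Compl compact_imp_closed\<close>)
    then show ?thesis by (simp add: grad_def vec_eq_iff partial_has_derivative)
  qed
  have Kmeas[measurable]: "K \<in> sets borel" using K(1) by (simp add: compact_imp_closed)
  have Yle: "norm (Y z) \<le> B * norm (indicator K z *\<^sub>R ?du z)" for z
    using mult_right_mono[OF \<eta>(3)[of z] norm_ge_zero[of "?du z"]] grad0[of z]
    by (cases "z \<in> K") (auto simp: Y_def norm_outer grad_def[symmetric] mult.commute)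
  have L1u: "L2 (\<lambda>z. indicator K z *\<^sub>R ?du z)" by (rule L2_indicator_mult[OF Ldu Kmeas])
  have [measurable]: "Y \<in> borel_measurable borel" unfolding Y_def by measurable
  have LY: "L2 Y" and bB: "b \<le> B * nrm2 (\<lambda>z. indicator K z *\<^sub>R ?du z)"
    unfolding b_def using L2_dominated[OF L1u, of Y B] Yle B0 by auto
  have "nrm2 (\<lambda>z. indicator K z *\<^sub>R ?du z) \<le> 1 * (\<bar>h\<bar> * nrm2 (\<lambda>x. column l (g x)))"
    unfolding k_def
    by (rule nrm2_difference_le[OF L(1) iu Lcol e D _ _ _ h]) (auto simp: indicator_def K(3) split: if_splits)
  also have "\<dots> \<le> \<bar>h\<bar> * nrm2 g" using nrm2_column_le[OF L(2)] by (simp add: mult_left_mono)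
  also have "\<dots> \<le> t" unfolding t_def by simp
  finally have bt: "b \<le> B * t"
    using bB mult_left_mono[OF _ B0] by (meson order_trans)
  have LX: "L2 X" and Xle: "nrm2 X \<le> N * a + 2 * N * b"
  proof -
    have 1: "L2 (\<lambda>z. \<eta> z *\<^sub>R (\<eta> z *\<^sub>R ?dg z))" "nrm2 (\<lambda>z. \<eta> z *\<^sub>R (\<eta> z *\<^sub>R ?dg z)) \<le> N * a"
      unfolding a_def by (rule L2_bounded_mult[OF La _ \<eta>(2)], measurable)+
    have 2: "L2 (\<lambda>z. (2 * \<eta> z) *\<^sub>R Y z)" "nrm2 (\<lambda>z. (2 * \<eta> z) *\<^sub>R Y z) \<le> (2 * N) * b"
    proof -
      have "\<bar>2 * \<eta> z\<bar> \<le> 2 * N" for z using \<eta>(2)[of z] by (simp add: abs_mult)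
      then show "L2 (\<lambda>z. (2 * \<eta> z) *\<^sub>R Y z)" "nrm2 (\<lambda>z. (2 * \<eta> z) *\<^sub>R Y z) \<le> (2 * N) * b"
        unfolding b_def using L2_bounded_mult[OF LY, of "\<lambda>z. 2 * \<eta> z" "2 * N"] by auto
    qed
    show "L2 X" "nrm2 X \<le> N * a + 2 * N * b"
      unfolding X_def using L2_add[OF 1(1) 2(1)] nrm2_triangle[OF 1(1) 2(1)] 1(2) 2(2) by auto
  qed
  have Lp: "L2 p"
  proof -
    have "\<bar>\<kappa> z\<bar> \<le> N * N" for z
      unfolding \<kappa>_def real_scaleR_def abs_mult using N0 by (intro mult_mono \<eta>(2)) auto
    then show ?thesis
      unfolding p_def by (intro L2_bounded_mult(1)[OF Ldu smooth_measurable[OF sm\<kappa>]])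
  qed
  have pK: "p z = 0" "X z = 0" if "z \<notin> K" for z
    using K(2)[OF that] grad0[OF that] by (auto simp: p_def X_def \<kappa>_def)
  have [measurable]: "p \<in> borel_measurable borel" "X \<in> borel_measurable borel" using Lp LX by (auto intro: L2_measurable)
  have fK: "K \<in> fmeasurable lborel"
    using K(1) emeasure_bounded_finite[OF compact_imp_bounded[OF K(1)]]
    by (simp add: fmeasurable_def compact_imp_closed)
  have ip: "integrable lborel p" by (rule L2_finite_support_integrable(1)[OF Lp fK pK(1)])
  define w W where "w z = p (z - k) - p z" and "W z = X (z - k) - X z" for z
  have Lpk: "L2 (\<lambda>z. p (z - k))" "L2 (\<lambda>z. X (z - k))" using L2_shift[OF Lp, of "- k"] L2_shift[OF LX, of "- k"] by auto
  have LcolX: "L2 (\<lambda>z. column j (X z))" "L2 (\<lambda>z. column j (X (z - k)))" for j using L2_column LX Lpk by blast+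
  have Lw: "L2 w" "L2 W" unfolding w_def W_def using Lp LX Lpk by (auto intro: L2_diff)
  have Dw: "distr_deriv UNIV (e j) w (\<lambda>z. column j (W z))" for j
  proof -
    have "distr_deriv UNIV (e j) (\<lambda>z. p (z - k)) (\<lambda>z. column j (X (z - k)))"
      using distr_deriv_shift[OF Dp _ L2_measurable[OF LcolX(1)] e, of j "- k"] by simp
    from distr_deriv_diff[OF Lpk(1) Lp LcolX(2) LcolX(1) e this Dp]
    have "distr_deriv UNIV (e j) w (\<lambda>x. column j (X (x - k)) - column j (X x))"
      unfolding w_def[abs_def] .
    moreover have "column j (X (x - k)) - column j (X x) = column j (W x)" for x
      by (simp add: W_def column_def vec_eq_iff)
    ultimately show ?thesis by simp
  qed
  have out: "x \<notin> K" "x - k \<notin> K" if "x \<notin> K \<union> ?Kk" for x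
    using that by (auto, metis diff_add_cancel image_eqI)
  have eq0: "(\<integral>x. f x \<bullet> w x \<partial>lborel) + (\<integral>x. \<sigma> x \<bullet> W x \<partial>lborel) = 0"
  proof (rule weak_equation_extend[OF e L(3,4) Lw eqn])
    show "compact (K \<union> ?Kk)" using K(1) cKk by (rule compact_Un)
    show "K \<union> ?Kk \<subseteq> Q" using KQ KkQ by blast
    show "w x = 0" "W x = 0" if "x \<notin> K \<union> ?Kk" for x
      using out[OF that] by (simp_all add: w_def W_def pK)
  qed (use Q Dw in auto)
  have wle: "nrm2 w \<le> \<bar>h\<bar> * (N * a + 2 * N * b)"
  proof -
    have "nrm2 (\<lambda>z. 1 *\<^sub>R (p (z + (- h) *\<^sub>R e l) - p z)) \<le> 1 * (\<bar>- h\<bar> * nrm2 (\<lambda>z. column l (X z)))"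
      by (rule nrm2_difference_le[OF Lp ip LcolX(1) e Dp, where r = "\<bar>h\<bar> + 1"]) auto
    also have "\<dots> \<le> \<bar>h\<bar> * (N * a + 2 * N * b)"
      using nrm2_column_le[OF LX, of l] Xle by (simp add: mult_left_mono)
    finally show ?thesis by (simp add: w_def[abs_def] k_def)
  qed
  have fw: "\<bar>\<integral>x. f x \<bullet> w x \<partial>lborel\<bar> \<le> F * (\<bar>h\<bar> * (N * a + 2 * N * b))"
    using L2_inner_bound[OF L(3) Lw(1)] wle mult_left_mono[OF wle nrm2_nonneg[of f]] unfolding F_def by linarith
  have L\<sigma>k: "L2 (\<lambda>x. \<sigma> (x + k))" by (rule L2_shift[OF L(4)])
  \<comment> \<open>Discrete integration by parts moves the difference from the test function to the flux.\<close>
  have \<sigma>W: "(\<integral>x. \<sigma> x \<bullet> W x \<partial>lborel) = (\<integral>x. (\<sigma> (x + k) - \<sigma> x) \<bullet> X x \<partial>lborel)"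
  proof -
    have "(\<integral>x. \<sigma> x \<bullet> W x \<partial>lborel) = (\<integral>x. \<sigma> x \<bullet> X (x - k) \<partial>lborel) - (\<integral>x. \<sigma> x \<bullet> X x \<partial>lborel)"
      unfolding W_def inner_diff_right
      by (intro Bochner_Integration.integral_diff L2_inner_integrable L(4) Lpk LX)
    also have "(\<integral>x. \<sigma> x \<bullet> X (x - k) \<partial>lborel) = (\<integral>x. \<sigma> (x + k) \<bullet> X x \<partial>lborel)"
      using integral_shift(1)[of "\<lambda>x. \<sigma> x \<bullet> X (x - k)" k] by simp
    also have "(\<integral>x. \<sigma> (x + k) \<bullet> X x \<partial>lborel) - (\<integral>x. \<sigma> x \<bullet> X x \<partial>lborel) = (\<integral>x. (\<sigma> (x + k) - \<sigma> x) \<bullet> X x \<partial>lborel)"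
      unfolding inner_diff_left
      by (intro Bochner_Integration.integral_diff[symmetric] L2_inner_integrable L(4) L\<sigma>k LX)
    finally show ?thesis .
  qed
  have LP: "L2 (\<lambda>z. \<eta> z *\<^sub>R P z)" and Ple: "nrm2 (\<lambda>z. \<eta> z *\<^sub>R P z) \<le> \<Theta> * a"
  proof -
    have "norm (\<eta> z *\<^sub>R P z) \<le> \<Theta> * norm (\<eta> z *\<^sub>R ?dg z)" for z
      using mult_left_mono[OF lip[of z] abs_ge_zero[of "\<eta> z"]] by (simp add: k_def mult_ac)
    then show "L2 (\<lambda>z. \<eta> z *\<^sub>R P z)" "nrm2 (\<lambda>z. \<eta> z *\<^sub>R P z) \<le> \<Theta> * a"
      unfolding a_def using L2_dominated[OF La, of "\<lambda>z. \<eta> z *\<^sub>R P z" \<Theta>] pos by auto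
  qed
  have split': "(\<sigma> (x + k) - \<sigma> x) \<bullet> X x = (\<eta> x *\<^sub>R P x) \<bullet> (\<eta> x *\<^sub>R ?dg x) + (\<eta> x *\<^sub>R r x) \<bullet> (\<eta> x *\<^sub>R ?dg x)
      + 2 * ((\<eta> x *\<^sub>R P x) \<bullet> Y x) + 2 * ((\<eta> x *\<^sub>R r x) \<bullet> Y x)" for x
  proof (cases "x \<in> K")
    case True
    show ?thesis unfolding split[OF True, folded k_def] X_def by (simp add: inner_simps algebra_simps)
  qed (simp add: pK K(2))
  define I1 I2 I3 I4 where "I1 = (\<integral>x. (\<eta> x *\<^sub>R P x) \<bullet> (\<eta> x *\<^sub>R ?dg x) \<partial>lborel)"
    and "I2 = (\<integral>x. (\<eta> x *\<^sub>R r x) \<bullet> (\<eta> x *\<^sub>R ?dg x) \<partial>lborel)"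
    and "I3 = (\<integral>x. (\<eta> x *\<^sub>R P x) \<bullet> Y x \<partial>lborel)" and "I4 = (\<integral>x. (\<eta> x *\<^sub>R r x) \<bullet> Y x \<partial>lborel)"
  note ints = L2_inner_integrable[OF LP La] L2_inner_integrable[OF r La] L2_inner_integrable[OF LP LY] L2_inner_integrable[OF r LY]
  have sumI: "(\<integral>x. \<sigma> x \<bullet> W x \<partial>lborel) = I1 + I2 + 2 * I3 + 2 * I4"
    unfolding \<sigma>W split' I1_def I2_def I3_def I4_def using ints by simp
  have I1: "\<theta> * a\<^sup>2 \<le> I1"
  proof -
    have "\<theta> * a\<^sup>2 = (\<integral>x. \<theta> * (norm (\<eta> x *\<^sub>R ?dg x))\<^sup>2 \<partial>lborel)" unfolding a_def nrm2_sq by simp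
    also have "\<dots> \<le> I1"
      unfolding I1_def
    proof (rule integral_mono)
      show "integrable lborel (\<lambda>x. \<theta> * (norm (\<eta> x *\<^sub>R ?dg x))\<^sup>2)"
        using L2_integrable[OF La] by (rule integrable_mult_right)
      show "\<theta> * (norm (\<eta> x *\<^sub>R ?dg x))\<^sup>2 \<le> (\<eta> x *\<^sub>R P x) \<bullet> (\<eta> x *\<^sub>R ?dg x)" for x
        using mult_left_mono[OF mono[of x] zero_le_power2[of "\<eta> x"]]
        by (simp add: k_def power_mult_distrib power2_eq_square mult_ac)
    qed (use ints in auto)
    finally show ?thesis .
  qed
  have a0: "a \<ge> 0" and b0: "b \<ge> 0" and R0: "R \<ge> 0" and F0: "F \<ge> 0" and t0: "t \<ge> 0"
    unfolding a_def b_def R_def F_def t_def by simp_all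
  have I2: "\<bar>I2\<bar> \<le> R * a" unfolding I2_def R_def a_def by (rule L2_inner_bound[OF r La])
  have I3: "\<bar>I3\<bar> \<le> \<Theta> * a * b"
    using L2_inner_bound[OF LP LY] mult_right_mono[OF Ple b0] unfolding I3_def b_def by linarith
  have I4: "\<bar>I4\<bar> \<le> R * b" unfolding I4_def R_def b_def by (rule L2_inner_bound[OF r LY])
  have Rt: "R \<le> t" "F * \<bar>h\<bar> \<le> t" unfolding R_def F_def t_def by (simp_all add: mult.commute)
  have "\<theta> * a\<^sup>2 \<le> F * (\<bar>h\<bar> * (N * a + 2 * N * b)) + R * a + 2 * (\<Theta> * a * b) + 2 * (R * b)"
    using I1 eq0 fw I2 I3 I4 unfolding sumI by linarith
  also have "\<dots> \<le> t * (N * a + 2 * N * (B * t)) + t * a + 2 * (\<Theta> * a * (B * t)) + 2 * (t * (B * t))"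
  proof -
    have "F * (\<bar>h\<bar> * (N * a + 2 * N * b)) = (F * \<bar>h\<bar>) * (N * a + 2 * N * b)" by simp
    also have "\<dots> \<le> t * (N * a + 2 * N * (B * t))"
      using Rt bt a0 b0 N0 t0 F0 by (intro mult_mono add_mono mult_left_mono) auto
    finally have "F * (\<bar>h\<bar> * (N * a + 2 * N * b)) \<le> t * (N * a + 2 * N * (B * t))" .
    moreover have "R * a \<le> t * a" using Rt a0 by (intro mult_right_mono) auto
    moreover have "\<Theta> * a * b \<le> \<Theta> * a * (B * t)" using bt pos a0 by (intro mult_left_mono) auto
    moreover have "R * b \<le> t * (B * t)" using Rt bt b0 t0 by (intro mult_mono) auto
    ultimately show ?thesis by linarith
  qed
  also have "\<dots> = (N + 1 + 2 * \<Theta> * B) * t * a + (2 * N * B + 2 * B) * t\<^sup>2"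
    by (simp add: power2_eq_square algebra_simps)
  finally have "a \<le> energy_const \<theta> \<Theta> N B * t"
    unfolding energy_const_def using a0 t0 N0 B0 pos by (intro quadratic_absorb) auto
  then show ?thesis unfolding a_def t_def k_def .
qed

section \<open>Existence of second derivatives\<close>

lemma nrm2_sum_le: "(\<And>i. i \<in> I \<Longrightarrow> L2 (u i)) \<Longrightarrow> nrm2 (\<lambda>x. \<Sum>i\<in>I. u i x) \<le> (\<Sum>i\<in>I. nrm2 (u i))"
proof (induction I rule: infinite_finite_induct)
  case (insert i I)
  have "nrm2 (\<lambda>x. u i x + (\<Sum>i\<in>I. u i x)) \<le> nrm2 (u i) + nrm2 (\<lambda>x. \<Sum>i\<in>I. u i x)"
    using insert.prems by (intro nrm2_triangle L2_sum) auto
  also have "\<dots> \<le> nrm2 (u i) + (\<Sum>i\<in>I. nrm2 (u i))" using insert by auto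
  finally show ?case using insert by simp
qed simp_all

text \<open>Convex combinations of the tails of a convergent sequence converge to the same limit.\<close>

lemma tail_combination_tendsto:
  fixes q :: "nat \<Rightarrow> 'b::real_normed_vector"
  assumes "\<And>n. w n \<in> tail_weights n" "q \<longlonglongrightarrow> L"
  shows "(\<lambda>n. \<Sum>i | w n i \<noteq> 0. w n i *\<^sub>R q i) \<longlonglongrightarrow> L"
proof (rule LIMSEQ_I)
  fix \<epsilon> :: real assume "\<epsilon> > 0"
  then obtain M where M: "\<And>i. i \<ge> M \<Longrightarrow> norm (q i - L) < \<epsilon> / 2" using LIMSEQ_D[OF assms(2), of "\<epsilon>/2"] by auto
  show "\<exists>M. \<forall>n\<ge>M. norm ((\<Sum>i | w n i \<noteq> 0. w n i *\<^sub>R q i) - L) < \<epsilon>"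
  proof (intro exI[of _ M] allI impI)
    fix n assume "n \<ge> M"
    obtain N where N: "\<And>i. 0 \<le> w n i" "\<And>i. i < n \<Longrightarrow> w n i = 0" "\<And>i. i \<ge> N \<Longrightarrow> w n i = 0" "(\<Sum>i<N. w n i) = 1"
      using tail_weightsE[OF assms(1)[of n]] by metis
    have "(\<Sum>i | w n i \<noteq> 0. w n i *\<^sub>R q i) = (\<Sum>i<N. w n i *\<^sub>R q i)"
      by (rule sum_support_eq) (rule N(3))
    then have "(\<Sum>i | w n i \<noteq> 0. w n i *\<^sub>R q i) - L = (\<Sum>i<N. w n i *\<^sub>R q i) - (\<Sum>i<N. w n i *\<^sub>R L)"
      unfolding scaleR_left.sum[symmetric] N(4) by simp
    also have "\<dots> = (\<Sum>i<N. w n i *\<^sub>R (q i - L))" by (simp add: sum_subtractf scaleR_diff_right)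
    also have "norm \<dots> \<le> (\<Sum>i<N. w n i * (\<epsilon> / 2))"
    proof (rule sum_norm_le)
      fix i
      show "norm (w n i *\<^sub>R (q i - L)) \<le> w n i * (\<epsilon> / 2)"
      proof (cases "i < n")
        case False
        then show ?thesis
          unfolding norm_scaleR real_norm_def abs_of_nonneg[OF N(1)]
          using N(1)[of i] M[of i] \<open>n \<ge> M\<close> by (intro mult_left_mono) auto
      qed (simp add: N(2))
    qed
    also have "\<dots> = \<epsilon> / 2" unfolding sum_distrib_right[symmetric] N(4) by simp
    finally show "norm ((\<Sum>i | w n i \<noteq> 0. w n i *\<^sub>R q i) - L) < \<epsilon>" using \<open>\<epsilon> > 0\<close> by simp
  qed
qed

lemma smooth_bounded_difference:
  fixes \<phi> :: "'a::euclidean_space \<Rightarrow> real"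
  assumes "smooth_on UNIV \<phi>" "e \<in> Basis" "\<And>x. \<bar>partial e \<phi> x\<bar> \<le> B"
  shows "\<bar>\<phi> (z + h *\<^sub>R e) - \<phi> z\<bar> \<le> \<bar>h\<bar> * B"
proof -
  have "(\<phi> has_derivative (\<lambda>d. \<Sum>b\<in>Basis. (d \<bullet> b) *\<^sub>R partial b \<phi> x)) (at x)" for x
    by (rule frechet_eq_sum_partial[OF smooth_on_differentiable[OF assms(1)]])
  have D: "((\<lambda>s. \<phi> (z + s *\<^sub>R e)) has_derivative (\<lambda>r. r * partial e \<phi> (z + s *\<^sub>R e))) (at s within T)" for s T
  proof -
    have *: "(\<phi> has_derivative frechet_derivative \<phi> (at (z + s *\<^sub>R e))) (at (z + s *\<^sub>R e))"
      using smooth_on_differentiable[OF assms(1)] frechet_derivative_works by blast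
    then have "((\<lambda>s. \<phi> (z + s *\<^sub>R e)) has_derivative (\<lambda>r. frechet_derivative \<phi> (at (z + s *\<^sub>R e)) (r *\<^sub>R e))) (at s within T)"
      by (rule has_derivative_compose[rotated]) (auto intro!: derivative_eq_intros)
    moreover have "frechet_derivative \<phi> (at (z + s *\<^sub>R e)) (r *\<^sub>R e) = r * partial e \<phi> (z + s *\<^sub>R e)" for r
      using linear_cmul[OF has_derivative_linear[OF *]] by (simp add: partial_def)
    ultimately show ?thesis by simp
  qed
  have "norm ((\<lambda>s. \<phi> (z + s *\<^sub>R e)) h - (\<lambda>s. \<phi> (z + s *\<^sub>R e)) 0) \<le> B * norm (h - 0)"
  proof (rule differentiable_bound[of UNIV _ "\<lambda>s r. r * partial e \<phi> (z + s *\<^sub>R e)"])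
    show "onorm (\<lambda>r. r * partial e \<phi> (z + s *\<^sub>R e)) \<le> B" for s
      using assms(3)[of "z + s *\<^sub>R e"] order_trans[OF abs_ge_zero assms(3)]
      by (intro onorm_bound) (simp_all add: abs_mult mult.commute[of B] mult_left_mono)
  qed (use D in auto)
  then show ?thesis by (simp add: mult.commute)
qed

text \<open>The difference quotients of a test function converge pointwise and are bounded by the maximum of its
  derivative.\<close>

lemma test_fun_difference_quotient_tendsto:
  fixes \<phi> :: "'a::euclidean_space \<Rightarrow> real" and g :: "'a \<Rightarrow> 'b::euclidean_space"
  assumes \<phi>: "test_fun Q \<phi>" and e: "e \<in> Basis" and g: "integrable lborel g"
    and h: "h \<longlonglongrightarrow> 0" "\<And>n. h n \<noteq> 0"
  shows "(\<lambda>n. \<integral>z. ((\<phi> (z - h n *\<^sub>R e) - \<phi> z) / h n) *\<^sub>R g z \<partial>lborel) \<longlonglongrightarrow> - (\<integral>z. partial e \<phi> z *\<^sub>R g z \<partial>lborel)"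
proof -
  have sm: "smooth_on UNIV \<phi>" by (rule test_fun_smooth[OF \<phi>])
  obtain B where B: "\<And>x. \<bar>partial e \<phi> x\<bar> \<le> B" using test_fun_bounded[OF test_fun_partial[OF \<phi> e]] by (metis real_norm_def)
  have [measurable]: "\<phi> \<in> borel_measurable borel" "partial e \<phi> \<in> borel_measurable borel" "g \<in> borel_measurable borel"
    using smooth_measurable sm smooth_on_partial[OF sm e] g by auto
  have "(\<lambda>n. \<integral>z. ((\<phi> (z - h n *\<^sub>R e) - \<phi> z) / h n) *\<^sub>R g z \<partial>lborel) \<longlonglongrightarrow> (\<integral>z. (- partial e \<phi> z) *\<^sub>R g z \<partial>lborel)"
  proof (rule integral_dominated_convergence)
    show "integrable lborel (\<lambda>z. B * norm (g z))" using g by simp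
    show "AE z in lborel. norm (((\<phi> (z - h n *\<^sub>R e) - \<phi> z) / h n) *\<^sub>R g z) \<le> B * norm (g z)" for n
    proof (rule AE_I2)
      fix z
      have "\<bar>\<phi> (z - h n *\<^sub>R e) - \<phi> z\<bar> \<le> \<bar>h n\<bar> * B"
        using smooth_bounded_difference[OF sm e B, of z "- h n"] by simp
      then have "\<bar>(\<phi> (z - h n *\<^sub>R e) - \<phi> z) / h n\<bar> \<le> B"
        using h(2)[of n] by (simp add: abs_divide pos_divide_le_eq mult.commute)
      then show "norm (((\<phi> (z - h n *\<^sub>R e) - \<phi> z) / h n) *\<^sub>R g z) \<le> B * norm (g z)"
        unfolding norm_scaleR by (intro mult_right_mono) auto
    qed
    show "AE z in lborel. (\<lambda>n. ((\<phi> (z - h n *\<^sub>R e) - \<phi> z) / h n) *\<^sub>R g z) \<longlonglongrightarrow> (- partial e \<phi> z) *\<^sub>R g z"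
    proof (intro AE_I2 tendsto_scaleR tendsto_const)
      fix z
      have *: "(\<phi> has_derivative frechet_derivative \<phi> (at z)) (at z)"
        using smooth_on_differentiable[OF sm] frechet_derivative_works by blast
      have "((\<lambda>s. \<phi> (z + s *\<^sub>R (- e))) has_derivative (\<lambda>r. frechet_derivative \<phi> (at z) (r *\<^sub>R (- e)))) (at 0)"
        by (rule has_derivative_compose[of _ _ 0 UNIV \<phi>]) (use * in \<open>auto intro!: derivative_eq_intros\<close>)
      then have "((\<lambda>s. \<phi> (z + s *\<^sub>R (- e))) has_real_derivative (- partial e \<phi> z)) (at 0)"
        unfolding has_field_derivative_def
        by (rule has_derivative_eq_rhs)
           (auto simp: partial_def linear_cmul[OF has_derivative_linear[OF *]] linear_neg[OF has_derivative_linear[OF *]])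
      then have "((\<lambda>s. (\<phi> (z + s *\<^sub>R (- e)) - \<phi> z) / s) \<longlongrightarrow> - partial e \<phi> z) (at 0)"
        by (simp add: has_field_derivative_iff)
      moreover have "filterlim h (at 0) sequentially"
        using h by (intro filterlim_atI) auto
      ultimately show "(\<lambda>n. (\<phi> (z - h n *\<^sub>R e) - \<phi> z) / h n) \<longlonglongrightarrow> - partial e \<phi> z"
        using filterlim_compose by fastforce
    qed
  qed measurable
  then show ?thesis by simp
qed

text \<open>Nirenberg's method: if the difference quotients of \<open>g\<close> stay bounded in mean square on compact
  sets, then the derivative exists. The weights \<open>\<omega>\<close> turn the local bounds into one global bound, so
  that Mazur's lemma gives one limit on all of \<open>Q\<close>.\<close>

lemma distr_deriv_exists:
  fixes g :: "'a::euclidean_space \<Rightarrow> 'b::euclidean_space"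
  assumes g: "L2 g" "integrable lborel g" and Q: "open Q" "bounded Q" and e: "e \<in> Basis"
    and bnd: "\<And>K. compact K \<Longrightarrow> K \<subseteq> Q \<Longrightarrow> \<exists>C d. d > 0 \<and>
      (\<forall>h. \<bar>h\<bar> < d \<longrightarrow> nrm2 (\<lambda>z. indicator K z *\<^sub>R (g (z + h *\<^sub>R e) - g z)) \<le> C * \<bar>h\<bar>)"
  obtains H where "H \<in> borel_measurable borel" "\<And>z. z \<notin> Q \<Longrightarrow> H z = 0"
    "\<And>K. compact K \<Longrightarrow> K \<subseteq> Q \<Longrightarrow> L2 (\<lambda>z. indicator K z *\<^sub>R H z)" "distr_deriv Q e g H"
proof -
  obtain K where K: "\<And>n::nat. compact (K n)" "\<And>n. K n \<subseteq> Q" "\<Union>(range K) = Q"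
    "\<And>A. compact A \<Longrightarrow> A \<subseteq> Q \<Longrightarrow> \<exists>N. \<forall>n\<ge>N. A \<subseteq> K n"
    using open_Union_compact_subsets[OF Q(1)] by metis
  have [measurable]: "K n \<in> sets borel" for n using K(1) by (simp add: compact_imp_closed)
  have [measurable]: "Q \<in> sets borel" using Q(1) by simp
  have [measurable]: "g \<in> borel_measurable borel" using g by auto
  have "\<exists>C d. d > 0 \<and> (\<forall>h. \<bar>h\<bar> < d \<longrightarrow> nrm2 (\<lambda>z. indicator (K m) z *\<^sub>R (g (z + h *\<^sub>R e) - g z)) \<le> C * \<bar>h\<bar>)" for m
    by (rule bnd[OF K(1,2)])
  then obtain C d where Cd: "\<And>m. d m > 0"
    "\<And>m h. \<bar>h\<bar> < d m \<Longrightarrow> nrm2 (\<lambda>z. indicator (K m) z *\<^sub>R (g (z + h *\<^sub>R e) - g z)) \<le> C m * \<bar>h\<bar>"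
    by metis
  \<comment> \<open>The increment \<open>h n\<close> is admissible for the first \<open>n\<close> compact sets.\<close>
  define h where "h n = min (Min (d ` {..n}) / 2) (inverse (real (Suc n)))" for n
  have Min_pos: "Min (d ` {..n}) > 0" for n using Cd(1) by auto
  have hpos: "h n > 0" for n unfolding h_def using Min_pos[of n] by auto
  have hd: "h n < d m" if "m \<le> n" for m n
  proof -
    have "Min (d ` {..n}) \<le> d m" using that by (intro Min_le) auto
    then show ?thesis unfolding h_def using Min_pos[of n] by linarith
  qed
  have h0: "h \<longlonglongrightarrow> 0"
    by (rule Lim_null_comparison[OF _ LIMSEQ_inverse_real_of_nat])
       (use hpos in \<open>auto simp: h_def abs_of_pos intro!: always_eventually less_imp_le\<close>)
  \<comment> \<open>On the points that first appear in \<open>K m\<close> the difference quotients are bounded by \<open>C m\<close>; the weights make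
    these bounds summable.\<close>
  define \<omega> where "\<omega> m = (1/2) ^ Suc m / (1 + \<bar>C m\<bar>)" for m
  have \<omega>pos: "\<omega> m > 0" for m unfolding \<omega>_def by (simp add: add_pos_nonneg)
  have \<omega>1: "\<omega> m \<le> 1" for m
    unfolding \<omega>_def by (auto simp: divide_le_eq add_pos_nonneg intro: order_trans[OF power_le_one])
  have \<omega>C: "\<omega> m * C m \<le> (1/2) ^ Suc m" for m
  proof -
    have "C m / (1 + \<bar>C m\<bar>) \<le> 1"
      using add_pos_nonneg[OF zero_less_one abs_ge_zero[of "C m"]] by (simp only: pos_divide_le_eq) simp
    from mult_left_mono[OF this, of "(1/2) ^ Suc m"] show ?thesis unfolding \<omega>_def by simp
  qed
  define idx where "idx z = (LEAST m. z \<in> K m)" for z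
  have [measurable]: "idx \<in> measurable borel (count_space UNIV)" unfolding idx_def by measurable
  have idx: "z \<in> K (idx z)" "z \<in> K m \<Longrightarrow> idx z \<le> m" if "z \<in> Q" for z m
    using that K(3) unfolding idx_def by (auto intro: LeastI Least_le)
  define y where "y n z = (if z \<in> K n then (\<omega> (idx z) / h n) *\<^sub>R (g (z + h n *\<^sub>R e) - g z) else 0)" for n z
  have [measurable]: "y n \<in> borel_measurable borel" for n unfolding y_def by measurable
  have Ldg: "L2 (\<lambda>z. g (z + h n *\<^sub>R e) - g z)" for n by (rule L2_shift_diff[OF g(1)])
  have yL2: "L2 (y n)" for n
  proof (rule L2_dominated(1)[OF Ldg[of n], of _ "1 / h n"])
    show "AE z in lborel. norm (y n z) \<le> 1 / h n * norm (g (z + h n *\<^sub>R e) - g z)"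
    proof (rule AE_I2)
      fix z
      have "\<omega> (idx z) / h n \<le> 1 / h n" using hpos[of n] \<omega>1 by (intro divide_right_mono) auto
      from mult_right_mono[OF this norm_ge_zero[of "g (z + h n *\<^sub>R e) - g z"]]
      show "norm (y n z) \<le> 1 / h n * norm (g (z + h n *\<^sub>R e) - g z)"
        using hpos[of n] \<omega>pos[of "idx z"] by (simp add: y_def)
    qed
  qed (use hpos[of n] in auto)
  have ybound: "nrm2 (y n) \<le> 1" for n
  proof -
    let ?t = "\<lambda>m z. if z \<in> K n \<and> idx z = m then y n z else 0"
    have tL2: "L2 (?t m)" for m by (rule L2_dominated(1)[OF yL2[of n], of _ 1]) auto
    have "y n z = (\<Sum>m\<le>n. ?t m z)" for z
      using idx(2)[of z n] K(2)[of n] by (cases "z \<in> K n") (auto simp: y_def sum.delta)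
    then have "nrm2 (y n) = nrm2 (\<lambda>z. \<Sum>m\<le>n. ?t m z)" by presburger
    also have "\<dots> \<le> (\<Sum>m\<le>n. nrm2 (?t m))" by (rule nrm2_sum_le[OF tL2])
    also have "\<dots> \<le> (\<Sum>m\<le>n. (1/2) ^ Suc m)"
    proof (rule sum_mono)
      fix m assume m: "m \<in> {..n}"
      have "nrm2 (?t m) \<le> (\<omega> m / h n) * nrm2 (\<lambda>z. indicator (K m) z *\<^sub>R (g (z + h n *\<^sub>R e) - g z))"
      proof (rule L2_dominated(2)[OF L2_indicator_mult(1)[OF Ldg]])
        show "AE z in lborel. norm (?t m z) \<le> \<omega> m / h n * norm (indicator (K m) z *\<^sub>R (g (z + h n *\<^sub>R e) - g z))"
        proof (rule AE_I2)
          fix z show "norm (?t m z) \<le> \<omega> m / h n * norm (indicator (K m) z *\<^sub>R (g (z + h n *\<^sub>R e) - g z))"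
            using idx(1)[of z] K(2)[of n] \<omega>pos[of m] hpos[of n]
            by (cases "z \<in> K n \<and> idx z = m") (auto simp: y_def abs_of_pos)
        qed
      qed (use \<omega>pos[of m] hpos[of n] in auto)
      also have "\<dots> \<le> (\<omega> m / h n) * (C m * h n)"
        using Cd(2)[of "h n" m] hd[of m n] m hpos[of n] \<omega>pos[of m] by (intro mult_left_mono) auto
      also have "\<dots> \<le> (1/2) ^ Suc m" using \<omega>C[of m] hpos[of n] by simp
      finally show "nrm2 (?t m) \<le> (1/2) ^ Suc m" .
    qed
    also have "\<dots> \<le> 1"
    proof -
      have "(\<Sum>m\<le>n. (1/2::real) ^ Suc m) = 1 - (1/2) ^ Suc n" by (induction n) auto
      then show ?thesis by simp
    qed
    finally show ?thesis .
  qed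
  have fQ: "Q \<in> fmeasurable lborel"
    using emeasure_bounded_finite[OF Q(2)] by (simp add: fmeasurable_def)
  have y0: "y n z = 0" if "z \<notin> Q" for n z using that K(2)[of n] by (auto simp: y_def)
  obtain w Y where w: "\<And>n. w n \<in> tail_weights n" and Y: "L2 Y" "\<And>z. z \<notin> Q \<Longrightarrow> Y z = 0"
    and lim: "(\<lambda>n. nrm2 (\<lambda>z. combination (w n) y z - Y z)) \<longlonglongrightarrow> 0"
  proof (rule Mazur_L2[of y 1 Q, OF yL2 ybound fQ y0])
    fix w Y assume "\<And>n. w n \<in> tail_weights n" "L2 Y" "\<And>z. z \<notin> Q \<Longrightarrow> Y z = 0"
      "(\<lambda>n. nrm2 (\<lambda>z. combination (w n) y z - Y z)) \<longlonglongrightarrow> 0"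
    then show thesis by (rule that)
  qed
  define H where "H z = (1 / \<omega> (idx z)) *\<^sub>R Y z" for z
  have [measurable]: "Y \<in> borel_measurable borel" using Y(1) by measurable
  have Hm[measurable]: "H \<in> borel_measurable borel" unfolding H_def by measurable
  \<comment> \<open>On a compact set only finitely many weights occur, so they can be divided out again.\<close>
  have low: "\<exists>\<mu>>0. \<exists>M. \<forall>z\<in>A. \<mu> \<le> \<omega> (idx z) \<and> (\<forall>n\<ge>M. z \<in> K n)" if A: "compact A" "A \<subseteq> Q" for A
  proof -
    obtain M where M: "\<And>n. n \<ge> M \<Longrightarrow> A \<subseteq> K n" using K(4)[OF A] by blast
    have "Min (\<omega> ` {..M}) \<le> \<omega> (idx z)" if "z \<in> A" for z
      using idx(2)[of z M] M[of M] A(2) that by (intro Min_le) auto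
    then show ?thesis using M \<omega>pos by (intro exI[of _ "Min (\<omega> ` {..M})"] conjI exI[of _ M]) auto
  qed
  show ?thesis
  proof (rule that[OF Hm])
    show "H z = 0" if "z \<notin> Q" for z using Y(2)[OF that] by (simp add: H_def)
    show "L2 (\<lambda>z. indicator A z *\<^sub>R H z)" if A: "compact A" "A \<subseteq> Q" for A
    proof -
      obtain \<mu> where \<mu>: "\<mu> > 0" "\<And>z. z \<in> A \<Longrightarrow> \<mu> \<le> \<omega> (idx z)" using low[OF A] by blast
      have [measurable]: "A \<in> sets borel" using A(1) by (simp add: compact_imp_closed)
      show ?thesis
      proof (rule L2_dominated(1)[OF Y(1), of _ "1 / \<mu>"])
        show "AE z in lborel. norm (indicator A z *\<^sub>R H z) \<le> 1 / \<mu> * norm (Y z)"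
          using \<mu> \<omega>pos by (intro AE_I2) (auto simp: H_def indicator_def abs_of_pos frac_le intro!: divide_left_mono mult_pos_pos)
      qed (use \<mu> in auto)
    qed
    show "distr_deriv Q e g H"
      unfolding distr_deriv_def
    proof (intro allI impI)
      fix \<phi> :: "'a \<Rightarrow> real" assume \<phi>: "test_fun Q \<phi>"
      obtain A where A: "compact A" "A \<subseteq> Q" "\<And>x. x \<notin> A \<Longrightarrow> \<phi> x = 0" using test_funE[OF \<phi>] by metis
      obtain \<mu> M where \<mu>: "\<mu> > 0" "\<And>z. z \<in> A \<Longrightarrow> \<mu> \<le> \<omega> (idx z)" "\<And>z n. z \<in> A \<Longrightarrow> n \<ge> M \<Longrightarrow> z \<in> K n"
        using low[OF A(1,2)] by metis
      define \<psi> where "\<psi> z = \<phi> z / \<omega> (idx z)" for z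
      have [measurable]: "\<phi> \<in> borel_measurable borel" by (rule test_fun_measurable[OF \<phi>])
      have \<psi>L2: "L2 \<psi>"
      proof (rule L2_dominated(1)[OF test_fun_L2[OF \<phi>], of _ "1 / \<mu>"])
        show "AE z in lborel. norm (\<psi> z) \<le> 1 / \<mu> * norm (\<phi> z)"
        proof (rule AE_I2)
          fix z show "norm (\<psi> z) \<le> 1 / \<mu> * norm (\<phi> z)"
            using \<mu>(1) \<mu>(2)[of z] A(3)[of z] \<omega>pos[of "idx z"]
            by (cases "z \<in> A") (auto simp: \<psi>_def abs_of_pos frac_le)
        qed
      qed (use \<mu> in \<open>auto simp: \<psi>_def[abs_def]\<close>)
      define q where "q i = (\<integral>z. \<psi> z *\<^sub>R y i z \<partial>lborel)" for i
      have q: "q i = (\<integral>z. ((\<phi> (z - h i *\<^sub>R e) - \<phi> z) / h i) *\<^sub>R g z \<partial>lborel)" if i: "i \<ge> M" for i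
      proof -
        have i1: "integrable lborel (\<lambda>z. \<phi> z *\<^sub>R g (z + h i *\<^sub>R e))" "integrable lborel (\<lambda>z. \<phi> z *\<^sub>R g z)"
          by (intro test_fun_mult_L2_integrable[OF \<phi>] L2_shift g)+
        have i2: "integrable lborel (\<lambda>z. \<phi> (z - h i *\<^sub>R e) *\<^sub>R g z)"
          using i1(1) integral_shift(2)[of "\<lambda>z. \<phi> (z - h i *\<^sub>R e) *\<^sub>R g z" "h i *\<^sub>R e"] by simp
        have "q i = (\<integral>z. (1 / h i) *\<^sub>R (\<phi> z *\<^sub>R g (z + h i *\<^sub>R e) - \<phi> z *\<^sub>R g z) \<partial>lborel)"
          unfolding q_def
        proof (rule Bochner_Integration.integral_cong[OF refl])
          fix z show "\<psi> z *\<^sub>R y i z = (1 / h i) *\<^sub>R (\<phi> z *\<^sub>R g (z + h i *\<^sub>R e) - \<phi> z *\<^sub>R g z)"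
            using \<mu>(3)[of z, OF _ i] A(3)[of z] \<omega>pos[of "idx z"]
            by (cases "z \<in> A") (auto simp: \<psi>_def y_def scaleR_diff_right)
        qed
        also have "\<dots> = (1 / h i) *\<^sub>R ((\<integral>z. \<phi> z *\<^sub>R g (z + h i *\<^sub>R e) \<partial>lborel) - (\<integral>z. \<phi> z *\<^sub>R g z \<partial>lborel))"
          using i1 by simp
        also have "(\<integral>z. \<phi> z *\<^sub>R g (z + h i *\<^sub>R e) \<partial>lborel) = (\<integral>z. \<phi> (z - h i *\<^sub>R e) *\<^sub>R g z \<partial>lborel)"
          using integral_shift(1)[of "\<lambda>z. \<phi> (z - h i *\<^sub>R e) *\<^sub>R g z" "h i *\<^sub>R e"] by simp
        also have "(1 / h i) *\<^sub>R ((\<integral>z. \<phi> (z - h i *\<^sub>R e) *\<^sub>R g z \<partial>lborel) - (\<integral>z. \<phi> z *\<^sub>R g z \<partial>lborel))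
          = (\<integral>z. (1 / h i) *\<^sub>R (\<phi> (z - h i *\<^sub>R e) *\<^sub>R g z - \<phi> z *\<^sub>R g z) \<partial>lborel)"
          using i1 i2 by simp
        also have "\<dots> = (\<integral>z. ((\<phi> (z - h i *\<^sub>R e) - \<phi> z) / h i) *\<^sub>R g z \<partial>lborel)"
          by (intro Bochner_Integration.integral_cong) (auto simp: scaleR_diff_left[symmetric])
        finally show ?thesis .
      qed
      have "(\<lambda>n. \<integral>z. ((\<phi> (z - h n *\<^sub>R e) - \<phi> z) / h n) *\<^sub>R g z \<partial>lborel) \<longlonglongrightarrow> - (\<integral>z. partial e \<phi> z *\<^sub>R g z \<partial>lborel)"
        using hpos less_imp_neq by (intro test_fun_difference_quotient_tendsto[OF \<phi> e g(2) h0]) fastforce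
      then have qlim: "q \<longlonglongrightarrow> - (\<integral>z. partial e \<phi> z *\<^sub>R g z \<partial>lborel)"
        by (rule Lim_transform_eventually) (use q in \<open>auto intro!: eventually_sequentiallyI[of M]\<close>)
      have comb: "(\<integral>z. \<psi> z *\<^sub>R combination (w n) y z \<partial>lborel) = (\<Sum>i | w n i \<noteq> 0. w n i *\<^sub>R q i)" for n
      proof -
        have "(\<integral>z. \<psi> z *\<^sub>R combination (w n) y z \<partial>lborel) = (\<integral>z. (\<Sum>i | w n i \<noteq> 0. w n i *\<^sub>R (\<psi> z *\<^sub>R y i z)) \<partial>lborel)"
          by (intro Bochner_Integration.integral_cong) (auto simp: combination_def scaleR_sum_right mult.commute)
        also have "\<dots> = (\<Sum>i | w n i \<noteq> 0. \<integral>z. w n i *\<^sub>R (\<psi> z *\<^sub>R y i z) \<partial>lborel)"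
          by (intro Bochner_Integration.integral_sum integrable_scaleR_right L2_scaleR_integrable \<psi>L2 yL2)
        also have "\<dots> = (\<Sum>i | w n i \<noteq> 0. w n i *\<^sub>R q i)"
          unfolding q_def by (intro sum.cong refl integral_scaleR_right)
        finally show ?thesis .
      qed
      have "(\<lambda>n. \<integral>z. \<psi> z *\<^sub>R combination (w n) y z \<partial>lborel) \<longlonglongrightarrow> - (\<integral>z. partial e \<phi> z *\<^sub>R g z \<partial>lborel)"
        unfolding comb by (rule tail_combination_tendsto[OF w qlim])
      moreover have "(\<lambda>n. \<integral>z. \<psi> z *\<^sub>R combination (w n) y z \<partial>lborel) \<longlonglongrightarrow> (\<integral>z. \<psi> z *\<^sub>R Y z \<partial>lborel)"
      proof (rule LIM_zero_cancel, rule Lim_null_comparison)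
        have Lc: "L2 (combination (w n) y)" for n by (rule L2_combination[OF yL2])
        show "\<forall>\<^sub>F n in sequentially. norm ((\<integral>z. \<psi> z *\<^sub>R combination (w n) y z \<partial>lborel) - (\<integral>z. \<psi> z *\<^sub>R Y z \<partial>lborel))
          \<le> nrm2 \<psi> * nrm2 (\<lambda>z. combination (w n) y z - Y z)"
        proof (intro always_eventually allI)
          fix n
          have Ld: "L2 (\<lambda>z. combination (w n) y z - Y z)" by (intro L2_diff Lc Y)
          have "(\<integral>z. \<psi> z *\<^sub>R combination (w n) y z \<partial>lborel) - (\<integral>z. \<psi> z *\<^sub>R Y z \<partial>lborel)
            = (\<integral>z. \<psi> z *\<^sub>R (combination (w n) y z - Y z) \<partial>lborel)"
            unfolding scaleR_diff_right
            by (intro Bochner_Integration.integral_diff[symmetric] L2_scaleR_integrable \<psi>L2 Lc Y)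
          also have "norm \<dots> \<le> (\<integral>z. norm (\<psi> z) * norm (combination (w n) y z - Y z) \<partial>lborel)"
            unfolding norm_scaleR[symmetric] real_norm_def
            by (rule order_trans[OF integral_norm_bound]) simp
          also have "\<dots> \<le> nrm2 \<psi> * nrm2 (\<lambda>z. combination (w n) y z - Y z)"
            by (rule Cauchy_Schwarz_nrm2(2)[OF \<psi>L2 Ld])
          finally show "norm ((\<integral>z. \<psi> z *\<^sub>R combination (w n) y z \<partial>lborel) - (\<integral>z. \<psi> z *\<^sub>R Y z \<partial>lborel))
            \<le> nrm2 \<psi> * nrm2 (\<lambda>z. combination (w n) y z - Y z)" .
        qed
        show "(\<lambda>n. nrm2 \<psi> * nrm2 (\<lambda>z. combination (w n) y z - Y z)) \<longlonglongrightarrow> 0"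
          by (rule tendsto_mult_right_zero[OF lim])
      qed
      ultimately have "(\<integral>z. \<psi> z *\<^sub>R Y z \<partial>lborel) = - (\<integral>z. partial e \<phi> z *\<^sub>R g z \<partial>lborel)"
        using LIMSEQ_unique by blast
      moreover have "(\<integral>z. \<psi> z *\<^sub>R Y z \<partial>lborel) = (\<integral>z. \<phi> z *\<^sub>R H z \<partial>lborel)"
        by (intro Bochner_Integration.integral_cong) (auto simp: \<psi>_def H_def)
      ultimately show "(\<integral>z. partial e \<phi> z *\<^sub>R g z \<partial>lborel) = - (\<integral>z. \<phi> z *\<^sub>R H z \<partial>lborel)" by simp
    qed
  qed
qed

section \<open>Gradients of uniformly convex functions\<close>

text \<open>The quadratic form of the Hessian.\<close>

definition hess_form :: "('e::euclidean_space \<Rightarrow> real) \<Rightarrow> 'e \<Rightarrow> 'e \<Rightarrow> real" where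
  "hess_form F x z = (\<Sum>a\<in>Basis. \<Sum>b\<in>Basis. partial a (partial b F) x * (z \<bullet> b) * (z \<bullet> a))"

lemma gradient_inner: "gradient F x \<bullet> v = (\<Sum>b\<in>Basis. (v \<bullet> b) * partial b F x)"
  unfolding gradient_def inner_sum_left by (simp add: inner_commute mult.commute)

lemma Ck_on_2D:
  assumes "Ck_on 2 UNIV F"
  shows "F differentiable (at x)" "b \<in> Basis \<Longrightarrow> partial b F differentiable (at x)"
    "a \<in> Basis \<Longrightarrow> b \<in> Basis \<Longrightarrow> continuous_on UNIV (partial a (partial b F))"
  using assms by (auto simp: numeral_2_eq_2)

lemma gradient_has_derivative:
  assumes "F differentiable (at x)"
  shows "(F has_derivative (\<lambda>h. gradient F x \<bullet> h)) (at x)"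
  using frechet_eq_sum_partial[OF assms] by (simp add: gradient_inner)

lemma gradient_line_derivative:
  assumes "Ck_on 2 UNIV F"
  shows "((\<lambda>s. gradient F (x + s *\<^sub>R d) \<bullet> d) has_real_derivative hess_form F (x + s *\<^sub>R d) d) (at s)"
proof -
  let ?y = "x + s *\<^sub>R d"
  have D: "((\<lambda>s. partial b F (x + s *\<^sub>R d)) has_derivative (\<lambda>r. \<Sum>a\<in>Basis. (r *\<^sub>R d \<bullet> a) *\<^sub>R partial a (partial b F) ?y)) (at s)"
    if "b \<in> Basis" for b
  proof -
    have "(partial b F has_derivative (\<lambda>h. \<Sum>a\<in>Basis. (h \<bullet> a) *\<^sub>R partial a (partial b F) ?y)) (at ?y)"
      by (rule frechet_eq_sum_partial[OF Ck_on_2D(2)[OF assms that]])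
    then show ?thesis
      by (rule has_derivative_compose[rotated]) (auto intro!: derivative_eq_intros)
  qed
  have "((\<lambda>s. \<Sum>b\<in>Basis. (d \<bullet> b) * partial b F (x + s *\<^sub>R d)) has_derivative
    (\<lambda>r. \<Sum>b\<in>Basis. (d \<bullet> b) * (\<Sum>a\<in>Basis. (r *\<^sub>R d \<bullet> a) *\<^sub>R partial a (partial b F) ?y))) (at s)"
    by (intro has_derivative_sum has_derivative_mult_right D)
  moreover have "(\<Sum>b\<in>Basis. (d \<bullet> b) * (\<Sum>a\<in>Basis. (r *\<^sub>R d \<bullet> a) *\<^sub>R partial a (partial b F) ?y)) = hess_form F ?y d * r" for r
    unfolding hess_form_def sum_distrib_left sum_distrib_right
    by (subst sum.swap) (simp add: mult_ac)
  ultimately show ?thesis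
    unfolding gradient_inner has_field_derivative_def by simp
qed

text \<open>Only the quadratic form of the Hessian is controlled, so the mean value theorem is applied to the
  gradient along the segment, in the direction of the segment.\<close>

lemma gradient_increment:
  assumes F: "Ck_on 2 UNIV F"
  obtains y where "(gradient F x - gradient F x') \<bullet> (x - x') = hess_form F y (x - x')"
proof -
  let ?d = "x - x'"
  have "\<exists>s. 0 < s \<and> s < 1 \<and> gradient F (x' + 1 *\<^sub>R ?d) \<bullet> ?d - gradient F (x' + 0 *\<^sub>R ?d) \<bullet> ?d
    = (1 - 0) * hess_form F (x' + s *\<^sub>R ?d) ?d"
    by (rule MVT2) (auto intro: gradient_line_derivative[OF F])
  then show ?thesis using that by (auto simp: inner_diff_left)
qed

text \<open>Cocoercivity: if the gradient field \<open>G\<close> of \<open>F\<close> satisfies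
  \<open>0 \<le> (G x - G y) \<bullet> (x - y) \<le> \<Theta> |x - y|\<^sup>2\<close>, then it is Lipschitz. The bound comes from
  comparing the minimum of \<open>z \<mapsto> F z - G x \<bullet> z\<close> with its value after a gradient step from \<open>y\<close>. In this
  way bounds on the quadratic form of the Hessian suffice for a Lipschitz bound on the gradient.\<close>

lemma cocoercive_gradient_Lipschitz:
  fixes F :: "'e::euclidean_space \<Rightarrow> real" and G :: "'e \<Rightarrow> 'e"
  assumes D: "\<And>x. (F has_derivative (\<lambda>h. G x \<bullet> h)) (at x)"
    and lo: "\<And>x y. 0 \<le> (G x - G y) \<bullet> (x - y)" and up: "\<And>x y. (G x - G y) \<bullet> (x - y) \<le> \<Theta> * (norm (x - y))\<^sup>2"
    and \<Theta>: "\<Theta> > 0"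
  shows "norm (G x - G y) \<le> \<Theta> * norm (x - y)"
proof -
  have line: "((\<lambda>s. F (x + s *\<^sub>R d) - s * (G x \<bullet> d) - c * s\<^sup>2) has_real_derivative
      (G (x + s *\<^sub>R d) - G x) \<bullet> d - c * (2 * s)) (at s)" for x d c s
  proof -
    have "((\<lambda>s. F (x + s *\<^sub>R d)) has_derivative (\<lambda>r. G (x + s *\<^sub>R d) \<bullet> (r *\<^sub>R d))) (at s)"
      using D by (rule has_derivative_compose[rotated]) (auto intro!: derivative_eq_intros)
    then have "((\<lambda>s. F (x + s *\<^sub>R d)) has_real_derivative G (x + s *\<^sub>R d) \<bullet> d) (at s)"
      unfolding has_field_derivative_def by (rule has_derivative_eq_rhs) (auto simp: mult.commute)
    then show ?thesis by (auto intro!: derivative_eq_intros simp: inner_diff_left)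
  qed
  have scaled: "s * ((G (x + s *\<^sub>R d) - G x) \<bullet> d) = (G (x + s *\<^sub>R d) - G x) \<bullet> ((x + s *\<^sub>R d) - x)" for s x d
    by simp
  have upper: "F (x + d) \<le> F x + G x \<bullet> d + \<Theta> / 2 * (norm d)\<^sup>2" for x d
  proof -
    obtain s where s: "0 < s" "s < 1" "F (x + 1 *\<^sub>R d) - 1 * (G x \<bullet> d) - \<Theta> / 2 * (norm d)\<^sup>2 * 1\<^sup>2
        - (F (x + 0 *\<^sub>R d) - 0 * (G x \<bullet> d) - \<Theta> / 2 * (norm d)\<^sup>2 * 0\<^sup>2)
        = (1 - 0) * ((G (x + s *\<^sub>R d) - G x) \<bullet> d - \<Theta> / 2 * (norm d)\<^sup>2 * (2 * s))"
      using MVT2[OF zero_less_one line[of x d "\<Theta> / 2 * (norm d)\<^sup>2"]] by blast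
    have "s * ((G (x + s *\<^sub>R d) - G x) \<bullet> d) \<le> s * (\<Theta> * s * (norm d)\<^sup>2)"
      unfolding scaled using up[of "x + s *\<^sub>R d" x] by (simp add: power_mult_distrib power2_eq_square mult_ac)
    then have "(G (x + s *\<^sub>R d) - G x) \<bullet> d \<le> \<Theta> * s * (norm d)\<^sup>2" using s(1) by (simp only: mult_le_cancel_left_pos)
    with s(3) show ?thesis by (simp add: algebra_simps)
  qed
  have lower: "F x + G x \<bullet> d \<le> F (x + d)" for x d
  proof -
    obtain s where s: "0 < s" "s < 1" "F (x + 1 *\<^sub>R d) - 1 * (G x \<bullet> d) - 0 * 1\<^sup>2
        - (F (x + 0 *\<^sub>R d) - 0 * (G x \<bullet> d) - 0 * 0\<^sup>2)
        = (1 - 0) * ((G (x + s *\<^sub>R d) - G x) \<bullet> d - 0 * (2 * s))"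
      using MVT2[OF zero_less_one line[of x d 0]] by blast
    have "0 \<le> s * ((G (x + s *\<^sub>R d) - G x) \<bullet> d)"
      unfolding scaled by (rule lo)
    then have "0 \<le> (G (x + s *\<^sub>R d) - G x) \<bullet> d" using s(1) by (simp add: zero_le_mult_iff)
    with s(3) show ?thesis by simp
  qed
  define a where "a = G y - G x"
  have na: "a \<bullet> a = (norm a)\<^sup>2" by (simp add: power2_norm_eq_inner)
  have "F x + G x \<bullet> (y - (1 / \<Theta>) *\<^sub>R a - x) \<le> F (x + (y - (1 / \<Theta>) *\<^sub>R a - x))" by (rule lower)
  also have "\<dots> = F (y + - ((1 / \<Theta>) *\<^sub>R a))" by (simp add: algebra_simps)
  also have "\<dots> \<le> F y + G y \<bullet> (- ((1 / \<Theta>) *\<^sub>R a)) + \<Theta> / 2 * (norm (- ((1 / \<Theta>) *\<^sub>R a)))\<^sup>2" by (rule upper)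
  finally have "F x + G x \<bullet> (y - x) - (1 / \<Theta>) * (G x \<bullet> a) \<le> F y - (1 / \<Theta>) * (G y \<bullet> a) + \<Theta> / 2 * (norm ((1 / \<Theta>) *\<^sub>R a))\<^sup>2"
    by (simp add: inner_diff_right)
  moreover have "\<Theta> / 2 * (norm ((1 / \<Theta>) *\<^sub>R a))\<^sup>2 = (norm a)\<^sup>2 / (2 * \<Theta>)"
    using \<Theta> by (simp add: power_mult_distrib power2_eq_square)
  moreover have "G y \<bullet> a - G x \<bullet> a = (norm a)\<^sup>2"
    unfolding na[symmetric] inner_diff_left[symmetric] a_def[symmetric] ..
  then have "(1 / \<Theta>) * (G y \<bullet> a) - (1 / \<Theta>) * (G x \<bullet> a) = (norm a)\<^sup>2 / \<Theta>"
    by (simp add: right_diff_distrib[symmetric] diff_divide_distrib[symmetric])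
  ultimately have "(norm a)\<^sup>2 / \<Theta> - (norm a)\<^sup>2 / (2 * \<Theta>) \<le> F y - F x - G x \<bullet> (y - x)" by linarith
  also have "\<dots> \<le> \<Theta> / 2 * (norm (y - x))\<^sup>2" using upper[of x "y - x"] by simp
  finally have "(norm a)\<^sup>2 / (2 * \<Theta>) \<le> \<Theta> / 2 * (norm (y - x))\<^sup>2" by (simp add: field_simps)
  then have "(norm a)\<^sup>2 \<le> (\<Theta> * norm (y - x))\<^sup>2"
    using \<Theta> by (simp add: field_simps power_mult_distrib power2_eq_square)
  then have "norm a \<le> \<Theta> * norm (y - x)" using \<Theta> by (auto intro: power2_le_imp_le)
  then show ?thesis by (simp add: a_def norm_minus_commute)
qed

definition elliptic_map :: "real \<Rightarrow> real \<Rightarrow> ('e::euclidean_space \<Rightarrow> 'e) \<Rightarrow> bool" where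
  "elliptic_map \<theta> \<Theta> S \<longleftrightarrow> (\<forall>x y. \<theta> * (norm (x - y))\<^sup>2 \<le> (S x - S y) \<bullet> (x - y)) \<and>
     (\<forall>x y. norm (S x - S y) \<le> \<Theta> * norm (x - y))"

text \<open>Differentiability at \<open>x\<close> with a linear approximation that is uniform for pairs of points near \<open>x\<close>. It is
  what continuity of the derivative is used for: increments at moving base points can be compared.\<close>

definition strictly_differentiable :: "('e::euclidean_space \<Rightarrow> 'e) \<Rightarrow> bool" where
  "strictly_differentiable S \<longleftrightarrow> (\<forall>x. \<exists>L. \<forall>\<epsilon>>0. \<exists>\<delta>>0. \<forall>y z. norm (y - x) < \<delta> \<longrightarrow> norm (z - x) < \<delta> \<longrightarrow>
     norm (S y - S z - L (y - z)) \<le> \<epsilon> * norm (y - z))"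

lemma elliptic_gradient:
  fixes F :: "'e::euclidean_space \<Rightarrow> real"
  assumes F: "Ck_on 2 UNIV F" and "\<theta> \<ge> 0" "\<Theta> > 0"
    and lo: "\<And>x z. \<theta> * (norm z)\<^sup>2 \<le> hess_form F x z" and up: "\<And>x z. hess_form F x z \<le> \<Theta> * (norm z)\<^sup>2"
  shows "elliptic_map \<theta> \<Theta> (gradient F)"
proof -
  have m: "\<theta> * (norm (x - y))\<^sup>2 \<le> (gradient F x - gradient F y) \<bullet> (x - y)"
    "(gradient F x - gradient F y) \<bullet> (x - y) \<le> \<Theta> * (norm (x - y))\<^sup>2" for x y
    using gradient_increment[OF F, of x y] lo up by metis+
  moreover have "norm (gradient F x - gradient F y) \<le> \<Theta> * norm (x - y)" for x y
  proof (rule cocoercive_gradient_Lipschitz[OF gradient_has_derivative[OF Ck_on_2D(1)[OF F]] _ m(2) \<open>\<Theta> > 0\<close>])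
    show "0 \<le> (gradient F x - gradient F y) \<bullet> (x - y)" for x y
      using m(1)[of x y] \<open>\<theta> \<ge> 0\<close> by (meson mult_nonneg_nonneg order_trans zero_le_power2)
  qed
  ultimately show ?thesis by (simp add: elliptic_map_def)
qed

text \<open>The difference between the gradient and its linearisation at \<open>x\<close> has a small derivative near \<open>x\<close>, because
  the second derivatives are continuous.\<close>

lemma gradient_strictly_differentiable:
  fixes F :: "'e::euclidean_space \<Rightarrow> real"
  assumes F: "Ck_on 2 UNIV F"
  shows "strictly_differentiable (gradient F)"
  unfolding strictly_differentiable_def
proof
  fix x
  define L where "L y d = (\<Sum>b\<in>Basis. (\<Sum>a\<in>Basis. (d \<bullet> a) *\<^sub>R partial a (partial b F) y) *\<^sub>R b)" for y d :: 'e
  have DG: "(gradient F has_derivative L y) (at y)" for y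
    unfolding gradient_def L_def[abs_def]
    by (intro has_derivative_sum has_derivative_scaleR_left frechet_eq_sum_partial Ck_on_2D(2)[OF F])
  have bl: "bounded_linear (L y)" for y using DG has_derivative_bounded_linear by blast
  let ?n = "real (DIM('e))"
  show "\<exists>L. \<forall>\<epsilon>>0. \<exists>\<delta>>0. \<forall>y z. norm (y - x) < \<delta> \<longrightarrow> norm (z - x) < \<delta> \<longrightarrow>
     norm (gradient F y - gradient F z - L (y - z)) \<le> \<epsilon> * norm (y - z)"
  proof (intro exI[of _ "L x"] allI impI)
    fix \<epsilon> :: real assume "\<epsilon> > 0"
    then have "\<epsilon> / (?n * ?n) > 0" by simp
    then have "\<exists>d>0. \<forall>y. norm (y - x) < d \<longrightarrow> \<bar>partial a (partial b F) y - partial a (partial b F) x\<bar> < \<epsilon> / (?n * ?n)"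
      if "a \<in> Basis" "b \<in> Basis" for a b
      using Ck_on_2D(3)[OF F that] unfolding continuous_on_iff dist_norm by (metis UNIV_I real_norm_def)
    then obtain d where d: "\<And>a b. a \<in> Basis \<Longrightarrow> b \<in> Basis \<Longrightarrow> d a b > 0"
      "\<And>a b y. a \<in> Basis \<Longrightarrow> b \<in> Basis \<Longrightarrow> norm (y - x) < d a b \<Longrightarrow>
        \<bar>partial a (partial b F) y - partial a (partial b F) x\<bar> < \<epsilon> / (?n * ?n)" by metis
    define \<delta> where "\<delta> = Min ((\<lambda>(a, b). d a b) ` (Basis \<times> Basis))"
    have \<delta>: "\<delta> > 0" unfolding \<delta>_def using d(1) by (subst Min_gr_iff) auto
    have \<delta>d: "\<delta> \<le> d a b" if "a \<in> Basis" "b \<in> Basis" for a b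
      unfolding \<delta>_def using that by (intro Min_le) auto
    show "\<exists>\<delta>>0. \<forall>y z. norm (y - x) < \<delta> \<longrightarrow> norm (z - x) < \<delta> \<longrightarrow>
       norm (gradient F y - gradient F z - L x (y - z)) \<le> \<epsilon> * norm (y - z)"
    proof (intro exI[of _ \<delta>] conjI \<delta> allI impI)
      fix y z assume yz: "norm (y - x) < \<delta>" "norm (z - x) < \<delta>"
      have "norm ((gradient F y - L x y) - (gradient F z - L x z)) \<le> \<epsilon> * norm (y - z)"
      proof (rule differentiable_bound[OF convex_ball, of x \<delta> "\<lambda>y. gradient F y - L x y" "\<lambda>y d. L y d - L x d"])
        fix v assume v: "v \<in> ball x \<delta>"
        show "((\<lambda>y. gradient F y - L x y) has_derivative (\<lambda>d. L v d - L x d)) (at v within ball x \<delta>)"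
          by (rule has_derivative_at_withinI[OF has_derivative_diff[OF DG bounded_linear_imp_has_derivative[OF bl]]])
        show "onorm (\<lambda>d. L v d - L x d) \<le> \<epsilon>"
        proof (rule onorm_bound)
          fix w :: 'e
          have "L v w - L x w = (\<Sum>b\<in>Basis. (\<Sum>a\<in>Basis. (w \<bullet> a) * (partial a (partial b F) v - partial a (partial b F) x)) *\<^sub>R b)"
            unfolding L_def by (simp add: sum_subtractf[symmetric] scaleR_diff_left[symmetric] right_diff_distrib)
          also have "norm \<dots> \<le> (\<Sum>b\<in>(Basis::'e set). \<Sum>a\<in>(Basis::'e set). norm w * (\<epsilon> / (?n * ?n)))"
          proof (rule sum_norm_le)
            fix b :: 'e assume b: "b \<in> Basis"
            have "norm ((\<Sum>a\<in>Basis. (w \<bullet> a) * (partial a (partial b F) v - partial a (partial b F) x)) *\<^sub>R b)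
              = \<bar>\<Sum>a\<in>Basis. (w \<bullet> a) * (partial a (partial b F) v - partial a (partial b F) x)\<bar>"
              using b by simp
            also have "\<dots> \<le> (\<Sum>a\<in>(Basis::'e set). norm w * (\<epsilon> / (?n * ?n)))"
            proof (rule order_trans[OF sum_abs sum_mono])
              fix a :: 'e assume a: "a \<in> Basis"
              have "norm (v - x) < d a b" using v \<delta>d[OF a b] by (simp add: dist_norm norm_minus_commute)
              then have "\<bar>partial a (partial b F) v - partial a (partial b F) x\<bar> \<le> \<epsilon> / (?n * ?n)"
                using d(2)[OF a b] less_imp_le by blast
              moreover have "\<bar>w \<bullet> a\<bar> \<le> norm w" by (rule Basis_le_norm[OF a])
              ultimately show "\<bar>(w \<bullet> a) * (partial a (partial b F) v - partial a (partial b F) x)\<bar> \<le> norm w * (\<epsilon> / (?n * ?n))"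
                unfolding abs_mult by (intro mult_mono) auto
            qed
            finally show "norm ((\<Sum>a\<in>Basis. (w \<bullet> a) * (partial a (partial b F) v - partial a (partial b F) x)) *\<^sub>R b)
              \<le> (\<Sum>a\<in>(Basis::'e set). norm w * (\<epsilon> / (?n * ?n)))" .
          qed
          also have "\<dots> = \<epsilon> * norm w" by simp
          finally show "norm (L v w - L x w) \<le> \<epsilon> * norm w" .
        qed (use \<open>\<epsilon> > 0\<close> in auto)
      qed (use yz in \<open>auto simp: dist_norm norm_minus_commute\<close>)
      moreover have "L x (y - z) = L x y - L x z" using bl linear_diff bounded_linear.linear by blast
      then have "gradient F y - gradient F z - L x (y - z) = (gradient F y - L x y) - (gradient F z - L x z)"
        by simp
      ultimately show "norm (gradient F y - gradient F z - L x (y - z)) \<le> \<epsilon> * norm (y - z)"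
        by (simp only:)
    qed
  qed
qed

lemma sum_Basis_vec:
  fixes f :: "real^'m \<Rightarrow> 'b::comm_monoid_add"
  shows "(\<Sum>b\<in>Basis. f b) = (\<Sum>i\<in>UNIV. f (axis i 1))"
proof -
  have B: "(Basis :: (real^'m) set) = range (\<lambda>i. axis i 1)" by (auto simp: Basis_vec_def)
  show ?thesis
    by (subst B, subst sum.reindex) (auto simp: inj_on_def axis_eq_axis)
qed

lemma sum_Basis_matrix:
  fixes f :: "real^'n^'m \<Rightarrow> 'b::comm_monoid_add"
  shows "(\<Sum>b\<in>Basis. f b) = (\<Sum>i\<in>UNIV. \<Sum>j\<in>UNIV. f (axis i (axis j 1)))"
proof -
  have B: "(Basis :: (real^'n^'m) set) = (\<lambda>(i, j). axis i (axis j 1)) ` (UNIV \<times> UNIV)"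
    by (auto simp: Basis_vec_def)
  have inj: "inj_on (\<lambda>(i, j). axis i (axis j 1) :: real^'n^'m) (UNIV \<times> UNIV)"
    by (auto simp: inj_on_def axis_eq_axis)
  show ?thesis
    unfolding sum.cartesian_product by (subst B, subst sum.reindex[OF inj]) (auto intro!: sum.cong)
qed

lemma hess_form_vec:
  fixes F :: "real^'m \<Rightarrow> real"
  shows "hess_form F w z = (\<Sum>i\<in>UNIV. \<Sum>j\<in>UNIV. partial (axis j 1) (partial (axis i 1) F) w * z $ i * z $ j)"
  unfolding hess_form_def sum_Basis_vec by (subst sum.swap) (simp add: inner_axis)

lemma hess_form_matrix:
  fixes F :: "real^'n^'m \<Rightarrow> real"
  shows "hess_form F M \<xi> = (\<Sum>i\<in>UNIV. \<Sum>k\<in>UNIV. \<Sum>j\<in>UNIV. \<Sum>l\<in>UNIV.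
    partial (axis k (axis l 1)) (partial (axis i (axis j 1)) F) M * \<xi> $ i $ j * \<xi> $ k $ l)"
proof -
  let ?p = "\<lambda>i j k l. partial (axis k (axis l 1)) (partial (axis i (axis j 1)) F) M * \<xi> $ i $ j * \<xi> $ k $ l"
  have "hess_form F M \<xi> = (\<Sum>i\<in>UNIV. \<Sum>j\<in>UNIV. \<Sum>k\<in>UNIV. \<Sum>l\<in>UNIV. ?p i j k l)"
    unfolding hess_form_def by (subst sum.swap) (simp add: sum_Basis_matrix inner_axis)
  also have "\<dots> = (\<Sum>i\<in>UNIV. \<Sum>k\<in>UNIV. \<Sum>j\<in>UNIV. \<Sum>l\<in>UNIV. ?p i j k l)"
    by (intro sum.cong refl sum.swap)
  finally show ?thesis .
qed

section \<open>Interior regularity and stability for the elliptic system\<close>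

text \<open>A square integrable solution of \<open>div S(Du) = f\<close> on \<open>Q\<close>, where the derivative only involves the
  coordinate directions \<open>e j\<close>. The functions vanish off \<open>Q\<close>; \<open>g\<close> is the Jacobian of \<open>u\<close>.\<close>

definition weak_system :: "'a::euclidean_space set \<Rightarrow> ('n::finite \<Rightarrow> 'a) \<Rightarrow> (real^'n^'m \<Rightarrow> real^'n^'m) \<Rightarrow>
    ('a \<Rightarrow> real^'m) \<Rightarrow> ('a \<Rightarrow> real^'n^'m) \<Rightarrow> ('a \<Rightarrow> real^'m) \<Rightarrow> bool" where
  "weak_system Q e S u g f \<longleftrightarrow> L2 u \<and> L2 g \<and> L2 f \<and> (\<forall>z. z \<notin> Q \<longrightarrow> u z = 0 \<and> g z = 0) \<and>
     (\<forall>j. distr_deriv Q (e j) u (\<lambda>z. column j (g z))) \<and>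
     (\<forall>w. test_fun Q w \<longrightarrow> (\<integral>z. f z \<bullet> w z \<partial>lborel) +
        (\<integral>z. (if z \<in> Q then S (g z) else 0) \<bullet> jacobian e w z \<partial>lborel) = 0)"

lemma bounded_open_fmeasurable:
  "open Q \<Longrightarrow> bounded Q \<Longrightarrow> Q \<in> fmeasurable (lborel :: 'a::euclidean_space measure)"
  using emeasure_bounded_finite[of Q] by (simp add: fmeasurable_def)

lemma elliptic_map_continuous: "elliptic_map \<theta> \<Theta> S \<Longrightarrow> continuous_on UNIV S"
proof -
  assume S: "elliptic_map \<theta> \<Theta> S"
  have "lipschitz_on (max \<Theta> 0) UNIV S"
  proof (rule lipschitz_onI)
    fix x y
    have "norm (S x - S y) \<le> \<Theta> * norm (x - y)" using S by (simp add: elliptic_map_def)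
    also have "\<dots> \<le> max \<Theta> 0 * norm (x - y)" by (intro mult_right_mono) auto
    finally show "dist (S x) (S y) \<le> max \<Theta> 0 * dist x y" by (simp add: dist_norm)
  qed simp
  then show ?thesis by (rule lipschitz_on_continuous_on)
qed

lemma flux_L2:
  assumes S: "elliptic_map \<theta> \<Theta> S" and "\<Theta> \<ge> 0" and Q: "open Q" "bounded Q" and g: "L2 g"
  shows "L2 (\<lambda>z. if z \<in> Q then S (g z) else 0)"
proof -
  have [measurable]: "S \<in> borel_measurable borel"
    by (rule borel_measurable_continuous_onI[OF elliptic_map_continuous[OF S]])
  have [measurable]: "g \<in> borel_measurable borel" "Q \<in> sets borel" using g Q by (auto intro: L2_measurable)
  have "L2 (\<lambda>z. S (g z) - S 0)"
  proof (rule L2_dominated(1)[OF g, of _ \<Theta>])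
    have "norm (S (g z) - S 0) \<le> \<Theta> * norm (g z - 0)" for z
      using S unfolding elliptic_map_def by blast
    then show "AE z in lborel. norm (S (g z) - S 0) \<le> \<Theta> * norm (g z)" by simp
  qed (use assms(2) in auto)
  then have 1: "L2 (\<lambda>z. indicator Q z *\<^sub>R (S (g z) - S 0))" by (rule L2_indicator_mult) simp
  have "(\<lambda>x. (norm (indicator Q x *\<^sub>R S 0))\<^sup>2) = (\<lambda>x. indicator Q x * (norm (S 0))\<^sup>2)"
    by (auto simp: indicator_def)
  moreover have "integrable lborel (indicator Q :: _ \<Rightarrow> real)"
    using emeasure_bounded_finite[OF Q(2)] by (intro integrable_real_indicator) auto
  ultimately have 2: "L2 (\<lambda>z. indicator Q z *\<^sub>R S 0)" by (simp add: L2_def)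
  have "(\<lambda>z. if z \<in> Q then S (g z) else 0) = (\<lambda>z. indicator Q z *\<^sub>R (S (g z) - S 0) + indicator Q z *\<^sub>R S 0)"
    by (auto simp: indicator_def)
  with L2_add[OF 1 2] show ?thesis by simp
qed

lemma cutoff_data:
  fixes e :: "'n::finite \<Rightarrow> 'a::euclidean_space"
  assumes "compact A" "open Q" "A \<subseteq> Q" and e: "\<And>j. e j \<in> Basis"
  obtains \<eta> :: "'a \<Rightarrow> real" and K and \<rho> N B :: real where "smooth_on UNIV \<eta>" "\<And>x. \<bar>\<eta> x\<bar> \<le> N" "\<And>x. norm (\<chi> j. partial (e j) \<eta> x) \<le> B"
    "compact K" "\<And>x. x \<notin> K \<Longrightarrow> \<eta> x = 0" "\<And>x. x \<in> K \<Longrightarrow> cball x \<rho> \<subseteq> Q" "\<rho> > 0"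
    "\<And>x. x \<in> A \<Longrightarrow> \<eta> x \<ge> 1"
proof -
  obtain \<eta> :: "'a \<Rightarrow> real" where \<eta>: "test_fun Q \<eta>" "\<And>x. \<eta> x \<ge> 0" "\<And>x. x \<in> A \<Longrightarrow> \<eta> x \<ge> 1"
    by (rule cutoff_exists[OF assms(1,2,3)]) (rule that)
  obtain K where K: "compact K" "K \<subseteq> Q" "\<And>x. x \<notin> K \<Longrightarrow> \<eta> x = 0" using test_funE[OF \<eta>(1)] by metis
  obtain N where N: "\<And>x. norm (\<eta> x) \<le> N" using test_fun_bounded[OF \<eta>(1)] by metis
  have "\<exists>B. \<forall>x. \<bar>partial (e j) \<eta> x\<bar> \<le> B" for j
    using test_fun_bounded[OF test_fun_partial[OF \<eta>(1) e[of j]]] by (metis real_norm_def)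
  then obtain B where B: "\<And>j x. \<bar>partial (e j) \<eta> x\<bar> \<le> B j" by metis
  obtain \<rho> where \<rho>: "\<rho> > 0" "(\<Union>x\<in>K. cball x \<rho>) \<subseteq> Q"
    using compact_subset_open_imp_cball_epsilon_subset[OF K(1) assms(2) K(2)] by metis
  show ?thesis
  proof (rule that[of \<eta> N "\<Sum>j\<in>UNIV. B j" K \<rho>])
    show "norm (\<chi> j. partial (e j) \<eta> x) \<le> (\<Sum>j\<in>UNIV. B j)" for x
      by (rule order_trans[OF norm_le_l1_cart]) (simp add: sum_mono B)
  qed (use \<eta> K N \<rho> test_fun_smooth in auto)
qed

text \<open>The energy estimate with the whole flux difference as the monotone part.\<close>

lemma weak_system_difference_bound:
  fixes S :: "real^'n^'m \<Rightarrow> real^'n^'m" and e :: "'n \<Rightarrow> 'a::euclidean_space"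
  assumes S: "elliptic_map \<theta> \<Theta> S" "\<theta> > 0" "\<Theta> > 0" and Q: "open Q" "bounded Q" and e: "\<And>j. e j \<in> Basis"
    and sol: "weak_system Q e S u g f" and A: "compact A" "A \<subseteq> Q"
  shows "\<exists>C d. d > 0 \<and> (\<forall>h. \<bar>h\<bar> < d \<longrightarrow> nrm2 (\<lambda>z. indicator A z *\<^sub>R (g (z + h *\<^sub>R e l) - g z)) \<le> C * \<bar>h\<bar>)"
proof -
  obtain \<eta> :: "'a \<Rightarrow> real" and K and \<rho> N B :: real where \<eta>: "smooth_on UNIV \<eta>" "\<And>x. \<bar>\<eta> x\<bar> \<le> N" "\<And>x. norm (\<chi> j. partial (e j) \<eta> x) \<le> B"
    and K: "compact K" "\<And>x. x \<notin> K \<Longrightarrow> \<eta> x = 0" "\<And>x. x \<in> K \<Longrightarrow> cball x \<rho> \<subseteq> Q" and \<rho>: "\<rho> > 0"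
    and \<eta>1: "\<And>x. x \<in> A \<Longrightarrow> \<eta> x \<ge> 1"
    by (rule cutoff_data[OF A(1) Q(1) A(2) e]) (rule that)
  note sol' = sol[unfolded weak_system_def]
  have L: "L2 u" "L2 g" "L2 f" using sol' by auto
  have fQ: "Q \<in> fmeasurable lborel" by (rule bounded_open_fmeasurable[OF Q])
  have iu: "integrable lborel u" using L2_finite_support_integrable(1)[OF L(1) fQ] sol' by auto
  have [measurable]: "S \<in> borel_measurable borel" "g \<in> borel_measurable borel"
    using borel_measurable_continuous_onI[OF elliptic_map_continuous[OF S(1)]] L by (auto intro: L2_measurable)
  let ?\<sigma> = "\<lambda>z. if z \<in> Q then S (g z) else 0"
  have L\<sigma>: "L2 ?\<sigma>" by (rule flux_L2[OF S(1) less_imp_le[OF S(3)] Q L(2)])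
  define C where "C = energy_const \<theta> \<Theta> N B * (nrm2 f + nrm2 g)"
  have "nrm2 (\<lambda>z. indicator A z *\<^sub>R (g (z + h *\<^sub>R e l) - g z)) \<le> C * \<bar>h\<bar>" if h: "\<bar>h\<bar> < \<rho>" for h
  proof -
    have LD: "L2 (\<lambda>z. g (z + h *\<^sub>R e l) - g z)" by (rule L2_shift_diff[OF L(2)])
    have L\<eta>: "L2 (\<lambda>z. \<eta> z *\<^sub>R (g (z + h *\<^sub>R e l) - g z))"
      by (rule L2_bounded_mult(1)[OF LD smooth_measurable[OF \<eta>(1)] \<eta>(2)])
    have [measurable]: "A \<in> sets borel" using A(1) by (simp add: compact_imp_closed)
    have "nrm2 (\<lambda>z. indicator A z *\<^sub>R (g (z + h *\<^sub>R e l) - g z)) \<le> 1 * nrm2 (\<lambda>z. \<eta> z *\<^sub>R (g (z + h *\<^sub>R e l) - g z))"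
    proof (rule L2_dominated(2)[OF L\<eta>])
      have "norm (indicator A z *\<^sub>R (g (z + h *\<^sub>R e l) - g z)) \<le> 1 * norm (\<eta> z *\<^sub>R (g (z + h *\<^sub>R e l) - g z))" for z
        using mult_right_mono[OF \<eta>1[of z] norm_ge_zero[of "g (z + h *\<^sub>R e l) - g z"]] \<eta>1[of z]
        by (cases "z \<in> A") auto
      then show "AE z in lborel. norm (indicator A z *\<^sub>R (g (z + h *\<^sub>R e l) - g z)) \<le> 1 * norm (\<eta> z *\<^sub>R (g (z + h *\<^sub>R e l) - g z))"
        by simp
    qed auto
    also have "1 * nrm2 (\<lambda>z. \<eta> z *\<^sub>R (g (z + h *\<^sub>R e l) - g z))
      \<le> energy_const \<theta> \<Theta> N B * (\<bar>h\<bar> * nrm2 f + \<bar>h\<bar> * nrm2 g + nrm2 (\<lambda>z. \<eta> z *\<^sub>R (0 :: real^'n^'m)))"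
      unfolding mult_1_left
    proof (rule energy_estimate[where r = "\<lambda>_. 0" and \<sigma> = ?\<sigma> and P = "\<lambda>z. S (g (z + h *\<^sub>R e l)) - S (g z)"
          and u = u and f = f and Q = Q and e = e and K = K and \<rho> = \<rho> and l = l and h = h])
      show "?\<sigma> (z + h *\<^sub>R e l) - ?\<sigma> z = S (g (z + h *\<^sub>R e l)) - S (g z) + 0" if "z \<in> K" for z
      proof -
        have "z \<in> cball z \<rho>" "z + h *\<^sub>R e l \<in> cball z \<rho>" using h \<rho> e[of l] by (auto simp: dist_norm)
        then have "z \<in> Q" "z + h *\<^sub>R e l \<in> Q" using K(3)[OF that] by blast+
        then show ?thesis by simp
      qed
      show "(\<lambda>z. S (g (z + h *\<^sub>R e l)) - S (g z)) \<in> borel_measurable borel" by measurable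
      show "distr_deriv Q (e j) u (\<lambda>x. column j (g x))" for j using sol' by blast
      show "(\<integral>x. f x \<bullet> w x \<partial>lborel) + (\<integral>x. ?\<sigma> x \<bullet> jacobian e w x \<partial>lborel) = 0" if "test_fun Q w" for w :: "'a \<Rightarrow> real^'m"
        using sol' that by blast
      show "\<theta> * (norm (g (z + h *\<^sub>R e l) - g z))\<^sup>2 \<le> (S (g (z + h *\<^sub>R e l)) - S (g z)) \<bullet> (g (z + h *\<^sub>R e l) - g z)" for z
        using S(1) unfolding elliptic_map_def by blast
      show "norm (S (g (z + h *\<^sub>R e l)) - S (g z)) \<le> \<Theta> * norm (g (z + h *\<^sub>R e l) - g z)" for z
        using S(1) unfolding elliptic_map_def by blast
    qed (use S(2,3) K \<eta> Q e L L\<sigma> iu h in auto)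
    finally show ?thesis unfolding C_def by (simp add: algebra_simps)
  qed
  with \<rho> show ?thesis by blast
qed

text \<open>Translates of \<open>H\<close> are close to \<open>H\<close>, so averages of \<open>H\<close> over short segments are close to it. The cutoff
  confines everything to a compact set, where \<open>H\<close> is square integrable.\<close>

lemma difference_quotient_tendsto:
  fixes g H :: "'a::euclidean_space \<Rightarrow> 'b::euclidean_space"
  assumes g: "L2 g" "integrable lborel g" and Q: "open Q" and e: "e \<in> Basis" and D: "distr_deriv Q e g H"
    and H: "\<And>A. compact A \<Longrightarrow> A \<subseteq> Q \<Longrightarrow> L2 (\<lambda>z. indicator A z *\<^sub>R H z)"
    and \<eta>: "\<eta> \<in> borel_measurable borel" "\<And>x. \<bar>\<eta> x\<bar> \<le> N"
    and K: "compact K" "\<And>x. x \<notin> K \<Longrightarrow> \<eta> x = 0" "\<rho> > 0" "\<And>x. x \<in> K \<Longrightarrow> cball x \<rho> \<subseteq> Q" and \<epsilon>: "\<epsilon> > 0"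
  obtains d where "d > 0" "\<And>h. \<bar>h\<bar> < d \<Longrightarrow> h \<noteq> 0 \<Longrightarrow>
    nrm2 (\<lambda>z. \<eta> z *\<^sub>R ((1 / h) *\<^sub>R (g (z + h *\<^sub>R e) - g z) - H z)) \<le> \<epsilon>"
proof -
  define K1 where "K1 = {x + y |x y. x \<in> K \<and> y \<in> cball 0 \<rho>}"
  define U where "U = (\<Union>x\<in>K. ball x \<rho>)"
  have K1: "compact K1" "K1 \<subseteq> Q" "U \<subseteq> K1"
  proof -
    show "compact K1" unfolding K1_def using K(1) by (intro compact_sums) auto
    show "K1 \<subseteq> Q" unfolding K1_def using K(4) by (force simp: dist_norm)
    show "U \<subseteq> K1"
    proof
      fix y assume "y \<in> U"
      then obtain x where "x \<in> K" "dist x y < \<rho>" by (auto simp: U_def)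
      then show "y \<in> K1" unfolding K1_def mem_Collect_eq
        by (intro exI[of _ x] exI[of _ "y - x"]) (auto simp: dist_norm norm_minus_commute)
    qed
  qed
  let ?H = "\<lambda>z. indicator K1 z *\<^sub>R H z"
  have LH: "L2 ?H" by (rule H[OF K1(1,2)])
  have DU: "distr_deriv U e g ?H"
    unfolding distr_deriv_def
  proof (intro allI impI)
    fix \<phi> :: "'a \<Rightarrow> real" assume \<phi>: "test_fun U \<phi>"
    have "test_fun Q \<phi>" using test_fun_mono[OF \<phi>] K1 by blast
    from distr_derivD[OF D this]
    have "(\<integral>x. partial e \<phi> x *\<^sub>R g x \<partial>lborel) = - (\<integral>x. \<phi> x *\<^sub>R H x \<partial>lborel)" .
    moreover obtain K0 where K0: "K0 \<subseteq> U" "\<And>x. x \<notin> K0 \<Longrightarrow> \<phi> x = 0" using test_funE[OF \<phi>] by metis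
    have "\<phi> x *\<^sub>R H x = \<phi> x *\<^sub>R ?H x" for x
      using K0(1) K0(2)[of x] K1(3) by (cases "x \<in> K1") auto
    ultimately show "(\<integral>x. partial e \<phi> x *\<^sub>R g x \<partial>lborel) = - (\<integral>x. \<phi> x *\<^sub>R ?H x \<partial>lborel)" by presburger
  qed
  have N0: "N \<ge> 0" using \<eta>(2)[of 0] by linarith
  then have "\<epsilon> / (N + 1) > 0" using \<epsilon> by simp
  then obtain d where d: "d > 0" "\<And>y. norm y < d \<Longrightarrow> nrm2 (\<lambda>x. ?H (x + y) - ?H x) < \<epsilon> / (N + 1)"
    using L2_shift_continuous[OF LH] by metis
  show ?thesis
  proof (rule that[of "min d (\<rho> / 2)"])
    show "min d (\<rho> / 2) > 0" using d K(3) by simp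
    fix h assume h: "\<bar>h\<bar> < min d (\<rho> / 2)" "h \<noteq> 0"
    have "nrm2 (\<lambda>z. \<eta> z *\<^sub>R (g (z + h *\<^sub>R e) - g z - h *\<^sub>R ?H z)) \<le> N * (\<bar>h\<bar> * (\<epsilon> / (N + 1)))"
    proof (rule nrm2_difference_deriv_le[OF g LH e DU \<eta>, of "\<rho> / 2"])
      show "cball z (\<rho> / 2) \<subseteq> U" if "\<eta> z \<noteq> 0" for z
        using K(2)[of z] that K(3) by (force simp: U_def)
      show "nrm2 (\<lambda>x. ?H (x + y) - ?H x) \<le> \<epsilon> / (N + 1)" if "norm y \<le> \<bar>h\<bar>" for y
        using d(2)[of y] that h by auto
    qed (use h in auto)
    also have "\<dots> \<le> \<bar>h\<bar> * \<epsilon>"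
    proof -
      have "N * (\<epsilon> / (N + 1)) \<le> \<epsilon>" using N0 \<epsilon> by (simp add: field_simps)
      from mult_left_mono[OF this abs_ge_zero[of h]] show ?thesis by (simp add: mult_ac)
    qed
    finally have le: "nrm2 (\<lambda>z. \<eta> z *\<^sub>R (g (z + h *\<^sub>R e) - g z - h *\<^sub>R ?H z)) \<le> \<bar>h\<bar> * \<epsilon>" .
    have inK1: "z \<in> K1" if "z \<in> K" for z
      unfolding K1_def mem_Collect_eq using that K(3) by (intro exI[of _ z] exI[of _ 0]) auto
    have "(\<lambda>z. \<eta> z *\<^sub>R ((1 / h) *\<^sub>R (g (z + h *\<^sub>R e) - g z) - H z))
      = (\<lambda>z. (1 / h) *\<^sub>R (\<eta> z *\<^sub>R (g (z + h *\<^sub>R e) - g z - h *\<^sub>R ?H z)))"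
    proof
      fix z show "\<eta> z *\<^sub>R ((1 / h) *\<^sub>R (g (z + h *\<^sub>R e) - g z) - H z)
        = (1 / h) *\<^sub>R (\<eta> z *\<^sub>R (g (z + h *\<^sub>R e) - g z - h *\<^sub>R ?H z))"
        using K(2)[of z] inK1[of z] h(2) by (cases "z \<in> K") (simp_all add: scaleR_diff_right)
    qed
    then have "nrm2 (\<lambda>z. \<eta> z *\<^sub>R ((1 / h) *\<^sub>R (g (z + h *\<^sub>R e) - g z) - H z))
      = \<bar>1 / h\<bar> * nrm2 (\<lambda>z. \<eta> z *\<^sub>R (g (z + h *\<^sub>R e) - g z - h *\<^sub>R ?H z))"
      by (simp only: nrm2_scaleR)
    also have "\<dots> \<le> \<bar>1 / h\<bar> * (\<bar>h\<bar> * \<epsilon>)" using le by (intro mult_left_mono) auto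
    also have "\<dots> = \<epsilon>" using h(2) by simp
    finally show "nrm2 (\<lambda>z. \<eta> z *\<^sub>R ((1 / h) *\<^sub>R (g (z + h *\<^sub>R e) - g z) - H z)) \<le> \<epsilon>" .
  qed
qed

text \<open>Both increments are \<open>t\<^sub>n L d\<close> up to an error \<open>o(t\<^sub>n)\<close>, with the same linear map \<open>L\<close>.\<close>

lemma strictly_differentiable_increment_tendsto:
  fixes S :: "'e::euclidean_space \<Rightarrow> 'e"
  assumes S: "strictly_differentiable S" and a: "a \<longlonglongrightarrow> x" and t: "t \<longlonglongrightarrow> 0" "\<And>n. t n > (0::real)"
  shows "(\<lambda>n. (1 / t n) *\<^sub>R ((S (a n + t n *\<^sub>R d) - S (a n)) - (S (x + t n *\<^sub>R d) - S x))) \<longlonglongrightarrow> 0"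
proof (rule LIMSEQ_I)
  fix \<epsilon> :: real assume \<epsilon>: "\<epsilon> > 0"
  define \<epsilon>' where "\<epsilon>' = \<epsilon> / (norm d + 1) / 2"
  have \<epsilon>': "\<epsilon>' > 0" unfolding \<epsilon>'_def using \<epsilon> by (simp add: add_nonneg_pos)
  obtain L where L: "\<And>\<epsilon>. \<epsilon> > 0 \<Longrightarrow> \<exists>\<delta>>0. \<forall>y z. norm (y - x) < \<delta> \<longrightarrow> norm (z - x) < \<delta> \<longrightarrow>
     norm (S y - S z - L (y - z)) \<le> \<epsilon> * norm (y - z)"
    using S unfolding strictly_differentiable_def by metis
  obtain \<delta> where \<delta>: "\<delta> > 0" "\<And>y z. norm (y - x) < \<delta> \<Longrightarrow> norm (z - x) < \<delta> \<Longrightarrow>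
     norm (S y - S z - L (y - z)) \<le> \<epsilon>' * norm (y - z)" using L[OF \<epsilon>'] by blast
  have td: "(\<lambda>n. t n *\<^sub>R d) \<longlonglongrightarrow> 0" using tendsto_scaleR[OF t(1) tendsto_const[of d]] by simp
  have lim: "(\<lambda>n. a n + t n *\<^sub>R d) \<longlonglongrightarrow> x" "(\<lambda>n. x + t n *\<^sub>R d) \<longlonglongrightarrow> x"
    using tendsto_add[OF a td] tendsto_add[OF tendsto_const[of x] td] by simp_all
  obtain N1 where N1: "\<And>n. n \<ge> N1 \<Longrightarrow> norm (a n - x) < \<delta>" using LIMSEQ_D[OF a \<delta>(1)] by blast
  obtain N2 where N2: "\<And>n. n \<ge> N2 \<Longrightarrow> norm (a n + t n *\<^sub>R d - x) < \<delta>" using LIMSEQ_D[OF lim(1) \<delta>(1)] by blast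
  obtain N3 where N3: "\<And>n. n \<ge> N3 \<Longrightarrow> norm (x + t n *\<^sub>R d - x) < \<delta>" using LIMSEQ_D[OF lim(2) \<delta>(1)] by blast
  show "\<exists>N. \<forall>n\<ge>N. norm ((1 / t n) *\<^sub>R ((S (a n + t n *\<^sub>R d) - S (a n)) - (S (x + t n *\<^sub>R d) - S x)) - 0) < \<epsilon>"
  proof (intro exI[of _ "max N1 (max N2 N3)"] allI impI)
    fix n assume n: "max N1 (max N2 N3) \<le> n"
    have 1: "norm (S (a n + t n *\<^sub>R d) - S (a n) - L (t n *\<^sub>R d)) \<le> \<epsilon>' * norm (t n *\<^sub>R d)"
      using \<delta>(2)[of "a n + t n *\<^sub>R d" "a n"] N1[of n] N2[of n] n by simp
    have 2: "norm (S (x + t n *\<^sub>R d) - S x - L (t n *\<^sub>R d)) \<le> \<epsilon>' * norm (t n *\<^sub>R d)"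
      using \<delta>(2)[of "x + t n *\<^sub>R d" x] N3[of n] n \<delta>(1) by simp
    have "norm ((S (a n + t n *\<^sub>R d) - S (a n)) - (S (x + t n *\<^sub>R d) - S x))
      \<le> norm (S (a n + t n *\<^sub>R d) - S (a n) - L (t n *\<^sub>R d)) + norm (S (x + t n *\<^sub>R d) - S x - L (t n *\<^sub>R d))"
      by norm
    also have "\<dots> \<le> 2 * \<epsilon>' * (t n * norm d)" using 1 2 t(2)[of n] by simp
    finally have "norm ((S (a n + t n *\<^sub>R d) - S (a n)) - (S (x + t n *\<^sub>R d) - S x)) \<le> 2 * \<epsilon>' * (t n * norm d)" .
    from mult_left_mono[OF this, of "1 / t n"]
    have "norm ((1 / t n) *\<^sub>R ((S (a n + t n *\<^sub>R d) - S (a n)) - (S (x + t n *\<^sub>R d) - S x)))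
      \<le> (1 / t n) * (2 * \<epsilon>' * (t n * norm d))"
      using t(2)[of n] by simp
    also have "\<dots> = 2 * \<epsilon>' * norm d" using t(2)[of n] by simp
    also have "\<dots> = \<epsilon> * (norm d / (norm d + 1))"
    proof -
      have "2 * \<epsilon>' = \<epsilon> / (norm d + 1)" unfolding \<epsilon>'_def by (simp only: mult_2 field_sum_of_halves)
      then show ?thesis by simp
    qed
    also have "\<dots> < \<epsilon> * 1"
      using \<epsilon> by (intro mult_strict_left_mono) (simp_all add: divide_less_eq add_nonneg_pos)
    finally show "norm ((1 / t n) *\<^sub>R ((S (a n + t n *\<^sub>R d) - S (a n)) - (S (x + t n *\<^sub>R d) - S x)) - 0) < \<epsilon>"
      by simp
  qed
qed

text \<open>Strong convergence of the second derivatives. The difference of two solutions is compared by the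
  energy estimate, where the splitting
  \<open>S(g\<^sub>k + \<Delta>g\<^sub>k) - S(g\<^sub>k) - (S(g + \<Delta>g) - S(g)) = P + r\<close> inserts \<open>S(g\<^sub>k + \<Delta>g)\<close>. The increments \<open>h\<close>
  tend to zero with \<open>k\<close>, fast enough for all difference quotients to be close to derivatives; then
  \<open>r / h\<close> behaves like \<open>(DS(g\<^sub>k) - DS(g)) H\<close>, which tends to zero by dominated convergence because
  the factor \<open>H\<close> does not depend on \<open>k\<close>.\<close>

lemma weak_system_stability:
  fixes S :: "real^'n^'m \<Rightarrow> real^'n^'m" and e :: "'n \<Rightarrow> 'a::euclidean_space"
  assumes S: "elliptic_map \<theta> \<Theta> S" "\<theta> > 0" "\<Theta> > 0" "strictly_differentiable S"
    and Q: "open Q" "bounded Q" and e: "\<And>j. e j \<in> Basis"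
    and sol: "weak_system Q e S u g f" and solk: "\<And>k. weak_system Q e S (uk k) (gk k) (fk k)"
    and conv: "(\<lambda>k. nrm2 (\<lambda>z. fk k z - f z)) \<longlonglongrightarrow> 0" "(\<lambda>k. nrm2 (\<lambda>z. gk k z - g z)) \<longlonglongrightarrow> 0"
      "AE z in lborel. (\<lambda>k. gk k z) \<longlonglongrightarrow> g z"
    and H: "H \<in> borel_measurable borel" "distr_deriv Q (e l) g H"
      "\<And>A. compact A \<Longrightarrow> A \<subseteq> Q \<Longrightarrow> L2 (\<lambda>z. indicator A z *\<^sub>R H z)"
    and Hk: "\<And>k. Hk k \<in> borel_measurable borel" "\<And>k. distr_deriv Q (e l) (gk k) (Hk k)"
      "\<And>k A. compact A \<Longrightarrow> A \<subseteq> Q \<Longrightarrow> L2 (\<lambda>z. indicator A z *\<^sub>R Hk k z)"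
    and A: "compact A" "A \<subseteq> Q"
  shows "(\<lambda>k. nrm2 (\<lambda>z. indicator A z *\<^sub>R (Hk k z - H z))) \<longlonglongrightarrow> 0"
proof -
  obtain \<eta> :: "'a \<Rightarrow> real" and K and \<rho> N B :: real where \<eta>: "smooth_on UNIV \<eta>" "\<And>x. \<bar>\<eta> x\<bar> \<le> N" "\<And>x. norm (\<chi> j. partial (e j) \<eta> x) \<le> B"
    and K: "compact K" "\<And>x. x \<notin> K \<Longrightarrow> \<eta> x = 0" "\<And>x. x \<in> K \<Longrightarrow> cball x \<rho> \<subseteq> Q" and \<rho>: "\<rho> > 0"
    and \<eta>1: "\<And>x. x \<in> A \<Longrightarrow> \<eta> x \<ge> 1"
    by (rule cutoff_data[OF A(1) Q(1) A(2) e]) (rule that)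
  have \<eta>m[measurable]: "\<eta> \<in> borel_measurable borel" by (rule smooth_measurable[OF \<eta>(1)])
  have KQ: "K \<subseteq> Q" using K(3) \<rho> by (meson centre_in_cball in_mono less_imp_le subsetI)
  have fQ: "Q \<in> fmeasurable lborel" by (rule bounded_open_fmeasurable[OF Q])
  note s = sol[unfolded weak_system_def] and sk = solk[unfolded weak_system_def]
  have L: "L2 u" "L2 g" "L2 f" and Lk: "L2 (uk k)" "L2 (gk k)" "L2 (fk k)" for k using s sk[of k] by auto
  have ig: "integrable lborel g" and igk: "integrable lborel (gk k)" for k
    using L2_finite_support_integrable(1)[OF L(2) fQ] L2_finite_support_integrable(1)[OF Lk(2) fQ] s sk[of k] by auto
  have iu: "integrable lborel (\<lambda>z. uk k z - u z)" for k
    using L2_finite_support_integrable(1)[OF L2_diff[OF Lk(1) L(1)] fQ] s sk[of k] by auto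
  have Sm[measurable]: "S \<in> borel_measurable borel"
    by (rule borel_measurable_continuous_onI[OF elliptic_map_continuous[OF S(1)]])
  have [measurable]: "g \<in> borel_measurable borel" "gk k \<in> borel_measurable borel" for k
    using L Lk by (auto intro: L2_measurable)
  have [measurable]: "H \<in> borel_measurable borel" "Hk k \<in> borel_measurable borel" for k using H Hk by auto
  let ?c = "\<lambda>k. 1 / real (Suc k)"
  have c: "?c k > 0" for k by simp
  \<comment> \<open>Difference quotients converge only for each solution separately, so the increment depends on \<open>k\<close>.\<close>
  have increment: "\<exists>h. 0 < h \<and> h < ?c k \<and> h < \<rho> \<and>
    nrm2 (\<lambda>z. \<eta> z *\<^sub>R ((1 / h) *\<^sub>R (g (z + h *\<^sub>R e l) - g z) - H z)) \<le> ?c k \<and>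
    nrm2 (\<lambda>z. \<eta> z *\<^sub>R ((1 / h) *\<^sub>R (gk k (z + h *\<^sub>R e l) - gk k z) - Hk k z)) \<le> ?c k" for k
  proof -
    obtain d1 where d1: "d1 > 0" "\<And>h. \<bar>h\<bar> < d1 \<Longrightarrow> h \<noteq> 0 \<Longrightarrow>
      nrm2 (\<lambda>z. \<eta> z *\<^sub>R ((1 / h) *\<^sub>R (g (z + h *\<^sub>R e l) - g z) - H z)) \<le> ?c k"
      using difference_quotient_tendsto[OF L(2) ig Q(1) e H(2) H(3) \<eta>m \<eta>(2) K(1,2) \<rho> K(3) c] by blast
    obtain d2 where d2: "d2 > 0" "\<And>h. \<bar>h\<bar> < d2 \<Longrightarrow> h \<noteq> 0 \<Longrightarrow>
      nrm2 (\<lambda>z. \<eta> z *\<^sub>R ((1 / h) *\<^sub>R (gk k (z + h *\<^sub>R e l) - gk k z) - Hk k z)) \<le> ?c k"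
      using difference_quotient_tendsto[OF Lk(2) igk Q(1) e Hk(2) Hk(3) \<eta>m \<eta>(2) K(1,2) \<rho> K(3) c] by blast
    define m where "m = min (min d1 d2) (min (?c k) \<rho>)"
    have "m > 0" "m \<le> d1" "m \<le> d2" "m \<le> ?c k" "m \<le> \<rho>"
      unfolding m_def using d1(1) d2(1) \<rho> c by (simp_all add: min.coboundedI1 min.coboundedI2)
    then have "0 < m / 2" "m / 2 < d1" "m / 2 < d2" "m / 2 < ?c k" "m / 2 < \<rho>" by linarith+
    with d1(2)[of "m / 2"] d2(2)[of "m / 2"] show ?thesis by (intro exI[of _ "m / 2"]) auto
  qed
  from choice[OF allI[OF increment]] obtain h where "\<forall>k. 0 < h k \<and> h k < ?c k \<and> h k < \<rho> \<and>
    nrm2 (\<lambda>z. \<eta> z *\<^sub>R ((1 / h k) *\<^sub>R (g (z + h k *\<^sub>R e l) - g z) - H z)) \<le> ?c k \<and>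
    nrm2 (\<lambda>z. \<eta> z *\<^sub>R ((1 / h k) *\<^sub>R (gk k (z + h k *\<^sub>R e l) - gk k z) - Hk k z)) \<le> ?c k" ..
  then have h: "\<And>k. 0 < h k" "\<And>k. h k < ?c k" "\<And>k. h k < \<rho>"
    "\<And>k. nrm2 (\<lambda>z. \<eta> z *\<^sub>R ((1 / h k) *\<^sub>R (g (z + h k *\<^sub>R e l) - g z) - H z)) \<le> ?c k"
    "\<And>k. nrm2 (\<lambda>z. \<eta> z *\<^sub>R ((1 / h k) *\<^sub>R (gk k (z + h k *\<^sub>R e l) - gk k z) - Hk k z)) \<le> ?c k"
    by blast+
  have c0: "?c \<longlonglongrightarrow> 0" using LIMSEQ_inverse_real_of_nat by (simp add: inverse_eq_divide)
  have h0: "h \<longlonglongrightarrow> 0"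
    by (rule Lim_null_comparison[OF _ c0]) (use h(1,2) in \<open>auto intro!: always_eventually less_imp_le simp: abs_of_pos\<close>)
  define D where "D k G z = (1 / h k) *\<^sub>R (G (z + h k *\<^sub>R e l) - G z)" for k and G :: "'a \<Rightarrow> real^'n^'m" and z
  have LD: "L2 (D k G)" if "L2 G" for k G unfolding D_def by (intro L2_scaleR L2_shift_diff that)
  \<comment> \<open>\<open>r\<close> is the remainder of the splitting, \<open>r'\<close> the same with \<open>\<Delta>g\<close> replaced by \<open>h H\<close>.\<close>
  define r where "r k z = (S (gk k z + (g (z + h k *\<^sub>R e l) - g z)) - S (gk k z)) - (S (g (z + h k *\<^sub>R e l)) - S (g z))" for k z
  define r' where "r' k z = (S (gk k z + h k *\<^sub>R H z) - S (gk k z)) - (S (g z + h k *\<^sub>R H z) - S (g z))" for k z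
  have [measurable]: "r k \<in> borel_measurable borel" "r' k \<in> borel_measurable borel" for k
    unfolding r_def r'_def by measurable
  have lip: "norm (S x - S y) \<le> \<Theta> * norm (x - y)" for x y using S(1) by (simp add: elliptic_map_def)
  have L\<eta>: "L2 (\<lambda>z. \<eta> z *\<^sub>R G z)" if "L2 G" for G :: "'a \<Rightarrow> real^'n^'m"
    by (rule L2_bounded_mult(1)[OF that \<eta>m \<eta>(2)])
  have \<eta>ind: "\<eta> z *\<^sub>R G z = \<eta> z *\<^sub>R (indicator K z *\<^sub>R G z)" for G :: "'a \<Rightarrow> real^'n^'m" and z
    using K(2)[of z] by (cases "z \<in> K") auto
  have L\<eta>H: "L2 (\<lambda>z. \<eta> z *\<^sub>R H z)" "L2 (\<lambda>z. \<eta> z *\<^sub>R Hk k z)" for k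
    unfolding \<eta>ind[of _ H] \<eta>ind[of _ "Hk k"] by (intro L\<eta> H(3) Hk(3) K(1) KQ)+
  have L\<eta>DH: "L2 (\<lambda>z. \<eta> z *\<^sub>R (D k g z - H z))" "L2 (\<lambda>z. \<eta> z *\<^sub>R (D k (gk k) z - Hk k z))" for k
    unfolding scaleR_diff_right by (intro L2_diff L\<eta> LD L L\<eta>H Lk)+
  \<comment> \<open>Pointwise \<open>r'/h\<close> tends to zero by strict differentiability, and \<open>2 \<Theta> |H|\<close> dominates it.\<close>
  have r'0: "(\<lambda>k. nrm2 (\<lambda>z. \<eta> z *\<^sub>R ((1 / h k) *\<^sub>R r' k z))) \<longlonglongrightarrow> 0"
  proof (rule L2_dominated_convergence[OF _ L\<eta>H(1), where c = "2 * \<Theta>"])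
    show "AE z in lborel. (\<lambda>k. \<eta> z *\<^sub>R ((1 / h k) *\<^sub>R r' k z)) \<longlonglongrightarrow> 0"
      using conv(3)
    proof eventually_elim
      case (elim z)
      have "(\<lambda>k. (1 / h k) *\<^sub>R r' k z) \<longlonglongrightarrow> 0"
        unfolding r'_def by (rule strictly_differentiable_increment_tendsto[OF S(4) elim h0 h(1)])
      from tendsto_scaleR[OF tendsto_const[of "\<eta> z"] this] show ?case by simp
    qed
    show "AE z in lborel. norm (\<eta> z *\<^sub>R ((1 / h k) *\<^sub>R r' k z)) \<le> 2 * \<Theta> * norm (\<eta> z *\<^sub>R H z)" for k
    proof (rule AE_I2)
      fix z
      have "norm (r' k z) \<le> norm (S (gk k z + h k *\<^sub>R H z) - S (gk k z)) + norm (S (g z + h k *\<^sub>R H z) - S (g z))"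
        unfolding r'_def by (rule norm_triangle_ineq4)
      also have "\<dots> \<le> \<Theta> * norm (h k *\<^sub>R H z) + \<Theta> * norm (h k *\<^sub>R H z)"
        using lip[of "gk k z + h k *\<^sub>R H z" "gk k z"] lip[of "g z + h k *\<^sub>R H z" "g z"] by simp
      finally have "norm (r' k z) \<le> h k * (2 * \<Theta> * norm (H z))" using h(1)[of k] by (simp add: mult_ac)
      then have "norm ((1 / h k) *\<^sub>R r' k z) \<le> 2 * \<Theta> * norm (H z)"
        using h(1)[of k] by (simp add: pos_divide_le_eq mult_ac)
      from mult_left_mono[OF this abs_ge_zero[of "\<eta> z"]]
      show "norm (\<eta> z *\<^sub>R ((1 / h k) *\<^sub>R r' k z)) \<le> 2 * \<Theta> * norm (\<eta> z *\<^sub>R H z)" by (simp add: mult_ac)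
    qed
  qed (use S(3) in auto)
  have L\<eta>r: "L2 (\<lambda>z. \<eta> z *\<^sub>R r k z)" for k
  proof (rule L2_dominated(1)[OF L\<eta>[OF L2_shift_diff[OF L(2)]], of _ "2 * \<Theta>"])
    show "AE z in lborel. norm (\<eta> z *\<^sub>R r k z) \<le> 2 * \<Theta> * norm (\<eta> z *\<^sub>R (g (z + h k *\<^sub>R e l) - g z))"
    proof (rule AE_I2)
      fix z
      have "norm (r k z) \<le> norm (S (gk k z + (g (z + h k *\<^sub>R e l) - g z)) - S (gk k z)) + norm (S (g (z + h k *\<^sub>R e l)) - S (g z))"
        unfolding r_def by (rule norm_triangle_ineq4)
      also have "\<dots> \<le> 2 * \<Theta> * norm (g (z + h k *\<^sub>R e l) - g z)"
        using lip[of "gk k z + (g (z + h k *\<^sub>R e l) - g z)" "gk k z"] lip[of "g (z + h k *\<^sub>R e l)" "g z"] by simp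
      finally have "norm (r k z) \<le> 2 * \<Theta> * norm (g (z + h k *\<^sub>R e l) - g z)" .
      from mult_left_mono[OF this abs_ge_zero[of "\<eta> z"]]
      show "norm (\<eta> z *\<^sub>R r k z) \<le> 2 * \<Theta> * norm (\<eta> z *\<^sub>R (g (z + h k *\<^sub>R e l) - g z))"
        unfolding norm_scaleR by (simp add: mult_ac)
    qed
  qed (use S(3) in auto)
  \<comment> \<open>Since \<open>S\<close> is Lipschitz, \<open>r\<close> and \<open>r'\<close> differ by at most \<open>2 \<Theta> |\<Delta>g - h H|\<close>.\<close>
  have rle: "nrm2 (\<lambda>z. \<eta> z *\<^sub>R ((1 / h k) *\<^sub>R r k z)) \<le> nrm2 (\<lambda>z. \<eta> z *\<^sub>R ((1 / h k) *\<^sub>R r' k z)) + 2 * \<Theta> * ?c k" for k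
  proof -
    have rr': "norm (\<eta> z *\<^sub>R ((1 / h k) *\<^sub>R r k z) - \<eta> z *\<^sub>R ((1 / h k) *\<^sub>R r' k z)) \<le> 2 * \<Theta> * norm (\<eta> z *\<^sub>R (D k g z - H z))" for z
    proof -
      let ?y = "g (z + h k *\<^sub>R e l) - g z"
      have "r k z - r' k z = (S (gk k z + ?y) - S (gk k z + h k *\<^sub>R H z)) - (S (g z + ?y) - S (g z + h k *\<^sub>R H z))"
        by (simp add: r_def r'_def)
      also have "norm \<dots> \<le> \<Theta> * norm (?y - h k *\<^sub>R H z) + \<Theta> * norm (?y - h k *\<^sub>R H z)"
        using lip[of "gk k z + ?y" "gk k z + h k *\<^sub>R H z"] lip[of "g z + ?y" "g z + h k *\<^sub>R H z"]
        by (intro order_trans[OF norm_triangle_ineq4 add_mono]) (simp_all add: diff_diff_eq)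
      also have "?y - h k *\<^sub>R H z = h k *\<^sub>R (D k g z - H z)"
        using h(1)[of k] by (simp add: D_def scaleR_diff_right)
      finally have "norm (r k z - r' k z) \<le> h k * (2 * \<Theta> * norm (D k g z - H z))" using h(1)[of k] by (simp add: mult_ac)
      then have "norm ((1 / h k) *\<^sub>R (r k z - r' k z)) \<le> 2 * \<Theta> * norm (D k g z - H z)"
        using h(1)[of k] by (simp add: pos_divide_le_eq mult_ac)
      from mult_left_mono[OF this abs_ge_zero[of "\<eta> z"]]
      have "norm (\<eta> z *\<^sub>R ((1 / h k) *\<^sub>R (r k z - r' k z))) \<le> 2 * \<Theta> * norm (\<eta> z *\<^sub>R (D k g z - H z))"
        unfolding norm_scaleR by (simp add: mult_ac)
      then show ?thesis by (simp only: scaleR_diff_right)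
    qed
    have dif: "L2 (\<lambda>z. \<eta> z *\<^sub>R ((1 / h k) *\<^sub>R r k z) - \<eta> z *\<^sub>R ((1 / h k) *\<^sub>R r' k z))"
      "nrm2 (\<lambda>z. \<eta> z *\<^sub>R ((1 / h k) *\<^sub>R r k z) - \<eta> z *\<^sub>R ((1 / h k) *\<^sub>R r' k z)) \<le> 2 * \<Theta> * nrm2 (\<lambda>z. \<eta> z *\<^sub>R (D k g z - H z))"
      using L2_dominated[OF L\<eta>DH(1)[of k], of "\<lambda>z. \<eta> z *\<^sub>R ((1 / h k) *\<^sub>R r k z) - \<eta> z *\<^sub>R ((1 / h k) *\<^sub>R r' k z)" "2 * \<Theta>"] rr' S(3) by auto
    have Lr: "L2 (\<lambda>z. \<eta> z *\<^sub>R ((1 / h k) *\<^sub>R r k z))" using L2_scaleR[OF L\<eta>r, of "1 / h k" k] by (simp add: mult.commute)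
    have Lr': "L2 (\<lambda>z. \<eta> z *\<^sub>R ((1 / h k) *\<^sub>R r' k z))" using L2_diff[OF Lr dif(1)] by simp
    have "nrm2 (\<lambda>z. \<eta> z *\<^sub>R (D k g z - H z)) \<le> ?c k" using h(4)[of k] unfolding D_def .
    then have "2 * \<Theta> * nrm2 (\<lambda>z. \<eta> z *\<^sub>R (D k g z - H z)) \<le> 2 * \<Theta> * ?c k" using S(3) by (intro mult_left_mono) auto
    with dif(2) nrm2_le_add_diff[OF Lr Lr'] show ?thesis by linarith
  qed
  define C where "C = energy_const \<theta> \<Theta> N B"
  have N0: "N \<ge> 0" using \<eta>(2)[of 0] by linarith
  have B0: "B \<ge> 0" using order_trans[OF norm_ge_zero \<eta>(3)] .
  have C0: "C \<ge> 0" unfolding C_def energy_const_def using N0 B0 S by simp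
  have main: "nrm2 (\<lambda>z. \<eta> z *\<^sub>R (D k (gk k) z - D k g z))
    \<le> C * (nrm2 (\<lambda>z. fk k z - f z) + nrm2 (\<lambda>z. gk k z - g z) + nrm2 (\<lambda>z. \<eta> z *\<^sub>R ((1 / h k) *\<^sub>R r k z)))" for k
  proof -
    let ?\<sigma> = "\<lambda>z. (if z \<in> Q then S (gk k z) else 0) - (if z \<in> Q then S (g z) else 0)"
    let ?P = "\<lambda>z. S (gk k (z + h k *\<^sub>R e l)) - S (gk k z + (g (z + h k *\<^sub>R e l) - g z))"
    let ?d = "\<lambda>z. (gk k (z + h k *\<^sub>R e l) - g (z + h k *\<^sub>R e l)) - (gk k z - g z)"
    have F: "L2 (\<lambda>z. if z \<in> Q then S (gk k z) else 0)" "L2 (\<lambda>z. if z \<in> Q then S (g z) else 0)"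
      using flux_L2[OF S(1) less_imp_le[OF S(3)] Q] Lk L by auto
    have en: "nrm2 (\<lambda>z. \<eta> z *\<^sub>R ?d z) \<le> energy_const \<theta> \<Theta> N B * (\<bar>h k\<bar> * nrm2 (\<lambda>z. fk k z - f z)
        + \<bar>h k\<bar> * nrm2 (\<lambda>z. gk k z - g z) + nrm2 (\<lambda>z. \<eta> z *\<^sub>R r k z))"
    proof (rule energy_estimate[where \<sigma> = ?\<sigma> and P = ?P and l = l and u = "\<lambda>z. uk k z - u z" and Q = Q and e = e and K = K and \<rho> = \<rho>])
      show "L2 (\<lambda>z. uk k z - u z)" "L2 (\<lambda>z. gk k z - g z)" "L2 (\<lambda>z. fk k z - f z)" by (intro L2_diff L Lk)+
      show "L2 ?\<sigma>" by (intro L2_diff F)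
      show "distr_deriv Q (e j) (\<lambda>z. uk k z - u z) (\<lambda>x. column j (gk k x - g x))" for j
      proof -
        have "distr_deriv Q (e j) (\<lambda>z. uk k z - u z) (\<lambda>x. column j (gk k x) - column j (g x))"
          using s sk[of k] by (intro distr_deriv_diff L Lk L2_column e) auto
        moreover have "column j (gk k x) - column j (g x) = column j (gk k x - g x)" for x
          by (simp add: column_def vec_eq_iff)
        ultimately show ?thesis by simp
      qed
      show "(\<integral>x. (fk k x - f x) \<bullet> w x \<partial>lborel) + (\<integral>x. ?\<sigma> x \<bullet> jacobian e w x \<partial>lborel) = 0"
        if w: "test_fun Q w" for w :: "'a \<Rightarrow> real^'m"
      proof -
        have Lw: "L2 w" by (rule test_fun_L2[OF w])
        have LJ: "L2 (jacobian e w)" by (rule test_fun_jacobian_L2[OF w e])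
        have "(\<integral>x. (fk k x - f x) \<bullet> w x \<partial>lborel) = (\<integral>x. fk k x \<bullet> w x \<partial>lborel) - (\<integral>x. f x \<bullet> w x \<partial>lborel)"
          unfolding inner_diff_left by (intro Bochner_Integration.integral_diff L2_inner_integrable L Lk Lw)
        moreover have "(\<integral>x. ?\<sigma> x \<bullet> jacobian e w x \<partial>lborel)
          = (\<integral>x. (if x \<in> Q then S (gk k x) else 0) \<bullet> jacobian e w x \<partial>lborel) - (\<integral>x. (if x \<in> Q then S (g x) else 0) \<bullet> jacobian e w x \<partial>lborel)"
          unfolding inner_diff_left by (intro Bochner_Integration.integral_diff L2_inner_integrable F LJ)
        moreover have "(\<integral>x. fk k x \<bullet> w x \<partial>lborel) + (\<integral>x. (if x \<in> Q then S (gk k x) else 0) \<bullet> jacobian e w x \<partial>lborel) = 0"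
          "(\<integral>x. f x \<bullet> w x \<partial>lborel) + (\<integral>x. (if x \<in> Q then S (g x) else 0) \<bullet> jacobian e w x \<partial>lborel) = 0"
          using s sk[of k] w by blast+
        ultimately show ?thesis by linarith
      qed
      show "?\<sigma> (z + h k *\<^sub>R e l) - ?\<sigma> z = ?P z + r k z" if "z \<in> K" for z
      proof -
        have "z \<in> cball z \<rho>" "z + h k *\<^sub>R e l \<in> cball z \<rho>" using h(1,3)[of k] \<rho> e[of l] by (auto simp: dist_norm)
        then have "z \<in> Q" "z + h k *\<^sub>R e l \<in> Q" using K(3)[OF that] by blast+
        then show ?thesis by (simp add: r_def)
      qed
      have dd: "gk k (z + h k *\<^sub>R e l) - (gk k z + (g (z + h k *\<^sub>R e l) - g z)) = ?d z" for z by simp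
      show "\<theta> * (norm (?d z))\<^sup>2 \<le> ?P z \<bullet> ?d z" for z
        using S(1) unfolding elliptic_map_def dd[symmetric] by blast
      show "norm (?P z) \<le> \<Theta> * norm (?d z)" for z using lip unfolding dd[symmetric] by blast
      show "?P \<in> borel_measurable borel" by measurable
    qed (use Q e iu \<eta> K h(1,3)[of k] S(2,3) L\<eta>r in auto)
    have "nrm2 (\<lambda>z. \<eta> z *\<^sub>R (D k (gk k) z - D k g z)) = nrm2 (\<lambda>z. (1 / h k) *\<^sub>R (\<eta> z *\<^sub>R ?d z))"
      by (rule arg_cong[of _ _ nrm2]) (auto simp: D_def algebra_simps)
    also have "\<dots> = (1 / h k) * nrm2 (\<lambda>z. \<eta> z *\<^sub>R ?d z)" unfolding nrm2_scaleR using h(1)[of k] by simp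
    also have "\<dots> \<le> (1 / h k) * (C * (h k * nrm2 (\<lambda>z. fk k z - f z)
        + h k * nrm2 (\<lambda>z. gk k z - g z) + nrm2 (\<lambda>z. \<eta> z *\<^sub>R r k z)))"
      using en h(1)[of k] unfolding C_def by (intro mult_left_mono) auto
    also have "\<dots> = C * (nrm2 (\<lambda>z. fk k z - f z) + nrm2 (\<lambda>z. gk k z - g z) + (1 / h k) * nrm2 (\<lambda>z. \<eta> z *\<^sub>R r k z))"
      using h(1)[of k] by (simp add: field_simps)
    also have "(1 / h k) * nrm2 (\<lambda>z. \<eta> z *\<^sub>R r k z) = nrm2 (\<lambda>z. (1 / h k) *\<^sub>R (\<eta> z *\<^sub>R r k z))"
      unfolding nrm2_scaleR using h(1)[of k] by simp
    also have "(\<lambda>z. (1 / h k) *\<^sub>R (\<eta> z *\<^sub>R r k z)) = (\<lambda>z. \<eta> z *\<^sub>R ((1 / h k) *\<^sub>R r k z))" by (simp add: mult.commute)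
    finally show ?thesis .
  qed
  have bound: "nrm2 (\<lambda>z. indicator A z *\<^sub>R (Hk k z - H z)) \<le> ?c k + C * (nrm2 (\<lambda>z. fk k z - f z) + nrm2 (\<lambda>z. gk k z - g z)
    + (nrm2 (\<lambda>z. \<eta> z *\<^sub>R ((1 / h k) *\<^sub>R r' k z)) + 2 * \<Theta> * ?c k)) + ?c k" for k
  proof -
    have [measurable]: "A \<in> sets borel" using A(1) by (simp add: compact_imp_closed)
    have LHH: "L2 (\<lambda>z. \<eta> z *\<^sub>R (Hk k z - H z))" unfolding scaleR_diff_right by (intro L2_diff L\<eta>H)
    have LDD: "L2 (\<lambda>z. \<eta> z *\<^sub>R (D k (gk k) z - D k g z))" by (intro L\<eta> L2_diff LD Lk L)
    have "nrm2 (\<lambda>z. indicator A z *\<^sub>R (Hk k z - H z)) \<le> 1 * nrm2 (\<lambda>z. \<eta> z *\<^sub>R (Hk k z - H z))"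
    proof (rule L2_dominated(2)[OF LHH])
      have "norm (indicator A z *\<^sub>R (Hk k z - H z)) \<le> 1 * norm (\<eta> z *\<^sub>R (Hk k z - H z))" for z
        using mult_right_mono[OF \<eta>1[of z] norm_ge_zero[of "Hk k z - H z"]] \<eta>1[of z] by (cases "z \<in> A") auto
      then show "AE z in lborel. norm (indicator A z *\<^sub>R (Hk k z - H z)) \<le> 1 * norm (\<eta> z *\<^sub>R (Hk k z - H z))" by simp
    qed auto
    also have "(\<lambda>z. \<eta> z *\<^sub>R (Hk k z - H z)) = (\<lambda>z. (\<eta> z *\<^sub>R (D k (gk k) z - D k g z) + \<eta> z *\<^sub>R (D k g z - H z)) - \<eta> z *\<^sub>R (D k (gk k) z - Hk k z))"
      by (auto simp: algebra_simps)
    also have "1 * nrm2 \<dots> \<le> (nrm2 (\<lambda>z. \<eta> z *\<^sub>R (D k (gk k) z - D k g z)) + nrm2 (\<lambda>z. \<eta> z *\<^sub>R (D k g z - H z)))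
       + nrm2 (\<lambda>z. \<eta> z *\<^sub>R (D k (gk k) z - Hk k z))"
      unfolding mult_1_left
      by (rule order_trans[OF nrm2_triangle_diff[OF L2_add[OF LDD L\<eta>DH(1)] L\<eta>DH(2)] add_right_mono[OF nrm2_triangle[OF LDD L\<eta>DH(1)]]])
    finally have 1: "nrm2 (\<lambda>z. indicator A z *\<^sub>R (Hk k z - H z)) \<le> nrm2 (\<lambda>z. \<eta> z *\<^sub>R (D k (gk k) z - D k g z))
      + nrm2 (\<lambda>z. \<eta> z *\<^sub>R (D k g z - H z)) + nrm2 (\<lambda>z. \<eta> z *\<^sub>R (D k (gk k) z - Hk k z))" .
    have 2: "nrm2 (\<lambda>z. \<eta> z *\<^sub>R (D k g z - H z)) \<le> ?c k" "nrm2 (\<lambda>z. \<eta> z *\<^sub>R (D k (gk k) z - Hk k z)) \<le> ?c k"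
      using h(4,5)[of k] unfolding D_def by auto
    have 3: "C * (nrm2 (\<lambda>z. fk k z - f z) + nrm2 (\<lambda>z. gk k z - g z) + nrm2 (\<lambda>z. \<eta> z *\<^sub>R ((1 / h k) *\<^sub>R r k z)))
      \<le> C * (nrm2 (\<lambda>z. fk k z - f z) + nrm2 (\<lambda>z. gk k z - g z) + (nrm2 (\<lambda>z. \<eta> z *\<^sub>R ((1 / h k) *\<^sub>R r' k z)) + 2 * \<Theta> * ?c k))"
      using C0 rle[of k] by (intro mult_left_mono add_left_mono)
    from 1 2 3 main[of k] show ?thesis by linarith
  qed
  have "(\<lambda>k. ?c k + C * (nrm2 (\<lambda>z. fk k z - f z) + nrm2 (\<lambda>z. gk k z - g z)
    + (nrm2 (\<lambda>z. \<eta> z *\<^sub>R ((1 / h k) *\<^sub>R r' k z)) + 2 * \<Theta> * ?c k)) + ?c k) \<longlonglongrightarrow> 0 + C * (0 + 0 + (0 + 2 * \<Theta> * 0)) + 0"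
    by (intro tendsto_add tendsto_mult tendsto_const c0 conv r'0)
  then show ?thesis
    by (intro Lim_null_comparison[of "\<lambda>k. nrm2 (\<lambda>z. indicator A z *\<^sub>R (Hk k z - H z))", OF always_eventually[OF allI]])
       (use bound in auto)
qed

section \<open>Borel representatives\<close>

text \<open>Lebesgue measure is complete.\<close>

lemma lebesgue_measurable_AE_cong:
  assumes f: "f \<in> measurable lebesgue N" and eq: "AE x in lborel. g x = f x" and g: "\<And>x. g x \<in> space N"
  shows "g \<in> measurable lebesgue N"
proof (rule measurableI)
  fix A assume A: "A \<in> sets N"
  have s: "f -` A \<inter> space lebesgue \<in> sets lebesgue" by (rule measurable_sets[OF f A])
  show "g -` A \<inter> space lebesgue \<in> sets lebesgue"
  proof (rule completion.in_sets_AE[OF _ s])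
    show "AE x in lebesgue. x \<in> f -` A \<inter> space lebesgue \<longleftrightarrow> x \<in> g -` A \<inter> space lebesgue"
      using AE_completion[OF eq] by eventually_elim auto
  qed simp
qed (rule g)

text \<open>\<open>u'\<close> is a Borel function on the whole space that represents the function \<open>u\<close> on \<open>S\<close>. All weak notions are
  transferred to such representatives, which can be sliced, translated and integrated with respect to
  Borel measure.\<close>

definition borel_rep :: "'a::euclidean_space set \<Rightarrow> ('a \<Rightarrow> 'b::euclidean_space) \<Rightarrow> ('a \<Rightarrow> 'b) \<Rightarrow> bool" where
  "borel_rep S u u' \<longleftrightarrow> u' \<in> borel_measurable borel \<and> (\<forall>x. x \<notin> S \<longrightarrow> u' x = 0) \<and>
     (AE x in lborel. x \<in> S \<longrightarrow> u x = u' x)"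

lemma borel_rep_measurable [measurable_dest]: "borel_rep S u u' \<Longrightarrow> u' \<in> borel_measurable borel"
  by (simp add: borel_rep_def)

lemma borel_rep_cong:
  assumes "borel_rep S h h'" "f' \<in> borel_measurable borel" "\<And>x. x \<notin> S \<Longrightarrow> f' x = 0" "\<And>x. x \<in> S \<Longrightarrow> h x = h' x \<Longrightarrow> f x = f' x"
  shows "borel_rep S f f'"
proof -
  have "AE x in lborel. x \<in> S \<longrightarrow> h x = h' x" using assms by (simp add: borel_rep_def)
  then have "AE x in lborel. x \<in> S \<longrightarrow> f x = f' x" by (rule AE_mp) (rule AE_I2, use assms(4) in blast)
  then show ?thesis using assms(2,3) by (simp add: borel_rep_def)
qed

lemma borel_rep_exists:
  fixes u :: "'a::euclidean_space \<Rightarrow> 'b::euclidean_space"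
  assumes u: "u \<in> borel_measurable (lebesgue_on S)" and S: "S \<in> sets borel"
  obtains u' where "borel_rep S u u'"
proof -
  have Sl: "S \<inter> space lebesgue \<in> sets lebesgue" using S by auto
  have m: "(\<lambda>x. indicator S x *\<^sub>R u x) \<in> borel_measurable lebesgue"
    using u borel_measurable_restrict_space_iff[OF Sl, of u] by simp
  have "\<exists>g. g \<in> borel_measurable lborel \<and> (AE x in lborel. (indicator S x *\<^sub>R u x) \<bullet> b = g x)" for b
  proof -
    have "(\<lambda>x. (indicator S x *\<^sub>R u x) \<bullet> b) \<in> borel_measurable lebesgue" using m by (rule borel_measurable_inner) simp
    from completion_ex_borel_measurable_real[OF this] show ?thesis by auto
  qed
  then obtain g where g: "\<And>b. g b \<in> borel_measurable lborel"
    "\<And>b. AE x in lborel. (indicator S x *\<^sub>R u x) \<bullet> b = g b x" by metis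
  have g'[measurable]: "g b \<in> borel_measurable borel" for b using g(1)[of b] by simp
  define u' where "u' x = indicator S x *\<^sub>R (\<Sum>b\<in>Basis. g b x *\<^sub>R b)" for x
  have "AE x in lborel. \<forall>b\<in>(Basis::'b set). (indicator S x *\<^sub>R u x) \<bullet> b = g b x"
    using g(2) by (intro AE_finite_allI) auto
  then have "AE x in lborel. x \<in> S \<longrightarrow> u x = u' x"
  proof eventually_elim
    case (elim x)
    show ?case
    proof
      assume x: "x \<in> S"
      have "u x = (\<Sum>b\<in>Basis. (u x \<bullet> b) *\<^sub>R b)" by (simp add: euclidean_representation)
      also have "\<dots> = (\<Sum>b\<in>Basis. g b x *\<^sub>R b)" using elim x by (intro sum.cong) auto
      finally show "u x = u' x" using x by (simp add: u'_def)
    qed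
  qed
  moreover have "u' \<in> borel_measurable borel" unfolding u'_def using S by measurable
  ultimately show thesis by (intro that[of u']) (auto simp: borel_rep_def u'_def)
qed

text \<open>Equality almost everywhere determines measurability and integrals, because Lebesgue measure is the
  completion of Borel measure.\<close>

lemma borel_rep_integral:
  fixes h h' :: "'a::euclidean_space \<Rightarrow> 'b::euclidean_space"
  assumes h: "borel_rep S h h'" and S: "S \<in> sets borel"
  shows "h \<in> borel_measurable (lebesgue_on S)" "(LINT x|lebesgue_on S. h x) = (\<integral>x. h' x \<partial>lborel)"
    "integrable (lebesgue_on S) h \<longleftrightarrow> integrable lborel h'"
proof -
  have Sl: "S \<inter> space lebesgue \<in> sets lebesgue" using S by auto
  have m: "h' \<in> borel_measurable borel" using h by (simp add: borel_rep_def)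
  have ml: "h' \<in> borel_measurable lborel" using m by simp
  have mc: "h' \<in> borel_measurable lebesgue" using ml by (rule measurable_completion)
  have ae: "AE x in lborel. indicator S x *\<^sub>R h x = h' x"
  proof -
    have "AE x in lborel. x \<in> S \<longrightarrow> h x = h' x" using h by (simp add: borel_rep_def)
    then show ?thesis by (rule AE_mp) (rule AE_I2, use h in \<open>auto simp: indicator_def borel_rep_def\<close>)
  qed
  have mh: "(\<lambda>x. indicator S x *\<^sub>R h x) \<in> borel_measurable lebesgue"
    by (rule lebesgue_measurable_AE_cong[OF mc ae]) simp
  then show "h \<in> borel_measurable (lebesgue_on S)"
    using borel_measurable_restrict_space_iff[OF Sl, of h] by simp
  have "(LINT x|lebesgue_on S. h x) = (LINT x|lebesgue. indicator S x *\<^sub>R h x)"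
    by (rule integral_restrict_space[OF Sl])
  also have "\<dots> = (LINT x|lebesgue. h' x)" by (rule integral_cong_AE[OF mh mc AE_completion[OF ae]])
  also have "\<dots> = (\<integral>x. h' x \<partial>lborel)" by (rule integral_completion[OF ml])
  finally show "(LINT x|lebesgue_on S. h x) = (\<integral>x. h' x \<partial>lborel)" .
  have "integrable (lebesgue_on S) h \<longleftrightarrow> integrable lebesgue (\<lambda>x. indicator S x *\<^sub>R h x)"
    by (rule integrable_restrict_space[OF Sl])
  also have "\<dots> \<longleftrightarrow> integrable lebesgue h'" by (rule integrable_cong_AE[OF mh mc AE_completion[OF ae]])
  also have "\<dots> \<longleftrightarrow> integrable lborel h'" by (rule integrable_completion[OF ml])
  finally show "integrable (lebesgue_on S) h \<longleftrightarrow> integrable lborel h'" .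
qed

lemma borel_rep_mult:
  fixes \<phi> :: "'a::euclidean_space \<Rightarrow> real"
  assumes h: "borel_rep S h h'" and m[measurable]: "\<phi> \<in> borel_measurable borel"
  shows "borel_rep S (\<lambda>x. \<phi> x *\<^sub>R h x) (\<lambda>x. \<phi> x *\<^sub>R h' x)"
proof -
  have [measurable]: "h' \<in> borel_measurable borel" by (rule borel_rep_measurable[OF h])
  show ?thesis by (rule borel_rep_cong[OF h]) (use h in \<open>auto simp: borel_rep_def\<close>)
qed

lemma borel_rep_norm_sq:
  assumes h: "borel_rep S h h'" shows "borel_rep S (\<lambda>x. (norm (h x))\<^sup>2) (\<lambda>x. (norm (h' x))\<^sup>2)"
proof -
  have [measurable]: "h' \<in> borel_measurable borel" by (rule borel_rep_measurable[OF h])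
  show ?thesis by (rule borel_rep_cong[OF h]) (use h in \<open>auto simp: borel_rep_def\<close>)
qed

lemma borel_rep_diff:
  assumes h: "borel_rep S h h'" and f: "borel_rep S f f'"
  shows "borel_rep S (\<lambda>x. h x - f x) (\<lambda>x. h' x - f' x)"
proof -
  have a: "AE x in lborel. x \<in> S \<longrightarrow> h x = h' x" "AE x in lborel. x \<in> S \<longrightarrow> f x = f' x"
    using assms by (auto simp: borel_rep_def)
  have "AE x in lborel. x \<in> S \<longrightarrow> h x - f x = h' x - f' x" using a(1) a(2) by eventually_elim auto
  then show ?thesis using assms by (auto simp: borel_rep_def)
qed

lemma borel_rep_linear:
  assumes T: "bounded_linear T" and h: "borel_rep S h h'"
  shows "borel_rep S (\<lambda>x. T (h x)) (\<lambda>x. T (h' x))"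
proof (rule borel_rep_cong[OF h])
  have "T \<in> borel_measurable borel"
    by (intro borel_measurable_continuous_onI linear_continuous_on T)
  then show "(\<lambda>x. T (h' x)) \<in> borel_measurable borel" by (rule measurable_compose[OF borel_rep_measurable[OF h]])
qed (use h linear_0[OF bounded_linear.linear[OF T]] in \<open>auto simp: borel_rep_def\<close>)

lemma borel_rep_subset:
  assumes "borel_rep S h h'" "K \<subseteq> S" "K \<in> sets borel"
  shows "borel_rep K h (\<lambda>x. indicator K x *\<^sub>R h' x)"
proof -
  have "AE x in lborel. x \<in> S \<longrightarrow> h x = h' x" using assms by (simp add: borel_rep_def)
  then have "AE x in lborel. x \<in> K \<longrightarrow> h x = indicator K x *\<^sub>R h' x"
    by (rule AE_mp) (rule AE_I2, use assms(2) in auto)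
  moreover have "(\<lambda>x. indicator K x *\<^sub>R h' x) \<in> borel_measurable borel"
    using borel_rep_measurable[OF assms(1)] assms(3) by measurable
  ultimately show ?thesis by (simp add: borel_rep_def)
qed

lemma borel_rep_unique:
  assumes "borel_rep S h h'" "borel_rep S h h''"
  shows "AE x in lborel. h' x = h'' x"
proof -
  have a: "AE x in lborel. x \<in> S \<longrightarrow> h x = h' x" "AE x in lborel. x \<in> S \<longrightarrow> h x = h'' x"
    using assms by (auto simp: borel_rep_def)
  show ?thesis using a(1) a(2)
  proof eventually_elim
    case (elim x) then show ?case using assms by (cases "x \<in> S") (auto simp: borel_rep_def)
  qed
qed

lemma L2_on_iff:
  assumes "borel_rep S h h'" "S \<in> sets borel"
  shows "L2_on S h \<longleftrightarrow> L2 h'"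
  using borel_rep_integral[OF assms] borel_rep_integral[OF borel_rep_norm_sq[OF assms(1)] assms(2)]
    borel_rep_measurable[OF assms(1)] by (simp add: L2_on_def L2_def)

lemma norm_sq_integral_eq:
  assumes "borel_rep S h h'" "S \<in> sets borel"
  shows "(LINT x|lebesgue_on S. (norm (h x))\<^sup>2) = (nrm2 h')\<^sup>2"
  using borel_rep_integral(2)[OF borel_rep_norm_sq[OF assms(1)] assms(2)] by (simp add: nrm2_sq)

lemma locally_integrable_iff:
  assumes h: "borel_rep S h h'" and S: "open S"
  shows "locally_integrable_on S h \<longleftrightarrow> (\<forall>K. compact K \<longrightarrow> K \<subseteq> S \<longrightarrow> integrable lborel (\<lambda>x. indicator K x *\<^sub>R h' x))"
proof -
  have "h absolutely_integrable_on K \<longleftrightarrow> integrable lborel (\<lambda>x. indicator K x *\<^sub>R h' x)" if K: "compact K" "K \<subseteq> S" for K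
  proof -
    have Kb: "K \<in> sets borel" using K by (simp add: borel_compact)
    have Kl: "K \<inter> space lebesgue \<in> sets lebesgue" using Kb by auto
    have "h absolutely_integrable_on K \<longleftrightarrow> integrable (lebesgue_on K) h"
      unfolding set_integrable_def by (rule integrable_restrict_space[OF Kl, symmetric])
    also have "\<dots> \<longleftrightarrow> integrable lborel (\<lambda>x. indicator K x *\<^sub>R h' x)"
      by (rule borel_rep_integral(3)[OF borel_rep_subset[OF h K(2) Kb] Kb])
    finally show ?thesis .
  qed
  then show ?thesis unfolding locally_integrable_on_def by auto
qed

text \<open>A locally integrable function is the limit of its restrictions to an exhaustion by compact sets.\<close>

lemma locally_integrable_borel_rep:
  fixes h :: "'a::euclidean_space \<Rightarrow> 'b::euclidean_space"
  assumes h: "locally_integrable_on S h" and S: "open S"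
  obtains h' where "borel_rep S h h'"
proof -
  obtain C where C: "\<And>n. compact (C n)" "\<And>n. C n \<subseteq> S" "\<And>n. C n \<subseteq> interior (C (Suc n))" "\<Union>(range C) = S"
    using open_Union_compact_subsets[OF S] by metis
  have m: "(\<lambda>x. indicator (C n) x *\<^sub>R h x) \<in> borel_measurable lebesgue" for n
    using h C unfolding locally_integrable_on_def set_integrable_def by (auto intro: borel_measurable_integrable)
  have inc: "C n \<subseteq> C (n + k)" for n k
  proof (induction k)
    case (Suc k)
    have "C (n + k) \<subseteq> C (Suc (n + k))" using C(3)[of "n + k"] interior_subset by blast
    then show ?case using Suc by auto
  qed simp
  have "(\<lambda>n. indicator (C n) x *\<^sub>R h x) \<longlonglongrightarrow> indicator S x *\<^sub>R h x" for x
  proof (cases "x \<in> S")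
    case True
    then obtain n0 where n0: "x \<in> C n0" using C(4) by auto
    have "indicator (C n) x *\<^sub>R h x = indicator S x *\<^sub>R h x" if "n \<ge> n0" for n
      using inc[of n0 "n - n0"] n0 that True by (auto simp: indicator_def)
    then have "eventually (\<lambda>n. indicator (C n) x *\<^sub>R h x = indicator S x *\<^sub>R h x) sequentially"
      unfolding eventually_sequentially by blast
    then show ?thesis by (rule tendsto_eventually)
  next
    case False
    then have "x \<notin> C n" for n using C(2) by auto
    then show ?thesis using False by simp
  qed
  then have "(\<lambda>x. indicator S x *\<^sub>R h x) \<in> borel_measurable lebesgue"
    by (intro borel_measurable_LIMSEQ_metric[OF m]) 
  moreover have Sl: "S \<inter> space lebesgue \<in> sets lebesgue" using S by auto
  ultimately have "h \<in> borel_measurable (lebesgue_on S)"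
    using borel_measurable_restrict_space_iff[OF Sl, of h] by simp
  then show thesis by (rule borel_rep_exists) (use S that in auto)
qed

section \<open>Weak derivatives through Borel representatives\<close>

lemma test_fun_mult_local_integrable:
  fixes \<phi> :: "'a::euclidean_space \<Rightarrow> real" and g :: "'a \<Rightarrow> 'b::euclidean_space"
  assumes \<phi>: "test_fun S \<phi>" and [measurable]: "g \<in> borel_measurable borel"
    and g: "\<And>K. compact K \<Longrightarrow> K \<subseteq> S \<Longrightarrow> integrable lborel (\<lambda>x. indicator K x *\<^sub>R g x)"
  shows "integrable lborel (\<lambda>x. \<phi> x *\<^sub>R g x)"
proof -
  obtain K where K: "compact K" "K \<subseteq> S" "\<And>x. x \<notin> K \<Longrightarrow> \<phi> x = 0" using test_funE[OF \<phi>] by metis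
  have "integrable lborel (\<lambda>x. \<phi> x *\<^sub>R (indicator K x *\<^sub>R g x))"
    by (rule test_fun_scaleR_integrable[OF \<phi> g[OF K(1,2)]])
  moreover have "(\<lambda>x. \<phi> x *\<^sub>R (indicator K x *\<^sub>R g x)) = (\<lambda>x. \<phi> x *\<^sub>R g x)"
  proof
    fix x show "\<phi> x *\<^sub>R (indicator K x *\<^sub>R g x) = \<phi> x *\<^sub>R g x" using K(3)[of x] by (cases "x \<in> K") auto
  qed
  ultimately show ?thesis by simp
qed

lemma has_weak_deriv_iff:
  assumes u: "borel_rep S u u'" and g: "borel_rep S g g'" and S: "open S" and b: "b \<in> Basis"
  shows "has_weak_deriv S b u g \<longleftrightarrow>
    locally_integrable_on S u \<and> locally_integrable_on S g \<and> distr_deriv S b u' g'"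
proof -
  have Sb: "S \<in> sets borel" using S by simp
  have "(LINT x|lebesgue_on S. partial b \<phi> x *\<^sub>R u x) = (\<integral>x. partial b \<phi> x *\<^sub>R u' x \<partial>lborel)"
    "(LINT x|lebesgue_on S. \<phi> x *\<^sub>R g x) = (\<integral>x. \<phi> x *\<^sub>R g' x \<partial>lborel)" if \<phi>: "test_fun S \<phi>" for \<phi> :: "'a \<Rightarrow> real"
    using borel_rep_integral(2)[OF borel_rep_mult[OF u test_fun_measurable[OF test_fun_partial[OF \<phi> b]]] Sb]
      borel_rep_integral(2)[OF borel_rep_mult[OF g test_fun_measurable[OF \<phi>]] Sb] by auto
  then show ?thesis unfolding has_weak_deriv_def distr_deriv_def by auto
qed

lemma has_weak_deriv_unique:
  assumes h: "has_weak_deriv S b u g" "has_weak_deriv S b u h" and S: "open S" and b: "b \<in> Basis"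
    and g: "borel_rep S g g'"
  shows "borel_rep S h g'"
proof -
  have li: "locally_integrable_on S u" "locally_integrable_on S g" "locally_integrable_on S h"
    using h by (auto simp: has_weak_deriv_def)
  obtain u' where u: "borel_rep S u u'" by (rule locally_integrable_borel_rep[OF li(1) S])
  obtain h' where h': "borel_rep S h h'" by (rule locally_integrable_borel_rep[OF li(3) S])
  note gi = li(2)[unfolded locally_integrable_iff[OF g S], rule_format]
  note hi = li(3)[unfolded locally_integrable_iff[OF h' S], rule_format]
  have [measurable]: "g' \<in> borel_measurable borel" "h' \<in> borel_measurable borel"
    using g h' by (auto simp: borel_rep_def)
  have D: "distr_deriv S b u' g'" "distr_deriv S b u' h'"
    using h has_weak_deriv_iff[OF u g S b] has_weak_deriv_iff[OF u h' S b] by auto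
  have "AE x in lborel. x \<in> S \<longrightarrow> g' x - h' x = 0"
  proof (rule fundamental_lemma[OF S])
    fix K :: "'a set" assume K: "compact K" "K \<subseteq> S"
    show "integrable lborel (\<lambda>x. indicator K x *\<^sub>R (g' x - h' x))"
      using Bochner_Integration.integrable_diff[OF gi[OF K] hi[OF K]] by (simp add: scaleR_diff_right)
  next
    fix \<phi> :: "'a \<Rightarrow> real" assume \<phi>: "test_fun S \<phi>"
    have "integrable lborel (\<lambda>x. \<phi> x *\<^sub>R g' x)" by (rule test_fun_mult_local_integrable[OF \<phi> _ gi]) auto
    moreover have "integrable lborel (\<lambda>x. \<phi> x *\<^sub>R h' x)" by (rule test_fun_mult_local_integrable[OF \<phi> _ hi]) auto
    ultimately show "(\<integral>x. \<phi> x *\<^sub>R (g' x - h' x) \<partial>lborel) = 0"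
      using distr_derivD[OF D(1) \<phi>] distr_derivD[OF D(2) \<phi>] by (simp add: scaleR_diff_right)
  qed
  moreover have "AE x in lborel. x \<in> S \<longrightarrow> h x = h' x" using h' by (simp add: borel_rep_def)
  ultimately have "AE x in lborel. x \<in> S \<longrightarrow> h x = g' x" by eventually_elim auto
  then show ?thesis using g by (auto simp: borel_rep_def)
qed

text \<open>The chosen weak derivative agrees almost everywhere with every other one.\<close>

lemma weak_deriv_rep:
  assumes h: "has_weak_deriv S b u g" and S: "open S" "b \<in> Basis" and g: "borel_rep S g g'"
  shows "borel_rep S (weak_deriv S b u) g'" "has_weak_deriv S b u (weak_deriv S b u)"
proof -
  show *: "has_weak_deriv S b u (weak_deriv S b u)" unfolding weak_deriv_def by (rule someI[where P = "has_weak_deriv S b u", OF h])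
  show "borel_rep S (weak_deriv S b u) g'" by (rule has_weak_deriv_unique[OF h * S g])
qed

lemma L2_indicator_integrable:
  assumes "L2 u" "compact K" shows "integrable lborel (\<lambda>x. indicator K x *\<^sub>R u x)"
proof (rule L2_finite_support_integrable(1))
  show "L2 (\<lambda>x. indicator K x *\<^sub>R u x)" using assms by (intro L2_indicator_mult borel_compact)
  show "K \<in> fmeasurable lborel" using assms by (rule_tac fmeasurable_compact)
qed auto

lemma L2_locally_integrable:
  assumes "borel_rep S u u'" "L2 u'" "open S" shows "locally_integrable_on S u"
  using L2_indicator_integrable[OF assms(2)] by (simp add: locally_integrable_iff[OF assms(1,3)])

section \<open>Sobolev functions and test functions\<close>

lemma partial_bounded_linear:
  assumes T: "bounded_linear T" and f: "f differentiable (at x)"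
  shows "partial b (\<lambda>x. T (f x)) x = T (partial b f x)"
proof -
  have "(f has_derivative frechet_derivative f (at x)) (at x)" using f by (simp add: frechet_derivative_works)
  from bounded_linear.has_derivative[OF T this] show ?thesis
    by (simp add: partial_has_derivative) (simp add: partial_def)
qed

lemma Ck_on_bounded_linear: "bounded_linear T \<Longrightarrow> Ck_on k UNIV f \<Longrightarrow> Ck_on k UNIV (\<lambda>x. T (f x))"
proof (induction k arbitrary: f)
  case 0 then show ?case using bounded_linear.continuous_on by (auto simp: o_def)
next
  case (Suc k)
  have "partial b (\<lambda>x. T (f x)) = (\<lambda>x. T (partial b f x))" for b
    using Suc.prems by (intro ext partial_bounded_linear) auto
  moreover have "(\<lambda>x. T (f x)) differentiable (at x)" for x
  proof -
    have "(f has_derivative frechet_derivative f (at x)) (at x)" using Suc.prems by (simp add: frechet_derivative_works)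
    from bounded_linear.has_derivative[OF Suc.prems(1) this] show ?thesis unfolding differentiable_def by blast
  qed
  ultimately show ?case using Suc by auto
qed

lemma test_fun_bounded_linear:
  assumes T: "bounded_linear T" and f: "test_fun S f" shows "test_fun S (\<lambda>x. T (f x))"
proof -
  obtain K where K: "compact K" "K \<subseteq> S" "\<And>x. x \<notin> K \<Longrightarrow> f x = 0" using test_funE[OF f] by metis
  show ?thesis
    using test_fun_smooth[OF f] K(3) linear_0[OF bounded_linear.linear[OF T]]
    by (intro test_funI[OF _ K(1,2)]) (auto simp: smooth_on_def intro: Ck_on_bounded_linear[OF T])
qed

text \<open>Difference quotients can be moved from one factor to the other by a translation; both sides are limits
  of difference quotients with opposite increments.\<close>

lemma test_fun_integral_by_parts_real:
  fixes f \<phi> :: "'a::euclidean_space \<Rightarrow> real"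
  assumes f: "test_fun UNIV f" and \<phi>: "test_fun UNIV \<phi>" and e: "e \<in> Basis"
  shows "(\<integral>x. partial e \<phi> x * f x \<partial>lborel) = - (\<integral>x. \<phi> x * partial e f x \<partial>lborel)"
proof -
  define h where "h n = 1 / real (Suc n)" for n
  have h: "h \<longlonglongrightarrow> 0" unfolding h_def by (rule LIMSEQ_Suc[OF lim_inverse_n'])
  have h0: "h \<longlonglongrightarrow> 0" "h n \<noteq> 0" "(\<lambda>n. - h n) \<longlonglongrightarrow> 0" "- h n \<noteq> 0" for n
    using h tendsto_minus[OF h] by (simp_all add: h_def del: of_nat_Suc)
  have [measurable]: "f \<in> borel_measurable borel" "\<phi> \<in> borel_measurable borel" using f \<phi> by (auto intro: test_fun_measurable)
  have i: "integrable lborel f" "integrable lborel \<phi>" using f \<phi> by (auto intro: test_fun_integrable)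
  have A: "(\<lambda>n. \<integral>z. ((\<phi> (z - h n *\<^sub>R e) - \<phi> z) / h n) *\<^sub>R f z \<partial>lborel) \<longlonglongrightarrow> - (\<integral>z. partial e \<phi> z *\<^sub>R f z \<partial>lborel)"
    by (rule test_fun_difference_quotient_tendsto[OF \<phi> e i(1) h0(1,2)])
  have B: "(\<lambda>n. \<integral>z. ((f (z - (- h n) *\<^sub>R e) - f z) / (- h n)) *\<^sub>R \<phi> z \<partial>lborel) \<longlonglongrightarrow> - (\<integral>z. partial e f z *\<^sub>R \<phi> z \<partial>lborel)"
    by (rule test_fun_difference_quotient_tendsto[OF f e i(2) h0(3,4)])
  have E: "(\<integral>z. ((\<phi> (z - h n *\<^sub>R e) - \<phi> z) / h n) *\<^sub>R f z \<partial>lborel) =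
    - (\<integral>z. ((f (z - (- h n) *\<^sub>R e) - f z) / (- h n)) *\<^sub>R \<phi> z \<partial>lborel)" for n
  proof -
    have t: "test_fun UNIV (\<lambda>z. \<phi> (z - h n *\<^sub>R e))" using test_fun_shift[OF \<phi>, of "- h n *\<^sub>R e" UNIV] by simp
    have t': "test_fun UNIV (\<lambda>z. f (z + h n *\<^sub>R e))" using test_fun_shift[OF f, of "h n *\<^sub>R e" UNIV] by simp
    have j: "integrable lborel (\<lambda>z. \<phi> (z - h n *\<^sub>R e) * f z)" "integrable lborel (\<lambda>z. \<phi> z * f z)"
      "integrable lborel (\<lambda>z. f (z + h n *\<^sub>R e) * \<phi> z)"
      using test_fun_scaleR_integrable[OF t i(1)] test_fun_scaleR_integrable[OF \<phi> i(1)]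
        test_fun_scaleR_integrable[OF t' i(2)] by simp_all
    have s: "(\<integral>z. \<phi> (z - h n *\<^sub>R e) * f z \<partial>lborel) = (\<integral>z. f (z + h n *\<^sub>R e) * \<phi> z \<partial>lborel)"
      using integral_shift(1)[of "\<lambda>z. \<phi> (z - h n *\<^sub>R e) * f z" "h n *\<^sub>R e"] by (simp add: mult.commute)
    have "(\<integral>z. ((\<phi> (z - h n *\<^sub>R e) - \<phi> z) / h n) *\<^sub>R f z \<partial>lborel)
      = (\<integral>z. (1 / h n) * (\<phi> (z - h n *\<^sub>R e) * f z - \<phi> z * f z) \<partial>lborel)"
      by (intro Bochner_Integration.integral_cong) (auto simp: field_simps)
    also have "\<dots> = (1 / h n) * ((\<integral>z. \<phi> (z - h n *\<^sub>R e) * f z \<partial>lborel) - (\<integral>z. \<phi> z * f z \<partial>lborel))"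
      using j by simp
    also have "\<dots> = (1 / h n) * ((\<integral>z. f (z + h n *\<^sub>R e) * \<phi> z \<partial>lborel) - (\<integral>z. \<phi> z * f z \<partial>lborel))" by (simp only: s)
    also have "\<dots> = (\<integral>z. (1 / h n) * (f (z + h n *\<^sub>R e) * \<phi> z - \<phi> z * f z) \<partial>lborel)"
      using j by simp
    also have "\<dots> = (\<integral>z. - (((f (z - (- h n) *\<^sub>R e) - f z) / (- h n)) *\<^sub>R \<phi> z) \<partial>lborel)"
      using h0(2)[of n] by (intro Bochner_Integration.integral_cong) (auto simp: field_simps)
    finally show ?thesis by simp
  qed
  have "(\<lambda>n. - (\<integral>z. ((f (z - (- h n) *\<^sub>R e) - f z) / (- h n)) *\<^sub>R \<phi> z \<partial>lborel)) \<longlonglongrightarrow> - (\<integral>z. partial e \<phi> z *\<^sub>R f z \<partial>lborel)"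
    using A unfolding E .
  from LIMSEQ_unique[OF this tendsto_minus[OF B]] show ?thesis by (simp add: mult.commute)
qed

lemma test_fun_distr_deriv:
  fixes f :: "'a::euclidean_space \<Rightarrow> 'b::euclidean_space"
  assumes f: "test_fun S f" and e: "e \<in> Basis"
  shows "distr_deriv S e f (partial e f)"
  unfolding distr_deriv_def
proof (intro allI impI, rule euclidean_eqI)
  fix \<phi> :: "'a \<Rightarrow> real" and b :: 'b
  assume \<phi>S: "test_fun S \<phi>" and b: "b \<in> Basis"
  have \<phi>: "test_fun UNIV \<phi>" and fU: "test_fun UNIV f"
    by (rule test_fun_mono[OF \<phi>S subset_UNIV], rule test_fun_mono[OF f subset_UNIV])
  have T: "bounded_linear (\<lambda>y. y \<bullet> b)" by (rule bounded_linear_inner_left)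
  have p: "partial e (\<lambda>x. f x \<bullet> b) = (\<lambda>x. partial e f x \<bullet> b)"
    by (intro ext partial_bounded_linear[OF T] smooth_on_differentiable test_fun_smooth[OF f])
  have i: "integrable lborel (\<lambda>x. partial e \<phi> x *\<^sub>R f x)" "integrable lborel (\<lambda>x. \<phi> x *\<^sub>R partial e f x)"
    by (rule test_fun_scaleR_integrable[OF test_fun_partial[OF \<phi> e] test_fun_integrable[OF f]])
       (rule test_fun_scaleR_integrable[OF \<phi> test_fun_integrable[OF test_fun_partial[OF f e]]])
  have "(\<integral>x. partial e \<phi> x * (f x \<bullet> b) \<partial>lborel) = - (\<integral>x. \<phi> x * (partial e f x \<bullet> b) \<partial>lborel)"
    using test_fun_integral_by_parts_real[OF test_fun_bounded_linear[OF T fU] \<phi> e] by (simp add: p)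
  moreover have "(\<integral>x. (partial e \<phi> x *\<^sub>R f x) \<bullet> b \<partial>lborel) = (\<integral>x. partial e \<phi> x *\<^sub>R f x \<partial>lborel) \<bullet> b"
    by (rule integral_inner_left) (rule i(1))
  moreover have "(\<integral>x. (\<phi> x *\<^sub>R partial e f x) \<bullet> b \<partial>lborel) = (\<integral>x. \<phi> x *\<^sub>R partial e f x \<partial>lborel) \<bullet> b"
    by (rule integral_inner_left) (rule i(2))
  ultimately show "(\<integral>x. partial e \<phi> x *\<^sub>R f x \<partial>lborel) \<bullet> b = - (\<integral>x. \<phi> x *\<^sub>R partial e f x \<partial>lborel) \<bullet> b"
    by (simp only: inner_scaleR_left inner_minus_left)
qed

text \<open>Borel representatives of a function in \<open>W\<^sup>1\<^sup>,\<^sup>2(\<Omega>)\<close> and of its Jacobian, both extended by zero.\<close>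

definition sobolev_rep :: "(real^'n) set \<Rightarrow> (real^'n \<Rightarrow> real^'m) \<Rightarrow> (real^'n \<Rightarrow> real^'m) \<Rightarrow> (real^'n \<Rightarrow> real^'n^'m) \<Rightarrow> bool" where
  "sobolev_rep \<Omega> u u' D \<longleftrightarrow> borel_rep \<Omega> u u' \<and> L2 u' \<and> L2 D \<and> (\<forall>x. x \<notin> \<Omega> \<longrightarrow> D x = 0) \<and>
     (\<forall>j. distr_deriv \<Omega> (axis j 1) u' (\<lambda>x. column j (D x)))"

lemma axis_Basis: "axis j (1::real) \<in> Basis" by (simp add: axis_in_Basis_iff)

lemma sobolev_rep_weak_deriv:
  fixes u :: "real^'n \<Rightarrow> real^'m"
  assumes r: "sobolev_rep \<Omega> u u' D" and S: "open \<Omega>"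
  shows "borel_rep \<Omega> (weak_deriv \<Omega> (axis j 1) u) (\<lambda>x. column j (D x))"
    "has_weak_deriv \<Omega> (axis j 1) u (\<lambda>x. column j (D x))"
proof -
  have L: "L2 (\<lambda>x. column j (D x))" using r by (intro L2_column) (simp add: sobolev_rep_def)
  have b: "borel_rep \<Omega> (\<lambda>x. column j (D x)) (\<lambda>x. column j (D x))"
    using L2_measurable[OF L] r by (auto simp: borel_rep_def sobolev_rep_def column_def vec_eq_iff)
  have u: "borel_rep \<Omega> u u'" "L2 u'" "distr_deriv \<Omega> (axis j 1) u' (\<lambda>x. column j (D x))" using r by (auto simp: sobolev_rep_def)
  show w: "has_weak_deriv \<Omega> (axis j 1) u (\<lambda>x. column j (D x))"
    using u L2_locally_integrable[OF u(1,2) S] L2_locally_integrable[OF b L S]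
    by (simp add: has_weak_deriv_iff[OF u(1) b S axis_Basis])
  show "borel_rep \<Omega> (weak_deriv \<Omega> (axis j 1) u) (\<lambda>x. column j (D x))"
    by (rule weak_deriv_rep[OF w S axis_Basis b])
qed

lemma nrm2_matrix_sq:
  fixes D :: "'a::euclidean_space \<Rightarrow> real^'n^'m"
  assumes "L2 D"
  shows "(nrm2 D)\<^sup>2 = (\<Sum>j\<in>UNIV. (nrm2 (\<lambda>x. column j (D x)))\<^sup>2)"
proof -
  have "(norm M)\<^sup>2 = (\<Sum>j\<in>UNIV. (norm (column j M))\<^sup>2)" for M :: "real^'n^'m"
  proof -
    have "(norm M)\<^sup>2 = (\<Sum>i\<in>UNIV. \<Sum>j\<in>UNIV. M $ i $ j * M $ i $ j)"
      by (simp add: power2_norm_eq_inner inner_vec_def)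
    also have "\<dots> = (\<Sum>j\<in>UNIV. \<Sum>i\<in>UNIV. M $ i $ j * M $ i $ j)" by (rule sum.swap)
    finally show ?thesis by (simp add: power2_norm_eq_inner inner_vec_def column_def)
  qed
  then show ?thesis using L2_integrable[OF L2_column[OF assms]] by (simp add: nrm2_sq)
qed

text \<open>Everything that is defined through the choice of a weak derivative can be read off from representatives.\<close>

lemma sobolev_rep_W12:
  fixes u :: "real^'n \<Rightarrow> real^'m"
  assumes r: "sobolev_rep \<Omega> u u' D" and S: "open \<Omega>"
  shows "W12 \<Omega> u" "(W12_norm \<Omega> u)\<^sup>2 = (nrm2 u')\<^sup>2 + (nrm2 D)\<^sup>2" "borel_rep \<Omega> (weak_D \<Omega> u) D"
proof -
  have Sb: "\<Omega> \<in> sets borel" using S by simp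
  have u: "borel_rep \<Omega> u u'" "L2 u'" "L2 D" and D0: "\<And>x. x \<notin> \<Omega> \<Longrightarrow> D x = 0" using r by (auto simp: sobolev_rep_def)
  note w = sobolev_rep_weak_deriv[OF r S]
  have b: "borel_rep \<Omega> (\<lambda>x. column j (D x)) (\<lambda>x. column j (D x))" for j
    using L2_measurable[OF L2_column[OF u(3)]] D0 by (auto simp: borel_rep_def column_def vec_eq_iff)
  show "W12 \<Omega> u" unfolding W12_def sum_Basis_vec
  proof (intro conjI ballI)
    show "L2_on \<Omega> u" using u L2_on_iff[OF u(1) Sb] by simp
    fix b' :: "real^'n" assume "b' \<in> Basis"
    then obtain j where "b' = axis j 1" by (auto simp: Basis_vec_def)
    then show "\<exists>g. has_weak_deriv \<Omega> b' u g \<and> L2_on \<Omega> g"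
      using w(2)[of j] L2_on_iff[OF b Sb, of j] L2_column[OF u(3), of j] by blast
  qed
  have n: "(LINT x|lebesgue_on \<Omega>. (norm (u x))\<^sup>2) = (nrm2 u')\<^sup>2"
    "(LINT x|lebesgue_on \<Omega>. (norm (weak_deriv \<Omega> (axis j 1) u x))\<^sup>2) = (nrm2 (\<lambda>x. column j (D x)))\<^sup>2" for j
    by (rule norm_sq_integral_eq[OF u(1) Sb], rule norm_sq_integral_eq[OF w(1) Sb])
  have "W12_norm \<Omega> u = sqrt ((nrm2 u')\<^sup>2 + (nrm2 D)\<^sup>2)"
    by (simp add: W12_norm_def sum_Basis_vec n nrm2_matrix_sq[OF u(3)])
  then show "(W12_norm \<Omega> u)\<^sup>2 = (nrm2 u')\<^sup>2 + (nrm2 D)\<^sup>2" by simp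
  have "AE x in lborel. \<forall>j\<in>(UNIV::'n set). x \<in> \<Omega> \<longrightarrow> weak_deriv \<Omega> (axis j 1) u x = column j (D x)"
    using w(1) by (intro AE_finite_allI) (auto simp: borel_rep_def)
  then have "AE x in lborel. x \<in> \<Omega> \<longrightarrow> weak_D \<Omega> u x = D x"
    by (rule AE_mp) (rule AE_I2, auto simp: weak_D_def vec_eq_iff column_def)
  then show "borel_rep \<Omega> (weak_D \<Omega> u) D" using D0 L2_measurable[OF u(3)] by (auto simp: borel_rep_def)
qed

lemma W12_sobolev_rep:
  fixes u :: "real^'n \<Rightarrow> real^'m"
  assumes W: "W12 \<Omega> u" and S: "open \<Omega>"
  obtains u' D where "sobolev_rep \<Omega> u u' D"
proof -
  have Sb: "\<Omega> \<in> sets borel" using S by simp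
  have "u \<in> borel_measurable (lebesgue_on \<Omega>)" using W by (auto simp: W12_def L2_on_def)
  then obtain u' where u: "borel_rep \<Omega> u u'" by (rule borel_rep_exists) (use Sb in auto)
  have uL: "L2 u'" using W L2_on_iff[OF u Sb] by (auto simp: W12_def)
  have "\<exists>g'. borel_rep \<Omega> g' g' \<and> L2 g' \<and> distr_deriv \<Omega> (axis j 1) u' g'" for j
  proof -
    obtain g where g: "has_weak_deriv \<Omega> (axis j 1) u g" "L2_on \<Omega> g" using W axis_Basis[of j] unfolding W12_def by blast
    have "g \<in> borel_measurable (lebesgue_on \<Omega>)" using g by (auto simp: L2_on_def)
    then obtain g' where g': "borel_rep \<Omega> g g'" by (rule borel_rep_exists) (use Sb in auto)
    show ?thesis using g' g L2_on_iff[OF g' Sb] has_weak_deriv_iff[OF u g' S axis_Basis]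
      by (intro exI[of _ g']) (auto simp: borel_rep_def)
  qed
  then obtain g where g: "\<And>j. borel_rep \<Omega> (g j) (g j)" "\<And>j. L2 (g j)" "\<And>j. distr_deriv \<Omega> (axis j 1) u' (g j)" by metis
  define D where "D x = (\<chi> i j. g j x $ i)" for x
  have c: "column j (D x) = g j x" for j x by (simp add: column_def D_def vec_eq_iff)
  have "(\<lambda>x. D x) = (\<lambda>x. \<Sum>j\<in>UNIV. outer (g j x) (axis j 1))"
  proof (intro ext)
    fix x
    have "(\<Sum>k\<in>UNIV. g k x $ i * (axis k 1 $ j)) = g j x $ i" for i j
    proof -
      have "(\<Sum>k\<in>UNIV. g k x $ i * (axis k 1 $ j)) = (\<Sum>k\<in>UNIV. if k = j then g k x $ i else 0)"
        by (intro sum.cong) (auto simp: axis_def)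
      then show ?thesis by simp
    qed
    then show "D x = (\<Sum>j\<in>UNIV. outer (g j x) (axis j 1))"
      by (simp add: D_def outer_def vec_eq_iff)
  qed
  moreover have "L2 (\<lambda>x. outer (g j x) (axis j 1 :: real^'n))" for j
    by (rule L2_dominated(1)[OF g(2)[of j], where c = 1]) (use L2_measurable[OF g(2)] in \<open>auto simp: norm_outer intro!: AE_I2\<close>)
  ultimately have "L2 D" using L2_sum[of UNIV "\<lambda>j x. outer (g j x) (axis j 1 :: real^'n)"] by simp
  moreover have "\<forall>x. x \<notin> \<Omega> \<longrightarrow> D x = 0" using g(1) by (auto simp: borel_rep_def D_def vec_eq_iff)
  ultimately show thesis using u uL g(3) by (intro that[of u' D]) (auto simp: sobolev_rep_def c)
qed

lemma sobolev_rep_diff: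
  fixes u v :: "real^'n \<Rightarrow> real^'m"
  assumes "sobolev_rep \<Omega> u u' D" "sobolev_rep \<Omega> v v' E"
  shows "sobolev_rep \<Omega> (\<lambda>x. u x - v x) (\<lambda>x. u' x - v' x) (\<lambda>x. D x - E x)"
proof -
  have "distr_deriv \<Omega> (axis j 1) (\<lambda>x. u' x - v' x) (\<lambda>x. column j (D x) - column j (E x))" for j
    using assms by (intro distr_deriv_diff axis_Basis L2_column) (auto simp: sobolev_rep_def)
  moreover have "column j (D x) - column j (E x) = column j (D x - E x)" for j x
    by (simp add: column_def vec_eq_iff)
  ultimately show ?thesis using assms borel_rep_diff L2_diff unfolding sobolev_rep_def by (auto simp: L2_diff)
qed

lemma sobolev_rep_cong:
  fixes u :: "real^'n \<Rightarrow> real^'m"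
  assumes r: "sobolev_rep \<Omega> u u' D" and v: "borel_rep \<Omega> u v'"
    and [measurable]: "E \<in> borel_measurable borel" and E0: "\<And>x. x \<notin> \<Omega> \<Longrightarrow> E x = 0" and ED: "AE x in lborel. E x = D x"
  shows "sobolev_rep \<Omega> u v' E"
proof -
  have u: "borel_rep \<Omega> u u'" "L2 u'" "L2 D" using r by (auto simp: sobolev_rep_def)
  have ae: "AE x in lborel. v' x = u' x" by (rule borel_rep_unique[OF v u(1)])
  have [measurable]: "v' \<in> borel_measurable borel" "u' \<in> borel_measurable borel" "D \<in> borel_measurable borel"
    using v u by (auto simp: borel_rep_def L2_measurable)
  have "L2 v'" by (rule L2_dominated(1)[OF u(2), where c = 1]) (use ae in \<open>auto elim: eventually_mono\<close>)
  moreover have "L2 E" by (rule L2_dominated(1)[OF u(3), where c = 1]) (use ED in \<open>auto elim: eventually_mono\<close>)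
  moreover have "distr_deriv \<Omega> (axis j 1) v' (\<lambda>x. column j (E x))" for j
    unfolding distr_deriv_def
  proof (intro allI impI)
    fix \<phi> :: "real^'n \<Rightarrow> real" assume \<phi>: "test_fun \<Omega> \<phi>"
    have [measurable]: "partial (axis j 1) \<phi> \<in> borel_measurable borel" "\<phi> \<in> borel_measurable borel"
      by (rule test_fun_measurable[OF test_fun_partial[OF \<phi> axis_Basis]], rule test_fun_measurable[OF \<phi>])
    have [measurable]: "(\<lambda>x. column j (E x)) \<in> borel_measurable borel" "(\<lambda>x. column j (D x)) \<in> borel_measurable borel"
      using L2_measurable[OF L2_column[OF \<open>L2 E\<close>]] L2_measurable[OF L2_column[OF u(3)]] by blast+
    have "(\<integral>x. partial (axis j 1) \<phi> x *\<^sub>R v' x \<partial>lborel) = (\<integral>x. partial (axis j 1) \<phi> x *\<^sub>R u' x \<partial>lborel)"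
      by (rule integral_cong_AE) (use ae in \<open>auto elim: eventually_mono\<close>)
    also have "\<dots> = - (\<integral>x. \<phi> x *\<^sub>R column j (D x) \<partial>lborel)"
      using r \<phi> by (simp add: sobolev_rep_def distr_deriv_def)
    also have "(\<integral>x. \<phi> x *\<^sub>R column j (D x) \<partial>lborel) = (\<integral>x. \<phi> x *\<^sub>R column j (E x) \<partial>lborel)"
      by (rule integral_cong_AE) (use ED in \<open>auto elim: eventually_mono\<close>)
    finally show "(\<integral>x. partial (axis j 1) \<phi> x *\<^sub>R v' x \<partial>lborel) = - (\<integral>x. \<phi> x *\<^sub>R column j (E x) \<partial>lborel)" .
  qed
  ultimately show ?thesis using v E0 by (simp add: sobolev_rep_def)
qed

lemma test_fun_sobolev_rep:
  fixes w :: "real^'n \<Rightarrow> real^'m"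
  assumes w: "test_fun \<Omega> w"
  shows "sobolev_rep \<Omega> w w (jacobian (\<lambda>j. axis j 1) w)"
proof -
  obtain K where K: "compact K" "K \<subseteq> \<Omega>" "\<And>x. x \<notin> K \<Longrightarrow> w x = 0" "\<And>x b. x \<notin> K \<Longrightarrow> partial b w x = 0"
    using test_funE[OF w] by metis
  have "L2 (jacobian (\<lambda>j. axis j 1) w)" by (rule test_fun_jacobian_L2[OF w axis_Basis])
  moreover have "column j (jacobian (\<lambda>j. axis j 1) w x) = partial (axis j 1) w x" for j x
    by (simp add: column_def jacobian_def vec_eq_iff)
  moreover have "jacobian (\<lambda>j. axis j 1) w x = 0" "w x = 0" if "x \<notin> \<Omega>" for x
  proof -
    have "x \<notin> K" using K(2) that by blast
    then show "jacobian (\<lambda>j. axis j 1) w x = 0" "w x = 0" using K(3,4) by (simp_all add: jacobian_def vec_eq_iff)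
  qed
  ultimately show ?thesis using test_fun_L2[OF w] test_fun_measurable[OF w] test_fun_distr_deriv[OF w axis_Basis]
    by (auto simp: sobolev_rep_def borel_rep_def)
qed

lemma test_fun_W12_0:
  fixes w :: "real^'n \<Rightarrow> real^'m"
  assumes w: "test_fun \<Omega> w" and S: "open \<Omega>"
  shows "W12_0 \<Omega> w"
proof -
  have "sobolev_rep \<Omega> (\<lambda>x. w x - w x) (\<lambda>x. w x - w x) (\<lambda>x. jacobian (\<lambda>j. axis j 1) w x - jacobian (\<lambda>j. axis j 1) w x)"
    by (rule sobolev_rep_diff[OF test_fun_sobolev_rep[OF w] test_fun_sobolev_rep[OF w]])
  from sobolev_rep_W12(2)[OF this S] have 0: "W12_norm \<Omega> (\<lambda>x. w x - w x) = 0"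
    by (simp only: diff_self L2_zero(2)) simp
  have "\<exists>\<phi>. (\<forall>k::nat. test_fun \<Omega> (\<phi> k)) \<and> (\<lambda>k. W12_norm \<Omega> (\<lambda>x. \<phi> k x - w x)) \<longlonglongrightarrow> 0"
    by (rule exI[where x = "\<lambda>k. w"]) (use w in \<open>simp only: 0 simp_thms tendsto_const\<close>)
  then show ?thesis using sobolev_rep_W12(1)[OF test_fun_sobolev_rep[OF w] S] unfolding W12_0_def by blast
qed

section \<open>Slices in time\<close>

lemma slice_measurable:
  fixes U :: "'a::euclidean_space \<times> real \<Rightarrow> 'b::topological_space"
  assumes U: "U \<in> borel_measurable borel" shows "(\<lambda>x. U (x, t)) \<in> borel_measurable borel"
proof -
  have "(\<lambda>x::'a. (x, t)) \<in> borel \<rightarrow>\<^sub>M borel \<Otimes>\<^sub>M borel" by measurable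
  then have "(\<lambda>x::'a. (x, t)) \<in> borel \<rightarrow>\<^sub>M borel" by (simp add: borel_prod)
  from measurable_compose[OF this U] show ?thesis .
qed

lemma slice_nn_integral:
  fixes U :: "'a::euclidean_space \<times> real \<Rightarrow> ennreal"
  assumes U: "U \<in> borel_measurable borel"
  shows "(\<integral>\<^sup>+z. U z \<partial>lborel) = (\<integral>\<^sup>+t. \<integral>\<^sup>+x. U (x, t) \<partial>lborel \<partial>lborel)"
proof -
  have "U \<in> borel_measurable (lborel \<Otimes>\<^sub>M lborel)" using U by (simp add: lborel_prod)
  from lborel_pair.nn_integral_snd[OF this] show ?thesis by (simp add: lborel_prod)
qed

text \<open>A null set is contained in a Borel null set, almost all of whose slices are null sets by Tonelli's theorem.\<close>

lemma slice_AE: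
  fixes P :: "'a::euclidean_space \<times> real \<Rightarrow> bool"
  assumes "AE z in lborel. P z" shows "AE t in lborel. AE x in lborel. P (x, t)"
proof -
  obtain N where N: "{z \<in> space lborel. \<not> P z} \<subseteq> N" "emeasure lborel N = 0" "N \<in> sets lborel"
    using AE_E[OF assms] by blast
  have Nb[measurable]: "N \<in> sets borel" using N(3) by simp
  have m: "(indicator N :: 'a \<times> real \<Rightarrow> ennreal) \<in> borel_measurable borel" by measurable
  then have mp: "(indicator N :: 'a \<times> real \<Rightarrow> ennreal) \<in> borel_measurable (lborel \<Otimes>\<^sub>M lborel)" by (simp add: lborel_prod)
  then have "(\<lambda>p. indicator N (snd p, fst p) :: ennreal) \<in> borel_measurable ((lborel::real measure) \<Otimes>\<^sub>M (lborel::'a measure))"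
    by measurable
  then have m2: "(\<lambda>t. \<integral>\<^sup>+x. indicator N (x, t) \<partial>(lborel :: 'a measure)) \<in> borel_measurable lborel"
    by (intro lborel.borel_measurable_nn_integral) (simp add: case_prod_beta)
  have "(\<integral>\<^sup>+t. \<integral>\<^sup>+x. indicator N (x, t) \<partial>(lborel :: 'a measure) \<partial>lborel) = 0"
    using slice_nn_integral[OF m] N by simp
  then have "AE t in lborel. (\<integral>\<^sup>+x. indicator N (x, t) \<partial>(lborel :: 'a measure)) = 0"
    using nn_integral_0_iff_AE[OF m2] by simp
  then show ?thesis
  proof eventually_elim
    case (elim t)
    have "AE x in (lborel :: 'a measure). (indicator N (x, t) :: ennreal) = 0"
      using elim slice_measurable[OF m, of t] by (subst (asm) nn_integral_0_iff_AE) auto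
    then show ?case by eventually_elim (use N(1) in \<open>auto simp: indicator_def split: if_splits\<close>)
  qed
qed

lemma slice_integral:
  fixes h :: "'a::euclidean_space \<times> real \<Rightarrow> 'b::euclidean_space"
  assumes h: "integrable lborel h"
  shows "integrable lborel (\<lambda>t. \<integral>x. h (x, t) \<partial>lborel)" "(\<integral>z. h z \<partial>lborel) = (\<integral>t. \<integral>x. h (x, t) \<partial>lborel \<partial>lborel)"
    "AE t in lborel. integrable lborel (\<lambda>x. h (x, t))"
proof -
  have "integrable (lborel \<Otimes>\<^sub>M lborel) (case_prod (\<lambda>x t. h (x, t)))" using h by (simp add: lborel_prod)
  note i = this
  show "integrable lborel (\<lambda>t. \<integral>x. h (x, t) \<partial>lborel)" by (rule lborel_pair.integrable_snd[OF i])
  show "AE t in lborel. integrable lborel (\<lambda>x. h (x, t))" by (rule lborel_pair.AE_integrable_snd[OF i])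
  show "(\<integral>z. h z \<partial>lborel) = (\<integral>t. \<integral>x. h (x, t) \<partial>lborel \<partial>lborel)"
    using lborel_pair.integral_snd[OF i] by (simp add: lborel_prod)
qed

lemma slice_L2:
  fixes U :: "'a::euclidean_space \<times> real \<Rightarrow> 'b::euclidean_space"
  assumes U: "L2 U"
  shows "AE t in lborel. L2 (\<lambda>x. U (x, t))" "integrable lborel (\<lambda>t. (nrm2 (\<lambda>x. U (x, t)))\<^sup>2)"
    "(nrm2 U)\<^sup>2 = (\<integral>t. (nrm2 (\<lambda>x. U (x, t)))\<^sup>2 \<partial>lborel)"
proof -
  note s = slice_integral[OF L2_integrable[OF U]]
  show "AE t in lborel. L2 (\<lambda>x. U (x, t))"
    using s(3) by eventually_elim (simp add: L2_def slice_measurable[OF L2_measurable[OF U]])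
  show "integrable lborel (\<lambda>t. (nrm2 (\<lambda>x. U (x, t)))\<^sup>2)" using s(1) by (simp add: nrm2_sq)
  show "(nrm2 U)\<^sup>2 = (\<integral>t. (nrm2 (\<lambda>x. U (x, t)))\<^sup>2 \<partial>lborel)" using s(2) by (simp add: nrm2_sq)
qed

lemma slice_nrm2_measurable:
  fixes U :: "'a::euclidean_space \<times> real \<Rightarrow> 'b::euclidean_space"
  assumes U: "U \<in> borel_measurable borel"
  shows "(\<lambda>t. nrm2 (\<lambda>x. U (x, t))) \<in> borel_measurable borel"
proof -
  have "(\<lambda>z. (norm (U z))\<^sup>2) \<in> borel_measurable (lborel \<Otimes>\<^sub>M lborel)" using U by (simp add: lborel_prod)
  then have "(\<lambda>p. (norm (U (snd p, fst p)))\<^sup>2) \<in> borel_measurable ((lborel::real measure) \<Otimes>\<^sub>M (lborel::'a measure))"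
    by measurable
  then have "(\<lambda>t. \<integral>x. (norm (U (x, t)))\<^sup>2 \<partial>(lborel::'a measure)) \<in> borel_measurable (lborel::real measure)"
    by (intro lborel.borel_measurable_lebesgue_integral) (simp add: case_prod_beta)
  then show ?thesis unfolding nrm2_def by simp
qed

lemma slice_L2I:
  fixes U :: "'a::euclidean_space \<times> real \<Rightarrow> 'b::euclidean_space"
  assumes U: "U \<in> borel_measurable borel" and T: "T > 0" and C: "C \<ge> 0"
    and z: "\<And>x t. t \<notin> {0<..<T} \<Longrightarrow> U (x, t) = 0"
    and b: "AE t in lborel. t \<in> {0<..<T} \<longrightarrow> L2 (\<lambda>x. U (x, t)) \<and> nrm2 (\<lambda>x. U (x, t)) \<le> C"
  shows "L2 U"
proof (rule L2I_nn(1)[OF U])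
  have m: "(\<lambda>z. ennreal ((norm (U z))\<^sup>2)) \<in> borel_measurable borel" using U by measurable
  have "(\<integral>\<^sup>+z. ennreal ((norm (U z))\<^sup>2) \<partial>lborel) = (\<integral>\<^sup>+t. \<integral>\<^sup>+x. ennreal ((norm (U (x, t)))\<^sup>2) \<partial>lborel \<partial>lborel)"
    by (rule slice_nn_integral[OF m])
  also have "\<dots> \<le> (\<integral>\<^sup>+t. ennreal (C\<^sup>2) * indicator {0<..<T} t \<partial>lborel)"
  proof (rule nn_integral_mono_AE)
    show "AE t in lborel. (\<integral>\<^sup>+x. ennreal ((norm (U (x, t)))\<^sup>2) \<partial>lborel) \<le> ennreal (C\<^sup>2) * indicator {0<..<T} t"
      using b
    proof eventually_elim
      case (elim t)
      show ?case
      proof (cases "t \<in> {0<..<T}")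
        case True
        then have "(\<integral>\<^sup>+x. ennreal ((norm (U (x, t)))\<^sup>2) \<partial>lborel) = ennreal ((nrm2 (\<lambda>x. U (x, t)))\<^sup>2)"
          using elim by (intro nn_integral_L2) auto
        also have "\<dots> \<le> ennreal (C\<^sup>2)" using elim True by (intro ennreal_leI power_mono) auto
        finally show ?thesis using True by simp
      qed (simp add: z)
    qed
  qed
  also have "\<dots> = ennreal (C\<^sup>2 * T)" using T by (simp add: nn_integral_cmult_indicator ennreal_mult)
  also have "\<dots> = ennreal ((C * sqrt T)\<^sup>2)" using T by (simp add: power_mult_distrib)
  finally show "(\<integral>\<^sup>+z. ennreal ((norm (U z))\<^sup>2) \<partial>lborel) \<le> ennreal ((C * sqrt T)\<^sup>2)" .
qed (use T C in simp)

lemma slice_borel_rep: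
  fixes v :: "'a::euclidean_space \<times> real \<Rightarrow> 'b::euclidean_space"
  assumes v: "borel_rep (cylinder \<Omega> T) v v'"
  shows "AE t in lborel. t \<in> {0<..<T} \<longrightarrow> borel_rep \<Omega> (\<lambda>x. v (x, t)) (\<lambda>x. v' (x, t))"
proof -
  have "AE z in lborel. z \<in> cylinder \<Omega> T \<longrightarrow> v z = v' z" using v by (simp add: borel_rep_def)
  from slice_AE[OF this] show ?thesis
  proof eventually_elim
    case (elim t)
    show ?case
    proof
      assume t: "t \<in> {0<..<T}"
      have "AE x in lborel. x \<in> \<Omega> \<longrightarrow> v (x, t) = v' (x, t)" using elim by eventually_elim (use t in auto)
      then show "borel_rep \<Omega> (\<lambda>x. v (x, t)) (\<lambda>x. v' (x, t))"
        using v slice_measurable[OF borel_rep_measurable[OF v]] by (auto simp: borel_rep_def)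
    qed
  qed
qed

lemma AE_lebesgue_on_iff:
  assumes "S \<in> sets lebesgue"
  shows "(AE x in lebesgue_on S. P x) \<longleftrightarrow> (AE x in lborel. x \<in> S \<longrightarrow> P x)"
  using assms by (subst AE_restrict_space_iff) (auto simp: AE_completion_iff)

section \<open>Gradients of functions of time with values in a Sobolev space\<close>

text \<open>If the slices converge for almost all times, the distance of two members is an integral over time of
  squared distances of slices. Along a pair of index sequences that violates the Cauchy condition these
  integrals would tend to zero by dominated convergence.\<close>

lemma slice_Cauchy:
  fixes g :: "nat \<Rightarrow> 'a::euclidean_space \<times> real \<Rightarrow> 'b::euclidean_space"
  assumes g: "\<And>k. L2 (g k)" and z: "\<And>k x t. t \<notin> {0<..<T} \<Longrightarrow> g k (x, t) = 0"
    and b: "\<And>k. AE t in lborel. nrm2 (\<lambda>x. g k (x, t)) \<le> C" and C: "C \<ge> 0"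
    and lim: "AE t in lborel. t \<in> {0<..<T} \<longrightarrow> (\<exists>D. L2 D \<and> (\<lambda>k. nrm2 (\<lambda>x. g k (x, t) - D x)) \<longlonglongrightarrow> 0)"
    and e: "e > 0"
  shows "\<exists>N. \<forall>m\<ge>N. \<forall>n\<ge>N. nrm2 (\<lambda>z. g m z - g n z) < e"
proof (rule ccontr)
  assume "\<not> ?thesis"
  then have "\<forall>N. \<exists>m n. m \<ge> N \<and> n \<ge> N \<and> nrm2 (\<lambda>z. g m z - g n z) \<ge> e" by (meson not_le)
  then obtain m n where mn: "\<And>N. m N \<ge> N" "\<And>N. n N \<ge> N" "\<And>N. nrm2 (\<lambda>z. g (m N) z - g (n N) z) \<ge> e" by metis
  define q where "q N t = (nrm2 (\<lambda>x. g (m N) (x, t) - g (n N) (x, t)))\<^sup>2" for N t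
  have sl: "AE t in lborel. \<forall>k. L2 (\<lambda>x. g k (x, t)) \<and> nrm2 (\<lambda>x. g k (x, t)) \<le> C"
    unfolding AE_all_countable
  proof
    fix k show "AE t in lborel. L2 (\<lambda>x. g k (x, t)) \<and> nrm2 (\<lambda>x. g k (x, t)) \<le> C"
      using slice_L2(1)[OF g[of k]] b[of k] by eventually_elim simp
  qed
  have "(\<lambda>N. \<integral>t. q N t \<partial>lborel) \<longlonglongrightarrow> (\<integral>t. 0 \<partial>(lborel :: real measure))"
  proof (rule integral_dominated_convergence[where w = "\<lambda>t. (2 * C)\<^sup>2 * indicator {0<..<T} t"])
    show "integrable lborel (\<lambda>t. (2 * C)\<^sup>2 * indicator {0<..<T} t)" by (cases "0 < T") (auto simp: integrable_indicator_iff)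
    show "q N \<in> borel_measurable lborel" for N
      unfolding q_def using slice_L2(2)[OF L2_diff[OF g[of "m N"] g[of "n N"]]] by (rule borel_measurable_integrable)
    show "AE t in lborel. (\<lambda>N. q N t) \<longlonglongrightarrow> 0"
      using lim sl
    proof eventually_elim
      case (elim t)
      show ?case
      proof (cases "t \<in> {0<..<T}")
        case True
        then obtain D where D: "L2 D" "(\<lambda>k. nrm2 (\<lambda>x. g k (x, t) - D x)) \<longlonglongrightarrow> 0" using elim by blast
        have mi: "filterlim m at_top sequentially" "filterlim n at_top sequentially"
          using mn(1,2) by (auto intro: filterlim_at_top_mono[OF filterlim_ident])
        have "(\<lambda>N. nrm2 (\<lambda>x. g (m N) (x, t) - D x) + nrm2 (\<lambda>x. g (n N) (x, t) - D x)) \<longlonglongrightarrow> 0"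
          using tendsto_add[OF filterlim_compose[OF D(2) mi(1)] filterlim_compose[OF D(2) mi(2)]] by simp
        then have "(\<lambda>N. nrm2 (\<lambda>x. g (m N) (x, t) - g (n N) (x, t))) \<longlonglongrightarrow> 0"
        proof (rule tendsto_sandwich[OF _ _ tendsto_const, rotated 2])
          show "\<forall>\<^sub>F N in sequentially. nrm2 (\<lambda>x. g (m N) (x, t) - g (n N) (x, t))
            \<le> nrm2 (\<lambda>x. g (m N) (x, t) - D x) + nrm2 (\<lambda>x. g (n N) (x, t) - D x)"
          proof (intro always_eventually allI)
            fix N
            show "nrm2 (\<lambda>x. g (m N) (x, t) - g (n N) (x, t))
              \<le> nrm2 (\<lambda>x. g (m N) (x, t) - D x) + nrm2 (\<lambda>x. g (n N) (x, t) - D x)"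
              using nrm2_triangle3[of "\<lambda>x. g (m N) (x, t)" D "\<lambda>x. g (n N) (x, t)"] elim D(1)
                nrm2_commute[of D "\<lambda>x. g (n N) (x, t)"] by simp
          qed
        qed auto
        then show ?thesis unfolding q_def using tendsto_power[of _ 0 sequentially 2] by fastforce
      qed (simp add: q_def z)
    qed
    show "AE t in lborel. norm (q N t) \<le> (2 * C)\<^sup>2 * indicator {0<..<T} t" for N
      using sl
    proof eventually_elim
      case (elim t)
      show ?case
      proof (cases "t \<in> {0<..<T}")
        case True
        have "nrm2 (\<lambda>x. g (m N) (x, t) - g (n N) (x, t)) \<le> nrm2 (\<lambda>x. g (m N) (x, t)) + nrm2 (\<lambda>x. g (n N) (x, t))"
          using elim by (intro nrm2_triangle_diff) auto
        also have "\<dots> \<le> 2 * C" using elim spec[OF elim, of "m N"] spec[OF elim, of "n N"] by linarith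
        finally have "(nrm2 (\<lambda>x. g (m N) (x, t) - g (n N) (x, t)))\<^sup>2 \<le> (2 * C)\<^sup>2" by (rule power_mono) simp
        then show ?thesis using True by (simp add: q_def)
      qed (simp add: q_def z)
    qed
  qed auto
  then have l: "(\<lambda>N. (nrm2 (\<lambda>z. g (m N) z - g (n N) z))\<^sup>2) \<longlonglongrightarrow> 0"
    unfolding q_def using slice_L2(3)[OF L2_diff[OF g g]] by simp
  have le: "e\<^sup>2 \<le> (nrm2 (\<lambda>z. g (m N) z - g (n N) z))\<^sup>2" for N
    using mn(3)[of N] e by (intro power_mono) auto
  have "e\<^sup>2 \<le> 0" by (rule LIMSEQ_le_const[OF l]) (use le in blast)
  then show False using e by simp
qed

text \<open>The limits of the slices come without any joint measurability in space and time; the limit in mean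
  square of the whole functions provides a jointly measurable version. \<open>R\<close> records what else is known about the
  limits.\<close>

lemma slice_limit:
  fixes g :: "nat \<Rightarrow> 'a::euclidean_space \<times> real \<Rightarrow> 'b::euclidean_space"
  assumes g: "\<And>k. L2 (g k)" and z: "\<And>k x. x \<notin> cylinder \<Omega> T \<Longrightarrow> g k x = 0" and Q: "open \<Omega>" "bounded \<Omega>"
    and b: "\<And>k. AE t in lborel. nrm2 (\<lambda>x. g k (x, t)) \<le> C" and C: "C \<ge> 0"
    and lim: "AE t in lborel. t \<in> {0<..<T} \<longrightarrow> (\<exists>D. R t D \<and> L2 D \<and> (\<lambda>k. nrm2 (\<lambda>x. g k (x, t) - D x)) \<longlonglongrightarrow> 0)"
  obtains Y where "L2 Y" "\<And>x. x \<notin> cylinder \<Omega> T \<Longrightarrow> Y x = 0"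
    "AE t in lborel. t \<in> {0<..<T} \<longrightarrow> (\<exists>D. R t D \<and> L2 D \<and> (AE x in lborel. Y (x, t) = D x))"
proof -
  have Qf: "cylinder \<Omega> T \<in> fmeasurable lborel"
    using Q by (intro bounded_open_fmeasurable open_Times bounded_Times) auto
  have lim': "AE t in lborel. t \<in> {0<..<T} \<longrightarrow> (\<exists>D. L2 D \<and> (\<lambda>k. nrm2 (\<lambda>x. g k (x, t) - D x)) \<longlonglongrightarrow> 0)"
    using lim by eventually_elim blast
  have cau: "\<exists>N. \<forall>m\<ge>N. \<forall>n\<ge>N. nrm2 (\<lambda>z. g m z - g n z) < e" if "e > 0" for e
    by (rule slice_Cauchy[OF g _ b C lim' that]) (use z in auto)
  obtain Y where Y: "L2 Y" "\<And>x. x \<notin> cylinder \<Omega> T \<Longrightarrow> Y x = 0" "(\<lambda>n. nrm2 (\<lambda>x. g n x - Y x)) \<longlonglongrightarrow> 0"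
  proof -
    have "\<exists>Y. L2 Y \<and> (\<forall>x. x \<notin> cylinder \<Omega> T \<longrightarrow> Y x = 0) \<and> (\<lambda>n. nrm2 (\<lambda>x. g n x - Y x)) \<longlonglongrightarrow> 0"
    proof (rule L2_complete[of g "cylinder \<Omega> T"])
      fix Y :: "'a \<times> real \<Rightarrow> 'b"
      assume "L2 Y" "\<And>x. x \<notin> cylinder \<Omega> T \<Longrightarrow> Y x = 0" "(\<lambda>n. nrm2 (\<lambda>x. g n x - Y x)) \<longlonglongrightarrow> 0"
      then show ?thesis by blast
    qed (use g Qf z cau in \<open>simp_all del: mem_Times_iff\<close>)
    then obtain Y where "L2 Y \<and> (\<forall>x. x \<notin> cylinder \<Omega> T \<longrightarrow> Y x = 0) \<and> (\<lambda>n. nrm2 (\<lambda>x. g n x - Y x)) \<longlonglongrightarrow> 0" ..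
    then show thesis by (intro that[of Y]) blast+
  qed
  have gY: "L2 (\<lambda>x. g k x - Y x)" for k by (rule L2_diff[OF g Y(1)])
  have "(\<lambda>n. (nrm2 (\<lambda>x. g n x - Y x))\<^sup>2) \<longlonglongrightarrow> 0" using tendsto_power[OF Y(3), of 2] by simp
  then have "(\<lambda>n. \<integral>t. norm ((nrm2 (\<lambda>x. g n (x, t) - Y (x, t)))\<^sup>2) \<partial>lborel) \<longlonglongrightarrow> 0"
    by (simp add: slice_L2(3)[OF gY])
  from tendsto_L1_AE_subseq[OF slice_L2(2)[OF gY] this] obtain r where r: "strict_mono r"
    "AE t in lborel. (\<lambda>n. (nrm2 (\<lambda>x. g (r n) (x, t) - Y (x, t)))\<^sup>2) \<longlonglongrightarrow> 0" by blast
  have sl: "AE t in lborel. \<forall>k. L2 (\<lambda>x. g k (x, t))"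
    unfolding AE_all_countable by (intro allI slice_L2(1) g)
  have "AE t in lborel. t \<in> {0<..<T} \<longrightarrow> (\<exists>D. R t D \<and> L2 D \<and> (AE x in lborel. Y (x, t) = D x))"
    using lim r(2) sl slice_L2(1)[OF Y(1)]
  proof eventually_elim
    case (elim t)
    show ?case
    proof
      assume "t \<in> {0<..<T}"
      then obtain D where D: "R t D" "L2 D" "(\<lambda>k. nrm2 (\<lambda>x. g k (x, t) - D x)) \<longlonglongrightarrow> 0" using elim by blast
      have "(\<lambda>n. sqrt ((nrm2 (\<lambda>x. g (r n) (x, t) - Y (x, t)))\<^sup>2)) \<longlonglongrightarrow> sqrt 0" by (rule tendsto_real_sqrt) (rule elim(2))
      then have a: "(\<lambda>n. nrm2 (\<lambda>x. g (r n) (x, t) - Y (x, t))) \<longlonglongrightarrow> 0" by simp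
      have "(\<lambda>n. nrm2 (\<lambda>x. g (r n) (x, t) - D x)) \<longlonglongrightarrow> 0"
        using LIMSEQ_subseq_LIMSEQ[OF D(3) r(1)] by (simp add: o_def)
      then have lim0: "(\<lambda>n. nrm2 (\<lambda>x. g (r n) (x, t) - Y (x, t)) + nrm2 (\<lambda>x. g (r n) (x, t) - D x)) \<longlonglongrightarrow> 0"
        using tendsto_add[OF a] by fastforce
      have "nrm2 (\<lambda>x. Y (x, t) - D x) \<le> nrm2 (\<lambda>x. g (r n) (x, t) - Y (x, t)) + nrm2 (\<lambda>x. g (r n) (x, t) - D x)" for n
        using nrm2_triangle3[of "\<lambda>x. Y (x, t)" "\<lambda>x. g (r n) (x, t)" D] elim D(2)
          nrm2_commute[of "\<lambda>x. Y (x, t)" "\<lambda>x. g (r n) (x, t)"] by simp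
      then have "nrm2 (\<lambda>x. Y (x, t) - D x) \<le> 0" using lim0 by (intro LIMSEQ_le_const) auto
      then have "nrm2 (\<lambda>x. Y (x, t) - D x) = 0" using nrm2_nonneg[of "\<lambda>x. Y (x, t) - D x"] by linarith
      then have "AE x in lborel. Y (x, t) - D x = 0" using elim D(2) by (intro nrm2_eq_0 L2_diff) auto
      then have "AE x in lborel. Y (x, t) = D x" by eventually_elim simp
      then show "\<exists>D. R t D \<and> L2 D \<and> (AE x in lborel. Y (x, t) = D x)" using D by blast
    qed
  qed
  note fin = this
  show thesis by (rule that[OF Y(1) _ fin]) (rule Y(2))
qed

text \<open>A jointly measurable gradient. The simple functions of the definition of strong measurability have jointly
  measurable gradients, which converge to the gradient of \<open>v\<close> for almost all times. Set to zero at the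
  times when their norm exceeds the essential bound on \<open>v\<close> by more than one, they converge in mean square
  on the cylinder.\<close>

lemma W12_time_representative:
  fixes v :: "(real^'n) \<times> real \<Rightarrow> real^'m"
  assumes \<Omega>: "open \<Omega>" "bounded \<Omega>" and T: "T > 0" and v: "v \<in> borel_measurable (lebesgue_on (cylinder \<Omega> T))"
    and L: "Linfty_W12 \<Omega> T (time_slice v)"
  obtains v' G where "borel_rep (cylinder \<Omega> T) v v'" "L2 v'" "L2 G" "\<And>z. z \<notin> cylinder \<Omega> T \<Longrightarrow> G z = 0"
    "AE t in lborel. t \<in> {0<..<T} \<longrightarrow> sobolev_rep \<Omega> (\<lambda>x. v (x, t)) (\<lambda>x. v' (x, t)) (\<lambda>x. G (x, t))"
proof -
  have Il: "{0..T} \<in> sets lebesgue" by simp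
  have Qo: "open (cylinder \<Omega> T)" using \<Omega> by (intro open_Times) auto
  obtain s where s: "\<And>k. finite (s k ` {0..T})" "\<And>k t. t \<in> {0..T} \<Longrightarrow> W12 \<Omega> (s k t)"
    "\<And>k f. {t\<in>{0..T}. s k t = f} \<in> sets lebesgue"
    "AE t in lebesgue_on {0..T}. (\<lambda>k. W12_norm \<Omega> (\<lambda>x. s k t x - v (x, t))) \<longlonglongrightarrow> 0"
    using L unfolding Linfty_W12_def strongly_measurable_W12_def by blast
  have W: "AE t in lebesgue_on {0..T}. W12 \<Omega> (time_slice v t)"
    using L unfolding Linfty_W12_def strongly_measurable_W12_def by blast
  obtain C0 where C0: "AE t in lebesgue_on {0..T}. W12_norm \<Omega> (time_slice v t) \<le> C0"
    using L unfolding Linfty_W12_def by blast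
  define C where "C = max C0 0"
  have C: "C \<ge> 0" "C0 \<le> C" by (auto simp: C_def)
  have "\<exists>p. sobolev_rep \<Omega> f (fst p) (snd p)" if "W12 \<Omega> f" for f :: "real^'n \<Rightarrow> real^'m"
    using W12_sobolev_rep[OF that \<Omega>(1)] by (metis fst_conv snd_conv)
  then obtain R where R: "\<And>f :: real^'n \<Rightarrow> real^'m. W12 \<Omega> f \<Longrightarrow> sobolev_rep \<Omega> f (fst (R f)) (snd (R f))" by metis
  define D where "D f = snd (R f)" for f
  have DL: "L2 (D f)" "\<And>x. x \<notin> \<Omega> \<Longrightarrow> D f x = 0" if "W12 \<Omega> f" for f
    using R[OF that] by (auto simp: sobolev_rep_def D_def)
  have "\<exists>c. c \<in> borel_measurable lborel \<and> (AE t in lborel. (indicator {t\<in>{0..T}. s k t = f} t :: real) = c t)" for k f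
  proof -
    have "(indicator {t\<in>{0..T}. s k t = f} :: real \<Rightarrow> real) \<in> borel_measurable lebesgue"
      using s(3)[of k f] by (rule borel_measurable_indicator)
    from completion_ex_borel_measurable_real[OF this] show ?thesis by auto
  qed
  \<comment> \<open>The level sets of the simple functions are only Lebesgue measurable, so their indicators are replaced by
    Borel functions of time.\<close>
  note cex = this
  define c where "c k f = (SOME c. c \<in> borel_measurable lborel \<and>
    (AE t in lborel. (indicator {t\<in>{0..T}. s k t = f} t :: real) = c t))" for k f
  have c: "c k f \<in> borel_measurable lborel"
    "AE t in lborel. (indicator {t\<in>{0..T}. s k t = f} t :: real) = c k f t" for k f
    using someI_ex[OF cex[of k f]] unfolding c_def by blast+
  define Fk where "Fk k = s k ` {0..T}" for k
  have Fk: "finite (Fk k)" "\<And>f. f \<in> Fk k \<Longrightarrow> W12 \<Omega> f" for k using s(1,2) by (auto simp: Fk_def)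
  define g0 where "g0 k z = (\<Sum>f\<in>Fk k. c k f (snd z) *\<^sub>R D f (fst z))" for k and z :: "(real^'n) \<times> real"
  have g0m: "g0 k \<in> borel_measurable borel" for k
  proof -
    have [measurable]: "c k f \<in> borel_measurable borel" for f using c(1)[of k f] by simp
    have "(\<lambda>z. c k f (snd z) *\<^sub>R D f (fst z)) \<in> borel_measurable borel" if "f \<in> Fk k" for f
    proof -
      have [measurable]: "D f \<in> borel_measurable borel" by (rule L2_measurable[OF DL(1)[OF Fk(2)[OF that]]])
      have "fst \<in> borel_measurable (borel :: ((real^'n) \<times> real) measure)" "snd \<in> borel_measurable (borel :: ((real^'n) \<times> real) measure)"
        by (auto intro!: borel_measurable_continuous_onI continuous_intros)
      then show ?thesis by measurable
    qed
    then show ?thesis unfolding g0_def by (intro borel_measurable_sum)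
  qed
  have g0L: "L2 (\<lambda>x. g0 k (x, t))" for k t
    unfolding g0_def fst_conv snd_conv by (intro L2_sum L2_scaleR DL(1) Fk(2))
  have g0z: "g0 k z = 0" if "fst z \<notin> \<Omega>" for k z
    using that DL(2) Fk(2) by (simp add: g0_def)
  \<comment> \<open>The times at which the gradient of the \<open>k\<close>-th simple function stays below the bound for \<open>v\<close>, up to \<open>1\<close>;
    almost every time belongs to \<open>E k\<close> for large \<open>k\<close>.\<close>
  define E where "E k = {t \<in> {0<..<T}. nrm2 (\<lambda>x. g0 k (x, t)) \<le> C + 1}" for k
  have Em: "E k \<in> sets borel" for k
  proof -
    have [measurable]: "(\<lambda>t. nrm2 (\<lambda>x. g0 k (x, t))) \<in> borel_measurable borel" by (rule slice_nrm2_measurable[OF g0m])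
    show ?thesis unfolding E_def by measurable
  qed
  define g where "g k z = indicator (E k) (snd z) *\<^sub>R g0 k z" for k z
  have gm: "g k \<in> borel_measurable borel" for k
  proof -
    have [measurable]: "(indicator (E k) :: real \<Rightarrow> real) \<in> borel_measurable borel" using Em by measurable
    have [measurable]: "snd \<in> borel_measurable (borel :: ((real^'n) \<times> real) measure)"
      by (auto intro!: borel_measurable_continuous_onI continuous_intros)
    show ?thesis unfolding g_def using g0m[of k] by measurable
  qed
  have gs: "L2 (\<lambda>x. g k (x, t))" "nrm2 (\<lambda>x. g k (x, t)) \<le> C + 1" for k t
  proof -
    show "L2 (\<lambda>x. g k (x, t))" unfolding g_def snd_conv by (rule L2_scaleR[OF g0L])
    show "nrm2 (\<lambda>x. g k (x, t)) \<le> C + 1"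
      using C by (cases "t \<in> E k") (auto simp: g_def E_def)
  qed
  have gz: "g k z = 0" if "z \<notin> cylinder \<Omega> T" for k z
    using that g0z[of z k] by (cases z) (auto simp: g_def E_def indicator_def)
  have gL: "L2 (g k)" for k
    by (rule slice_L2I[OF gm T, where C = "C + 1"]) (use C gs gz in auto)
  have cv: "AE t in lborel. \<forall>k. \<forall>f\<in>Fk k. (indicator {t\<in>{0..T}. s k t = f} t :: real) = c k f t"
    unfolding AE_all_countable using c(2) Fk(1) by (intro allI AE_finite_allI) auto
  define Rt where "Rt t E = (\<exists>V. sobolev_rep \<Omega> (\<lambda>x. v (x, t)) V E \<and> nrm2 V \<le> C)" for t E
  have lim: "AE t in lborel. t \<in> {0<..<T} \<longrightarrow> (\<exists>D. Rt t D \<and> L2 D \<and> (\<lambda>k. nrm2 (\<lambda>x. g k (x, t) - D x)) \<longlonglongrightarrow> 0)"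
    using cv s(4)[unfolded AE_lebesgue_on_iff[OF Il]] W[unfolded AE_lebesgue_on_iff[OF Il]] C0[unfolded AE_lebesgue_on_iff[OF Il]]
  proof eventually_elim
    case (elim t)
    show ?case
    proof
      assume t: "t \<in> {0<..<T}"
      then have t0: "t \<in> {0..T}" by auto
      obtain V Dt where VD: "sobolev_rep \<Omega> (\<lambda>x. v (x, t)) V Dt"
        using W12_sobolev_rep[OF _ \<Omega>(1), of "time_slice v t"] elim t0 by blast
      have DtL: "L2 Dt" using VD by (simp add: sobolev_rep_def)
      have nv: "W12_norm \<Omega> (time_slice v t) \<ge> 0" unfolding W12_norm_def by (intro real_sqrt_ge_zero add_nonneg_nonneg sum_nonneg integral_nonneg_AE) auto
      have "W12_norm \<Omega> (time_slice v t) \<le> C" using elim(4) t0 C(2) by force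
      then have "(W12_norm \<Omega> (time_slice v t))\<^sup>2 \<le> C\<^sup>2" using nv by (rule power_mono)
      then have "(nrm2 V)\<^sup>2 + (nrm2 Dt)\<^sup>2 \<le> C\<^sup>2" using sobolev_rep_W12(2)[OF VD \<Omega>(1)] by simp
      then have "(nrm2 V)\<^sup>2 \<le> C\<^sup>2" "(nrm2 Dt)\<^sup>2 \<le> C\<^sup>2"
        using zero_le_power2[of "nrm2 V"] zero_le_power2[of "nrm2 Dt"] by linarith+
      then have b: "nrm2 V \<le> C" "nrm2 Dt \<le> C" using C(1) power2_le_imp_le by blast+
      have g0e: "g0 k (x, t) = D (s k t) x" for k x
      proof -
        have "g0 k (x, t) = (\<Sum>f\<in>Fk k. if f = s k t then D f x else 0)"
          unfolding g0_def fst_conv snd_conv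
        proof (rule sum.cong[OF refl])
          fix f assume "f \<in> Fk k"
          then have "c k f t = indicator {t\<in>{0..T}. s k t = f} t" using elim(1) by simp
          then show "c k f t *\<^sub>R D f x = (if f = s k t then D f x else 0)" using t0 by (auto simp: indicator_def)
        qed
        also have "\<dots> = D (s k t) x" using Fk(1)[of k] t0 by (auto simp: Fk_def)
        finally show ?thesis .
      qed
      have "(\<lambda>k. nrm2 (\<lambda>x. g0 k (x, t) - Dt x)) \<longlonglongrightarrow> 0"
      proof (rule tendsto_sandwich[OF _ _ tendsto_const])
        show "(\<lambda>k. W12_norm \<Omega> (\<lambda>x. s k t x - v (x, t))) \<longlonglongrightarrow> 0" using elim(2) t0 by blast
        show "\<forall>\<^sub>F k in sequentially. nrm2 (\<lambda>x. g0 k (x, t) - Dt x) \<le> W12_norm \<Omega> (\<lambda>x. s k t x - v (x, t))"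
        proof (intro always_eventually allI)
          fix k
          have "sobolev_rep \<Omega> (\<lambda>x. s k t x - v (x, t)) (\<lambda>x. fst (R (s k t)) x - V x) (\<lambda>x. D (s k t) x - Dt x)"
            unfolding D_def by (rule sobolev_rep_diff[OF R[OF s(2)[OF t0]] VD])
          from sobolev_rep_W12(2)[OF this \<Omega>(1)]
          have "(nrm2 (\<lambda>x. D (s k t) x - Dt x))\<^sup>2 \<le> (W12_norm \<Omega> (\<lambda>x. s k t x - v (x, t)))\<^sup>2"
            using zero_le_power2[of "nrm2 (\<lambda>x. fst (R (s k t)) x - V x)"] by linarith
          moreover have "W12_norm \<Omega> (\<lambda>x. s k t x - v (x, t)) \<ge> 0"
            unfolding W12_norm_def by (intro real_sqrt_ge_zero add_nonneg_nonneg sum_nonneg integral_nonneg_AE) auto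
          ultimately have "nrm2 (\<lambda>x. D (s k t) x - Dt x) \<le> W12_norm \<Omega> (\<lambda>x. s k t x - v (x, t))"
            using power2_le_imp_le by blast
          then show "nrm2 (\<lambda>x. g0 k (x, t) - Dt x) \<le> W12_norm \<Omega> (\<lambda>x. s k t x - v (x, t))" by (simp only: g0e)
        qed
      qed auto
      note l0 = this
      have "\<forall>\<^sub>F k in sequentially. nrm2 (\<lambda>x. g0 k (x, t) - Dt x) < 1" using order_tendstoD(2)[OF l0, of 1] by simp
      then have "\<forall>\<^sub>F k in sequentially. nrm2 (\<lambda>x. g0 k (x, t) - Dt x) = nrm2 (\<lambda>x. g k (x, t) - Dt x)"
      proof eventually_elim
        case (elim k)
        have "nrm2 (\<lambda>x. g0 k (x, t)) \<le> C + 1" using nrm2_le_add_diff[OF g0L[of k t] DtL] elim b by linarith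
        then have "t \<in> E k" using t by (simp add: E_def)
        then show ?case by (simp add: g_def)
      qed
      then have "(\<lambda>k. nrm2 (\<lambda>x. g k (x, t) - Dt x)) \<longlonglongrightarrow> 0" by (rule Lim_transform_eventually[OF l0])
      then show "\<exists>D. Rt t D \<and> L2 D \<and> (\<lambda>k. nrm2 (\<lambda>x. g k (x, t) - D x)) \<longlonglongrightarrow> 0"
        using VD b DtL unfolding Rt_def by blast
    qed
  qed
  have gb: "AE t in lborel. nrm2 (\<lambda>x. g k (x, t)) \<le> C + 1" for k using gs by simp
  have C1: "C + 1 \<ge> 0" using C by simp
  have "\<exists>Y. L2 Y \<and> (\<forall>x. x \<notin> cylinder \<Omega> T \<longrightarrow> Y x = 0) \<and>
    (AE t in lborel. t \<in> {0<..<T} \<longrightarrow> (\<exists>D. Rt t D \<and> L2 D \<and> (AE x in lborel. Y (x, t) = D x)))"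
    by (rule slice_limit[OF gL gz \<Omega> gb C1 lim]) blast+
  then obtain Y where Y: "L2 Y" "\<forall>x. x \<notin> cylinder \<Omega> T \<longrightarrow> Y x = 0"
    "AE t in lborel. t \<in> {0<..<T} \<longrightarrow> (\<exists>D. Rt t D \<and> L2 D \<and> (AE x in lborel. Y (x, t) = D x))" by blast
  obtain v' where v': "borel_rep (cylinder \<Omega> T) v v'" by (rule borel_rep_exists[OF v]) (use Qo that in auto)
  have fin: "AE t in lborel. t \<in> {0<..<T} \<longrightarrow> sobolev_rep \<Omega> (\<lambda>x. v (x, t)) (\<lambda>x. v' (x, t)) (\<lambda>x. Y (x, t))
     \<and> nrm2 (\<lambda>x. v' (x, t)) \<le> C"
    using Y(3) slice_borel_rep[OF v']
  proof eventually_elim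
    case (elim t)
    show ?case
    proof
      assume t: "t \<in> {0<..<T}"
      then obtain D V where D: "sobolev_rep \<Omega> (\<lambda>x. v (x, t)) V D" "nrm2 V \<le> C" "AE x in lborel. Y (x, t) = D x"
        using elim unfolding Rt_def by blast
      have b: "borel_rep \<Omega> (\<lambda>x. v (x, t)) (\<lambda>x. v' (x, t))" using elim t by blast
      have "nrm2 (\<lambda>x. v' (x, t)) = nrm2 V"
        using D(1) b borel_rep_unique[OF b, of V] by (intro nrm2_cong_AE) (auto simp: sobolev_rep_def borel_rep_def)
      moreover have "sobolev_rep \<Omega> (\<lambda>x. v (x, t)) (\<lambda>x. v' (x, t)) (\<lambda>x. Y (x, t))"
        by (rule sobolev_rep_cong[OF D(1) b slice_measurable[OF L2_measurable[OF Y(1)]] _ D(3)]) (use Y(2) in auto)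
      ultimately show "sobolev_rep \<Omega> (\<lambda>x. v (x, t)) (\<lambda>x. v' (x, t)) (\<lambda>x. Y (x, t)) \<and> nrm2 (\<lambda>x. v' (x, t)) \<le> C"
        using D(2) by simp
    qed
  qed
  have v'L: "L2 v'"
  proof (rule slice_L2I[OF borel_rep_measurable[OF v'] T C(1)])
    show "v' (x, t) = 0" if "t \<notin> {0<..<T}" for x t using v' that by (auto simp: borel_rep_def)
    show "AE t in lborel. t \<in> {0<..<T} \<longrightarrow> L2 (\<lambda>x. v' (x, t)) \<and> nrm2 (\<lambda>x. v' (x, t)) \<le> C"
      using fin by eventually_elim (auto simp: sobolev_rep_def)
  qed
  have fin': "AE t in lborel. t \<in> {0<..<T} \<longrightarrow> sobolev_rep \<Omega> (\<lambda>x. v (x, t)) (\<lambda>x. v' (x, t)) (\<lambda>x. Y (x, t))"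
    using fin by eventually_elim blast
  show thesis by (rule that[OF v' v'L Y(1) _ fin']) (use Y(2) in blast)
qed

section \<open>The weak system in space-time\<close>

lemma slice_has_derivative:
  fixes f :: "'a::euclidean_space \<times> real \<Rightarrow> 'b::real_normed_vector"
  assumes "f differentiable (at (x, t))"
  shows "((\<lambda>x. f (x, t)) has_derivative (\<lambda>h. frechet_derivative f (at (x, t)) (h, 0))) (at x)"
proof -
  have "(f has_derivative frechet_derivative f (at (x, t))) (at (x, t))"
    using assms by (simp add: frechet_derivative_works)
  then show ?thesis by (rule has_derivative_compose[rotated]) (auto intro!: derivative_eq_intros)
qed

lemma partial_slice:
  fixes f :: "'a::euclidean_space \<times> real \<Rightarrow> 'b::real_normed_vector"
  assumes "f differentiable (at (x, t))"
  shows "partial b (\<lambda>x. f (x, t)) x = partial (b, 0) f (x, t)"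
  using partial_has_derivative[OF slice_has_derivative[OF assms]] by (simp add: partial_def)

lemma Basis_slice: "b \<in> Basis \<Longrightarrow> (b, 0::real) \<in> Basis" by (simp add: Basis_prod_def)

lemma Ck_on_slice: "Ck_on k UNIV f \<Longrightarrow> Ck_on k UNIV (\<lambda>x::'a::euclidean_space. f (x, t::real))"
proof (induction k arbitrary: f)
  case 0
  have "continuous_on UNIV (\<lambda>x. f (x, t))"
    by (rule continuous_on_compose2[of UNIV f]) (use 0 in \<open>auto intro!: continuous_intros\<close>)
  then show ?case by simp
next
  case (Suc k)
  have d: "f differentiable (at z)" for z using Suc.prems unfolding Ck_on.simps by blast
  have "partial b (\<lambda>x. f (x, t)) = (\<lambda>x. partial (b, 0) f (x, t))" for b by (rule ext, rule partial_slice[OF d])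
  moreover have "(\<lambda>x. f (x, t)) differentiable (at x)" for x
    using slice_has_derivative[OF d, of t x] unfolding differentiable_def by blast
  moreover have "Ck_on k UNIV (\<lambda>x. partial (b, 0) f (x, t))" if "b \<in> Basis" for b
    using Suc.prems Basis_slice[OF that] by (intro Suc.IH) auto
  ultimately show ?case by simp
qed

lemma test_fun_slice:
  assumes f: "test_fun (cylinder \<Omega> T) f"
  shows "test_fun \<Omega> (\<lambda>x::'a::euclidean_space. f (x, t))"
proof -
  obtain K where K: "compact K" "K \<subseteq> cylinder \<Omega> T" "\<And>x. x \<notin> K \<Longrightarrow> f x = 0" using test_funE[OF f] by metis
  have "compact (fst ` K)" using K(1) by (intro compact_continuous_image continuous_intros)
  moreover have "f (x, t) = 0" if "x \<notin> fst ` K" for x using K(3)[of "(x, t)"] that by force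
  moreover have "smooth_on UNIV (\<lambda>x. f (x, t))"
    using test_fun_smooth[OF f] unfolding smooth_on_def by (auto intro: Ck_on_slice)
  ultimately show ?thesis using K(2) by (intro test_funI[of _ "fst ` K"]) auto
qed

lemma test_fun_slice_zero:
  assumes f: "test_fun (cylinder \<Omega> T) f" and t: "t \<notin> {0<..<T}"
  shows "f (x, t) = 0"
proof -
  obtain K where K: "compact K" "K \<subseteq> cylinder \<Omega> T" "\<And>x. x \<notin> K \<Longrightarrow> f x = 0" using test_funE[OF f] by metis
  show ?thesis using K(2,3) t by blast
qed

lemma jacobian_slice:
  fixes w :: "'a::euclidean_space \<times> real \<Rightarrow> real^'m"
  assumes "smooth_on UNIV w"
  shows "jacobian e (\<lambda>x. w (x, t)) x = jacobian (\<lambda>j. (e j, 0)) w (x, t)"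
  using partial_slice[OF smooth_on_differentiable[OF assms]] by (simp add: jacobian_def)

text \<open>The slices are uniformly bounded with support in the projection of \<open>K\<close>.\<close>

lemma slice_continuous_tendsto:
  fixes W :: "'a::euclidean_space \<times> real \<Rightarrow> 'b::euclidean_space"
  assumes W: "continuous_on UNIV W" and K: "compact K" "\<And>z. z \<notin> K \<Longrightarrow> W z = 0" and q: "q \<longlonglongrightarrow> t"
  shows "(\<lambda>n. nrm2 (\<lambda>x. W (x, q n) - W (x, t))) \<longlonglongrightarrow> 0" "L2 (\<lambda>x. W (x, s))"
proof -
  have c: "compact (fst ` K)" using K(1) by (intro compact_continuous_image continuous_intros)
  have z: "W (x, s) = 0" if "x \<notin> fst ` K" for x s using K(2)[of "(x, s)"] that by force
  have cs: "continuous_on UNIV (\<lambda>x. W (x, s))" for s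
    by (rule continuous_on_compose2[OF W]) (auto intro!: continuous_intros)
  show "L2 (\<lambda>x. W (x, s))" by (rule continuous_compact_support_L2[OF cs c z])
  obtain B where B: "B > 0" "\<And>z. norm (W z) \<le> B" using continuous_compact_support_bounded[OF W K] by blast
  have m: "(\<lambda>x. W (x, s)) \<in> borel_measurable borel" for s by (rule borel_measurable_continuous_onI[OF cs])
  show "(\<lambda>n. nrm2 (\<lambda>x. W (x, q n) - W (x, t))) \<longlonglongrightarrow> 0"
  proof (rule L2_dominated_convergence[OF _ L2_indicator_compact[OF c], where c = "2 * B"])
    show "(\<lambda>x. W (x, q n) - W (x, t)) \<in> borel_measurable borel" for n
      using m[of "q n"] m[of t] by measurable
    show "AE x in lborel. (\<lambda>n. W (x, q n) - W (x, t)) \<longlonglongrightarrow> 0"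
    proof (rule AE_I2)
      fix x
      have "isCont W (x, t)" using W by (simp add: continuous_on_eq_continuous_at)
      moreover have "(\<lambda>n. (x, q n)) \<longlonglongrightarrow> (x, t)" by (intro tendsto_Pair tendsto_const q)
      ultimately have "(\<lambda>n. W (x, q n)) \<longlonglongrightarrow> W (x, t)" by (rule isCont_tendsto_compose)
      then show "(\<lambda>n. W (x, q n) - W (x, t)) \<longlonglongrightarrow> 0" by (rule LIM_zero)
    qed
    show "AE x in lborel. norm (W (x, q n) - W (x, t)) \<le> 2 * B * norm (indicator (fst ` K) x :: real)" for n
    proof (rule AE_I2)
      fix x
      show "norm (W (x, q n) - W (x, t)) \<le> 2 * B * norm (indicator (fst ` K) x :: real)"
        using norm_triangle_ineq4[of "W (x, q n)" "W (x, t)"] B(2)[of "(x, q n)"] B(2)[of "(x, t)"] z[of x]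
        by (cases "x \<in> fst ` K") auto
    qed
  qed (use B in simp)
qed

text \<open>Slices of test functions are test functions, so the identity for slices can be integrated over time.\<close>

lemma slice_distr_deriv:
  fixes v' :: "(real^'n) \<times> real \<Rightarrow> real^'m"
  assumes L: "L2 v'" "L2 G"
    and s: "AE t in lborel. t \<in> {0<..<T} \<longrightarrow> sobolev_rep \<Omega> (V t) (\<lambda>x. v' (x, t)) (\<lambda>x. G (x, t))"
  shows "distr_deriv (cylinder \<Omega> T) (axis j 1, 0) v' (\<lambda>z. column j (G z))"
  unfolding distr_deriv_def
proof (intro allI impI)
  fix \<phi> :: "(real^'n) \<times> real \<Rightarrow> real"
  assume \<phi>: "test_fun (cylinder \<Omega> T) \<phi>"
  have B: "(axis j 1 :: real^'n, 0::real) \<in> Basis" by (intro Basis_slice axis_Basis)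
  have p\<phi>: "test_fun (cylinder \<Omega> T) (partial (axis j 1, 0) \<phi>)" by (rule test_fun_partial[OF \<phi> B])
  have i: "integrable lborel (\<lambda>z. partial (axis j 1, 0) \<phi> z *\<^sub>R v' z)" "integrable lborel (\<lambda>z. \<phi> z *\<^sub>R column j (G z))"
    by (rule test_fun_mult_L2_integrable[OF p\<phi> L(1)], rule test_fun_mult_L2_integrable[OF \<phi> L2_column[OF L(2)]])
  have "(\<integral>z. partial (axis j 1, 0) \<phi> z *\<^sub>R v' z \<partial>lborel) = (\<integral>t. \<integral>x. partial (axis j 1, 0) \<phi> (x, t) *\<^sub>R v' (x, t) \<partial>lborel \<partial>lborel)"
    by (rule slice_integral(2)[OF i(1)])
  also have "\<dots> = (\<integral>t. - (\<integral>x. \<phi> (x, t) *\<^sub>R column j (G (x, t)) \<partial>lborel) \<partial>lborel)"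
  proof (rule integral_cong_AE)
    show "(\<lambda>t. \<integral>x. partial (axis j 1, 0) \<phi> (x, t) *\<^sub>R v' (x, t) \<partial>lborel) \<in> borel_measurable lborel"
      using slice_integral(1)[OF i(1)] by (rule borel_measurable_integrable)
    show "(\<lambda>t. - (\<integral>x. \<phi> (x, t) *\<^sub>R column j (G (x, t)) \<partial>lborel)) \<in> borel_measurable lborel"
      using slice_integral(1)[OF i(2)] by (intro borel_measurable_uminus borel_measurable_integrable)
    show "AE t in lborel. (\<integral>x. partial (axis j 1, 0) \<phi> (x, t) *\<^sub>R v' (x, t) \<partial>lborel)
      = - (\<integral>x. \<phi> (x, t) *\<^sub>R column j (G (x, t)) \<partial>lborel)"
      using s
    proof eventually_elim
      case (elim t)
      show ?case
      proof (cases "t \<in> {0<..<T}")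
        case True
        then have "distr_deriv \<Omega> (axis j 1) (\<lambda>x. v' (x, t)) (\<lambda>x. column j (G (x, t)))"
          using elim by (simp add: sobolev_rep_def)
        from distr_derivD[OF this test_fun_slice[OF \<phi>]] show ?thesis
          by (simp add: partial_slice[OF smooth_on_differentiable[OF test_fun_smooth[OF \<phi>]]])
      next
        case False
        then show ?thesis using test_fun_slice_zero[OF \<phi> False] test_fun_slice_zero[OF p\<phi> False] by simp
      qed
    qed
  qed
  also have "\<dots> = - (\<integral>z. \<phi> z *\<^sub>R column j (G z) \<partial>lborel)" using slice_integral(2)[OF i(2)] by simp
  finally show "(\<integral>z. partial (axis j 1, 0) \<phi> z *\<^sub>R v' z \<partial>lborel) = - (\<integral>z. \<phi> z *\<^sub>R column j (G z) \<partial>lborel)" .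
qed

text \<open>The exceptional set of times depends on the test function, and there are uncountably many slices
  \<open>w(\<cdot>,q)\<close>. The equation is therefore used for rational \<open>q\<close> only, at almost all times \<open>t\<close>; then \<open>q\<close> tends to
  \<open>t\<close>.\<close>

lemma slice_weak_equation:
  fixes f :: "(real^'n) \<times> real \<Rightarrow> real^'m" and \<sigma> :: "(real^'n) \<times> real \<Rightarrow> real^'n^'m"
  assumes L: "L2 f" "L2 \<sigma>"
    and eqn: "\<And>w. test_fun \<Omega> w \<Longrightarrow> AE t in lborel. t \<in> {0<..<T} \<longrightarrow>
      (\<integral>x. f (x, t) \<bullet> w x \<partial>lborel) + (\<integral>x. \<sigma> (x, t) \<bullet> jacobian (\<lambda>j. axis j 1) w x \<partial>lborel) = 0"
    and w: "test_fun (cylinder \<Omega> T) w"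
  shows "(\<integral>z. f z \<bullet> w z \<partial>lborel) + (\<integral>z. \<sigma> z \<bullet> jacobian (\<lambda>j. (axis j 1, 0)) w z \<partial>lborel) = 0"
proof -
  define J where "J = jacobian (\<lambda>j::'n. (axis j 1 :: real^'n, 0::real)) w"
  have B: "(axis j 1 :: real^'n, 0::real) \<in> Basis" for j by (intro Basis_slice axis_Basis)
  obtain K where K: "compact K" "K \<subseteq> cylinder \<Omega> T" "\<And>x. x \<notin> K \<Longrightarrow> w x = 0" "\<And>x b. x \<notin> K \<Longrightarrow> partial b w x = 0"
    using test_funE[OF w] by metis
  have sw: "smooth_on UNIV w" by (rule test_fun_smooth[OF w])
  have Jc: "continuous_on UNIV J" unfolding J_def by (rule jacobian_continuous[OF sw B])
  have wc: "continuous_on UNIV w" by (rule smooth_on_continuous[OF sw])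
  have J0: "J z = 0" if "z \<notin> K" for z using K(4)[OF that] by (simp add: J_def jacobian_def vec_eq_iff)
  have JL: "L2 J" by (rule continuous_compact_support_L2[OF Jc K(1) J0])
  have wL: "L2 w" by (rule continuous_compact_support_L2[OF wc K(1,3)])
  have i: "integrable lborel (\<lambda>z. f z \<bullet> w z)" "integrable lborel (\<lambda>z. \<sigma> z \<bullet> J z)"
    by (rule L2_inner_integrable[OF L(1) wL], rule L2_inner_integrable[OF L(2) JL])
  have rat: "AE t in lborel. \<forall>q. t \<in> {0<..<T} \<longrightarrow>
      (\<integral>x. f (x, t) \<bullet> w (x, of_rat q) \<partial>lborel) + (\<integral>x. \<sigma> (x, t) \<bullet> J (x, of_rat q) \<partial>lborel) = 0"
    unfolding AE_all_countable
  proof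
    fix q
    show "AE t in lborel. t \<in> {0<..<T} \<longrightarrow>
      (\<integral>x. f (x, t) \<bullet> w (x, of_rat q) \<partial>lborel) + (\<integral>x. \<sigma> (x, t) \<bullet> J (x, of_rat q) \<partial>lborel) = 0"
      using eqn[OF test_fun_slice[OF w, of "of_rat q"]] by (simp only: jacobian_slice[OF sw] J_def)
  qed
  have "AE t in lborel. (\<integral>x. f (x, t) \<bullet> w (x, t) \<partial>lborel) + (\<integral>x. \<sigma> (x, t) \<bullet> J (x, t) \<partial>lborel) = 0"
    using rat slice_L2(1)[OF L(1)] slice_L2(1)[OF L(2)]
  proof eventually_elim
    case (elim t)
    show ?case
    proof (cases "t \<in> {0<..<T}")
      case True
      have "\<exists>q. \<bar>of_rat q - t\<bar> < 1 / real (Suc n)" for n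
      proof -
        obtain q where "t - 1 / real (Suc n) < of_rat q" "of_rat q < t" using of_rat_dense[of "t - 1 / real (Suc n)" t] by auto
        then show ?thesis by (intro exI[of _ q]) auto
      qed
      then obtain q where q: "\<And>n. \<bar>of_rat (q n) - t\<bar> < 1 / real (Suc n)" by metis
      have "(\<lambda>n. of_rat (q n) - t) \<longlonglongrightarrow> 0"
        by (rule Lim_null_comparison[OF _ LIMSEQ_Suc[OF lim_inverse_n']]) (use q less_imp_le in \<open>auto intro!: always_eventually\<close>)
      then have qt: "(\<lambda>n. of_rat (q n)) \<longlonglongrightarrow> t" by (rule LIM_zero_cancel)
      note lw = slice_continuous_tendsto[OF wc K(1,3) qt] and lJ = slice_continuous_tendsto[OF Jc K(1) J0 qt]
      have "(\<lambda>n. \<integral>x. f (x, t) \<bullet> w (x, of_rat (q n)) \<partial>lborel) \<longlonglongrightarrow> (\<integral>x. f (x, t) \<bullet> w (x, t) \<partial>lborel)"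
        by (rule L2_inner_tendsto) (use elim lw in auto)
      moreover have "(\<lambda>n. \<integral>x. \<sigma> (x, t) \<bullet> J (x, of_rat (q n)) \<partial>lborel) \<longlonglongrightarrow> (\<integral>x. \<sigma> (x, t) \<bullet> J (x, t) \<partial>lborel)"
        by (rule L2_inner_tendsto) (use elim lJ in auto)
      ultimately have "(\<lambda>n. (\<integral>x. f (x, t) \<bullet> w (x, of_rat (q n)) \<partial>lborel) + (\<integral>x. \<sigma> (x, t) \<bullet> J (x, of_rat (q n)) \<partial>lborel))
        \<longlonglongrightarrow> (\<integral>x. f (x, t) \<bullet> w (x, t) \<partial>lborel) + (\<integral>x. \<sigma> (x, t) \<bullet> J (x, t) \<partial>lborel)" by (rule tendsto_add)
      moreover have "(\<integral>x. f (x, t) \<bullet> w (x, of_rat (q n)) \<partial>lborel) + (\<integral>x. \<sigma> (x, t) \<bullet> J (x, of_rat (q n)) \<partial>lborel) = 0" for n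
        using elim(1) True by blast
      ultimately show ?thesis by (simp add: LIMSEQ_const_iff)
    next
      case False
      have "(x, t) \<notin> K" for x using K(2) False by blast
      then show ?thesis by (simp add: K(3) J0)
    qed
  qed
  then have "(\<integral>t. (\<integral>x. f (x, t) \<bullet> w (x, t) \<partial>lborel) + (\<integral>x. \<sigma> (x, t) \<bullet> J (x, t) \<partial>lborel) \<partial>lborel) = 0"
    by (rule integral_eq_zero_AE)
  then show ?thesis
    using slice_integral(2)[OF i(1)] slice_integral(2)[OF i(2)] slice_integral(1)[OF i(1)] slice_integral(1)[OF i(2)]
    unfolding J_def by simp
qed

text \<open>Every notion in the definition of a weak solution is expressed by the Borel representatives \<open>v'\<close>, \<open>G\<close> and
  \<open>p\<close> of \<open>v\<close>, its spatial gradient and its time derivative.\<close>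

lemma weak_solution_system:
  fixes v :: "(real^'n) \<times> real \<Rightarrow> real^'m"
  assumes \<Omega>: "open \<Omega>" "bounded \<Omega>" and T: "T > 0" and sol: "weak_solution \<psi> F \<Omega> T v"
    and \<psi>: "elliptic_map \<alpha> A (gradient \<psi>)" "gradient \<psi> 0 = 0" "A > 0"
    and F: "elliptic_map \<theta> \<Theta> (gradient F)" "\<Theta> > 0"
  obtains v' G p where "borel_rep (cylinder \<Omega> T) v v'" "borel_rep (cylinder \<Omega> T) (weak_dt \<Omega> T v) p" "L2 p"
    "AE t in lborel. t \<in> {0<..<T} \<longrightarrow> sobolev_rep \<Omega> (\<lambda>x. v (x, t)) (\<lambda>x. v' (x, t)) (\<lambda>x. G (x, t))"
    "weak_system (cylinder \<Omega> T) (\<lambda>j. (axis j 1, 0)) (gradient F) v' G (\<lambda>z. gradient \<psi> (p z))"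
proof -
  have Qo: "open (cylinder \<Omega> T)" and Qb: "bounded (cylinder \<Omega> T)"
    using \<Omega> by (auto intro!: open_Times bounded_Times)
  have \<Omega>b: "\<Omega> \<in> sets borel" and Qs: "cylinder \<Omega> T \<in> sets borel" using \<Omega>(1) Qo by auto
  have tB: "(0 :: real^'n, 1::real) \<in> Basis" by (simp add: Basis_prod_def)
  have sv: "v \<in> borel_measurable (lebesgue_on (cylinder \<Omega> T))" "Linfty_W12 \<Omega> T (time_slice v)"
    and eqn: "\<And>w. W12_0 \<Omega> w \<Longrightarrow> AE t in lebesgue_on {0..T}.
        (LINT x|lebesgue_on \<Omega>. gradient \<psi> (weak_dt \<Omega> T v (x, t)) \<bullet> w x) +
        (LINT x|lebesgue_on \<Omega>. gradient F (weak_D \<Omega> (time_slice v t) x) \<bullet> weak_D \<Omega> w x) = 0"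
    using sol unfolding weak_solution_def by blast+
  obtain v' G where v': "borel_rep (cylinder \<Omega> T) v v'" "L2 v'" "L2 G" "\<And>z. z \<notin> cylinder \<Omega> T \<Longrightarrow> G z = 0"
    "AE t in lborel. t \<in> {0<..<T} \<longrightarrow> sobolev_rep \<Omega> (\<lambda>x. v (x, t)) (\<lambda>x. v' (x, t)) (\<lambda>x. G (x, t))"
    by (rule W12_time_representative[OF \<Omega> T sv]) blast
  obtain g where g: "has_weak_deriv (cylinder \<Omega> T) (0, 1) v g" "L2_on (cylinder \<Omega> T) g"
    using sol unfolding weak_solution_def by blast
  have "g \<in> borel_measurable (lebesgue_on (cylinder \<Omega> T))" using g by (simp add: L2_on_def)
  then obtain p where p: "borel_rep (cylinder \<Omega> T) g p" by (rule borel_rep_exists) (use Qs that in auto)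
  have pL: "L2 p" using g(2) L2_on_iff[OF p Qs] by simp
  have pt: "borel_rep (cylinder \<Omega> T) (weak_dt \<Omega> T v) p" unfolding weak_dt_def by (rule weak_deriv_rep(1)[OF g(1) Qo tB p])
  define f where "f z = gradient \<psi> (p z)" for z
  define \<sigma> where "\<sigma> z = (if z \<in> cylinder \<Omega> T then gradient F (G z) else 0)" for z
  have [measurable]: "gradient \<psi> \<in> borel_measurable borel" "gradient F \<in> borel_measurable borel"
    by (intro borel_measurable_continuous_onI elliptic_map_continuous[OF \<psi>(1)] elliptic_map_continuous[OF F(1)])+
  have fm: "f \<in> borel_measurable borel" unfolding f_def using L2_measurable[OF pL] by measurable
  have fL: "L2 f"
  proof (rule L2_dominated(1)[OF pL fm, where c = A])
    have "norm (gradient \<psi> y) \<le> A * norm y" for y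
      using \<psi>(1,2) unfolding elliptic_map_def by (metis diff_zero)
    then show "AE z in lborel. norm (f z) \<le> A * norm (p z)" by (simp add: f_def)
  qed (use \<psi> in simp)
  have \<sigma>L: "L2 \<sigma>" unfolding \<sigma>_def by (rule flux_L2[OF F(1) _ Qo Qb v'(3)]) (use F in simp)
  have eq: "AE t in lborel. t \<in> {0<..<T} \<longrightarrow>
      (\<integral>x. f (x, t) \<bullet> w x \<partial>lborel) + (\<integral>x. \<sigma> (x, t) \<bullet> jacobian (\<lambda>j. axis j 1) w x \<partial>lborel) = 0" if w: "test_fun \<Omega> w" for w
  proof -
    have wm[measurable]: "w \<in> borel_measurable borel" by (rule test_fun_measurable[OF w])
    have wr: "borel_rep \<Omega> (weak_D \<Omega> w) (jacobian (\<lambda>j. axis j 1) w)"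
      by (rule sobolev_rep_W12(3)[OF test_fun_sobolev_rep[OF w] \<Omega>(1)])
    have w0: "w x = 0" "jacobian (\<lambda>j. axis j 1) w x = 0" if "x \<notin> \<Omega>" for x
      using test_fun_sobolev_rep[OF w] that by (auto simp: sobolev_rep_def borel_rep_def)
    have "AE t in lebesgue_on {0..T}.
        (LINT x|lebesgue_on \<Omega>. gradient \<psi> (weak_dt \<Omega> T v (x, t)) \<bullet> w x) +
        (LINT x|lebesgue_on \<Omega>. gradient F (weak_D \<Omega> (time_slice v t) x) \<bullet> weak_D \<Omega> w x) = 0"
      by (rule eqn[OF test_fun_W12_0[OF w \<Omega>(1)]])
    then have "AE t in lborel. t \<in> {0..T} \<longrightarrow>
        (LINT x|lebesgue_on \<Omega>. gradient \<psi> (weak_dt \<Omega> T v (x, t)) \<bullet> w x) +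
        (LINT x|lebesgue_on \<Omega>. gradient F (weak_D \<Omega> (time_slice v t) x) \<bullet> weak_D \<Omega> w x) = 0"
      by (subst (asm) AE_lebesgue_on_iff) auto
    then show ?thesis using slice_borel_rep[OF pt] v'(5)
    proof eventually_elim
      case (elim t)
      show ?case
      proof
        assume t: "t \<in> {0<..<T}"
        then have r: "borel_rep \<Omega> (\<lambda>x. weak_dt \<Omega> T v (x, t)) (\<lambda>x. p (x, t))"
          and s: "sobolev_rep \<Omega> (time_slice v t) (\<lambda>x. v' (x, t)) (\<lambda>x. G (x, t))" using elim by blast+
        have G: "borel_rep \<Omega> (weak_D \<Omega> (time_slice v t)) (\<lambda>x. G (x, t))" by (rule sobolev_rep_W12(3)[OF s \<Omega>(1)])
        have "borel_rep \<Omega> (\<lambda>x. gradient \<psi> (weak_dt \<Omega> T v (x, t)) \<bullet> w x) (\<lambda>x. f (x, t) \<bullet> w x)"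
        proof (rule borel_rep_cong[OF r])
          show "(\<lambda>x. f (x, t) \<bullet> w x) \<in> borel_measurable borel" using slice_measurable[OF fm, of t] by measurable
        qed (auto simp: f_def w0)
        from borel_rep_integral(2)[OF this \<Omega>b]
        have a: "(LINT x|lebesgue_on \<Omega>. gradient \<psi> (weak_dt \<Omega> T v (x, t)) \<bullet> w x) = (\<integral>x. f (x, t) \<bullet> w x \<partial>lborel)" .
        have wJ: "AE x in lborel. x \<in> \<Omega> \<longrightarrow> weak_D \<Omega> w x = jacobian (\<lambda>j. axis j 1) w x"
          "AE x in lborel. x \<in> \<Omega> \<longrightarrow> weak_D \<Omega> (time_slice v t) x = G (x, t)"
          using wr G by (auto simp: borel_rep_def)
        have "AE x in lborel. x \<in> \<Omega> \<longrightarrow> gradient F (weak_D \<Omega> (time_slice v t) x) \<bullet> weak_D \<Omega> w x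
            = \<sigma> (x, t) \<bullet> jacobian (\<lambda>j. axis j 1) w x"
          using wJ(1) wJ(2) by eventually_elim (use t in \<open>auto simp: \<sigma>_def\<close>)
        moreover have "(\<lambda>x. \<sigma> (x, t) \<bullet> jacobian (\<lambda>j. axis j 1) w x) \<in> borel_measurable borel"
          using slice_measurable[OF L2_measurable[OF \<sigma>L], of t] borel_rep_measurable[OF wr] by measurable
        ultimately have "borel_rep \<Omega> (\<lambda>x. gradient F (weak_D \<Omega> (time_slice v t) x) \<bullet> weak_D \<Omega> w x)
            (\<lambda>x. \<sigma> (x, t) \<bullet> jacobian (\<lambda>j. axis j 1) w x)"
          by (simp add: borel_rep_def w0)
        from borel_rep_integral(2)[OF this \<Omega>b]
        have b: "(LINT x|lebesgue_on \<Omega>. gradient F (weak_D \<Omega> (time_slice v t) x) \<bullet> weak_D \<Omega> w x)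
          = (\<integral>x. \<sigma> (x, t) \<bullet> jacobian (\<lambda>j. axis j 1) w x \<partial>lborel)" .
        show "(\<integral>x. f (x, t) \<bullet> w x \<partial>lborel) + (\<integral>x. \<sigma> (x, t) \<bullet> jacobian (\<lambda>j. axis j 1) w x \<partial>lborel) = 0"
          using elim(1) t unfolding a b by simp
      qed
    qed
  qed
  have "weak_system (cylinder \<Omega> T) (\<lambda>j. (axis j 1, 0)) (gradient F) v' G f"
    unfolding weak_system_def
  proof (intro conjI allI impI)
    show "v' z = 0" "G z = 0" if "z \<notin> cylinder \<Omega> T" for z
      using v'(1) v'(4)[OF that] that unfolding borel_rep_def by blast+
    show "distr_deriv (cylinder \<Omega> T) (axis j 1, 0) v' (\<lambda>z. column j (G z))" for j
      by (rule slice_distr_deriv[OF v'(2,3,5)])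
    show "(\<integral>z. f z \<bullet> w z \<partial>lborel) + (\<integral>z. (if z \<in> cylinder \<Omega> T then gradient F (G z) else 0) \<bullet> jacobian (\<lambda>j. (axis j 1, 0)) w z \<partial>lborel) = 0"
      if "test_fun (cylinder \<Omega> T) w" for w
      using slice_weak_equation[OF fL \<sigma>L eq that] unfolding \<sigma>_def .
  qed (fact v' fL)+
  then have sys: "weak_system (cylinder \<Omega> T) (\<lambda>j. (axis j 1, 0)) (gradient F) v' G (\<lambda>z. gradient \<psi> (p z))"
    by (simp only: f_def[abs_def])
  show thesis by (rule that[OF v'(1) pt pL v'(5) sys])
qed

section \<open>Compactness of the Hessians\<close>

text \<open>The distance in \<open>W\<^sup>1\<^sup>,\<^sup>2(\<Omega>)\<close> controls that of the gradients, slice by slice.\<close>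

lemma gradient_distance_le:
  fixes u v :: "(real^'n) \<times> real \<Rightarrow> real^'m"
  assumes \<Omega>: "open \<Omega>" and L: "L2 G" "L2 H" and z: "\<And>z. z \<notin> cylinder \<Omega> T \<Longrightarrow> G z = 0 \<and> H z = 0"
    and s: "AE t in lborel. t \<in> {0<..<T} \<longrightarrow> sobolev_rep \<Omega> (\<lambda>x. u (x, t)) (\<lambda>x. u' (x, t)) (\<lambda>x. G (x, t))"
      "AE t in lborel. t \<in> {0<..<T} \<longrightarrow> sobolev_rep \<Omega> (\<lambda>x. v (x, t)) (\<lambda>x. v' (x, t)) (\<lambda>x. H (x, t))"
    and N: "integrable (lebesgue_on {0..T}) (\<lambda>t. (W12_norm \<Omega> (\<lambda>x. u (x, t) - v (x, t)))\<^sup>2)"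
  shows "(nrm2 (\<lambda>z. G z - H z))\<^sup>2 \<le> (LINT t|lebesgue_on {0..T}. (W12_norm \<Omega> (\<lambda>x. u (x, t) - v (x, t)))\<^sup>2)"
proof -
  let ?N = "\<lambda>t. (W12_norm \<Omega> (\<lambda>x. u (x, t) - v (x, t)))\<^sup>2"
  have Ib: "{0..T} \<in> sets borel" by simp
  obtain h where h: "borel_rep {0..T} ?N h"
    by (rule borel_rep_exists[OF borel_measurable_integrable[OF N] Ib]) blast
  have hi: "integrable lborel h" using N borel_rep_integral(3)[OF h Ib] by simp
  have GH: "L2 (\<lambda>z. G z - H z)" by (rule L2_diff[OF L])
  have ha: "AE t in lborel. t \<in> {0..T} \<longrightarrow> ?N t = h t" "\<And>t. t \<notin> {0..T} \<Longrightarrow> h t = 0" using h by (auto simp: borel_rep_def)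
  have "(nrm2 (\<lambda>z. G z - H z))\<^sup>2 = (\<integral>t. (nrm2 (\<lambda>x. G (x, t) - H (x, t)))\<^sup>2 \<partial>lborel)" by (rule slice_L2(3)[OF GH])
  also have "\<dots> \<le> (\<integral>t. h t \<partial>lborel)"
  proof (rule integral_mono_AE[OF slice_L2(2)[OF GH] hi])
    show "AE t in lborel. (nrm2 (\<lambda>x. G (x, t) - H (x, t)))\<^sup>2 \<le> h t"
      using s ha(1)
    proof eventually_elim
      case (elim t)
      show ?case
      proof (cases "t \<in> {0<..<T}")
        case True
        then have "sobolev_rep \<Omega> (\<lambda>x. u (x, t) - v (x, t)) (\<lambda>x. u' (x, t) - v' (x, t)) (\<lambda>x. G (x, t) - H (x, t))"
          using elim by (intro sobolev_rep_diff) blast+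
        from sobolev_rep_W12(2)[OF this \<Omega>] have "(nrm2 (\<lambda>x. G (x, t) - H (x, t)))\<^sup>2 \<le> ?N t" by simp
        also have "?N t = h t" using elim True by auto
        finally show ?thesis .
      next
        case False
        have "G (x, t) = 0 \<and> H (x, t) = 0" for x using z[of "(x, t)"] False by simp
        then have "(nrm2 (\<lambda>x. G (x, t) - H (x, t)))\<^sup>2 = 0" by simp
        also have "0 \<le> h t"
        proof (cases "t \<in> {0..T}")
          case True
          have "0 \<le> ?N t" by (rule zero_le_power2)
          also have "?N t = h t" using elim(3) True by blast
          finally show ?thesis .
        qed (simp add: ha(2))
        finally show ?thesis .
      qed
    qed
  qed
  also have "\<dots> = (LINT t|lebesgue_on {0..T}. ?N t)" by (rule borel_rep_integral(2)[OF h Ib, symmetric])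
  finally show ?thesis .
qed

text \<open>Two integrations by parts, the first with \<open>\<partial>\<^sub>d \<phi>\<close> as the test function.\<close>

lemma second_weak_derivative:
  fixes v v' :: "'a::euclidean_space \<Rightarrow> real^'m" and G H :: "'a \<Rightarrow> real^'n^'m"
  assumes Q: "open Q" and e: "e \<in> Basis" "d \<in> Basis" and v: "borel_rep Q v v'" "L2 v'" and G: "L2 G"
    and H: "H \<in> borel_measurable borel" "\<And>z. z \<notin> Q \<Longrightarrow> H z = 0"
      "\<And>K. compact K \<Longrightarrow> K \<subseteq> Q \<Longrightarrow> L2 (\<lambda>z. indicator K z *\<^sub>R H z)"
    and D: "distr_deriv Q e v' (\<lambda>z. column j (G z))" "distr_deriv Q d G H"
  shows "has_weak_deriv2 Q e d (\<lambda>z. v z $ i) (\<lambda>z. H z $ i $ j)"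
proof -
  have Qb: "Q \<in> sets borel" using Q by simp
  have bl: "bounded_linear (\<lambda>y::real^'m. y $ i)" by (rule bounded_linear_vec_nth)
  have bl2: "bounded_linear (\<lambda>M::real^'n^'m. M $ i $ j)"
    using bounded_linear_compose[OF bounded_linear_vec_nth bounded_linear_vec_nth] by blast
  have vi: "borel_rep Q (\<lambda>z. v z $ i) (\<lambda>z. v' z $ i)" by (rule borel_rep_linear[OF bl v(1)])
  have viL: "L2 (\<lambda>z. v' z $ i)"
    by (rule L2_dominated(1)[OF v(2) borel_rep_measurable[OF vi], where c = 1]) (auto intro!: AE_I2 simp: component_le_norm_cart)
  have Hb: "borel_rep Q H H" using H by (simp add: borel_rep_def)
  have Hi: "borel_rep Q (\<lambda>z. H z $ i $ j) (\<lambda>z. H z $ i $ j)" by (rule borel_rep_linear[OF bl2 Hb])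
  have HK: "integrable lborel (\<lambda>z. indicator K z *\<^sub>R H z)" if K: "compact K" "K \<subseteq> Q" for K
  proof -
    have "(\<lambda>z. indicator K z *\<^sub>R (indicator K z *\<^sub>R H z)) = (\<lambda>z. indicator K z *\<^sub>R H z)" by (auto simp: indicator_def)
    then show ?thesis using L2_indicator_integrable[OF H(3)[OF K] K(1)] by simp
  qed
  have HiK: "integrable lborel (\<lambda>z. indicator K z *\<^sub>R (H z $ i $ j))" if K: "compact K" "K \<subseteq> Q" for K
    using integrable_bounded_linear[OF bl2 HK[OF K]] by simp
  have eq: "(LINT z|lebesgue_on Q. partial e (partial d \<phi>) z *\<^sub>R (v z $ i)) = (LINT z|lebesgue_on Q. \<phi> z *\<^sub>R (H z $ i $ j))"
    if \<phi>: "test_fun Q \<phi>" for \<phi> :: "'a \<Rightarrow> real"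
  proof -
    have p: "test_fun Q (partial d \<phi>)" "test_fun Q (partial e (partial d \<phi>))"
      by (intro test_fun_partial \<phi> e)+
    have m: "\<phi> \<in> borel_measurable borel" "partial e (partial d \<phi>) \<in> borel_measurable borel"
      by (rule test_fun_measurable[OF \<phi>], rule test_fun_measurable[OF p(2)])
    have i1: "integrable lborel (\<lambda>z. partial e (partial d \<phi>) z *\<^sub>R v' z)" by (rule test_fun_mult_L2_integrable[OF p(2) v(2)])
    have i2: "integrable lborel (\<lambda>z. partial d \<phi> z *\<^sub>R G z)" by (rule test_fun_mult_L2_integrable[OF p(1) G])
    have i2': "integrable lborel (\<lambda>z. partial d \<phi> z *\<^sub>R column j (G z))" by (rule test_fun_mult_L2_integrable[OF p(1) L2_column[OF G]])
    have i3: "integrable lborel (\<lambda>z. \<phi> z *\<^sub>R H z)" by (rule test_fun_mult_local_integrable[OF \<phi> H(1) HK])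
    have "(LINT z|lebesgue_on Q. partial e (partial d \<phi>) z *\<^sub>R (v z $ i)) = (\<integral>z. partial e (partial d \<phi>) z *\<^sub>R (v' z $ i) \<partial>lborel)"
      by (rule borel_rep_integral(2)[OF borel_rep_mult[OF vi m(2)] Qb])
    also have "\<dots> = (\<integral>z. partial e (partial d \<phi>) z *\<^sub>R v' z \<partial>lborel) $ i"
      using integral_bounded_linear[OF bl i1] by simp
    also have "\<dots> = - (\<integral>z. partial d \<phi> z *\<^sub>R column j (G z) \<partial>lborel) $ i"
      using distr_derivD[OF D(1) p(1)] by simp
    also have "(\<integral>z. partial d \<phi> z *\<^sub>R column j (G z) \<partial>lborel) $ i = (\<integral>z. partial d \<phi> z *\<^sub>R (G z $ i $ j) \<partial>lborel)"
      using integral_bounded_linear[OF bl i2'] by (simp add: column_def)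
    also have "\<dots> = (\<integral>z. partial d \<phi> z *\<^sub>R G z \<partial>lborel) $ i $ j"
      using integral_bounded_linear[OF bl2 i2] by simp
    also have "\<dots> = - (\<integral>z. \<phi> z *\<^sub>R H z \<partial>lborel) $ i $ j" using distr_derivD[OF D(2) \<phi>] by simp
    also have "(\<integral>z. \<phi> z *\<^sub>R H z \<partial>lborel) $ i $ j = (\<integral>z. \<phi> z *\<^sub>R (H z $ i $ j) \<partial>lborel)"
      using integral_bounded_linear[OF bl2 i3] by simp
    also have "\<dots> = (LINT z|lebesgue_on Q. \<phi> z *\<^sub>R (H z $ i $ j))"
      by (rule borel_rep_integral(2)[OF borel_rep_mult[OF Hi m(1)] Qb, symmetric])
    finally show ?thesis by simp
  qed
  show ?thesis unfolding has_weak_deriv2_def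
    using L2_locally_integrable[OF vi viL Q] locally_integrable_iff[OF Hi Q] HiK eq by blast
qed

text \<open>The array of all second derivatives is a sum of such terms, one for each direction of the second
  differentiation; in this way linearity gives its measurability and norm bounds.\<close>

definition tensor_slot :: "'n \<Rightarrow> real^'n^'m \<Rightarrow> real^'n^'n^'m" where
  "tensor_slot l M = (\<chi> i j. axis l (M $ i $ j))"

lemma tensor_slot_component: "(\<Sum>l\<in>UNIV. tensor_slot l (M l)) $ i $ j $ k = M k $ i $ j"
proof -
  have "(\<Sum>l\<in>UNIV. tensor_slot l (M l)) $ i $ j $ k = (\<Sum>l\<in>UNIV. if l = k then M l $ i $ j else 0)"
    by (simp add: tensor_slot_def axis_def eq_commute)
  then show ?thesis by simp
qed

lemma bounded_linear_tensor_slot: "bounded_linear (tensor_slot l :: real^'n^'m \<Rightarrow> real^'n^'n^'m)"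
  by (intro linear_conv_bounded_linear[THEN iffD1] linearI) (auto simp: tensor_slot_def axis_def vec_eq_iff)

lemma norm_tensor_slot: "norm (tensor_slot l M) = norm (M :: real^'n^'m)"
proof -
  have ax: "axis l c = c *\<^sub>R (axis l 1 :: real^'n)" for c :: real by (simp add: vec_eq_iff axis_def)
  have a: "norm (axis l c :: real^'n) = norm c" for c :: real
    unfolding ax[of c] norm_scaleR norm_axis_1 by simp
  have "norm (tensor_slot l M $ i) = norm (M $ i)" for i
    unfolding norm_vec_def[of "tensor_slot l M $ i"] norm_vec_def[of "M $ i"]
    by (simp add: tensor_slot_def a)
  then show ?thesis by (simp add: norm_vec_def[of "tensor_slot l M"] norm_vec_def[of M])
qed

lemma nrm2_tensor_le:
  fixes W :: "'n::finite \<Rightarrow> 'a::euclidean_space \<Rightarrow> real^'n^'m"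
  assumes W: "\<And>l. L2 (W l)"
  shows "L2 (\<lambda>z. \<Sum>l\<in>UNIV. tensor_slot l (W l z))" "nrm2 (\<lambda>z. \<Sum>l\<in>UNIV. tensor_slot l (W l z)) \<le> (\<Sum>l\<in>UNIV. nrm2 (W l))"
proof -
  have t: "L2 (\<lambda>z. tensor_slot l (W l z))" "nrm2 (\<lambda>z. tensor_slot l (W l z)) \<le> nrm2 (W l)" for l
  proof -
    have "tensor_slot l \<in> borel_measurable (borel :: (real^'n^'m) measure)"
      by (intro borel_measurable_continuous_onI linear_continuous_on bounded_linear_tensor_slot)
    from measurable_compose[OF L2_measurable[OF W] this]
    have m: "(\<lambda>z. tensor_slot l (W l z)) \<in> borel_measurable borel" .
    have le: "AE z in lborel. norm (tensor_slot l (W l z)) \<le> 1 * norm (W l z)" by (simp add: norm_tensor_slot)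
    show "L2 (\<lambda>z. tensor_slot l (W l z))" "nrm2 (\<lambda>z. tensor_slot l (W l z)) \<le> nrm2 (W l)"
      using L2_dominated[OF W m le] by simp_all
  qed
  show "L2 (\<lambda>z. \<Sum>l\<in>UNIV. tensor_slot l (W l z))" by (rule L2_sum[OF t(1)])
  have "nrm2 (\<lambda>z. \<Sum>l\<in>UNIV. tensor_slot l (W l z)) \<le> (\<Sum>l\<in>UNIV. nrm2 (\<lambda>z. tensor_slot l (W l z)))"
    by (rule nrm2_sum_le[OF t(1)])
  also have "\<dots> \<le> (\<Sum>l\<in>UNIV. nrm2 (W l))" by (rule sum_mono[OF t(2)])
  finally show "nrm2 (\<lambda>z. \<Sum>l\<in>UNIV. tensor_slot l (W l z)) \<le> (\<Sum>l\<in>UNIV. nrm2 (W l))" .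
qed

lemma gradient_zero_at_minimum:
  fixes \<psi> :: "'a::euclidean_space \<Rightarrow> real"
  assumes d: "\<psi> differentiable (at x)" and m: "\<And>y. \<psi> x \<le> \<psi> y"
  shows "gradient \<psi> x = 0"
proof -
  have "(\<lambda>h. gradient \<psi> x \<bullet> h) = (\<lambda>h. 0)"
    by (rule differential_zero_maxmin[OF UNIV_I open_UNIV gradient_has_derivative[OF d]]) (use m in blast)
  from fun_cong[OF this, of "gradient \<psi> x"] show ?thesis by simp
qed

lemma weak_system_hessian:
  fixes S :: "real^'n^'m \<Rightarrow> real^'n^'m" and e :: "'n \<Rightarrow> 'a::euclidean_space"
  assumes S: "elliptic_map \<theta> \<Theta> S" "\<theta> > 0" "\<Theta> > 0" and Q: "open Q" "bounded Q" and e: "\<And>j. e j \<in> Basis"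
    and sol: "weak_system Q e S u g f"
  shows "\<exists>H. H \<in> borel_measurable borel \<and> (\<forall>z. z \<notin> Q \<longrightarrow> H z = 0) \<and>
    (\<forall>K. compact K \<longrightarrow> K \<subseteq> Q \<longrightarrow> L2 (\<lambda>z. indicator K z *\<^sub>R H z)) \<and> distr_deriv Q (e l) g H"
proof -
  have g: "L2 g" "\<And>z. z \<notin> Q \<Longrightarrow> g z = 0" using sol unfolding weak_system_def by blast+
  have gi: "integrable lborel g" by (rule L2_finite_support_integrable(1)[OF g(1) bounded_open_fmeasurable[OF Q] g(2)])
  show ?thesis
    by (rule distr_deriv_exists[OF g(1) gi Q e[of l] weak_system_difference_bound[OF S Q e sol]]) blast+
qed

theorem corollary4p3:
  fixes \<psi> :: "real^'m \<Rightarrow> real"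
    and F :: "real^'n^'m \<Rightarrow> real"
    and \<Omega> :: "(real^'n) set"
    and T \<alpha> A \<theta> \<Theta> :: real
    and vk :: "nat \<Rightarrow> (real^'n) \<times> real \<Rightarrow> real^'m"
    and v :: "(real^'n) \<times> real \<Rightarrow> real^'m"
  assumes "CARD('m) > 1"
    and "bounded_smooth_domain \<Omega>"
    and "T > 0"
    and "Ck_on 2 UNIV \<psi>" and "Ck_on 2 UNIV F"
    and "bdd_below (range \<psi>)" and "(INF w. \<psi> w) = \<psi> 0" and "\<psi> 0 = 0"
    and "\<alpha> > 0" and "A > 0" and "\<theta> > 0" and "\<Theta> > 0"
    and "\<And>w z. \<alpha> * (norm z)\<^sup>2 \<le>
           (\<Sum>i\<in>UNIV. \<Sum>j\<in>UNIV. partial (axis j 1) (partial (axis i 1) \<psi>) w * z $ i * z $ j)"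
    and "\<And>w z. (\<Sum>i\<in>UNIV. \<Sum>j\<in>UNIV. partial (axis j 1) (partial (axis i 1) \<psi>) w * z $ i * z $ j)
           \<le> A * (norm z)\<^sup>2"
    and "\<And>M \<xi>. \<theta> * (norm \<xi>)\<^sup>2 \<le>
           (\<Sum>i\<in>UNIV. \<Sum>k\<in>UNIV. \<Sum>j\<in>UNIV. \<Sum>l\<in>UNIV.
              partial (axis k (axis l 1)) (partial (axis i (axis j 1)) F) M * \<xi> $ i $ j * \<xi> $ k $ l)"
    and "\<And>M \<xi>. (\<Sum>i\<in>UNIV. \<Sum>k\<in>UNIV. \<Sum>j\<in>UNIV. \<Sum>l\<in>UNIV.
              partial (axis k (axis l 1)) (partial (axis i (axis j 1)) F) M * \<xi> $ i $ j * \<xi> $ k $ l)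
           \<le> \<Theta> * (norm \<xi>)\<^sup>2"
    and "\<And>k. weak_solution \<psi> F \<Omega> T (vk k)"
    and "weak_solution \<psi> F \<Omega> T v"
    and "tendsto_L2_W12 \<Omega> T (\<lambda>k. time_slice (vk k)) (time_slice v)"
    and "tendsto_L2 (cylinder \<Omega> T) (\<lambda>k. weak_dt \<Omega> T (vk k)) (weak_dt \<Omega> T v)"
  shows "\<exists>(r :: nat \<Rightarrow> nat) Hk H. strict_mono r \<and>
           (\<forall>j. has_spatial_hessian \<Omega> T (vk (r j)) (Hk j)) \<and>
           has_spatial_hessian \<Omega> T v H \<and>
           tendsto_L2_loc (cylinder \<Omega> T) Hk H"
proof -
  let ?Q = "cylinder \<Omega> T" and ?e = "\<lambda>j::'n. (axis j 1 :: real^'n, 0::real)"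
  have \<Omega>: "open \<Omega>" "bounded \<Omega>" using assms(2) unfolding bounded_smooth_domain_def by blast+
  have Q: "open ?Q" "bounded ?Q" using \<Omega> by (auto intro!: open_Times bounded_Times)
  have Qb: "?Q \<in> sets borel" using Q by simp
  have e: "?e j \<in> Basis" for j by (intro Basis_slice axis_Basis)
  have \<psi>e: "elliptic_map \<alpha> A (gradient \<psi>)"
    by (rule elliptic_gradient[OF assms(4)]) (use assms(9,10,13,14) in \<open>simp_all add: hess_form_vec\<close>)
  have Fe: "elliptic_map \<theta> \<Theta> (gradient F)"
    by (rule elliptic_gradient[OF assms(5)]) (use assms(11,12,15,16) in \<open>simp_all add: hess_form_matrix\<close>)
  have Fs: "strictly_differentiable (gradient F)" by (rule gradient_strictly_differentiable[OF assms(5)])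
  have "\<psi> 0 \<le> \<psi> w" for w using cINF_lower[OF assms(6), of w] assms(7) by simp
  then have \<psi>0: "gradient \<psi> 0 = 0" by (rule gradient_zero_at_minimum[OF Ck_on_2D(1)[OF assms(4)]])
  \<comment> \<open>The data of a solution are chosen simultaneously for the limit and for all members of the sequence.\<close>
  define good where "good w = (\<lambda>(w', G, p). borel_rep ?Q w w' \<and> borel_rep ?Q (weak_dt \<Omega> T w) p \<and> L2 p \<and>
    (AE t in lborel. t \<in> {0<..<T} \<longrightarrow> sobolev_rep \<Omega> (\<lambda>x. w (x, t)) (\<lambda>x. w' (x, t)) (\<lambda>x. G (x, t))) \<and>
    weak_system ?Q ?e (gradient F) w' G (\<lambda>z. gradient \<psi> (p z)))" for w :: "(real^'n) \<times> real \<Rightarrow> real^'m"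
  have ex: "\<exists>q. good w q" if w: "weak_solution \<psi> F \<Omega> T w" for w
  proof (rule weak_solution_system[OF \<Omega> assms(3) w \<psi>e \<psi>0 assms(10) Fe assms(12)])
    fix w' G p assume "borel_rep ?Q w w'" "borel_rep ?Q (weak_dt \<Omega> T w) p" "L2 p"
      "AE t in lborel. t \<in> {0<..<T} \<longrightarrow> sobolev_rep \<Omega> (\<lambda>x. w (x, t)) (\<lambda>x. w' (x, t)) (\<lambda>x. G (x, t))"
      "weak_system ?Q ?e (gradient F) w' G (\<lambda>z. gradient \<psi> (p z))"
    then have "good w (w', G, p)" unfolding good_def by simp
    then show "\<exists>q. good w q" ..
  qed
  define q where "q w = (SOME q. good w q)" for w
  define rep where "rep w = fst (q w)" for w
  define Dx where "Dx w = fst (snd (q w))" for w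
  define dt where "dt w = snd (snd (q w))" for w
  have gd: "borel_rep ?Q w (rep w)" "borel_rep ?Q (weak_dt \<Omega> T w) (dt w)" "L2 (dt w)"
    "AE t in lborel. t \<in> {0<..<T} \<longrightarrow> sobolev_rep \<Omega> (\<lambda>x. w (x, t)) (\<lambda>x. rep w (x, t)) (\<lambda>x. Dx w (x, t))"
    "weak_system ?Q ?e (gradient F) (rep w) (Dx w) (\<lambda>z. gradient \<psi> (dt w z))" if w: "weak_solution \<psi> F \<Omega> T w" for w
  proof -
    have "good w (q w)" unfolding q_def by (rule someI_ex[OF ex[OF w]])
    then show "borel_rep ?Q w (rep w)" "borel_rep ?Q (weak_dt \<Omega> T w) (dt w)" "L2 (dt w)"
      "AE t in lborel. t \<in> {0<..<T} \<longrightarrow> sobolev_rep \<Omega> (\<lambda>x. w (x, t)) (\<lambda>x. rep w (x, t)) (\<lambda>x. Dx w (x, t))"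
      "weak_system ?Q ?e (gradient F) (rep w) (Dx w) (\<lambda>z. gradient \<psi> (dt w z))"
      unfolding good_def rep_def Dx_def dt_def case_prod_beta by blast+
  qed
  have wL: "L2 (rep w)" "L2 (Dx w)" "\<And>z. z \<notin> ?Q \<Longrightarrow> Dx w z = 0" "L2 (\<lambda>z. gradient \<psi> (dt w z))"
    "distr_deriv ?Q (?e j) (rep w) (\<lambda>z. column j (Dx w z))" if "weak_solution \<psi> F \<Omega> T w" for w j
    using gd(5)[OF that] unfolding weak_system_def by blast+
  note vs = assms(18) and vks = assms(17)
  have fk: "(\<lambda>k. nrm2 (\<lambda>z. gradient \<psi> (dt (vk k) z) - gradient \<psi> (dt v z))) \<longlonglongrightarrow> 0"
  proof -
    have "(LINT x|lebesgue_on ?Q. (norm (weak_dt \<Omega> T (vk k) x - weak_dt \<Omega> T v x))\<^sup>2) = (nrm2 (\<lambda>z. dt (vk k) z - dt v z))\<^sup>2" for k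
      by (rule norm_sq_integral_eq[OF borel_rep_diff[OF gd(2)[OF vks] gd(2)[OF vs]] Qb])
    then have "(\<lambda>k. (nrm2 (\<lambda>z. dt (vk k) z - dt v z))\<^sup>2) \<longlonglongrightarrow> 0" using assms(20) unfolding tendsto_L2_def by simp
    from tendsto_real_sqrt[OF this] have lim: "(\<lambda>k. A * nrm2 (\<lambda>z. dt (vk k) z - dt v z)) \<longlonglongrightarrow> 0"
      by (intro tendsto_mult_right_zero) simp
    have "nrm2 (\<lambda>z. gradient \<psi> (dt (vk k) z) - gradient \<psi> (dt v z)) \<le> A * nrm2 (\<lambda>z. dt (vk k) z - dt v z)" for k
    proof (rule L2_dominated(2)[OF L2_diff[OF gd(3)[OF vks] gd(3)[OF vs]]])
      show "(\<lambda>z. gradient \<psi> (dt (vk k) z) - gradient \<psi> (dt v z)) \<in> borel_measurable borel"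
        by (rule L2_measurable[OF L2_diff[OF wL(4)[OF vks] wL(4)[OF vs]]])
    qed (use \<psi>e assms(10) in \<open>auto simp: elliptic_map_def\<close>)
    note le = this
    show ?thesis
    proof (rule tendsto_sandwich[OF _ _ tendsto_const lim])
      show "\<forall>\<^sub>F k in sequentially. 0 \<le> nrm2 (\<lambda>z. gradient \<psi> (dt (vk k) z) - gradient \<psi> (dt v z))"
        by (rule always_eventually) simp
      show "\<forall>\<^sub>F k in sequentially. nrm2 (\<lambda>z. gradient \<psi> (dt (vk k) z) - gradient \<psi> (dt v z)) \<le> A * nrm2 (\<lambda>z. dt (vk k) z - dt v z)"
        by (rule always_eventually) (rule allI, rule le)
    qed
  qed
  have gk: "(\<lambda>k. nrm2 (\<lambda>z. Dx (vk k) z - Dx v z)) \<longlonglongrightarrow> 0"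
  proof -
    have N: "integrable (lebesgue_on {0..T}) (\<lambda>t. (W12_norm \<Omega> (\<lambda>x. vk k (x, t) - v (x, t)))\<^sup>2)" for k
      using assms(19) unfolding tendsto_L2_W12_def L2_W12_def by blast
    have l: "(\<lambda>k. LINT t|lebesgue_on {0..T}. (W12_norm \<Omega> (\<lambda>x. vk k (x, t) - v (x, t)))\<^sup>2) \<longlonglongrightarrow> 0"
      using assms(19) unfolding tendsto_L2_W12_def by blast
    have "(nrm2 (\<lambda>z. Dx (vk k) z - Dx v z))\<^sup>2 \<le> (LINT t|lebesgue_on {0..T}. (W12_norm \<Omega> (\<lambda>x. vk k (x, t) - v (x, t)))\<^sup>2)" for k
      by (rule gradient_distance_le[OF \<Omega>(1) wL(2)[OF vks] wL(2)[OF vs] _ gd(4)[OF vks] gd(4)[OF vs] N])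
        (use wL(3)[OF vks] wL(3)[OF vs] in blast)
    note le = this
    have "(\<lambda>k. (nrm2 (\<lambda>z. Dx (vk k) z - Dx v z))\<^sup>2) \<longlonglongrightarrow> 0"
      by (rule tendsto_sandwich[OF _ _ tendsto_const l]) (rule always_eventually, simp, rule always_eventually, rule allI, rule le)
    from tendsto_real_sqrt[OF this] show ?thesis by simp
  qed
  have dL: "L2 (\<lambda>z. Dx (vk k) z - Dx v z)" for k by (rule L2_diff[OF wL(2)[OF vks] wL(2)[OF vs]])
  have "(\<lambda>k. \<integral>z. norm ((norm (Dx (vk k) z - Dx v z))\<^sup>2) \<partial>lborel) \<longlonglongrightarrow> 0"
    using tendsto_power[OF gk, of 2] by (simp add: nrm2_sq)
  \<comment> \<open>The subsequence provides the almost everywhere convergence of the gradients.\<close>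
  from tendsto_L1_AE_subseq[OF L2_integrable[OF dL] this] obtain r where r: "strict_mono r"
    "AE z in lborel. (\<lambda>n. (norm (Dx (vk (r n)) z - Dx v z))\<^sup>2) \<longlonglongrightarrow> 0" by blast
  have ae: "AE z in lborel. (\<lambda>n. Dx (vk (r n)) z) \<longlonglongrightarrow> Dx v z"
    using r(2)
  proof eventually_elim
    case (elim z)
    from tendsto_real_sqrt[OF elim] have "(\<lambda>n. norm (Dx (vk (r n)) z - Dx v z)) \<longlonglongrightarrow> 0" by simp
    then show ?case by (rule LIM_zero_cancel[OF tendsto_norm_zero_cancel])
  qed
  define isH where "isH w l H \<longleftrightarrow> H \<in> borel_measurable borel \<and> (\<forall>z. z \<notin> ?Q \<longrightarrow> H z = 0) \<and>
    (\<forall>K. compact K \<longrightarrow> K \<subseteq> ?Q \<longrightarrow> L2 (\<lambda>z. indicator K z *\<^sub>R H z)) \<and> distr_deriv ?Q (?e l) (Dx w) H" for w l H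
  define Hs where "Hs w l = (SOME H. isH w l H)" for w l
  have Hs: "Hs w l \<in> borel_measurable borel" "\<And>z. z \<notin> ?Q \<Longrightarrow> Hs w l z = 0"
    "\<And>K. compact K \<Longrightarrow> K \<subseteq> ?Q \<Longrightarrow> L2 (\<lambda>z. indicator K z *\<^sub>R Hs w l z)" "distr_deriv ?Q (?e l) (Dx w) (Hs w l)"
    if w: "weak_solution \<psi> F \<Omega> T w" for w l
  proof -
    have "\<exists>H. isH w l H" unfolding isH_def by (rule weak_system_hessian[OF Fe assms(11,12) Q e gd(5)[OF w]])
    then have "isH w l (Hs w l)" unfolding Hs_def by (rule someI_ex)
    then show "Hs w l \<in> borel_measurable borel" "\<And>z. z \<notin> ?Q \<Longrightarrow> Hs w l z = 0"
      "\<And>K. compact K \<Longrightarrow> K \<subseteq> ?Q \<Longrightarrow> L2 (\<lambda>z. indicator K z *\<^sub>R Hs w l z)" "distr_deriv ?Q (?e l) (Dx w) (Hs w l)"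
      unfolding isH_def by blast+
  qed
  \<comment> \<open>The last index of the array is the direction of the second differentiation.\<close>
  define Hess where "Hess w z = (\<Sum>l\<in>UNIV. tensor_slot l (Hs w l z))" for w z
  have hess: "has_spatial_hessian \<Omega> T w (Hess w)" if w: "weak_solution \<psi> F \<Omega> T w" for w
    unfolding has_spatial_hessian_def Hess_def tensor_slot_component
    by (intro allI second_weak_derivative[OF Q(1) e e gd(1)[OF w] wL(1)[OF w] wL(2)[OF w] Hs(1-3)[OF w] wL(5)[OF w] Hs(4)[OF w]])
  have lin: "tensor_slot l (c *\<^sub>R M) = c *\<^sub>R tensor_slot l M" "tensor_slot l (M - M') = tensor_slot l M - tensor_slot l M'"
    for l :: 'n and c and M M' :: "real^'n^'m"
    by (rule linear_scale[OF bounded_linear.linear[OF bounded_linear_tensor_slot]],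
        rule linear_diff[OF bounded_linear.linear[OF bounded_linear_tensor_slot]])
  have loc: "tendsto_L2 K (\<lambda>n. Hess (vk (r n))) (Hess v)" if K: "compact K" "K \<subseteq> ?Q" for K
  proof -
    have Kb: "K \<in> sets borel" using K(1) by (rule borel_compact)
    have rep: "borel_rep K (Hess w) (\<lambda>z. indicator K z *\<^sub>R Hess w z)" "L2 (\<lambda>z. indicator K z *\<^sub>R Hess w z)"
      if w: "weak_solution \<psi> F \<Omega> T w" for w
    proof -
      have "(\<lambda>z. \<Sum>l\<in>UNIV. tensor_slot l (indicator K z *\<^sub>R Hs w l z)) = (\<lambda>z. indicator K z *\<^sub>R Hess w z)"
        by (simp add: Hess_def lin scaleR_sum_right)
      then show L: "L2 (\<lambda>z. indicator K z *\<^sub>R Hess w z)"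
        using nrm2_tensor_le(1)[of "\<lambda>l z. indicator K z *\<^sub>R Hs w l z"] Hs(3)[OF w K] by simp
      show "borel_rep K (Hess w) (\<lambda>z. indicator K z *\<^sub>R Hess w z)"
        using L2_measurable[OF L] by (auto simp: borel_rep_def)
    qed
    have "(\<lambda>n. nrm2 (\<lambda>z. indicator K z *\<^sub>R Hess (vk (r n)) z - indicator K z *\<^sub>R Hess v z)) \<longlonglongrightarrow> 0"
    proof (rule tendsto_sandwich[OF _ _ tendsto_const])
      have "(\<lambda>n. nrm2 (\<lambda>z. indicator K z *\<^sub>R (Hs (vk (r n)) l z - Hs v l z))) \<longlonglongrightarrow> 0" for l
        by (rule weak_system_stability[OF Fe assms(11,12) Fs Q e gd(5)[OF vs] gd(5)[OF vks]
              LIMSEQ_subseq_LIMSEQ[OF fk r(1), unfolded o_def] LIMSEQ_subseq_LIMSEQ[OF gk r(1), unfolded o_def] ae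
              Hs(1)[OF vs] Hs(4)[OF vs] Hs(3)[OF vs] Hs(1)[OF vks] Hs(4)[OF vks] Hs(3)[OF vks] K])
      then show "(\<lambda>n. \<Sum>l\<in>UNIV. nrm2 (\<lambda>z. indicator K z *\<^sub>R (Hs (vk (r n)) l z - Hs v l z))) \<longlonglongrightarrow> 0"
        using tendsto_sum[of UNIV "\<lambda>l n. nrm2 (\<lambda>z. indicator K z *\<^sub>R (Hs (vk (r n)) l z - Hs v l z))" "\<lambda>_. 0"] by simp
      show "\<forall>\<^sub>F n in sequentially. nrm2 (\<lambda>z. indicator K z *\<^sub>R Hess (vk (r n)) z - indicator K z *\<^sub>R Hess v z)
        \<le> (\<Sum>l\<in>UNIV. nrm2 (\<lambda>z. indicator K z *\<^sub>R (Hs (vk (r n)) l z - Hs v l z)))"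
      proof (intro always_eventually allI)
        fix n
        have "L2 (\<lambda>z. indicator K z *\<^sub>R (Hs (vk (r n)) l z - Hs v l z))" for l
          using L2_diff[OF Hs(3)[OF vks K, of "r n" l] Hs(3)[OF vs K, of l]] by (simp add: scaleR_diff_right)
        from nrm2_tensor_le(2)[of "\<lambda>l z. indicator K z *\<^sub>R (Hs (vk (r n)) l z - Hs v l z)", OF this]
        show "nrm2 (\<lambda>z. indicator K z *\<^sub>R Hess (vk (r n)) z - indicator K z *\<^sub>R Hess v z)
          \<le> (\<Sum>l\<in>UNIV. nrm2 (\<lambda>z. indicator K z *\<^sub>R (Hs (vk (r n)) l z - Hs v l z)))"
          by (simp add: Hess_def lin scaleR_sum_right scaleR_diff_right sum_subtractf)
      qed
    qed auto
    from tendsto_power[OF this, of 2]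
    have "(\<lambda>n. (nrm2 (\<lambda>z. indicator K z *\<^sub>R Hess (vk (r n)) z - indicator K z *\<^sub>R Hess v z))\<^sup>2) \<longlonglongrightarrow> 0" by simp
    then show ?thesis unfolding tendsto_L2_def
      using norm_sq_integral_eq[OF borel_rep_diff[OF rep(1)[OF vks] rep(1)[OF vs]] Kb]
        L2_on_iff[OF rep(1)[OF vks] Kb] L2_on_iff[OF rep(1)[OF vs] Kb] rep(2)[OF vks] rep(2)[OF vs] by simp
  qed
  then have "tendsto_L2_loc ?Q (\<lambda>n. Hess (vk (r n))) (Hess v)" unfolding tendsto_L2_loc_def by blast
  then show ?thesis using r(1) hess[OF vks] hess[OF vs]
    by (intro exI[of _ r] exI[of _ "\<lambda>j. Hess (vk (r j))"] exI[of _ "Hess v"]) simp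
qed

end
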